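(* Let $\mathsf E\to M$ be an $\Omega$ vector bundle and $\gamma(t)=(\triangle_t,\phi_t)$, $t\in[0,1]$, a smooth path of module connections and Higgs fields on $\mathsf E$. Let $\triangle'_t=\frac{d}{dt}\triangle_t$, $\phi'_t=\frac{d}{dt}\phi_t$, and let $\mathsf R_t$ be the curvature of $\triangle_t$ and $\triangle_t\phi_t$ the Higgs field covariant derivative. Then the string potential of $\gamma$ is $$S(\gamma)=\sum_{j=1}^\infty j\int_0^1\!\int_{S^1}\Big[(j-1)\,\overline{\mathrm{tr}}_j\big(\triangle'_t,\underbrace{\mathsf R_t,\dots,\mathsf R_t}_{j-2},\triangle_t\phi_t\big)+\overline{\mathrm{tr}}_j\big(\underbrace{\mathsf R_t,\dots,\mathsf R_t}_{j-1},\phi'_t\big)\Big]\,d\theta\,dt .$$ (For $j=1$ the first term is zero.)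
   Context: $M$ is a compact smooth manifold, possibly with corners; $S^1=\mathbb R/2\pi\mathbb Z$ with basepoint $0$; fibre integration along $M\times S^1\to M$ uses the canonical orientation, with $\int_{S^1}(f\,\mathrm{pr}^*\beta)\wedge d\theta=\beta\int_{S^1}f\,d\theta$. $L\mathbb C=C^\infty(S^1,\mathbb C)$. For a free $L\mathbb C$-module $N$ of rank $n$, $I_\theta N$ is the submodule of elements vanishing at $\theta$ (under any $N\cong L\mathbb C^n$). An $\Omega$-module of rank $n$ is such an $N$ with a chosen isomorphism $N/I_0N\cong\mathbb C^n$ (framing at $0$); isomorphisms are $L\mathbb C$-linear and preserve framings. An $\Omega$ vector bundle of rank $n$ is a smooth Fréchet bundle $\mathsf E\to M$ with $\Omega$-module fibres, locally isomorphic to $U\times L\mathbb C^n$ by fibrewise $\Omega$-module isomorphisms. A Higgs field $\phi$ is a smooth family of $\mathbb C$-linear maps $\mathsf E_m\to\mathsf E_m$ with $\phi(fv)=(\partial_\theta f)v+f\phi(v)$ for $f\in L\mathbb C$. A module connection $\triangle$ is a connection with $\triangle(fv)=(d_Mf)v+f\triangle v$ for $f\in C^\infty(M\times S^1,\mathbb C)$ ($d_M$: differential along $M$), inducing the trivial connection on $\bigcup_m\mathsf E_m/I_0\mathsf E_m\cong M\times\mathbb C^n$. The Higgs field covariant derivative is the $\mathrm{End}_{L\mathbb C}(\mathsf E)$-valued 1-form $\triangle\phi(X)v=\triangle_X(\phi(v))-\phi(\triangle_Xv)$. The caloron transform of $\mathsf E$ is the vector bundle $E\to M\times S^1$ with fibres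 $\mathsf E_m/I_\theta\mathsf E_m$; evaluation identifies sections $\check s$ of $\mathsf E$ with sections $s$ of $E$, and $(\triangle,\phi)$ determines the connection $\nabla$ on $E$ with $\nabla_Xs=\triangle_X\check s$ ($X$ tangent to $M$), $\nabla_{\partial_\theta}s=\phi(\check s)$. With $Ch(\nabla)=\sum_{j\ge0}\frac1{j!}(\frac1{2\pi i})^j\mathrm{tr}(R^{\wedge j})$ ($R$ the curvature of $\nabla$), the string form is $s(\triangle,\phi)=\int_{S^1}Ch(\nabla)$. A smooth path $\gamma(t)=(\triangle_t,\phi_t)$ is regarded as a module connection $\triangle^\gamma$ on $\mathsf E\times[0,1]\to M\times[0,1]$ restricting to $\triangle_t$ on $M\times\{t\}$ and satisfying $\triangle^\gamma_V\mathrm{pr}^*v=0$ for $V$ vertical for $\mathrm{pr}\colon M\times[0,1]\to M$ and $v\in\Gamma(M,\mathsf E)$, together with a Higgs field $\phi^\gamma$ on $\mathsf E\times[0,1]$ restricting to $\phi_t$. With $\varsigma_t\colon m\mapsto(m,t)$, the string potential is the even form $S(\gamma)=\int_0^1\varsigma_t^*\imath_{\partial_t}s(\triangle^\gamma,\phi^\gamma)\,dt$ on $M$. The normalised symmetrised trace is $\overline{\mathrm{tr}}_k(\xi_1,\dots,\xi_k)=\frac{1}{(k!)^2(2\pi i)^k}\sum_{\sigma\in S_k}\mathrm{tr}(\xi_{\sigma(1)}\cdots\xi_{\sigma(k)})$ on $\mathfrak{gl}(n)$, extended to forms by $\overline{\mathrm{tr}}_k(\omega_1\otimes\xi_1,\dots,\omega_k\otimes\xi_k)=\omega_1\wedge\dots\wedge\omega_k\,\overline{\mathrm{tr}}_k(\xi_1,\dots,\xi_k)$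 and applied pointwise in $\theta$. *)

theory Defs
  imports "HOL-Analysis.Analysis" "HOL-Algebra.Module" "HOL-Algebra.AbelCoset" "HOL-Combinatorics.Permutations"
begin

section \<open>Smooth functions on subsets of normed spaces\<close>

fun C_k_on :: "nat \<Rightarrow> 'a::real_normed_vector set \<Rightarrow> ('a \<Rightarrow> 'b::real_normed_vector) \<Rightarrow> bool" where
  "C_k_on 0 U f \<longleftrightarrow> continuous_on U f"
| "C_k_on (Suc k) U f \<longleftrightarrow>
     (\<forall>x\<in>U. f differentiable (at x)) \<and>
     (\<forall>v. C_k_on k U (\<lambda>x. frechet_derivative f (at x) v))"

text \<open>Smoothness on an arbitrary (for instance relatively open in a quadrant) subset means local
  extendability to smooth functions on open sets.\<close>

definition smooth_on :: "'a::real_normed_vector set \<Rightarrow> ('a \<Rightarrow> 'b::real_normed_vector) \<Rightarrow> bool" where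
  "smooth_on S f \<longleftrightarrow>
     (\<forall>x\<in>S. \<exists>U g. open U \<and> x \<in> U \<and> (\<forall>k. C_k_on k U g) \<and> (\<forall>y\<in>S \<inter> U. f y = g y))"


section \<open>Manifolds with corners\<close>

text \<open>The model space is the span of a set \<open>dirs\<close> of standard basis vectors of a Euclidean space, so
  that every dimension \<open>card dirs\<close>, including 0, is allowed.\<close>

record ('m, 'a) manifold =
  top :: "'m topology"
  dirs :: "'a set"
  charts :: "('m set \<times> ('m \<Rightarrow> 'a)) set"

abbreviation points :: "('m, 'a) manifold \<Rightarrow> 'm set" where
  "points M \<equiv> topspace (top M)"

definition quadrant :: "'a::euclidean_space set \<Rightarrow> 'a set \<Rightarrow> 'a set" where
  "quadrant B C = {x. (\<forall>b\<in>Basis - B. x \<bullet> b = 0) \<and> (\<forall>b\<in>C. 0 \<le> x \<bullet> b)}"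

text \<open>Second countability is automatic, since the space is compact.\<close>

definition compact_manifold_with_corners :: "('m, 'a::euclidean_space) manifold \<Rightarrow> bool" where
  "compact_manifold_with_corners M \<longleftrightarrow>
     compact_space (top M) \<and> Hausdorff_space (top M) \<and> dirs M \<subseteq> Basis \<and>
     (\<Union>(U, \<phi>)\<in>charts M. U) = points M \<and>
     (\<forall>(U, \<phi>)\<in>charts M.
        openin (top M) U \<and>
        homeomorphic_map (subtopology (top M) U) (top_of_set (\<phi> ` U)) \<phi> \<and>
        (\<exists>C\<subseteq>dirs M. openin (top_of_set (quadrant (dirs M) C)) (\<phi> ` U))) \<and>
     (\<forall>(U, \<phi>)\<in>charts M. \<forall>(V, \<psi>)\<in>charts M.
        smooth_on (\<phi> ` (U \<inter> V)) (\<lambda>x. \<psi> (inv_into U \<phi> x)))"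

definition times_interval :: "('m, 'a::euclidean_space) manifold \<Rightarrow> ('m \<times> real, 'a \<times> real) manifold" where
  "times_interval M =
     \<lparr>top = prod_topology (top M) (top_of_set {0..1}),
      dirs = insert (0, 1) ((\<lambda>b. (b, 0)) ` dirs M),
      charts = (\<lambda>(U, \<phi>). (U \<times> {0..<1}, \<lambda>(m, t). (\<phi> m, t))) ` charts M
             \<union> (\<lambda>(U, \<phi>). (U \<times> {0<..1}, \<lambda>(m, t). (\<phi> m, 1 - t))) ` charts M\<rparr>"

definition smooth_funs :: "('m, 'a::euclidean_space) manifold \<Rightarrow> ('m \<Rightarrow> real) set" where
  "smooth_funs M = {f. \<forall>(U, \<phi>)\<in>charts M. smooth_on (\<phi> ` U) (\<lambda>x. f (inv_into U \<phi> x))}"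

text \<open>The circle is \<open>\<real> / 2\<pi>\<int>\<close>: functions on \<open>M \<times> S\<^sup>1\<close> are functions on \<open>M \<times> \<real>\<close> that are
  \<open>2\<pi>\<close>-periodic in the second variable. Smooth maps into spaces of loops are understood through the
  exponential law \<open>C\<^sup>\<infinity>(M, C\<^sup>\<infinity>(S\<^sup>1, \<complex>)) = C\<^sup>\<infinity>(M \<times> S\<^sup>1, \<complex>)\<close>.\<close>

definition smooth_loop_family ::
    "('m, 'a::euclidean_space) manifold \<Rightarrow> 'm set \<Rightarrow> ('m \<Rightarrow> real \<Rightarrow> complex) \<Rightarrow> bool" where
  "smooth_loop_family M W f \<longleftrightarrow>
     (\<forall>(U, \<phi>)\<in>charts M.
        smooth_on (\<phi> ` (U \<inter> W) \<times> UNIV) (\<lambda>(x, \<theta>). f (inv_into U \<phi> x) \<theta>)) \<and>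
     (\<forall>m\<in>W. \<forall>\<theta>. f m (\<theta> + 2 * pi) = f m \<theta>)"


section \<open>Vector fields and differential forms\<close>

text \<open>A vector field is a derivation of the algebra of smooth functions. As an operator it may do
  anything to functions that are not smooth, and two operators are the same vector field if they agree
  on smooth functions at all points of the manifold. A differential form is evaluated on lists of
  vector fields; forms may be inhomogeneous, and the value on a list of length \<open>p\<close> is that of the
  component of degree \<open>p\<close>.\<close>

type_synonym 'm vfield = "('m \<Rightarrow> real) \<Rightarrow> 'm \<Rightarrow> real"
type_synonym 'm form = "'m vfield list \<Rightarrow> 'm \<Rightarrow> complex"

definition vector_fields :: "('m, 'a::euclidean_space) manifold \<Rightarrow> 'm vfield set" where
  "vector_fields M = {X.
     (\<forall>f\<in>smooth_funs M. X f \<in> smooth_funs M) \<and>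
     (\<forall>f\<in>smooth_funs M. \<forall>g\<in>smooth_funs M. \<forall>m\<in>points M.
        (\<forall>a b. X (\<lambda>p. a * f p + b * g p) m = a * X f m + b * X g m) \<and>
        X (\<lambda>p. f p * g p) m = X f m * g m + f m * X g m)}"

definition complex_derivative :: "'m vfield \<Rightarrow> ('m \<Rightarrow> complex) \<Rightarrow> 'm \<Rightarrow> complex" where
  "complex_derivative X f = (\<lambda>m. Complex (X (\<lambda>p. Re (f p)) m) (X (\<lambda>p. Im (f p)) m))"

definition lie_bracket :: "'m vfield \<Rightarrow> 'm vfield \<Rightarrow> 'm vfield" where
  "lie_bracket X Y = (\<lambda>f p. X (Y f) p - Y (X f) p)"

text \<open>Vector fields on a product of a manifold with \<open>S\<^sup>1\<close> or \<open>[0,1]\<close>: the lift of a vector field on the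
  first factor, the coordinate field of the second factor (one-sided at end points of \<open>T\<close>), and the
  component along the first factor of a vector field \<open>Z\<close>, at a fixed value \<open>r\<close> of the second
  coordinate.\<close>

definition lift :: "'m vfield \<Rightarrow> ('m \<times> real) vfield" where
  "lift X = (\<lambda>f (m, r). X (\<lambda>p. f (p, r)) m)"

definition coord_field :: "real set \<Rightarrow> ('m \<times> real) vfield" where
  "coord_field T = (\<lambda>f (m, r). vector_derivative (\<lambda>u. f (m, u)) (at r within T))"

definition base_part :: "('m \<times> real) vfield \<Rightarrow> real \<Rightarrow> 'm vfield" where
  "base_part Z r = (\<lambda>g m. Z (\<lambda>q. g (fst q)) (m, r))"

text \<open>The angle is not a function on the circle, whence
  \<open>d\<theta> = cos \<theta> d(sin \<theta>) - sin \<theta> d(cos \<theta>)\<close>.\<close>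

definition dtheta :: "('m \<times> real) vfield \<Rightarrow> 'm \<times> real \<Rightarrow> real" where
  "dtheta Z = (\<lambda>(m, \<theta>). cos \<theta> * Z (\<lambda>q. sin (snd q)) (m, \<theta>) - sin \<theta> * Z (\<lambda>q. cos (snd q)) (m, \<theta>))"

text \<open>With \<open>d\<theta>\<close> in the last place, this satisfies
  \<open>\<integral>(f pr\<^sup>*\<beta>) \<and> d\<theta> = \<beta> \<integral> f d\<theta>\<close>.\<close>

definition fibre_integral :: "('m \<times> real) form \<Rightarrow> 'm form" where
  "fibre_integral \<omega> = (\<lambda>Xs m.
     integral {0..2*pi} (\<lambda>\<theta>. \<omega> (map lift Xs @ [coord_field UNIV]) (m, \<theta>)))"

definition interior_product :: "'m vfield \<Rightarrow> 'm form \<Rightarrow> 'm form" where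
  "interior_product X \<omega> = (\<lambda>Xs. \<omega> (X # Xs))"

text \<open>Pull-back along \<open>m \<mapsto> (m, t)\<close>; a lifted vector field is related to the original one by this map.\<close>

definition slice_pullback :: "real \<Rightarrow> ('m \<times> real) form \<Rightarrow> 'm form" where
  "slice_pullback t \<omega> = (\<lambda>Xs m. \<omega> (map lift Xs) (m, t))"

text \<open>Extension of a multilinear map \<open>\<Phi>\<close> on a vector space to forms with values in it, given by
  \<open>\<Phi>(\<omega>\<^sub>1 \<otimes> \<xi>\<^sub>1, \<dots>, \<omega>\<^sub>k \<otimes> \<xi>\<^sub>k) = \<omega>\<^sub>1 \<and> \<dots> \<and> \<omega>\<^sub>k \<Phi>(\<xi>\<^sub>1, \<dots>, \<xi>\<^sub>k)\<close>, with the convention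
  \<open>(\<alpha> \<and> \<beta>)(X\<^sub>1, \<dots>) = 1/(p! q!) \<Sum>\<^sub>\<pi> sgn(\<pi>) \<alpha>(X\<^bsub>\<pi>(1)\<^esub>, \<dots>) \<beta>(\<dots>)\<close>. A vector-valued form is given
  with its degree.\<close>

fun eval_blocks :: "(nat \<times> ('v list \<Rightarrow> 'b)) list \<Rightarrow> 'v list \<Rightarrow> 'b list" where
  "eval_blocks [] Xs = []"
| "eval_blocks ((p, A) # As) Xs = A (take p Xs) # eval_blocks As (drop p Xs)"

definition extend_to_forms ::
    "('b list \<Rightarrow> complex) \<Rightarrow> (nat \<times> ('v list \<Rightarrow> 'b)) list \<Rightarrow> 'v list \<Rightarrow> complex" where
  "extend_to_forms \<Phi> As Xs =
     (if length Xs = sum_list (map fst As) then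
        (1 / (\<Prod>(p, A)\<leftarrow>As. fact p)) *
        (\<Sum>\<pi> | \<pi> permutes {..<length Xs}.
           of_int (sign \<pi>) * \<Phi> (eval_blocks As (map (\<lambda>i. Xs ! \<pi> i) [0..<length Xs])))
      else 0)"


section \<open>Free modules and traces\<close>

definition std_basis :: "('r, 'x) ring_scheme \<Rightarrow> nat \<Rightarrow> nat \<Rightarrow> nat \<Rightarrow> 'r" where
  "std_basis R n i = (\<lambda>k\<in>{..<n}. if k = i then \<one>\<^bsub>R\<^esub> else \<zero>\<^bsub>R\<^esub>)"

text \<open>Module isomorphisms from \<open>N\<close> to \<open>R\<^sup>n\<close>.\<close>

definition free_iso ::
    "('r, 'x) ring_scheme \<Rightarrow> nat \<Rightarrow> ('r, 'v, 'y) module_scheme \<Rightarrow> ('v \<Rightarrow> nat \<Rightarrow> 'r) \<Rightarrow> bool" where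
  "free_iso R n N \<beta> \<longleftrightarrow>
     bij_betw \<beta> (carrier N) ({..<n} \<rightarrow>\<^sub>E carrier R) \<and>
     (\<forall>v\<in>carrier N. \<forall>w\<in>carrier N. \<beta> (v \<oplus>\<^bsub>N\<^esub> w) = (\<lambda>i\<in>{..<n}. \<beta> v i \<oplus>\<^bsub>R\<^esub> \<beta> w i)) \<and>
     (\<forall>r\<in>carrier R. \<forall>v\<in>carrier N. \<beta> (r \<odot>\<^bsub>N\<^esub> v) = (\<lambda>i\<in>{..<n}. r \<otimes>\<^bsub>R\<^esub> \<beta> v i))"

definition mod_trace ::
    "('r, 'x) ring_scheme \<Rightarrow> nat \<Rightarrow> ('r, 'v, 'y) module_scheme \<Rightarrow> ('v \<Rightarrow> 'v) \<Rightarrow> 'r" where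
  "mod_trace R n N T =
     (let \<beta> = (SOME \<beta>. free_iso R n N \<beta>)
      in finsum R (\<lambda>i. \<beta> (T (inv_into (carrier N) \<beta> (std_basis R n i))) i) {..<n})"

definition complex_ring :: "complex ring" where
  "complex_ring = \<lparr>carrier = UNIV, mult = (*), one = 1, zero = 0, add = (+)\<rparr>"

definition loop_ring :: "(real \<Rightarrow> complex) ring" where
  "loop_ring =
     \<lparr>carrier = {f. smooth_on UNIV f \<and> (\<forall>\<theta>. f (\<theta> + 2 * pi) = f \<theta>)},
      mult = (\<lambda>f g \<theta>. f \<theta> * g \<theta>), one = (\<lambda>\<theta>. 1), zero = (\<lambda>\<theta>. 0), add = (\<lambda>f g \<theta>. f \<theta> + g \<theta>)\<rparr>"


section \<open>\<open>\<Omega>\<close>-modules and \<open>\<Omega>\<close> vector bundles\<close>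

type_synonym 'e loop_module = "(real \<Rightarrow> complex, 'e) module"

definition vanishing_at :: "nat \<Rightarrow> 'e loop_module \<Rightarrow> real \<Rightarrow> 'e set" where
  "vanishing_at n N \<theta> =
     {v \<in> carrier N. \<forall>\<beta>. free_iso loop_ring n N \<beta> \<longrightarrow> (\<forall>i<n. \<beta> v i \<theta> = 0)}"

text \<open>The framing \<open>N/I\<^sub>0N \<cong> \<complex>\<^sup>n\<close> is given as a linear surjection of \<open>N\<close> onto \<open>\<complex>\<^sup>n\<close> with kernel
  \<open>I\<^sub>0N\<close>.\<close>

definition omega_module :: "nat \<Rightarrow> 'e loop_module \<Rightarrow> ('e \<Rightarrow> nat \<Rightarrow> complex) \<Rightarrow> bool" where
  "omega_module n N fr \<longleftrightarrow>
     Module.module loop_ring N \<and> (\<exists>\<beta>. free_iso loop_ring n N \<beta>) \<and>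
     fr ` carrier N = ({..<n} \<rightarrow>\<^sub>E UNIV) \<and>
     (\<forall>v\<in>carrier N. \<forall>w\<in>carrier N. \<forall>i<n. fr (v \<oplus>\<^bsub>N\<^esub> w) i = fr v i + fr w i) \<and>
     (\<forall>f\<in>carrier loop_ring. \<forall>v\<in>carrier N. \<forall>i<n. fr (f \<odot>\<^bsub>N\<^esub> v) i = f 0 * fr v i) \<and>
     {v \<in> carrier N. \<forall>i<n. fr v i = 0} = vanishing_at n N 0"

record ('m, 'e) omega_bundle =
  rank :: nat
  fib :: "'m \<Rightarrow> 'e loop_module"
  framing :: "'m \<Rightarrow> 'e \<Rightarrow> nat \<Rightarrow> complex"
  trivs :: "('m set \<times> ('m \<Rightarrow> 'e \<Rightarrow> nat \<Rightarrow> real \<Rightarrow> complex)) set"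

text \<open>A transition function is linear over loops, so it is a loop-valued matrix, and its smoothness is
  that of its entries.\<close>

definition omega_vector_bundle ::
    "('m, 'a::euclidean_space) manifold \<Rightarrow> ('m, 'e) omega_bundle \<Rightarrow> bool" where
  "omega_vector_bundle M E \<longleftrightarrow>
     (\<forall>m\<in>points M. omega_module (rank E) (fib E m) (framing E m)) \<and>
     (\<Union>(U, \<tau>)\<in>trivs E. U) = points M \<and>
     (\<forall>(U, \<tau>)\<in>trivs E. openin (top M) U \<and>
        (\<forall>m\<in>U. free_iso loop_ring (rank E) (fib E m) (\<tau> m) \<and>
           (\<forall>v\<in>carrier (fib E m). \<forall>i<rank E. \<tau> m v i 0 = framing E m v i))) \<and>
     (\<forall>(U, \<tau>)\<in>trivs E. \<forall>(V, \<sigma>)\<in>trivs E. \<forall>i<rank E. \<forall>j<rank E.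
        smooth_loop_family M (U \<inter> V)
          (\<lambda>m. \<sigma> m (inv_into (carrier (fib E m)) (\<tau> m) (std_basis loop_ring (rank E) i)) j))"

definition sections ::
    "('m, 'a::euclidean_space) manifold \<Rightarrow> ('m, 'e) omega_bundle \<Rightarrow> ('m \<Rightarrow> 'e) set" where
  "sections M E = {v \<in> (\<Pi>\<^sub>E m\<in>points M. carrier (fib E m)).
     \<forall>(U, \<tau>)\<in>trivs E. \<forall>i<rank E. smooth_loop_family M U (\<lambda>m. \<tau> m (v m) i)}"

definition pull_interval :: "('m, 'e) omega_bundle \<Rightarrow> ('m \<times> real, 'e) omega_bundle" where
  "pull_interval E =
     \<lparr>rank = rank E, fib = (\<lambda>q. fib E (fst q)), framing = (\<lambda>q. framing E (fst q)),
      trivs = (\<lambda>(U, \<tau>). (U \<times> {0..1}, \<lambda>q. \<tau> (fst q))) ` trivs E\<rparr>"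


section \<open>Higgs fields and connections\<close>

type_synonym ('m, 'e) conn = "'m vfield \<Rightarrow> ('m \<Rightarrow> 'e) \<Rightarrow> 'm \<Rightarrow> 'e"
type_synonym ('m, 'e) higgs = "'m \<Rightarrow> 'e \<Rightarrow> 'e"

definition higgs_field ::
    "('m, 'a::euclidean_space) manifold \<Rightarrow> ('m, 'e) omega_bundle \<Rightarrow> ('m, 'e) higgs \<Rightarrow> bool" where
  "higgs_field M E \<phi> \<longleftrightarrow>
     (\<forall>m\<in>points M. \<forall>v\<in>carrier (fib E m).
        \<phi> m v \<in> carrier (fib E m) \<and>
        (\<forall>w\<in>carrier (fib E m). \<phi> m (v \<oplus>\<^bsub>fib E m\<^esub> w) = \<phi> m v \<oplus>\<^bsub>fib E m\<^esub> \<phi> m w) \<and>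
        (\<forall>c. \<phi> m ((\<lambda>\<theta>. c) \<odot>\<^bsub>fib E m\<^esub> v) = (\<lambda>\<theta>. c) \<odot>\<^bsub>fib E m\<^esub> \<phi> m v) \<and>
        (\<forall>f\<in>carrier loop_ring. \<phi> m (f \<odot>\<^bsub>fib E m\<^esub> v) =
           (\<lambda>\<theta>. vector_derivative f (at \<theta>)) \<odot>\<^bsub>fib E m\<^esub> v \<oplus>\<^bsub>fib E m\<^esub> f \<odot>\<^bsub>fib E m\<^esub> \<phi> m v)) \<and>
     (\<forall>v\<in>sections M E. (\<lambda>m\<in>points M. \<phi> m (v m)) \<in> sections M E)"

text \<open>The fourth clause says that \<open>D\<close> is well defined on vector fields, the fifth and sixth that
  \<open>D v\<close> is a 1-form; the last says that the trivial connection is induced on the fibres at 0.\<close>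

definition module_connection ::
    "('m, 'a::euclidean_space) manifold \<Rightarrow> ('m, 'e) omega_bundle \<Rightarrow> ('m, 'e) conn \<Rightarrow> bool" where
  "module_connection M E D \<longleftrightarrow>
     (\<forall>X\<in>vector_fields M. \<forall>v\<in>sections M E.
        D X v \<in> sections M E \<and>
        (\<forall>w\<in>sections M E. \<forall>m\<in>points M.
           D X (\<lambda>p\<in>points M. v p \<oplus>\<^bsub>fib E p\<^esub> w p) m = D X v m \<oplus>\<^bsub>fib E m\<^esub> D X w m) \<and>
        (\<forall>f. smooth_loop_family M (points M) f \<longrightarrow> (\<forall>m\<in>points M.
           D X (\<lambda>p\<in>points M. f p \<odot>\<^bsub>fib E p\<^esub> v p) m =
             (\<lambda>\<theta>. complex_derivative X (\<lambda>p. f p \<theta>) m) \<odot>\<^bsub>fib E m\<^esub> v m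
             \<oplus>\<^bsub>fib E m\<^esub> f m \<odot>\<^bsub>fib E m\<^esub> D X v m)) \<and>
        (\<forall>Y\<in>vector_fields M.
           (\<forall>h\<in>smooth_funs M. \<forall>m\<in>points M. X h m = Y h m) \<longrightarrow> D X v = D Y v) \<and>
        (\<forall>Y\<in>vector_fields M. \<forall>m\<in>points M.
           D (\<lambda>h p. X h p + Y h p) v m = D X v m \<oplus>\<^bsub>fib E m\<^esub> D Y v m) \<and>
        (\<forall>f\<in>smooth_funs M. \<forall>m\<in>points M.
           D (\<lambda>h p. f p * X h p) v m = (\<lambda>\<theta>. complex_of_real (f m)) \<odot>\<^bsub>fib E m\<^esub> D X v m) \<and>
        (\<forall>m\<in>points M. \<forall>i<rank E.
           framing E m (D X v m) i = complex_derivative X (\<lambda>p. framing E p (v p) i) m))"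

definition curvature ::
    "'p set \<Rightarrow> ('p \<Rightarrow> ('r, 'v) module) \<Rightarrow> ('p, 'v) conn \<Rightarrow> 'p vfield \<Rightarrow> 'p vfield \<Rightarrow>
     ('p \<Rightarrow> 'v) \<Rightarrow> 'p \<Rightarrow> 'v" where
  "curvature P F D X Y s =
     (\<lambda>p\<in>P. D X (D Y s) p \<ominus>\<^bsub>F p\<^esub> D Y (D X s) p \<ominus>\<^bsub>F p\<^esub> D (lie_bracket X Y) s p)"

definition higgs_derivative ::
    "'m set \<Rightarrow> ('m \<Rightarrow> 'e loop_module) \<Rightarrow> ('m, 'e) conn \<Rightarrow> ('m, 'e) higgs \<Rightarrow> 'm vfield \<Rightarrow>
     ('m \<Rightarrow> 'e) \<Rightarrow> 'm \<Rightarrow> 'e" where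
  "higgs_derivative P F D \<phi> X v =
     (\<lambda>m\<in>P. D X (\<lambda>p\<in>P. \<phi> p (v p)) m \<ominus>\<^bsub>F m\<^esub> \<phi> m (D X v m))"

text \<open>The endomorphism of the fibre at \<open>x\<close> induced by an operator on sections that is linear over
  functions.\<close>

definition at_point :: "('p \<Rightarrow> 'v) set \<Rightarrow> (('p \<Rightarrow> 'v) \<Rightarrow> 'p \<Rightarrow> 'v) \<Rightarrow> 'p \<Rightarrow> 'v \<Rightarrow> 'v" where
  "at_point \<Gamma> T x e = T (SOME s. s \<in> \<Gamma> \<and> s x = e) x"


section \<open>The caloron transform and the string form\<close>

text \<open>The complex vector space \<open>N/I\<^sub>\<theta>N\<close>; the fields \<open>mult\<close> and \<open>one\<close> of a module record
  are irrelevant.\<close>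

definition quotient_at :: "nat \<Rightarrow> 'e loop_module \<Rightarrow> real \<Rightarrow> (complex, 'e set) module" where
  "quotient_at n N \<theta> =
     (let I = vanishing_at n N \<theta> in
      \<lparr>carrier = a_rcosets\<^bsub>N\<^esub> I, mult = undefined, one = undefined,
       zero = I, add = set_add N,
       smult = (\<lambda>c V. \<Union>v\<in>V. I +>\<^bsub>N\<^esub> ((\<lambda>\<theta>. c) \<odot>\<^bsub>N\<^esub> v))\<rparr>)"

definition caloron_fib :: "('m, 'e) omega_bundle \<Rightarrow> 'm \<times> real \<Rightarrow> (complex, 'e set) module" where
  "caloron_fib E = (\<lambda>(m, \<theta>). quotient_at (rank E) (fib E m) \<theta>)"

definition eval_class :: "('m, 'e) omega_bundle \<Rightarrow> 'm \<times> real \<Rightarrow> 'e \<Rightarrow> 'e set" where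
  "eval_class E = (\<lambda>(m, \<theta>) v. vanishing_at (rank E) (fib E m) \<theta> +>\<^bsub>fib E m\<^esub> v)"

definition eval_section ::
    "('m, 'a) manifold \<Rightarrow> ('m, 'e) omega_bundle \<Rightarrow> ('m \<Rightarrow> 'e) \<Rightarrow> 'm \<times> real \<Rightarrow> 'e set" where
  "eval_section M E v = (\<lambda>q\<in>points M \<times> UNIV. eval_class E q (v (fst q)))"

definition caloron_sections ::
    "('m, 'a::euclidean_space) manifold \<Rightarrow> ('m, 'e) omega_bundle \<Rightarrow> ('m \<times> real \<Rightarrow> 'e set) set" where
  "caloron_sections M E = eval_section M E ` sections M E"

text \<open>The connection with \<open>\<nabla>\<^sub>X s = D\<^sub>X v\<close> for lifted \<open>X\<close> and \<open>\<nabla>\<^sub>Z s = \<phi>(v)\<close> for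
  \<open>Z = \<partial>/\<partial>\<theta>\<close>, where \<open>s\<close> is the evaluation of \<open>v\<close> (lemmas \<open>caloron_connection_lift\<close>, \<open>caloron_connection_theta\<close> below), extended to all
  vector fields on \<open>M \<times> S\<^sup>1\<close> linearly over functions, that is, by splitting \<open>Z\<close> at \<open>(m, \<theta>)\<close> into
  its component along \<open>M\<close> and \<open>d\<theta>(Z) \<partial>/\<partial>\<theta>\<close>.\<close>

definition caloron_connection ::
    "('m, 'a::euclidean_space) manifold \<Rightarrow> ('m, 'e) omega_bundle \<Rightarrow> ('m, 'e) conn \<Rightarrow> ('m, 'e) higgs \<Rightarrow>
     ('m \<times> real, 'e set) conn" where
  "caloron_connection M E D \<phi> Z s =
     (let v = the_inv_into (sections M E) (eval_section M E) s in
      (\<lambda>q\<in>points M \<times> UNIV.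
        eval_class E q (D (base_part Z (snd q)) v (fst q))
        \<oplus>\<^bsub>caloron_fib E q\<^esub>
        complex_of_real (dtheta Z q) \<odot>\<^bsub>caloron_fib E q\<^esub> eval_class E q (\<phi> (fst q) (v (fst q)))))"

lemma free_iso_add:
  "free_iso loop_ring n N \<beta> \<Longrightarrow> v \<in> carrier N \<Longrightarrow> w \<in> carrier N \<Longrightarrow> i < n \<Longrightarrow>
     \<beta> (v \<oplus>\<^bsub>N\<^esub> w) i \<theta> = \<beta> v i \<theta> + \<beta> w i \<theta>"
  by (simp add: free_iso_def loop_ring_def)

lemma vanishing_at_subgroup:
  assumes "omega_module n N fr"
  shows "abelian_subgroup (vanishing_at n N \<theta>) N"
proof -
  interpret N: Module.module loop_ring N using assms by (simp add: omega_module_def)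
  have z: "\<beta> \<zero>\<^bsub>N\<^esub> i \<theta>' = 0" if "free_iso loop_ring n N \<beta>" "i < n" for \<beta> i \<theta>'
    using free_iso_add[OF that(1) N.M.zero_closed N.M.zero_closed that(2), of \<theta>'] by simp
  have neg: "\<beta> (\<ominus>\<^bsub>N\<^esub> v) i \<theta>' = - \<beta> v i \<theta>'"
    if "free_iso loop_ring n N \<beta>" "i < n" "v \<in> carrier N" for \<beta> i \<theta>' v
    using free_iso_add[OF that(1) that(3) N.M.a_inv_closed[OF that(3)] that(2), of \<theta>']
      z[OF that(1,2)] that(3) by (simp add: N.M.r_neg eq_neg_iff_add_eq_0 add.commute)
  have "additive_subgroup (vanishing_at n N \<theta>) N"
  proof (rule additive_subgroup.intro, rule subgroup.intro)
    show "vanishing_at n N \<theta> \<subseteq> carrier (add_monoid N)" by (auto simp: vanishing_at_def)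
    show "x \<otimes>\<^bsub>add_monoid N\<^esub> y \<in> vanishing_at n N \<theta>"
      if "x \<in> vanishing_at n N \<theta>" "y \<in> vanishing_at n N \<theta>" for x y
      using that by (auto simp: vanishing_at_def free_iso_add)
    show "\<one>\<^bsub>add_monoid N\<^esub> \<in> vanishing_at n N \<theta>" by (auto simp: vanishing_at_def z)
    show "inv\<^bsub>add_monoid N\<^esub> x \<in> vanishing_at n N \<theta>" if "x \<in> vanishing_at n N \<theta>" for x
      using that by (auto simp: vanishing_at_def a_inv_def[symmetric]) (metis neg neg_equal_0_iff_equal)
  qed
  then show ?thesis
    by (intro abelian_subgroupI3) (auto simp: N.M.abelian_group_axioms)
qed

lemma inj_on_eval_section:
  assumes "omega_vector_bundle M E"
  shows "inj_on (eval_section M E) (sections M E)"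
proof (rule inj_onI)
  fix v w assume v: "v \<in> sections M E" and w: "w \<in> sections M E"
    and eq: "eval_section M E v = eval_section M E w"
  have "v m = w m" if m: "m \<in> points M" for m
  proof -
    have om: "omega_module (rank E) (fib E m) (framing E m)"
      using assms m by (simp add: omega_vector_bundle_def)
    interpret N: Module.module loop_ring "fib E m" using om by (simp add: omega_module_def)
    have vm: "v m \<in> carrier (fib E m)" and wm: "w m \<in> carrier (fib E m)"
      using v w m by (auto simp: sections_def)
    obtain \<beta> where b: "free_iso loop_ring (rank E) (fib E m) \<beta>"
      using om by (auto simp: omega_module_def)
    have "\<beta> (v m) i \<theta> = \<beta> (w m) i \<theta>" if i: "i < rank E" for i \<theta>
    proof -
      interpret I: abelian_subgroup "vanishing_at (rank E) (fib E m) \<theta>" "fib E m"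
        using om by (rule vanishing_at_subgroup)
      have "eval_class E (m, \<theta>) (v m) = eval_class E (m, \<theta>) (w m)"
        using fun_cong[OF eq, of "(m, \<theta>)"] m by (simp add: eval_section_def)
      then have "v m \<in> vanishing_at (rank E) (fib E m) \<theta> +>\<^bsub>fib E m\<^esub> w m"
        using I.a_rcos_self[OF vm] by (simp add: eval_class_def)
      then obtain k where k: "k \<in> vanishing_at (rank E) (fib E m) \<theta>" "v m = k \<oplus>\<^bsub>fib E m\<^esub> w m"
        unfolding a_r_coset_def' UN_iff singleton_iff by (elim bexE)
      have "k \<in> carrier (fib E m)" "\<beta> k i \<theta> = 0"
        using k(1) b i unfolding vanishing_at_def by blast+
      then show ?thesis using free_iso_add[OF b _ wm i] k(2) by simp
    qed
    moreover have "\<beta> (v m) \<in> {..<rank E} \<rightarrow>\<^sub>E carrier loop_ring"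
      "\<beta> (w m) \<in> {..<rank E} \<rightarrow>\<^sub>E carrier loop_ring"
      using b vm wm by (auto simp: free_iso_def bij_betw_def)
    ultimately have "\<beta> (v m) = \<beta> (w m)" by (intro PiE_ext) auto
    then show "v m = w m" using b vm wm by (auto simp: free_iso_def bij_betw_def inj_on_def)
  qed
  then show "v = w" using v w by (intro PiE_ext[of v "points M" _ w]) (auto simp: sections_def)
qed

lemma eval_class_add:
  assumes "omega_vector_bundle M E" "m \<in> points M" "e \<in> carrier (fib E m)" "e' \<in> carrier (fib E m)"
  shows "eval_class E (m, \<theta>) e \<oplus>\<^bsub>caloron_fib E (m, \<theta>)\<^esub> eval_class E (m, \<theta>) e' =
    eval_class E (m, \<theta>) (e \<oplus>\<^bsub>fib E m\<^esub> e')"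
proof -
  interpret I: abelian_subgroup "vanishing_at (rank E) (fib E m) \<theta>" "fib E m"
    using assms by (intro vanishing_at_subgroup) (auto simp: omega_vector_bundle_def)
  show ?thesis using assms
    by (simp add: caloron_fib_def quotient_at_def Let_def eval_class_def I.a_rcos_sum)
qed

lemma const_loop [simp]: "(\<lambda>\<theta>. c) \<in> carrier loop_ring"
proof -
  have "C_k_on k UNIV (\<lambda>_::real. c)" for k and c :: complex
    by (induction k arbitrary: c) (simp_all add: frechet_derivative_const)
  then show ?thesis by (auto simp: loop_ring_def smooth_on_def)
qed

lemma free_iso_smult:
  assumes "free_iso loop_ring n N \<beta>" "v \<in> carrier N" "i < n"
  shows "\<beta> ((\<lambda>\<theta>. c) \<odot>\<^bsub>N\<^esub> v) i \<theta> = c * \<beta> v i \<theta>"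
proof -
  have "\<beta> ((\<lambda>\<theta>. c) \<odot>\<^bsub>N\<^esub> v) = (\<lambda>i\<in>{..<n}. (\<lambda>\<theta>. c) \<otimes>\<^bsub>loop_ring\<^esub> \<beta> v i)"
    using assms const_loop[of c] unfolding free_iso_def by blast
  with assms(3) show ?thesis by (simp add: loop_ring_def)
qed

lemma eval_class_smult:
  assumes E: "omega_vector_bundle M E" and m: "m \<in> points M" and e: "e \<in> carrier (fib E m)"
  shows "c \<odot>\<^bsub>caloron_fib E (m, \<theta>)\<^esub> eval_class E (m, \<theta>) e =
    eval_class E (m, \<theta>) ((\<lambda>\<theta>. c) \<odot>\<^bsub>fib E m\<^esub> e)"
proof -
  let ?N = "fib E m" and ?I = "vanishing_at (rank E) (fib E m) \<theta>"
  have om: "omega_module (rank E) ?N (framing E m)"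
    using E m by (simp add: omega_vector_bundle_def)
  interpret N: Module.module loop_ring ?N using om by (simp add: omega_module_def)
  interpret I: abelian_subgroup ?I ?N using om by (rule vanishing_at_subgroup)
  have "?I +>\<^bsub>?N\<^esub> ((\<lambda>\<theta>. c) \<odot>\<^bsub>?N\<^esub> v) = ?I +>\<^bsub>?N\<^esub> ((\<lambda>\<theta>. c) \<odot>\<^bsub>?N\<^esub> e)"
    if v: "v \<in> ?I +>\<^bsub>?N\<^esub> e" for v
  proof -
    obtain k where k: "k \<in> ?I" "v = k \<oplus>\<^bsub>?N\<^esub> e"
      using v unfolding a_r_coset_def' UN_iff singleton_iff by (elim bexE)
    have kc: "k \<in> carrier ?N" using k(1) unfolding vanishing_at_def by blast
    have ck: "(\<lambda>\<theta>. c) \<odot>\<^bsub>?N\<^esub> k \<in> ?I"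
      unfolding vanishing_at_def mem_Collect_eq
    proof (intro conjI allI impI)
      fix \<beta> i assume b: "free_iso loop_ring (rank E) ?N \<beta>" and i: "i < rank E"
      have "\<beta> k i \<theta> = 0" using k(1) b i unfolding vanishing_at_def by blast
      then show "\<beta> ((\<lambda>\<theta>. c) \<odot>\<^bsub>?N\<^esub> k) i \<theta> = 0" by (simp add: free_iso_smult[OF b kc i])
    qed (rule N.smult_closed[OF const_loop kc])
    have "(\<lambda>\<theta>. c) \<odot>\<^bsub>?N\<^esub> v = (\<lambda>\<theta>. c) \<odot>\<^bsub>?N\<^esub> k \<oplus>\<^bsub>?N\<^esub> (\<lambda>\<theta>. c) \<odot>\<^bsub>?N\<^esub> e"
      unfolding k(2) by (rule N.smult_r_distr[OF const_loop kc e])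
    then have "(\<lambda>\<theta>. c) \<odot>\<^bsub>?N\<^esub> v \<in> ?I +>\<^bsub>?N\<^esub> ((\<lambda>\<theta>. c) \<odot>\<^bsub>?N\<^esub> e)"
      using ck unfolding a_r_coset_def' UN_iff singleton_iff by (intro bexI)
    from I.a_repr_independence'[OF this N.smult_closed[OF const_loop e]] show ?thesis
      by (rule sym)
  qed
  then have "(\<Union>v\<in>?I +>\<^bsub>?N\<^esub> e. ?I +>\<^bsub>?N\<^esub> ((\<lambda>\<theta>. c) \<odot>\<^bsub>?N\<^esub> v)) =
      ?I +>\<^bsub>?N\<^esub> ((\<lambda>\<theta>. c) \<odot>\<^bsub>?N\<^esub> e)"
    by (intro UN_constant_eq[OF I.a_rcos_self[OF e]] ballI)
  then show ?thesis by (simp add: caloron_fib_def quotient_at_def Let_def eval_class_def)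
qed

lemma const_smooth_funs:
  fixes M :: "('m, 'a::euclidean_space) manifold"
  shows "(\<lambda>_. c) \<in> smooth_funs M"
proof -
  have "C_k_on k UNIV (\<lambda>_::'a. c)" for k and c :: real
    by (induction k arbitrary: c) (simp_all add: frechet_derivative_const)
  then have "smooth_on S (\<lambda>_::'a. c)" for S
    unfolding smooth_on_def by (intro ballI exI[of _ UNIV] exI[of _ "\<lambda>_. c"]) simp
  then show ?thesis by (simp add: smooth_funs_def)
qed

lemma vector_field_const:
  assumes "X \<in> vector_fields M" "m \<in> points M"
  shows "X (\<lambda>_. c) m = 0"
proof -
  have L: "X (\<lambda>p. 1 * 1) m = X (\<lambda>_. 1) m * 1 + 1 * X (\<lambda>_. 1) m"
    and S: "X (\<lambda>p. c * 1 + 0 * 1) m = c * X (\<lambda>_. 1) m + 0 * X (\<lambda>_. 1) m"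
    using assms const_smooth_funs[of 1 M] unfolding vector_fields_def by fast+
  from L S show ?thesis by simp
qed

lemma section_closed: "v \<in> sections M E \<Longrightarrow> m \<in> points M \<Longrightarrow> v m \<in> carrier (fib E m)"
  unfolding sections_def by blast

lemma module_connection_closed:
  "module_connection M E D \<Longrightarrow> X \<in> vector_fields M \<Longrightarrow> v \<in> sections M E \<Longrightarrow> D X v \<in> sections M E"
  unfolding module_connection_def by blast

lemma module_connection_cong:
  assumes "module_connection M E D" "X \<in> vector_fields M" "Y \<in> vector_fields M" "v \<in> sections M E"
    and "\<And>h m. h \<in> smooth_funs M \<Longrightarrow> m \<in> points M \<Longrightarrow> X h m = Y h m"
  shows "D X v = D Y v"
proof -
  have "(\<forall>h\<in>smooth_funs M. \<forall>m\<in>points M. X h m = Y h m) \<longrightarrow> D X v = D Y v"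
    using assms(1-4) unfolding module_connection_def by blast
  with assms(5) show ?thesis by blast
qed

lemma module_connection_scale:
  assumes "module_connection M E D" "X \<in> vector_fields M" "v \<in> sections M E"
    "f \<in> smooth_funs M" "m \<in> points M"
  shows "D (\<lambda>h p. f p * X h p) v m = (\<lambda>\<theta>. complex_of_real (f m)) \<odot>\<^bsub>fib E m\<^esub> D X v m"
  using assms unfolding module_connection_def by blast

lemma higgs_field_closed:
  "higgs_field M E \<phi> \<Longrightarrow> m \<in> points M \<Longrightarrow> e \<in> carrier (fib E m) \<Longrightarrow> \<phi> m e \<in> carrier (fib E m)"
  unfolding higgs_field_def by blast

lemma eval_section_apply:
  assumes "m \<in> points M"
  shows "eval_section M E v (m, \<theta>) = eval_class E (m, \<theta>) (v m)"
proof -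
  have q: "(m, \<theta>) \<in> points M \<times> UNIV" using assms by blast
  show ?thesis unfolding eval_section_def restrict_apply if_P[OF q] fst_conv by (rule refl)
qed

lemma eval_section_outside:
  assumes "m \<notin> points M"
  shows "eval_section M E v (m, \<theta>) = undefined"
    and "caloron_connection M E D \<phi> Z s (m, \<theta>) = undefined"
proof -
  have q: "(m, \<theta>) \<notin> points M \<times> UNIV" using assms by blast
  show "eval_section M E v (m, \<theta>) = undefined"
    unfolding eval_section_def restrict_apply if_not_P[OF q] by (rule refl)
  show "caloron_connection M E D \<phi> Z s (m, \<theta>) = undefined"
    unfolding caloron_connection_def Let_def restrict_apply if_not_P[OF q] by (rule refl)
qed

lemma caloron_connection_eval_section:
  assumes E: "omega_vector_bundle M E" and v: "v \<in> sections M E" and m: "m \<in> points M"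
  shows "caloron_connection M E D \<phi> Z (eval_section M E v) (m, \<theta>) =
    eval_class E (m, \<theta>) (D (base_part Z \<theta>) v m) \<oplus>\<^bsub>caloron_fib E (m, \<theta>)\<^esub>
    complex_of_real (dtheta Z (m, \<theta>)) \<odot>\<^bsub>caloron_fib E (m, \<theta>)\<^esub> eval_class E (m, \<theta>) (\<phi> m (v m))"
proof -
  have t: "the_inv_into (sections M E) (eval_section M E) (eval_section M E v) = v"
    by (rule the_inv_into_f_f[OF inj_on_eval_section[OF E] v])
  have q: "(m, \<theta>) \<in> points M \<times> UNIV" using m by blast
  show ?thesis
    unfolding caloron_connection_def Let_def t restrict_apply if_P[OF q] fst_conv snd_conv by (rule refl)
qed

lemma caloron_connection_lift:
  assumes E: "omega_vector_bundle M E" and D: "module_connection M E D" and \<phi>: "higgs_field M E \<phi>"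
    and X: "X \<in> vector_fields M" and v: "v \<in> sections M E"
  shows "caloron_connection M E D \<phi> (lift X) (eval_section M E v) = eval_section M E (D X v)"
proof
  fix q :: "'a \<times> real"
  obtain m \<theta> where q: "q = (m, \<theta>)" by fastforce
  have b: "base_part (lift X) r = X" for r
    by (simp add: base_part_def lift_def)
  show "caloron_connection M E D \<phi> (lift X) (eval_section M E v) q = eval_section M E (D X v) q"
  proof (cases "m \<in> points M")
    case m: True
    interpret N: Module.module loop_ring "fib E m"
      using E m by (simp add: omega_vector_bundle_def omega_module_def)
    have c: "D X v m \<in> carrier (fib E m)" "\<phi> m (v m) \<in> carrier (fib E m)"
      by (rule section_closed[OF module_connection_closed[OF D X v] m],
          rule higgs_field_closed[OF \<phi> m section_closed[OF v m]])
    have d: "dtheta (lift X) (m, \<theta>) = 0"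
      using vector_field_const[OF X m] by (simp add: dtheta_def lift_def)
    have z: "(\<lambda>_. 0) = \<zero>\<^bsub>loop_ring\<^esub>" by (simp add: loop_ring_def)
    have "caloron_connection M E D \<phi> (lift X) (eval_section M E v) q =
        eval_class E (m, \<theta>) (D X v m \<oplus>\<^bsub>fib E m\<^esub> (\<lambda>_. 0) \<odot>\<^bsub>fib E m\<^esub> \<phi> m (v m))"
      unfolding q caloron_connection_eval_section[OF E v m] b d of_real_0
        eval_class_smult[OF E m c(2)]
      by (rule eval_class_add[OF E m c(1) N.smult_closed[OF const_loop c(2)]])
    also have "\<dots> = eval_class E (m, \<theta>) (D X v m)"
      unfolding z N.smult_l_null[OF c(2)] N.M.r_zero[OF c(1)] by (rule refl)
    finally show ?thesis unfolding q eval_section_apply[OF m] .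
  qed (simp add: q eval_section_outside)
qed

lemma zero_vector_field: "(\<lambda>f p. 0) \<in> vector_fields M"
  using const_smooth_funs[of 0 M] by (simp add: vector_fields_def)

lemma module_connection_zero:
  assumes E: "omega_vector_bundle M E" and D: "module_connection M E D" and v: "v \<in> sections M E"
    and m: "m \<in> points M" and Y: "Y \<in> vector_fields M"
    and 0: "\<And>h p. h \<in> smooth_funs M \<Longrightarrow> p \<in> points M \<Longrightarrow> Y h p = 0"
  shows "D Y v m = \<zero>\<^bsub>fib E m\<^esub>"
proof -
  interpret N: Module.module loop_ring "fib E m"
    using E m by (simp add: omega_vector_bundle_def omega_module_def)
  have "D Y v = D (\<lambda>f p. 0) v"
    by (rule module_connection_cong[OF D Y zero_vector_field v]) (simp add: 0)
  then have "D Y v m = D (\<lambda>f p. 0) v m" by (rule fun_cong)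
  also have "\<dots> = D (\<lambda>h p. 0 * Y h p) v m" by simp
  also have "\<dots> = (\<lambda>\<theta>. complex_of_real 0) \<odot>\<^bsub>fib E m\<^esub> D Y v m"
    by (rule module_connection_scale[OF D Y v const_smooth_funs m])
  also have "(\<lambda>\<theta>. complex_of_real 0) = \<zero>\<^bsub>loop_ring\<^esub>" by (simp add: loop_ring_def)
  also have "\<zero>\<^bsub>loop_ring\<^esub> \<odot>\<^bsub>fib E m\<^esub> D Y v m = \<zero>\<^bsub>fib E m\<^esub>"
    by (rule N.smult_l_null[OF section_closed[OF module_connection_closed[OF D Y v] m]])
  finally show ?thesis .
qed

lemma caloron_connection_theta:
  assumes E: "omega_vector_bundle M E" and D: "module_connection M E D" and \<phi>: "higgs_field M E \<phi>"
    and v: "v \<in> sections M E"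
  shows "caloron_connection M E D \<phi> (coord_field UNIV) (eval_section M E v) =
    eval_section M E (\<lambda>m\<in>points M. \<phi> m (v m))"
proof
  fix q :: "'a \<times> real"
  obtain m \<theta> where q: "q = (m, \<theta>)" by fastforce
  have b: "base_part (coord_field UNIV) \<theta> = (\<lambda>f p. 0)"
    by (simp add: base_part_def coord_field_def)
  show "caloron_connection M E D \<phi> (coord_field UNIV) (eval_section M E v) q =
    eval_section M E (\<lambda>m\<in>points M. \<phi> m (v m)) q"
  proof (cases "m \<in> points M")
    case m: True
    interpret N: Module.module loop_ring "fib E m"
      using E m by (simp add: omega_vector_bundle_def omega_module_def)
    have c: "\<phi> m (v m) \<in> carrier (fib E m)"
      by (rule higgs_field_closed[OF \<phi> m section_closed[OF v m]])
    have z: "D (\<lambda>f p. 0) v m = \<zero>\<^bsub>fib E m\<^esub>"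
      by (rule module_connection_zero[OF E D v m zero_vector_field]) simp
    have "vector_derivative sin (at \<theta>) = cos \<theta>" "vector_derivative cos (at \<theta>) = - sin \<theta>"
      by (auto intro!: vector_derivative_at simp flip: has_real_derivative_iff_has_vector_derivative)
    then have d: "dtheta (coord_field UNIV) (m, \<theta>) = 1"
      using sin_cos_squared_add2[of \<theta>] by (simp add: dtheta_def coord_field_def power2_eq_square)
    have o: "(\<lambda>_. 1) = \<one>\<^bsub>loop_ring\<^esub>" by (simp add: loop_ring_def)
    have "caloron_connection M E D \<phi> (coord_field UNIV) (eval_section M E v) q =
        eval_class E (m, \<theta>) (\<zero>\<^bsub>fib E m\<^esub> \<oplus>\<^bsub>fib E m\<^esub> (\<lambda>_. 1) \<odot>\<^bsub>fib E m\<^esub> \<phi> m (v m))"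
      unfolding q caloron_connection_eval_section[OF E v m] b d z of_real_1
        eval_class_smult[OF E m c]
      by (rule eval_class_add[OF E m N.M.zero_closed N.smult_closed[OF const_loop c]])
    also have "\<dots> = eval_class E (m, \<theta>) (\<phi> m (v m))"
      unfolding o N.smult_one[OF c] N.M.l_zero[OF c] by (rule refl)
    finally show ?thesis unfolding q eval_section_apply[OF m] restrict_apply if_P[OF m] .
  qed (simp add: q eval_section_outside)
qed

text \<open>The family \<open>F\<close> of fibres is a complex vector bundle of rank \<open>n\<close> over \<open>P\<close> with space of
  sections \<open>\<Gamma>\<close>. In each degree at most one summand is nonzero.\<close>

definition chern_character ::
    "'p set \<Rightarrow> nat \<Rightarrow> ('p \<Rightarrow> (complex, 'v) module) \<Rightarrow> ('p \<Rightarrow> 'v) set \<Rightarrow> ('p, 'v) conn \<Rightarrow> 'p form" where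
  "chern_character P n F \<Gamma> D = (\<lambda>Zs x.
     \<Sum>j. 1 / fact j * (1 / (2 * pi * \<i>)) ^ j *
       extend_to_forms (\<lambda>Ts. mod_trace complex_ring n (F x) (foldr (\<circ>) Ts id))
         (replicate j (2, \<lambda>Ws. at_point \<Gamma> (curvature P F D (Ws ! 0) (Ws ! 1)) x)) Zs)"

definition string_form ::
    "('m, 'a::euclidean_space) manifold \<Rightarrow> ('m, 'e) omega_bundle \<Rightarrow> ('m, 'e) conn \<Rightarrow> ('m, 'e) higgs \<Rightarrow>
     'm form" where
  "string_form M E D \<phi> =
     fibre_integral (chern_character (points M \<times> UNIV) (rank E) (caloron_fib E)
       (caloron_sections M E) (caloron_connection M E D \<phi>))"


section \<open>Paths of connections and Higgs fields\<close>

text \<open>The derivative at \<open>t\<close> of a path in a fibre, in the coordinates given by any (equivalently, some)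
  isomorphism with \<open>L\<complex>\<^sup>n\<close>.\<close>

definition fibre_derivative :: "nat \<Rightarrow> 'e loop_module \<Rightarrow> (real \<Rightarrow> 'e) \<Rightarrow> real \<Rightarrow> 'e" where
  "fibre_derivative n N c t =
     (THE w. w \<in> carrier N \<and>
        (\<forall>\<beta>. free_iso loop_ring n N \<beta> \<longrightarrow> (\<forall>i<n. \<forall>\<theta>.
           ((\<lambda>u. \<beta> (c u) i \<theta>) has_vector_derivative \<beta> w i \<theta>) (at t within {0..1}))))"

definition smooth_path ::
    "('m, 'a::euclidean_space) manifold \<Rightarrow> ('m, 'e) omega_bundle \<Rightarrow> (real \<Rightarrow> ('m, 'e) conn) \<Rightarrow>
     (real \<Rightarrow> ('m, 'e) higgs) \<Rightarrow> bool" where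
  "smooth_path M E D \<phi> \<longleftrightarrow>
     (\<forall>t\<in>{0..1}. module_connection M E (D t) \<and> higgs_field M E (\<phi> t)) \<and>
     (\<forall>v\<in>sections M E.
        (\<forall>X\<in>vector_fields M. (\<lambda>q\<in>points M \<times> {0..1}. D (snd q) X v (fst q))
           \<in> sections (times_interval M) (pull_interval E)) \<and>
        (\<lambda>q\<in>points M \<times> {0..1}. \<phi> (snd q) (fst q) (v (fst q)))
           \<in> sections (times_interval M) (pull_interval E))"

text \<open>The connection on the pull-back to \<open>M \<times> [0,1]\<close> which restricts to \<open>D\<^sub>t\<close> on \<open>M \<times> {t}\<close> and is
  trivial in the vertical direction, that is, \<open>D\<^sub>t + dt \<partial>/\<partial>t\<close>: at \<open>(m, t)\<close> the vector field \<open>Y\<close>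
  splits into its component along \<open>M\<close> and \<open>dt(Y) \<partial>/\<partial>t\<close>. See the lemmas
  \<open>path_connection_restrict\<close> and \<open>path_connection_vertical\<close> below.\<close>

definition path_connection ::
    "('m, 'a::euclidean_space) manifold \<Rightarrow> ('m, 'e) omega_bundle \<Rightarrow> (real \<Rightarrow> ('m, 'e) conn) \<Rightarrow>
     ('m \<times> real, 'e) conn" where
  "path_connection M E D Y w =
     (\<lambda>(m, t)\<in>points M \<times> {0..1}.
        D t (base_part Y t) (\<lambda>p\<in>points M. w (p, t)) m
        \<oplus>\<^bsub>fib E m\<^esub>
        (\<lambda>\<theta>. complex_of_real (Y snd (m, t))) \<odot>\<^bsub>fib E m\<^esub>
          fibre_derivative (rank E) (fib E m) (\<lambda>u. w (m, u)) t)"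

lemma fibre_derivative_const:
  assumes N: "omega_module n N fr" and w: "w \<in> carrier N" and t: "t \<in> {0..1}"
    and c: "\<And>u. u \<in> {0..1} \<Longrightarrow> c u = w"
  shows "fibre_derivative n N c t = \<zero>\<^bsub>N\<^esub>"
proof -
  interpret N: Module.module loop_ring N using N by (simp add: omega_module_def)
  have z: "\<beta> \<zero>\<^bsub>N\<^esub> i \<theta>' = 0" if "free_iso loop_ring n N \<beta>" "i < n" for \<beta> i \<theta>'
    using free_iso_add[OF that(1) N.M.zero_closed N.M.zero_closed that(2), of \<theta>'] by simp
  have d: "((\<lambda>u. \<beta> (c u) i \<theta>) has_vector_derivative 0) (at t within {0..1})" for \<beta> i and \<theta> :: real
    by (rule has_vector_derivative_transform[OF t _ has_vector_derivative_const[of "\<beta> w i \<theta>"]])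
       (simp add: c)
  have nt: "at t within {0..1} \<noteq> bot" using t
    by (simp add: trivial_limit_within islimpt_Icc)
  show ?thesis unfolding fibre_derivative_def
  proof (rule the_equality)
    show "\<zero>\<^bsub>N\<^esub> \<in> carrier N \<and>
      (\<forall>\<beta>. free_iso loop_ring n N \<beta> \<longrightarrow> (\<forall>i<n. \<forall>\<theta>.
         ((\<lambda>u. \<beta> (c u) i \<theta>) has_vector_derivative \<beta> \<zero>\<^bsub>N\<^esub> i \<theta>) (at t within {0..1})))"
      by (simp add: z d)
    fix e assume e: "e \<in> carrier N \<and>
      (\<forall>\<beta>. free_iso loop_ring n N \<beta> \<longrightarrow> (\<forall>i<n. \<forall>\<theta>.
         ((\<lambda>u. \<beta> (c u) i \<theta>) has_vector_derivative \<beta> e i \<theta>) (at t within {0..1})))"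
    obtain \<beta> where b: "free_iso loop_ring n N \<beta>" using N by (auto simp: omega_module_def)
    have "\<beta> e i \<theta> = \<beta> \<zero>\<^bsub>N\<^esub> i \<theta>" if "i < n" for i \<theta>
      using vector_derivative_unique_within[OF nt d] e b that z[OF b that] by metis
    moreover have "\<beta> e \<in> {..<n} \<rightarrow>\<^sub>E carrier loop_ring" "\<beta> \<zero>\<^bsub>N\<^esub> \<in> {..<n} \<rightarrow>\<^sub>E carrier loop_ring"
      using b e by (auto simp: free_iso_def bij_betw_def)
    ultimately have "\<beta> e = \<beta> \<zero>\<^bsub>N\<^esub>" by (intro PiE_ext) auto
    then show "e = \<zero>\<^bsub>N\<^esub>" using b e by (auto simp: free_iso_def bij_betw_def inj_on_def)
  qed
qed

lemma path_connection_pull_back: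
  assumes E: "omega_vector_bundle M E" and D: "module_connection M E (D t)"
    and v: "v \<in> sections M E" and m: "m \<in> points M" and t: "t \<in> {0..1}"
    and Y: "base_part Y t \<in> vector_fields M"
  shows "path_connection M E D Y (\<lambda>q\<in>points M \<times> {0..1}. v (fst q)) (m, t) =
    D t (base_part Y t) v m"
proof -
  interpret N: Module.module loop_ring "fib E m"
    using E m by (simp add: omega_vector_bundle_def omega_module_def)
  have om: "omega_module (rank E) (fib E m) (framing E m)"
    using E m by (simp add: omega_vector_bundle_def)
  have vm: "v m \<in> carrier (fib E m)" and ext: "v \<in> extensional (points M)"
    using v m by (auto simp: sections_def PiE_def)
  have w: "(\<lambda>p\<in>points M. (\<lambda>q\<in>points M \<times> {0..1}. v (fst q)) (p, t)) = v"
    using ext t by (auto simp: fun_eq_iff extensional_def)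
  have d: "fibre_derivative (rank E) (fib E m)
      (\<lambda>u. (\<lambda>q\<in>points M \<times> {0..1}. v (fst q)) (m, u)) t = \<zero>\<^bsub>fib E m\<^esub>"
    using m by (intro fibre_derivative_const[OF om vm t]) simp
  have c: "D t (base_part Y t) v m \<in> carrier (fib E m)"
    by (rule section_closed[OF module_connection_closed[OF D Y v] m])
  have q: "(m, t) \<in> points M \<times> {0..1}" using m t by blast
  show ?thesis
    unfolding path_connection_def w restrict_apply[of _ _ "(m, t)"] if_P[OF q] prod.case
      d N.smult_r_null[OF const_loop]
    by (rule N.M.r_zero[OF c])
qed

lemma path_connection_restrict:
  assumes "omega_vector_bundle M E" "module_connection M E (D t)"
    "v \<in> sections M E" "m \<in> points M" "t \<in> {0..1}" and X: "X \<in> vector_fields M"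
  shows "path_connection M E D (lift X) (\<lambda>q\<in>points M \<times> {0..1}. v (fst q)) (m, t) = D t X v m"
proof -
  have "base_part (lift X) t = X" by (simp add: base_part_def lift_def)
  then show ?thesis
    using path_connection_pull_back[where D = D and Y = "lift X" and t = t, OF assms(1-5)] X by simp
qed

lemma path_connection_vertical:
  assumes "omega_vector_bundle M E" "module_connection M E (D t)"
    "v \<in> sections M E" "m \<in> points M" "t \<in> {0..1}"
  shows "path_connection M E D (coord_field {0..1}) (\<lambda>q\<in>points M \<times> {0..1}. v (fst q)) (m, t) =
    \<zero>\<^bsub>fib E m\<^esub>"
proof -
  have "at t within {0..1} \<noteq> bot"
    using assms(5) by (simp add: trivial_limit_within islimpt_Icc)
  then have z: "base_part (coord_field {0..1}) t = (\<lambda>(f :: 'a \<Rightarrow> real) p. 0)"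
    by (simp add: base_part_def coord_field_def
      vector_derivative_within[OF _ has_vector_derivative_const])
  have Y: "base_part (coord_field {0..1}) t \<in> vector_fields M"
    unfolding z by (rule zero_vector_field)
  show ?thesis
    unfolding path_connection_pull_back[where D = D and t = t, OF assms Y] unfolding z
    by (rule module_connection_zero[where D = "D t", OF assms(1-4) zero_vector_field]) (rule refl)
qed

definition path_higgs :: "(real \<Rightarrow> ('m, 'e) higgs) \<Rightarrow> ('m \<times> real, 'e) higgs" where
  "path_higgs \<phi> = (\<lambda>(m, t). \<phi> t m)"

definition string_potential ::
    "('m, 'a::euclidean_space) manifold \<Rightarrow> ('m, 'e) omega_bundle \<Rightarrow> (real \<Rightarrow> ('m, 'e) conn) \<Rightarrow>
     (real \<Rightarrow> ('m, 'e) higgs) \<Rightarrow> 'm form" where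
  "string_potential M E D \<phi> = (\<lambda>Xs m. integral {0..1} (\<lambda>t.
     slice_pullback t
       (interior_product (coord_field {0..1})
         (string_form (times_interval M) (pull_interval E) (path_connection M E D) (path_higgs \<phi>)))
       Xs m))"


section \<open>The normalised symmetrised trace of endomorphism-valued forms\<close>

type_synonym ('m, 'e) endo_form = "nat \<times> ('m vfield list \<Rightarrow> 'm \<Rightarrow> 'e \<Rightarrow> 'e)"

text \<open>The trace over loops of a loop-linear endomorphism is its trace pointwise in \<open>\<theta>\<close>.\<close>

definition sym_trace :: "nat \<Rightarrow> 'e loop_module \<Rightarrow> real \<Rightarrow> ('e \<Rightarrow> 'e) list \<Rightarrow> complex" where
  "sym_trace n N \<theta> Ts =
     1 / ((fact (length Ts))\<^sup>2 * (2 * pi * \<i>) ^ length Ts) *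
     (\<Sum>\<sigma> | \<sigma> permutes {..<length Ts}.
        mod_trace loop_ring n N (foldr (\<circ>) (map (\<lambda>i. Ts ! \<sigma> i) [0..<length Ts]) id) \<theta>)"

definition tr_bar ::
    "('m, 'e) omega_bundle \<Rightarrow> ('m, 'e) endo_form list \<Rightarrow> real \<Rightarrow> 'm form" where
  "tr_bar E As \<theta> = (\<lambda>Xs m.
     extend_to_forms (sym_trace (rank E) (fib E m) \<theta>) (map (\<lambda>(p, A). (p, \<lambda>Ys. A Ys m)) As) Xs)"

definition curvature_form ::
    "('m, 'a::euclidean_space) manifold \<Rightarrow> ('m, 'e) omega_bundle \<Rightarrow> ('m, 'e) conn \<Rightarrow>
     ('m, 'e) endo_form" where
  "curvature_form M E D =
     (2, \<lambda>Ys. at_point (sections M E) (curvature (points M) (fib E) D (Ys ! 0) (Ys ! 1)))"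

definition higgs_derivative_form ::
    "('m, 'a::euclidean_space) manifold \<Rightarrow> ('m, 'e) omega_bundle \<Rightarrow> ('m, 'e) conn \<Rightarrow>
     ('m, 'e) higgs \<Rightarrow> ('m, 'e) endo_form" where
  "higgs_derivative_form M E D \<phi> =
     (1, \<lambda>Ys. at_point (sections M E) (higgs_derivative (points M) (fib E) D \<phi> (Ys ! 0)))"

definition conn_dot_form ::
    "('m, 'a::euclidean_space) manifold \<Rightarrow> ('m, 'e) omega_bundle \<Rightarrow> (real \<Rightarrow> ('m, 'e) conn) \<Rightarrow>
     real \<Rightarrow> ('m, 'e) endo_form" where
  "conn_dot_form M E D t =
     (1, \<lambda>Ys. at_point (sections M E)
        (\<lambda>v. \<lambda>m\<in>points M. fibre_derivative (rank E) (fib E m) (\<lambda>u. D u (Ys ! 0) v m) t))"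

definition higgs_dot_form ::
    "('m, 'e) omega_bundle \<Rightarrow> (real \<Rightarrow> ('m, 'e) higgs) \<Rightarrow> real \<Rightarrow> ('m, 'e) endo_form" where
  "higgs_dot_form E \<phi> t =
     (0, \<lambda>Ys m e. fibre_derivative (rank E) (fib E m) (\<lambda>u. \<phi> u m e) t)"

end

theory Submission
  imports Defs
begin

text \<open>In a local frame of the bundle, and at fixed \<open>t\<close> and \<open>\<theta>\<close>, the curvature of the caloron connection of
  the path on \<open>M \<times> [0,1] \<times> S\<^sup>1\<close> has the matrix components
  \<open>\<triangle>'(X)\<close> in the directions \<open>(\<partial>\<^sub>t, X)\<close>, \<open>\<phi>'\<close> in \<open>(\<partial>\<^sub>t, \<partial>\<^sub>\<theta>)\<close>, \<open>(\<triangle>\<phi>)(X)\<close> in \<open>(X, \<partial>\<^sub>\<theta>)\<close> and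
  \<open>\<R>(X, Y)\<close> in \<open>(X, Y)\<close>, for \<open>X\<close> and \<open>Y\<close> tangent to \<open>M\<close>. The commutators with \<open>\<partial>\<^sub>t\<close> are derivatives in
  \<open>t\<close> because mixed partial derivatives commute.
  The alternating sum that evaluates \<open>tr(R\<^sup>j)\<close> on \<open>(\<partial>\<^sub>t, X\<^sub>1, \<dots>, X\<^sub>p, \<partial>\<^sub>\<theta>)\<close> is split according to whether \<open>\<partial>\<^sub>t\<close>
  and \<open>\<partial>\<^sub>\<theta>\<close> enter the same factor or two different ones; symmetrising over the order of the factors, the
  \<open>2j\<close> positions of the first kind give the \<open>\<phi>'\<close> term and the \<open>4j(j - 1)\<close> of the second kind the \<open>\<triangle>'\<close> term.
  The identity thus holds between integrands, and only \<open>j = p/2 + 1\<close> contributes.\<close>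

section \<open>Calculus of smooth functions\<close>

text \<open>Vector fields and connections are given as operators on global functions and sections;
  neither locality nor components are part of the data. Much of the work recovers them: Hadamard's
  lemma and cutoff functions bring a vector field into the form \<Sum> a_b \<partial>_b, and a frame
  multiplied by a cutoff brings a connection into the form d + A. Endomorphisms are read off from an
  arbitrarily chosen section through a fibre element, traces from an arbitrarily chosen basis, so
  tensoriality and invariance of the trace must be proved before any matrix appears. At corners and
  at the ends of [0,1] derivatives are computed from any smooth extension.

  Constants: the Chern form carries 1/(j! 2^j (2 \<pi> i)^j), the right-hand side 1/((j!)^2 (2 \<pi>
  i)^j) and one 1/2 for each curvature factor. Symmetrising over the order of the factors supplies
  the second j!, and 2j/2^j = j/2^(j-1), 4j(j-1)/2^j = j(j-1)/2^(j-2) leave j and j(j-1).\<close>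

lemma frechet_derivative_eq: "(f has_derivative f') (at x) \<Longrightarrow> frechet_derivative f (at x) = f'"
  by (rule frechet_derivative_at[symmetric])

lemma C_k_on_SucI:
  assumes "\<And>x. x \<in> U \<Longrightarrow> (f has_derivative f' x) (at x)"
    and "\<And>v. C_k_on k U (\<lambda>x. frechet_derivative f (at x) v)"
  shows "C_k_on (Suc k) U f"
  using assms by (auto simp: differentiable_def)

lemma C_k_on_has_derivative:
  assumes "C_k_on (Suc k) U f" "x \<in> U"
  shows "(f has_derivative frechet_derivative f (at x)) (at x)"
  using assms by (simp add: frechet_derivative_works)

text \<open>Over an open set the derivative at a point sees only the germ of the function, so
  equality on \<open>U\<close> passes to derivatives of every order.\<close>

lemma C_k_on_cong:
  assumes "open U" "\<And>x. x \<in> U \<Longrightarrow> f x = g x" "C_k_on k U f"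
  shows "C_k_on k U g"
  using assms(2,3)
proof (induction k arbitrary: f g)
  case 0
  show ?case using continuous_on_eq[OF 0(2)[unfolded C_k_on.simps] 0(1)] by simp
next
  case (Suc k)
  have d: "(g has_derivative frechet_derivative f (at x)) (at x)" if "x \<in> U" for x
    using has_derivative_transform_within_open[OF C_k_on_has_derivative[OF Suc.prems(2) that] assms(1) that]
      Suc.prems(1) by blast
  have "C_k_on k U (\<lambda>x. frechet_derivative g (at x) v)" for v
    by (rule Suc.IH[of "\<lambda>x. frechet_derivative f (at x) v"])
       (use Suc.prems(2) frechet_derivative_eq[OF d] in simp_all)
  with d show ?case by (rule C_k_on_SucI)
qed

text \<open>Lets a derivative be supplied by a formula \<open>f'\<close> valid on \<open>U\<close>,
  whereas the definition of \<open>C_k_on\<close> speaks of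
  \<open>frechet_derivative\<close>.\<close>

lemma C_k_on_SucI':
  assumes "open U" "\<And>x. x \<in> U \<Longrightarrow> (f has_derivative f' x) (at x)"
    and "\<And>v. C_k_on k U (\<lambda>x. f' x v)"
  shows "C_k_on (Suc k) U f"
  by (rule C_k_on_SucI[OF assms(2)], assumption, rule C_k_on_cong[OF assms(1) _ assms(3)])
     (simp add: frechet_derivative_eq[OF assms(2)])

lemma C_k_on_subset: "C_k_on k U f \<Longrightarrow> V \<subseteq> U \<Longrightarrow> C_k_on k V f"
  by (induction k arbitrary: f) (auto intro: continuous_on_subset)

lemma C_k_on_Suc_imp: "C_k_on (Suc k) U f \<Longrightarrow> C_k_on k U f"
proof (induction k arbitrary: f)
  case 0
  then show ?case
    by (auto intro!: continuous_at_imp_continuous_on differentiable_imp_continuous_within)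
qed simp

lemma C_k_on_continuous: "C_k_on k U f \<Longrightarrow> continuous_on U f"
  by (induction k) (auto dest: C_k_on_Suc_imp simp del: C_k_on.simps(2))

lemma C_k_on_const: "C_k_on k U (\<lambda>x. c)"
  by (induction k arbitrary: c) (simp_all add: frechet_derivative_const)

lemma C_k_on_bounded_linear:
  assumes "bounded_linear f"
  shows "C_k_on k U f"
proof (cases k)
  case 0
  then show ?thesis using assms by (simp add: linear_continuous_on)
next
  case (Suc j)
  have "frechet_derivative f (at x) = f" for x
    by (rule frechet_derivative_eq[OF bounded_linear_imp_has_derivative[OF assms]])
  then show ?thesis unfolding Suc
    by (intro C_k_on_SucI[OF bounded_linear_imp_has_derivative[OF assms]]) (simp add: C_k_on_const)
qed

lemma C_k_on_linear_comp:
  assumes "bounded_linear L" "open U" "C_k_on k U f"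
  shows "C_k_on k U (\<lambda>x. L (f x))"
  using assms(3)
proof (induction k arbitrary: f)
  case 0
  then show ?case by (simp add: bounded_linear.continuous_on[OF assms(1)])
next
  case (Suc k)
  show ?case
    by (rule C_k_on_SucI'[OF assms(2) bounded_linear.has_derivative[OF assms(1) C_k_on_has_derivative[OF Suc.prems]]])
       (assumption, rule Suc.IH, use Suc.prems in simp)
qed

lemma C_k_on_add:
  assumes "open U" "C_k_on k U f" "C_k_on k U g"
  shows "C_k_on k U (\<lambda>x. f x + g x)"
  using assms(2,3)
proof (induction k arbitrary: f g)
  case (Suc k)
  show ?case
    by (rule C_k_on_SucI'[OF assms(1) has_derivative_add[OF C_k_on_has_derivative[OF Suc.prems(1)]
          C_k_on_has_derivative[OF Suc.prems(2)]]])
       (assumption, assumption, rule Suc.IH, use Suc.prems in simp_all)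
qed (auto intro: continuous_on_add)

lemma C_k_on_sum:
  assumes "open U" "\<And>i. i \<in> I \<Longrightarrow> C_k_on k U (f i)"
  shows "C_k_on k U (\<lambda>x. \<Sum>i\<in>I. f i x)"
  using assms(2)
  by (induction I rule: infinite_finite_induct) (auto intro!: C_k_on_add C_k_on_const assms(1))

lemma C_k_on_bilinear:
  assumes "bounded_bilinear B" "open U" "C_k_on k U f" "C_k_on k U g"
  shows "C_k_on k U (\<lambda>x. B (f x) (g x))"
  using assms(3,4)
proof (induction k arbitrary: f g)
  case 0
  then show ?case using assms(1) by (simp add: bounded_bilinear.continuous_on)
next
  case (Suc k)
  show ?case
    by (rule C_k_on_SucI'[OF assms(2) bounded_bilinear.FDERIV[OF assms(1)
          C_k_on_has_derivative[OF Suc.prems(1)] C_k_on_has_derivative[OF Suc.prems(2)]]])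
       (assumption, assumption, use Suc.prems in \<open>intro C_k_on_add assms(2) Suc.IH C_k_on_Suc_imp[OF Suc.prems(1)]
          C_k_on_Suc_imp[OF Suc.prems(2)]; simp\<close>)
qed

text \<open>In the chain rule the direction Dg(x) v varies with x as well. Expanding it in the basis
  of the middle space separates the two dependences, and the induction hypothesis applies to the
  partial derivatives of \<open>f\<close>. The induction runs over the order of \<open>f\<close>
  alone, with \<open>g\<close> smooth throughout.\<close>

lemma C_k_on_compose:
  fixes g :: "'a::real_normed_vector \<Rightarrow> 'b::euclidean_space"
    and f :: "'b \<Rightarrow> 'c::real_normed_vector"
  assumes U: "open U" and sub: "g ` U \<subseteq> V" and g: "\<And>k. C_k_on k U g" and "C_k_on k V f"
  shows "C_k_on k U (\<lambda>x. f (g x))"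
  using assms(4)
proof (induction k arbitrary: f)
  case 0
  then show ?case using g[of 0] sub by (auto intro: continuous_on_compose2)
next
  case (Suc k)
  have 1: "((\<lambda>x. f (g x)) has_derivative
      (\<lambda>v. frechet_derivative f (at (g x)) (frechet_derivative g (at x) v))) (at x)"
    if "x \<in> U" for x
    by (rule has_derivative_compose[OF C_k_on_has_derivative[OF g that] C_k_on_has_derivative[OF Suc.prems]])
       (use that sub in auto)
  have lin: "frechet_derivative f (at (g x)) w = (\<Sum>b\<in>Basis. (w \<bullet> b) *\<^sub>R frechet_derivative f (at (g x)) b)"
    if "x \<in> U" for x w
  proof -
    have "linear (frechet_derivative f (at (g x)))"
      using C_k_on_has_derivative[OF Suc.prems, of "g x"] that sub
      by (auto intro: has_derivative_linear)
    from linear_sum[OF this, of "\<lambda>b. (w \<bullet> b) *\<^sub>R b" Basis] linear_scale[OF this]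
    show ?thesis by (simp add: euclidean_representation)
  qed
  have 2: "C_k_on k U (\<lambda>x. \<Sum>b\<in>Basis. (frechet_derivative g (at x) v \<bullet> b) *\<^sub>R frechet_derivative f (at (g x)) b)" for v
    using Suc.prems g[of "Suc k"]
    by (intro C_k_on_sum U C_k_on_bilinear[OF bounded_bilinear_scaleR] Suc.IH
        C_k_on_linear_comp[OF bounded_linear_inner_left]) auto
  show ?case
    by (rule C_k_on_SucI'[OF U 1]) (auto intro!: C_k_on_cong[OF U _ 2] lin[symmetric])
qed

lemma C_k_on_Pair:
  assumes "open U" "C_k_on k U f" "C_k_on k U g"
  shows "C_k_on k U (\<lambda>x. (f x, g x))"
  using assms(2,3)
proof (induction k arbitrary: f g)
  case (Suc k)
  show ?case
    by (rule C_k_on_SucI'[OF assms(1) has_derivative_Pair[OF C_k_on_has_derivative[OF Suc.prems(1)]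
          C_k_on_has_derivative[OF Suc.prems(2)]]])
       (assumption, assumption, rule Suc.IH, use Suc.prems in simp_all)
qed (auto intro: continuous_on_Pair)

text \<open>Differentiation under the integral sign replaces \<open>H\<close> by its derivative in
  the direction \<open>(v, 0)\<close>, an integrand of the same kind of one order less, so the
  induction closes.\<close>

lemma C_k_on_parametric_integral:
  fixes H :: "'a::euclidean_space \<times> real \<Rightarrow> 'b::banach"
  assumes U: "open U" "convex U" and sub: "U \<times> {0..1} \<subseteq> W" and "C_k_on k W H"
  shows "C_k_on k U (\<lambda>x. integral {0..1} (\<lambda>s. H (x, s)))"
  using assms(4)
proof (induction k arbitrary: H)
  case 0
  have "continuous_on (U \<times> cbox 0 1) (\<lambda>(x, t). H (x, t))"
    using 0 sub by (auto simp: case_prod_eta intro: continuous_on_subset)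
  then show ?case using integral_continuous_on_param[of U 0 1 "\<lambda>x t. H (x, t)"] by simp
next
  case (Suc k)
  define D where "D x s v = frechet_derivative H (at (x, s)) (v, 0)" for x s v
  have d: "((\<lambda>x. H (x, s)) has_derivative D x s) (at x)" if "x \<in> U" "s \<in> {0..1}" for x s
  proof -
    have "((\<lambda>x. (x, s)) has_derivative (\<lambda>v. (v, 0))) (at x)"
      by (auto intro!: derivative_eq_intros)
    moreover have "(x, s) \<in> W" using sub that by blast
    ultimately show ?thesis unfolding D_def
      by (rule has_derivative_compose[OF _ C_k_on_has_derivative[OF Suc.prems]])
  qed
  \<comment> \<open>The Leibniz rule wants the derivative as a continuous family of bounded linear
    maps; on a Euclidean domain this continuity can be checked on each vector separately.\<close>
  define L where "L x s = Blinfun (D x s)" for x s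
  have L: "blinfun_apply (L x s) = D x s" if "x \<in> U" "s \<in> {0..1}" for x s
    unfolding L_def by (rule bounded_linear_Blinfun_apply[OF has_derivative_bounded_linear[OF d[OF that]]])
  have cD: "continuous_on (U \<times> {0..1}) (\<lambda>(x, s). D x s v)" for v
  proof -
    have "C_k_on k W (\<lambda>z. frechet_derivative H (at z) (v, 0))" using Suc.prems by simp
    then have "continuous_on W (\<lambda>z. frechet_derivative H (at z) (v, 0))" by (rule C_k_on_continuous)
    then show ?thesis using sub unfolding D_def by (auto simp: case_prod_eta intro: continuous_on_subset)
  qed
  have cL: "continuous_on (U \<times> cbox 0 1) (\<lambda>(x, s). L x s)"
  proof (rule continuous_on_blinfun_componentwise)
    fix i :: 'a
    show "continuous_on (U \<times> cbox 0 1) (\<lambda>x. blinfun_apply (case x of (x, s) \<Rightarrow> L x s) i)"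
      by (rule continuous_on_eq[of _ "\<lambda>(x, s). D x s i"]) (use cD[of i] L in auto)
  qed
  have cH: "continuous_on (cbox 0 1) (\<lambda>s. H (x, s))" if "x \<in> U" for x
  proof -
    have "continuous_on W H" by (rule C_k_on_continuous[OF Suc.prems])
    then show ?thesis
      by (rule continuous_on_compose2) (use sub that in \<open>auto intro!: continuous_intros\<close>)
  qed
  have 1: "((\<lambda>x. integral {0..1} (\<lambda>s. H (x, s))) has_derivative
      (\<lambda>v. integral {0..1} (\<lambda>s. D x s v))) (at x)" if x: "x \<in> U" for x
  proof -
    have "((\<lambda>x. integral (cbox 0 1) (\<lambda>s. H (x, s))) has_derivative integral (cbox 0 1) (L x)) (at x within U)"
      by (rule leibniz_rule[OF _ _ cL x U(2)])
         (use d L integrable_continuous[OF cH] in \<open>auto intro: has_derivative_at_withinI\<close>)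
    moreover have "blinfun_apply (integral (cbox 0 1) (L x)) v = integral {0..1} (\<lambda>s. D x s v)" for v
    proof -
      have "L x integrable_on cbox 0 1"
        by (rule integrable_continuous, rule continuous_on_compose2[OF cL, of _ "Pair x", simplified])
           (use x in \<open>auto intro!: continuous_intros\<close>)
      then have "blinfun_apply (integral (cbox 0 1) (L x)) v = integral (cbox 0 1) (\<lambda>s. blinfun_apply (L x s) v)"
        by (rule blinfun_apply_integral)
      also have "\<dots> = integral {0..1} (\<lambda>s. D x s v)"
        using L[OF x] by (auto intro!: integral_cong)
      finally show ?thesis .
    qed
    then have "blinfun_apply (integral (cbox 0 1) (L x)) = (\<lambda>v. integral {0..1} (\<lambda>s. D x s v))" by (rule ext)
    ultimately show ?thesis unfolding at_within_open[OF x U(1)] by simp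
  qed
  show ?case
    by (rule C_k_on_SucI'[OF U(1) 1], assumption, unfold D_def, rule Suc.IH) (use Suc.prems in simp)
qed

text \<open>Symmetry through integrals: the increment of \<open>f\<close> along \<open>v\<close> is
  the integral of \<open>fv\<close>. Differentiated along \<open>w\<close> under the integral sign,
  and then in the upper limit at 0, it gives the derivative of \<open>fv\<close> along
  \<open>w\<close>; done directly, the same two steps give the derivative of \<open>fw\<close> along
  \<open>v\<close>.\<close>

lemma C_k_on_mixed_derivatives:
  fixes f :: "'a::euclidean_space \<Rightarrow> 'b::banach"
  assumes U: "open U" "x \<in> U" and f: "\<And>k. C_k_on k U f"
  shows "frechet_derivative (\<lambda>y. frechet_derivative f (at y) v) (at x) w =
    frechet_derivative (\<lambda>y. frechet_derivative f (at y) w) (at x) v"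
proof -
  define fv where "fv = (\<lambda>y. frechet_derivative f (at y) v)"
  define fw where "fw = (\<lambda>y. frechet_derivative f (at y) w)"
  define fvw where "fvw = (\<lambda>y. frechet_derivative fv (at y) w)"
  have Cv: "C_k_on k U fv" and Cw: "C_k_on k U fw" for k
    using f[of "Suc k"] by (auto simp: fv_def fw_def)
  have Cvw: "C_k_on k U fvw" for k using Cv[of "Suc k"] by (simp add: fvw_def)
  have cont: "continuous_on U g" if "\<And>k. C_k_on k U g" for g :: "'a \<Rightarrow> 'b" using that[of 0] by simp
  obtain \<delta> where \<delta>: "\<delta> > 0" "ball x \<delta> \<subseteq> U" using U openE by blast
  \<comment> \<open>The displacement s v + u w has norm at most \<epsilon> (norm v + norm w). The
    factor 2 leaves room below \<delta>, and the summand 1 covers the case that both vectors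
    vanish.\<close>
  define \<epsilon> where "\<epsilon> = \<delta> / (2 * (norm v + norm w + 1))"
  have \<epsilon>: "\<epsilon> > 0" using \<delta> by (auto simp: \<epsilon>_def intro!: divide_pos_pos add_nonneg_pos)
  have inU: "x + s *\<^sub>R v + u *\<^sub>R w \<in> U" if "s \<in> {0..\<epsilon>}" "u \<in> {-\<epsilon>..\<epsilon>}" for s u
  proof -
    have "norm (s *\<^sub>R v + u *\<^sub>R w) \<le> \<bar>s\<bar> * norm v + \<bar>u\<bar> * norm w"
      by (rule norm_triangle_le) simp
    also have "\<dots> \<le> \<epsilon> * norm v + \<epsilon> * norm w"
      using that by (intro add_mono mult_right_mono) auto
    also have "\<dots> < \<epsilon> * (2 * (norm v + norm w + 1))"
      using mult_nonneg_nonneg[of \<epsilon> "norm v"] mult_nonneg_nonneg[of \<epsilon> "norm w"] \<epsilon>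
      by (simp add: algebra_simps add_nonneg_pos)
    also have "\<dots> = \<delta>"
      using add_nonneg_pos[of "norm v + norm w" 1] unfolding \<epsilon>_def
      by (intro nonzero_eq_divide_eq[THEN iffD1, OF _ refl]) auto
    finally have "dist x (x + s *\<^sub>R v + u *\<^sub>R w) < \<delta>"
      by (simp add: dist_norm norm_minus_commute add.assoc add.commute)
    then show ?thesis using \<delta>(2) by auto
  qed
  have line: "((\<lambda>s. g (y + s *\<^sub>R d)) has_vector_derivative frechet_derivative g (at (y + s *\<^sub>R d)) d) (at s within S)"
    if "y + s *\<^sub>R d \<in> U" "\<And>k. C_k_on k U g" for g :: "'a \<Rightarrow> 'b" and y d s S
  proof -
    have "((\<lambda>s. y + s *\<^sub>R d) has_derivative (\<lambda>h. h *\<^sub>R d)) (at s within S)"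
      by (auto intro!: derivative_eq_intros)
    from has_derivative_compose[OF this C_k_on_has_derivative[OF that(2,1)]]
    show ?thesis unfolding has_vector_derivative_def
      using linear_scale[OF has_derivative_linear[OF C_k_on_has_derivative[OF that(2,1)]]] by simp
  qed
  have ftc: "integral {0..s} (\<lambda>\<sigma>. fv (x + \<sigma> *\<^sub>R v + u *\<^sub>R w)) = f (x + s *\<^sub>R v + u *\<^sub>R w) - f (x + u *\<^sub>R w)"
    if s: "s \<in> {0..\<epsilon>}" and u: "u \<in> {-\<epsilon>..\<epsilon>}" for s u
  proof -
    have eq: "(x + u *\<^sub>R w) + \<sigma> *\<^sub>R v = x + \<sigma> *\<^sub>R v + u *\<^sub>R w" for \<sigma> by simp
    have "((\<lambda>\<sigma>. f (x + \<sigma> *\<^sub>R v + u *\<^sub>R w)) has_vector_derivative fv (x + \<sigma> *\<^sub>R v + u *\<^sub>R w)) (at \<sigma> within {0..s})"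
      if "\<sigma> \<in> {0..s}" for \<sigma>
      using line[of "x + u *\<^sub>R w" \<sigma> v f "{0..s}"] inU[of \<sigma> u] f that s u unfolding eq fv_def by auto
    from fundamental_theorem_of_calculus[OF _ this] s show ?thesis
      by (auto intro!: integral_unique)
  qed
  \<comment> \<open>The increment in \<open>ftc\<close> is differentiated in \<open>u\<close> at 0
    in two ways, under the integral sign and directly; uniqueness of the derivative equates the
    results.\<close>
  have "fw (x + s *\<^sub>R v) - fw x = integral {0..s} (\<lambda>\<sigma>. fvw (x + \<sigma> *\<^sub>R v))" if s: "s \<in> {0..\<epsilon>}" for s
  proof -
    have "((\<lambda>u. integral (cbox 0 s) (\<lambda>\<sigma>. fv (x + \<sigma> *\<^sub>R v + u *\<^sub>R w))) has_vector_derivative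
        integral (cbox 0 s) (\<lambda>\<sigma>. fvw (x + \<sigma> *\<^sub>R v + 0 *\<^sub>R w))) (at 0 within {-\<epsilon>..\<epsilon>})"
    proof (rule leibniz_rule_vector_derivative)
      show "((\<lambda>u. fv (x + \<sigma> *\<^sub>R v + u *\<^sub>R w)) has_vector_derivative fvw (x + \<sigma> *\<^sub>R v + u *\<^sub>R w))
         (at u within {-\<epsilon>..\<epsilon>})" if "u \<in> {-\<epsilon>..\<epsilon>}" "\<sigma> \<in> cbox 0 s" for u \<sigma>
        unfolding fvw_def using inU[of \<sigma> u] that s Cv by (intro line) auto
      show "(\<lambda>\<sigma>. fv (x + \<sigma> *\<^sub>R v + u *\<^sub>R w)) integrable_on cbox 0 s" if "u \<in> {-\<epsilon>..\<epsilon>}" for u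
        by (rule integrable_continuous, rule continuous_on_compose2[OF cont[OF Cv]])
           (use inU that s in \<open>auto intro!: continuous_intros\<close>)
      show "continuous_on ({-\<epsilon>..\<epsilon>} \<times> cbox 0 s) (\<lambda>(u, \<sigma>). fvw (x + \<sigma> *\<^sub>R v + u *\<^sub>R w))"
        unfolding split_beta by (rule continuous_on_compose2[OF cont[OF Cvw]])
           (use inU s in \<open>auto intro!: continuous_intros\<close>)
    qed (use \<epsilon> in auto)
    moreover have "((\<lambda>u. f (x + s *\<^sub>R v + u *\<^sub>R w) - f (x + u *\<^sub>R w)) has_vector_derivative
        fw (x + s *\<^sub>R v + 0 *\<^sub>R w) - fw (x + 0 *\<^sub>R w)) (at 0 within {-\<epsilon>..\<epsilon>})"
      unfolding fw_def using inU[of s 0] inU[of 0 0] s \<epsilon> f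
      by (intro has_vector_derivative_diff line) auto
    then have "((\<lambda>u. integral (cbox 0 s) (\<lambda>\<sigma>. fv (x + \<sigma> *\<^sub>R v + u *\<^sub>R w))) has_vector_derivative
        fw (x + s *\<^sub>R v + 0 *\<^sub>R w) - fw (x + 0 *\<^sub>R w)) (at 0 within {-\<epsilon>..\<epsilon>})"
      by (rule has_vector_derivative_transform[rotated 2]) (use ftc s \<epsilon> in auto)
    moreover have "at 0 within {-\<epsilon>..\<epsilon>} \<noteq> bot"
      using \<epsilon> by (simp add: trivial_limit_within islimpt_Icc)
    ultimately show ?thesis using vector_derivative_unique_within by fastforce
  qed
  moreover have "((\<lambda>s. integral {0..s} (\<lambda>\<sigma>. fvw (x + \<sigma> *\<^sub>R v))) has_vector_derivative fvw (x + 0 *\<^sub>R v)) (at 0 within {0..\<epsilon>})"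
    by (rule integral_has_vector_derivative, rule continuous_on_compose2[OF cont[OF Cvw]])
       (use inU[of _ 0] \<epsilon> in \<open>auto intro!: continuous_intros\<close>)
  ultimately have "((\<lambda>s. fw (x + s *\<^sub>R v) - fw x) has_vector_derivative fvw x) (at 0 within {0..\<epsilon>})"
    using \<epsilon> by (auto intro: has_vector_derivative_transform[rotated 2])
  moreover have "((\<lambda>s. fw (x + s *\<^sub>R v) - fw x) has_vector_derivative
      frechet_derivative fw (at (x + 0 *\<^sub>R v)) v - 0) (at 0 within {0..\<epsilon>})"
    using U Cw by (intro has_vector_derivative_diff line has_vector_derivative_const) auto
  moreover have "at 0 within {0..\<epsilon>} \<noteq> bot"
    using \<epsilon> by (simp add: trivial_limit_within islimpt_Icc)
  ultimately have "frechet_derivative fw (at x) v = fvw x"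
    using vector_derivative_unique_within by fastforce
  then show ?thesis by (simp add: fvw_def fv_def fw_def)
qed

subsection \<open>Bump functions\<close>

text \<open>Derivatives of exp (-1/x) produce negative powers of x. Including all these powers gives
  a family closed under differentiation, so one induction over the order covers every member; the
  bump functions use only \<open>flat 0\<close>.\<close>

definition flat :: "nat \<Rightarrow> real \<Rightarrow> real" where
  "flat n x = (if x \<le> 0 then 0 else exp (- (1 / x)) / x ^ n)"

text \<open>With y = 1/x the right-hand limit is that of y^n / exp y at infinity.\<close>

lemma flat_tendsto: "(flat n \<longlongrightarrow> 0) (at 0)"
proof -
  have "((\<lambda>x. inverse x ^ n / exp (inverse x)) \<longlongrightarrow> 0) (at_right (0::real))"
    using filterlim_compose[OF tendsto_power_div_exp_0 filterlim_inverse_at_top_right] .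
  then have "(flat n \<longlongrightarrow> 0) (at_right 0)"
    by (rule Lim_transform_eventually)
       (auto simp: eventually_at_filter flat_def exp_minus field_simps)
  moreover have "(flat n \<longlongrightarrow> 0) (at_left 0)"
    by (rule Lim_transform_eventually[OF tendsto_const]) (auto simp: eventually_at_filter flat_def)
  ultimately show ?thesis using filterlim_split_at_real by blast
qed

lemma flat_has_derivative:
  "(flat n has_real_derivative flat (n + 2) x - of_nat n * flat (n + 1) x) (at x)"
proof (cases "x = 0")
  case True
  \<comment> \<open>At 0 the difference quotient of \<open>flat n\<close> is
    \<open>flat (Suc n)\<close> itself, whose limit is known.\<close>
  have "(\<lambda>h. (flat n (0 + h) - flat n 0) / h) = flat (Suc n)"
    by (auto simp: flat_def fun_eq_iff)
  then show ?thesis using flat_tendsto[of "Suc n"] by (simp add: True DERIV_def flat_def[of _ 0])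
next
  case False
  show ?thesis
  proof (cases "x < 0")
    case True
    show ?thesis
      by (rule has_field_derivative_transform_within[of "\<lambda>_. 0" _ _ UNIV "-x"])
         (use True in \<open>auto simp: flat_def dist_real_def\<close>)
  next
    case F: False
    then have x: "x > 0" using False by simp
    have 1: "((\<lambda>x. exp (- (1 / x))) has_real_derivative exp (- (1 / x)) * (1 / x\<^sup>2)) (at x)"
      using x by (auto intro!: derivative_eq_intros simp: power2_eq_square)
    have 2: "((\<lambda>x. x ^ n) has_real_derivative of_nat n * x ^ (n - 1)) (at x)"
      by (auto intro!: derivative_eq_intros)
    have "(exp (- (1 / x)) * (1 / x\<^sup>2) * x ^ n - exp (- (1 / x)) * (of_nat n * x ^ (n - 1))) / (x ^ n * x ^ n) =
        flat (n + 2) x - of_nat n * flat (n + 1) x"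
      using x by (cases n) (auto simp: flat_def field_simps power2_eq_square)
    then have "((\<lambda>x. exp (- (1 / x)) / x ^ n) has_real_derivative
        flat (n + 2) x - of_nat n * flat (n + 1) x) (at x)"
      using DERIV_divide[OF 1 2] x by simp
    then show ?thesis
      by (rule has_field_derivative_transform_within[of _ _ _ UNIV x])
         (use x in \<open>auto simp: flat_def dist_real_def\<close>)
  qed
qed

lemma C_k_on_flat: "C_k_on k UNIV (flat n)"
proof (induction k arbitrary: n)
  case 0
  show ?case using flat_has_derivative
    by (auto intro!: continuous_at_imp_continuous_on DERIV_isCont)
next
  case (Suc k)
  show ?case
  proof (rule C_k_on_SucI'[OF _ flat_has_derivative[unfolded has_field_derivative_def]])
    fix v
    have *: "(flat (n + 2) x - of_nat n * flat (n + 1) x) * v =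
      v * flat (n + 2) x + (- v * of_nat n) * flat (n + 1) x" for x by (simp add: algebra_simps)
    show "C_k_on k UNIV (\<lambda>x. (flat (n + 2) x - of_nat n * flat (n + 1) x) * v)"
      unfolding * by (intro C_k_on_add C_k_on_linear_comp[OF bounded_linear_mult_right] Suc.IH open_UNIV)
  qed auto
qed

text \<open>\<open>flat 0\<close> is applied twice: c - flat 0 (t - \<rho>) equals c for t \<le>
  \<rho> and is nonpositive from t = 2 \<rho> on, so a further \<open>flat 0\<close>, divided by its
  value at c, gives 1 and 0 there. For t the squared distance is taken; \<rho> = e^2/2 then makes
  the function vanish from distance \<open>e\<close> on, and (e/2)^2 \<le> \<rho> admits r =
  e/2.\<close>

lemma smooth_bump:
  fixes x0 :: "'a::euclidean_space"
  assumes "e > 0"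
  obtains b :: "'a \<Rightarrow> real" and r where "\<And>k. C_k_on k UNIV b" "r > 0" "r < e"
    "\<And>x. dist x0 x < r \<Longrightarrow> b x = 1" "\<And>x. e \<le> dist x0 x \<Longrightarrow> b x = 0"
proof -
  define \<rho> where "\<rho> = e\<^sup>2 / 2"
  have \<rho>: "\<rho> > 0" using assms by (simp add: \<rho>_def)
  define c where "c = flat 0 \<rho>"
  have c: "c > 0" using \<rho> by (simp add: c_def flat_def)
  define u where "u t = flat 0 (c - flat 0 (t - \<rho>)) / flat 0 c" for t
  define b where "b x = u ((x - x0) \<bullet> (x - x0))" for x :: 'a
  have u1: "u t = 1" if "t \<le> \<rho>" for t using that c by (simp add: u_def flat_def)
  have u0: "u t = 0" if "2 * \<rho> \<le> t" for t
  proof -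
    have "flat 0 \<rho> \<le> flat 0 (t - \<rho>)" using that \<rho> by (auto simp: flat_def intro!: frac_le)
    then show ?thesis by (simp add: u_def flat_def[of 0 "flat 0 \<rho> - _"] c_def)
  qed
  have b: "C_k_on k UNIV b" for k
  proof -
    have *: "b = (\<lambda>x. (1 / flat 0 c) * flat 0 (c + - flat 0 ((x + - x0) \<bullet> (x + - x0) + - \<rho>)))"
      by (simp add: b_def u_def fun_eq_iff)
    have id: "C_k_on j UNIV (\<lambda>x::'a. x)" for j by (rule C_k_on_bounded_linear[OF bounded_linear_ident])
    show ?thesis unfolding *
      by (intro C_k_on_linear_comp[OF bounded_linear_mult_right] C_k_on_compose[OF _ _ _ C_k_on_flat]
          C_k_on_add C_k_on_const C_k_on_linear_comp[OF bounded_linear_minus[OF bounded_linear_ident]]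
          C_k_on_bilinear[OF bounded_bilinear_inner] id open_UNIV subset_UNIV)
  qed
  have sq: "(x - x0) \<bullet> (x - x0) = (dist x0 x)\<^sup>2" for x
    by (simp add: dist_norm norm_minus_commute[of x0] power2_norm_eq_inner)
  show ?thesis
  proof (rule that[of b "e / 2"])
    fix x assume "dist x0 x < e / 2"
    then have "(dist x0 x)\<^sup>2 \<le> (e / 2)\<^sup>2" by (intro power_mono) auto
    also have "\<dots> \<le> \<rho>" by (simp add: \<rho>_def power2_eq_square)
    finally show "b x = 1" by (simp add: b_def sq u1)
  next
    fix x assume "e \<le> dist x0 x"
    then have "e\<^sup>2 \<le> (dist x0 x)\<^sup>2" using assms by (intro power_mono) auto
    then show "b x = 0" by (simp add: b_def sq u0 \<rho>_def)
  qed (use assms b in auto)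
qed

text \<open>The difference of values is the integral of the derivative along the segment from
  \<open>x0\<close> to \<open>x\<close>; expanding x - x0 in the basis pulls the coordinate
  differences out of the integral. A derivation can then be computed, since each summand is a
  product whose first factor vanishes at \<open>x0\<close>.\<close>

lemma hadamard:
  fixes g :: "'a::euclidean_space \<Rightarrow> real"
  assumes g: "\<And>k. C_k_on k (ball x0 e) g" and e: "e > 0"
  obtains G where "\<And>b k. C_k_on k (ball x0 e) (G b)"
    "\<And>b. G b x0 = frechet_derivative g (at x0) b"
    "\<And>x. x \<in> ball x0 e \<Longrightarrow> g x = g x0 + (\<Sum>b\<in>Basis. ((x - x0) \<bullet> b) * G b x)"
proof -
  \<comment> \<open>\<open>l\<close> runs along the segment from \<open>x0\<close> to
    \<open>x\<close>. The preimage \<open>W\<close> of the ball is open and contains the ball times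
    [0,1], as the smoothness of the parametric integral requires.\<close>
  define l where "l = (\<lambda>(x, s::real). x0 + s *\<^sub>R (x - x0))"
  define W where "W = l -` ball x0 e"
  have l: "C_k_on k UNIV l" for k
  proof -
    have *: "l = (\<lambda>z. x0 + snd z *\<^sub>R (fst z + - x0))" by (auto simp: l_def)
    show ?thesis unfolding *
      by (intro C_k_on_add C_k_on_const C_k_on_bilinear[OF bounded_bilinear_scaleR]
          C_k_on_bounded_linear bounded_linear_fst bounded_linear_snd open_UNIV)
  qed
  have W: "open W" unfolding W_def
    using l[of 0] by (intro open_vimage) auto
  have inW: "ball x0 e \<times> {0..1} \<subseteq> W"
  proof clarify
    fix x and s :: real assume x: "x \<in> ball x0 e" and s: "s \<in> {0..1}"
    have "\<bar>s\<bar> * norm (x - x0) \<le> 1 * norm (x - x0)" using s by (intro mult_right_mono) auto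
    then show "(x, s) \<in> W" using x by (auto simp: W_def l_def dist_norm norm_minus_commute)
  qed
  define G where "G b x = integral {0..1} (\<lambda>s. frechet_derivative g (at (l (x, s))) b)" for b x
  have dg: "C_k_on k (ball x0 e) (\<lambda>y. frechet_derivative g (at y) b)" for k b
    using g[of "Suc k"] by simp
  have "C_k_on k (ball x0 e) (G b)" for k b
    unfolding G_def
    by (rule C_k_on_parametric_integral[OF open_ball convex_ball inW])
       (rule C_k_on_compose[OF W _ C_k_on_subset[OF l] dg], auto simp: W_def)
  moreover have "G b x0 = frechet_derivative g (at x0) b" for b
    by (simp add: G_def l_def)
  moreover have "g x = g x0 + (\<Sum>b\<in>Basis. ((x - x0) \<bullet> b) * G b x)" if x: "x \<in> ball x0 e" for x
  proof -
    have in1: "l (x, s) \<in> ball x0 e" if "s \<in> {0..1}" for s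
      using subsetD[OF inW, of "(x, s)"] x that by (auto simp: W_def)
    have "((\<lambda>s. g (l (x, s))) has_vector_derivative frechet_derivative g (at (l (x, s))) (x - x0)) (at s within {0..1})"
      if "s \<in> {0..1}" for s
    proof -
      have 1: "((\<lambda>s. l (x, s)) has_derivative (\<lambda>h. h *\<^sub>R (x - x0))) (at s within {0..1})"
        by (auto simp: l_def intro!: derivative_eq_intros)
      note 2 = C_k_on_has_derivative[OF g in1[OF that]]
      from has_derivative_compose[OF 1 2] show ?thesis
        unfolding has_vector_derivative_def using linear_scale[OF has_derivative_linear[OF 2]] by simp
    qed
    from fundamental_theorem_of_calculus[OF _ this]
    have "((\<lambda>s. frechet_derivative g (at (l (x, s))) (x - x0)) has_integral (g x - g x0)) {0..1}"
      by (simp add: l_def)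
    then have I: "g x - g x0 = integral {0..1} (\<lambda>s. frechet_derivative g (at (l (x, s))) (x - x0))"
      by (rule integral_unique[symmetric])
    have lin: "frechet_derivative g (at (l (x, s))) (x - x0) =
        (\<Sum>b\<in>Basis. ((x - x0) \<bullet> b) * frechet_derivative g (at (l (x, s))) b)" if "s \<in> {0..1}" for s
    proof -
      have "linear (frechet_derivative g (at (l (x, s))))"
        by (rule has_derivative_linear[OF C_k_on_has_derivative[OF g in1[OF that]]])
      from linear_sum[OF this, of "\<lambda>b. ((x - x0) \<bullet> b) *\<^sub>R b" Basis] linear_scale[OF this]
      show ?thesis by (simp add: euclidean_representation)
    qed
    have int: "(\<lambda>s. frechet_derivative g (at (l (x, s))) b) integrable_on {0..1}" for b
      by (rule integrable_continuous_real, rule continuous_on_compose2[of "ball x0 e" "\<lambda>y. frechet_derivative g (at y) b"])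
         (use dg[of 0 b] in1 in \<open>auto simp: l_def intro!: continuous_intros\<close>)
    have "g x - g x0 = integral {0..1} (\<lambda>s. \<Sum>b\<in>Basis. ((x - x0) \<bullet> b) * frechet_derivative g (at (l (x, s))) b)"
      unfolding I using lin by (intro integral_cong) auto
    also have "\<dots> = (\<Sum>b\<in>Basis. ((x - x0) \<bullet> b) * G b x)"
      unfolding G_def using int by (subst integral_sum) (auto intro!: integrable_on_mult_right)
    finally show ?thesis by simp
  qed
  ultimately show ?thesis using that by blast
qed

section \<open>Smooth families of functions on manifolds with corners\<close>

lemma smooth_onE:
  assumes "smooth_on S f" "x \<in> S"
  obtains U g where "open U" "x \<in> U" "\<And>k. C_k_on k U g" "\<And>y. y \<in> S \<Longrightarrow> y \<in> U \<Longrightarrow> f y = g y"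
  using assms unfolding smooth_on_def by (metis IntI)

lemma smooth_onI:
  assumes "\<And>x. x \<in> S \<Longrightarrow> \<exists>U g. open U \<and> x \<in> U \<and> (\<forall>k. C_k_on k U g) \<and> (\<forall>y\<in>S \<inter> U. f y = g y)"
  shows "smooth_on S f"
  using assms by (simp add: smooth_on_def)

lemma smooth_on_C_k: "(\<And>k. C_k_on k UNIV f) \<Longrightarrow> smooth_on S f"
  by (rule smooth_onI) (metis UNIV_I open_UNIV)

lemma smooth_on_subset: "smooth_on T f \<Longrightarrow> S \<subseteq> T \<Longrightarrow> smooth_on S f"
  by (rule smooth_onI, erule smooth_onE[of T f]) blast+

lemma smooth_on_cong: "smooth_on S f \<Longrightarrow> (\<And>x. x \<in> S \<Longrightarrow> f x = g x) \<Longrightarrow> smooth_on S g"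
  unfolding smooth_on_def by (metis IntD1)

lemma smooth_on_local:
  assumes "\<And>x. x \<in> S \<Longrightarrow> \<exists>W. open W \<and> x \<in> W \<and> smooth_on (S \<inter> W) f"
  shows "smooth_on S f"
proof (rule smooth_onI)
  fix x assume x: "x \<in> S"
  obtain W where W: "open W" "x \<in> W" "smooth_on (S \<inter> W) f" using assms[OF x] by blast
  obtain U g where U: "open U" "x \<in> U" "\<And>k. C_k_on k U g" "\<And>y. y \<in> S \<inter> W \<Longrightarrow> y \<in> U \<Longrightarrow> f y = g y"
    using smooth_onE[OF W(3), of x] x W(2) by blast
  have "C_k_on k (U \<inter> W) g" for k by (rule C_k_on_subset[OF U(3)]) simp
  then show "\<exists>U g. open U \<and> x \<in> U \<and> (\<forall>k. C_k_on k U g) \<and> (\<forall>y\<in>S \<inter> U. f y = g y)"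
    using U W by (intro exI[of _ "U \<inter> W"] exI[of _ g]) auto
qed

lemma smooth_on_linear_comp:
  assumes "bounded_linear L" "smooth_on S f"
  shows "smooth_on S (\<lambda>x. L (f x))"
proof (rule smooth_onI)
  fix x assume "x \<in> S"
  then obtain U g where U: "open U" "x \<in> U" "\<And>k. C_k_on k U g" and eq: "\<And>y. y \<in> S \<Longrightarrow> y \<in> U \<Longrightarrow> f y = g y"
    using smooth_onE[OF assms(2)] by blast
  note U(1,2) eq
  moreover have "C_k_on k U (\<lambda>x. L (g x))" for k
    by (rule C_k_on_linear_comp[OF assms(1) U(1,3)])
  ultimately show "\<exists>U g. open U \<and> x \<in> U \<and> (\<forall>k. C_k_on k U g) \<and> (\<forall>y\<in>S \<inter> U. L (f y) = g y)"
    by (intro exI[of _ U] exI[of _ "\<lambda>x. L (g x)"]) auto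
qed

text \<open>The local extensions of the two functions live on different neighbourhoods; sums,
  products and pairs all pass to the intersection, so this is done once.\<close>

lemma smooth_on_binary:
  fixes f :: "'a::real_normed_vector \<Rightarrow> 'b::real_normed_vector"
    and g :: "'a \<Rightarrow> 'c::real_normed_vector" and B :: "'b \<Rightarrow> 'c \<Rightarrow> 'd::real_normed_vector"
  assumes B: "\<And>U (f' :: 'a \<Rightarrow> 'b) (g' :: 'a \<Rightarrow> 'c) k. open U \<Longrightarrow> C_k_on k U f' \<Longrightarrow> C_k_on k U g' \<Longrightarrow> C_k_on k U (\<lambda>x. B (f' x) (g' x))"
    and f: "smooth_on S f" and g: "smooth_on S g"
  shows "smooth_on S (\<lambda>x. B (f x) (g x))"
proof (rule smooth_onI)
  fix x assume x: "x \<in> S"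
  obtain U f' where U: "open U" "x \<in> U" "\<And>k. C_k_on k U f'" "\<And>y. y \<in> S \<Longrightarrow> y \<in> U \<Longrightarrow> f y = f' y"
    using smooth_onE[OF f x] by blast
  obtain V g' where V: "open V" "x \<in> V" "\<And>k. C_k_on k V g'" "\<And>y. y \<in> S \<Longrightarrow> y \<in> V \<Longrightarrow> g y = g' y"
    using smooth_onE[OF g x] by blast
  have "C_k_on k (U \<inter> V) (\<lambda>x. B (f' x) (g' x))" for k
    by (rule B[where f' = f' and g' = g'])
       (use U(1) V(1) in \<open>auto intro: C_k_on_subset[OF U(3)] C_k_on_subset[OF V(3)]\<close>)
  then show "\<exists>U h. open U \<and> x \<in> U \<and> (\<forall>k. C_k_on k U h) \<and> (\<forall>y\<in>S \<inter> U. B (f y) (g y) = h y)"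
    using U(1,2,4) V(1,2,4) by (intro exI[of _ "U \<inter> V"] exI[of _ "\<lambda>x. B (f' x) (g' x)"]) auto
qed

lemma smooth_on_add: "smooth_on S f \<Longrightarrow> smooth_on S g \<Longrightarrow> smooth_on S (\<lambda>x. f x + g x)"
  by (rule smooth_on_binary[of "(+)"]) (auto intro: C_k_on_add)

lemma smooth_on_bilinear:
  "bounded_bilinear B \<Longrightarrow> smooth_on S f \<Longrightarrow> smooth_on S g \<Longrightarrow> smooth_on S (\<lambda>x. B (f x) (g x))"
  by (rule smooth_on_binary[of B]) (auto intro: C_k_on_bilinear)

lemma smooth_on_Pair: "smooth_on S f \<Longrightarrow> smooth_on S g \<Longrightarrow> smooth_on S (\<lambda>x. (f x, g x))"
  by (rule smooth_on_binary[of Pair]) (auto intro: C_k_on_Pair)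

text \<open>The extensions near \<open>x\<close> and near \<open>h x\<close> compose on the part of
  the first neighbourhood that the extension of \<open>h\<close> maps into the second one;
  continuity of that extension makes this part open.\<close>

lemma smooth_on_compose:
  fixes h :: "'a::real_normed_vector \<Rightarrow> 'b::euclidean_space"
  assumes f: "smooth_on T f" and h: "smooth_on S h" and sub: "h ` S \<subseteq> T"
  shows "smooth_on S (\<lambda>x. f (h x))"
proof (rule smooth_onI)
  fix x assume x: "x \<in> S"
  obtain U h' where U: "open U" "x \<in> U" "\<And>k. C_k_on k U h'" "\<And>y. y \<in> S \<Longrightarrow> y \<in> U \<Longrightarrow> h y = h' y"
    using smooth_onE[OF h x] by blast
  have "h x \<in> T" using x sub by blast
  from smooth_onE[OF f this] obtain V g where V: "open V" "h x \<in> V" "\<And>k. C_k_on k V g"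
    "\<And>y. y \<in> T \<Longrightarrow> y \<in> V \<Longrightarrow> f y = g y" by metis
  define W where "W = U \<inter> h' -` V"
  have W: "open W" unfolding W_def
    by (rule continuous_open_preimage[OF C_k_on_continuous[OF U(3)] U(1) V(1)])
  have 1: "C_k_on k W (\<lambda>x. g (h' x))" for k
    by (rule C_k_on_compose[OF W _ C_k_on_subset[OF U(3)] V(3)]) (auto simp: W_def)
  have 2: "f (h y) = g (h' y)" if "y \<in> S \<inter> W" for y
    using that U(4)[of y] V(4)[of "h y"] sub by (auto simp: W_def)
  have 3: "x \<in> W" using U(2) V(2) U(4)[OF x] by (simp add: W_def)
  show "\<exists>U g'. open U \<and> x \<in> U \<and> (\<forall>k. C_k_on k U g') \<and> (\<forall>y\<in>S \<inter> U. f (h y) = g' y)"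
    using W 1 2 3 by blast
qed

lemma smooth_on_linear: "bounded_linear L \<Longrightarrow> smooth_on S L"
  by (rule smooth_on_C_k) (rule C_k_on_bounded_linear)

lemma smooth_on_const: "smooth_on S (\<lambda>x. c)"
  by (rule smooth_on_C_k) (rule C_k_on_const)

text \<open>Joint smoothness in a chart coordinate and a parameter. Plain functions, loop families
  (\<open>Q = UNIV\<close>) and families over [0,1] \<times> \<real> are all instances, so closure
  properties and parameter derivatives are proved once.\<close>

definition smooth_fam ::
  "('m, 'a::euclidean_space) manifold \<Rightarrow> 'm set \<Rightarrow> 'q::euclidean_space set \<Rightarrow>
    ('m \<Rightarrow> 'q \<Rightarrow> 'b::real_normed_vector) \<Rightarrow> bool" where
  "smooth_fam M W Q f \<longleftrightarrow>
     (\<forall>U \<phi>. (U, \<phi>) \<in> charts M \<longrightarrow>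
       smooth_on (\<phi> ` (U \<inter> W) \<times> Q) (\<lambda>z. f (inv_into U \<phi> (fst z)) (snd z)))"

lemma smooth_famD:
  "smooth_fam M W Q f \<Longrightarrow> (U, \<phi>) \<in> charts M \<Longrightarrow>
    smooth_on (\<phi> ` (U \<inter> W) \<times> Q) (\<lambda>z. f (inv_into U \<phi> (fst z)) (snd z))"
  by (simp add: smooth_fam_def)

lemma smooth_fam_subset:
  assumes "smooth_fam M W Q f" "W' \<subseteq> W" "Q' \<subseteq> Q"
  shows "smooth_fam M W' Q' f"
  unfolding smooth_fam_def
proof (safe, goal_cases)
  case (1 U \<phi>)
  show ?case by (rule smooth_on_subset[OF smooth_famD[OF assms(1) 1]]) (use assms(2,3) in auto)
qed

lemma smooth_fam_add:
  "smooth_fam M W Q f \<Longrightarrow> smooth_fam M W Q g \<Longrightarrow> smooth_fam M W Q (\<lambda>p q. f p q + g p q)"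
  unfolding smooth_fam_def by (intro allI impI smooth_on_add) auto

lemma smooth_fam_bilinear:
  "bounded_bilinear B \<Longrightarrow> smooth_fam M W Q f \<Longrightarrow> smooth_fam M W Q g \<Longrightarrow> smooth_fam M W Q (\<lambda>p q. B (f p q) (g p q))"
  unfolding smooth_fam_def by (intro allI impI smooth_on_bilinear[of B]) auto

lemmas smooth_fam_mult = smooth_fam_bilinear[OF bounded_bilinear_mult]

lemma smooth_fam_linear:
  "bounded_linear L \<Longrightarrow> smooth_fam M W Q f \<Longrightarrow> smooth_fam M W Q (\<lambda>p q. L (f p q))"
  unfolding smooth_fam_def by (intro allI impI smooth_on_linear_comp[of L]) auto

lemma smooth_fam_const: "smooth_fam M W Q (\<lambda>p q. c)"
  by (simp add: smooth_fam_def smooth_on_const)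

lemma smooth_fam_sum:
  "(\<And>i. i \<in> I \<Longrightarrow> smooth_fam M W Q (f i)) \<Longrightarrow> smooth_fam M W Q (\<lambda>p q. \<Sum>i\<in>I. f i p q)"
  by (induction I rule: infinite_finite_induct) (auto intro!: smooth_fam_add smooth_fam_const)

lemma smooth_fam_reparam:
  fixes h :: "'r::euclidean_space \<Rightarrow> 'q::euclidean_space"
  assumes f: "smooth_fam M W Q f" and h: "smooth_on Q' h" and sub: "h ` Q' \<subseteq> Q"
  shows "smooth_fam M W Q' (\<lambda>p r. f p (h r))"
  unfolding smooth_fam_def
proof (safe, goal_cases)
  case (1 U \<phi>)
  have A: "smooth_on (\<phi> ` (U \<inter> W) \<times> Q') (\<lambda>z. (fst z, h (snd z)))"
    by (intro smooth_on_Pair smooth_on_linear bounded_linear_fst smooth_on_compose[OF h]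
        bounded_linear_snd) auto
  have B: "(\<lambda>z. (fst z, h (snd z))) ` (\<phi> ` (U \<inter> W) \<times> Q') \<subseteq> \<phi> ` (U \<inter> W) \<times> Q" using sub by auto
  show ?case using smooth_on_compose[OF smooth_famD[OF f 1] A B] by simp
qed

section \<open>Charts, gluing by zero and cutoff functions\<close>

locale corner_manifold =
  fixes M :: "('m, 'a::euclidean_space) manifold"
  assumes M: "compact_manifold_with_corners M"
begin

lemma Hausdorff: "Hausdorff_space (top M)"
  and chart_cover: "p \<in> points M \<Longrightarrow> \<exists>U \<phi>. (U, \<phi>) \<in> charts M \<and> p \<in> U"
  and chart_open: "(U, \<phi>) \<in> charts M \<Longrightarrow> openin (top M) U"
  and chart_homeo: "(U, \<phi>) \<in> charts M \<Longrightarrow>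
    homeomorphic_map (subtopology (top M) U) (top_of_set (\<phi> ` U)) \<phi>"
  and chart_quadrant: "(U, \<phi>) \<in> charts M \<Longrightarrow>
    \<exists>C\<subseteq>dirs M. openin (top_of_set (quadrant (dirs M) C)) (\<phi> ` U)"
  and transition_smooth: "(U, \<phi>) \<in> charts M \<Longrightarrow> (V, \<psi>) \<in> charts M \<Longrightarrow>
    smooth_on (\<phi> ` (U \<inter> V)) (\<lambda>x. \<psi> (inv_into U \<phi> x))"
  using M unfolding compact_manifold_with_corners_def by blast+

lemma chart_subset: "(U, \<phi>) \<in> charts M \<Longrightarrow> U \<subseteq> points M"
  using chart_open openin_subset by blast

lemma chart_inj: "(U, \<phi>) \<in> charts M \<Longrightarrow> inj_on \<phi> U"
  using homeomorphic_imp_injective_map[OF chart_homeo] chart_subset by (simp add: Int_absorb1)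

lemma chart_inv: "(U, \<phi>) \<in> charts M \<Longrightarrow> p \<in> U \<Longrightarrow> inv_into U \<phi> (\<phi> p) = p"
  by (simp add: chart_inj)

lemma chart_image_open:
  assumes "(U, \<phi>) \<in> charts M" "openin (top M) W"
  obtains B where "open B" "\<phi> ` (U \<inter> W) = \<phi> ` U \<inter> B"
proof -
  have "openin (subtopology (top M) U) (U \<inter> W)"
    using assms(2) by (auto simp: openin_subtopology)
  then have "openin (top_of_set (\<phi> ` U)) (\<phi> ` (U \<inter> W))"
    using homeomorphic_map_openness_eq[OF chart_homeo[OF assms(1)]] by blast
  then show ?thesis using that by (auto simp: openin_open)
qed

lemma chart_preimage_open:
  assumes "(U, \<phi>) \<in> charts M" "open B"
  shows "openin (top M) {p \<in> U. \<phi> p \<in> B}"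
proof -
  have "openin (subtopology (top M) U) {p \<in> topspace (subtopology (top M) U). \<phi> p \<in> \<phi> ` U \<inter> B}"
    by (rule openin_continuous_map_preimage[OF homeomorphic_imp_continuous_map[OF chart_homeo[OF assms(1)]]])
       (use assms(2) in auto)
  moreover have "{p \<in> topspace (subtopology (top M) U). \<phi> p \<in> \<phi> ` U \<inter> B} = {p \<in> U. \<phi> p \<in> B}"
    using chart_subset[OF assms(1)] by auto
  ultimately show ?thesis using openin_trans_full chart_open[OF assms(1)] by fastforce
qed

lemma smooth_fam_local:
  assumes "\<And>p. p \<in> W \<Longrightarrow> \<exists>O'. openin (top M) O' \<and> p \<in> O' \<and> smooth_fam M (W \<inter> O') Q f"
  shows "smooth_fam M W Q f"
  unfolding smooth_fam_def
proof (safe, goal_cases)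
  case (1 U \<phi>)
  show ?case
  proof (rule smooth_on_local)
    fix z assume "z \<in> \<phi> ` (U \<inter> W) \<times> Q"
    then obtain p q where p: "p \<in> U" "p \<in> W" "q \<in> Q" "z = (\<phi> p, q)" by blast
    obtain O' where O': "openin (top M) O'" "p \<in> O'" "smooth_fam M (W \<inter> O') Q f"
      using assms[OF p(2)] by blast
    obtain B where B: "open B" "\<phi> ` (U \<inter> O') = \<phi> ` U \<inter> B"
      using chart_image_open[OF 1 O'(1)] by blast
    have "\<phi> ` (U \<inter> W) \<times> Q \<inter> B \<times> UNIV \<subseteq> \<phi> ` (U \<inter> (W \<inter> O')) \<times> Q"
    proof clarify
      fix a b assume a: "a \<in> U" "a \<in> W" "\<phi> a \<in> B" "b \<in> Q"
      then have "\<phi> a \<in> \<phi> ` (U \<inter> O')" using B(2) by blast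
      then have "a \<in> O'" using a(1) chart_inj[OF 1] by (auto simp: inj_on_def)
      then show "\<phi> a \<in> \<phi> ` (U \<inter> (W \<inter> O'))" using a by blast
    qed
    then have "smooth_on (\<phi> ` (U \<inter> W) \<times> Q \<inter> B \<times> UNIV) (\<lambda>z. f (inv_into U \<phi> (fst z)) (snd z))"
      by (rule smooth_on_subset[OF smooth_famD[OF O'(3) 1]])
    moreover have "\<phi> p \<in> B" using B(2) p(1) O'(2) by blast
    ultimately show "\<exists>W'. open W' \<and> z \<in> W' \<and>
        smooth_on (\<phi> ` (U \<inter> W) \<times> Q \<inter> W') (\<lambda>z. f (inv_into U \<phi> (fst z)) (snd z))"
      using B(1) p(4) by (intro exI[of _ "B \<times> UNIV"]) (auto intro: open_Times)
  qed
qed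

lemma smooth_fam_cong:
  assumes f: "smooth_fam M W Q f" and eq: "\<And>p q. p \<in> W \<Longrightarrow> q \<in> Q \<Longrightarrow> f p q = g p q"
  shows "smooth_fam M W Q g"
  unfolding smooth_fam_def
proof (safe, goal_cases)
  case (1 U \<phi>)
  show ?case by (rule smooth_on_cong[OF smooth_famD[OF f 1]]) (use eq chart_inv[OF 1] in auto)
qed

text \<open>Any other chart is reached through the transition function, so smoothness needs to be
  seen in one chart only.\<close>

lemma smooth_fam_in_chart:
  assumes U: "(U, \<phi>) \<in> charts M" and W: "W \<subseteq> U"
    and f: "smooth_on (\<phi> ` W \<times> Q) (\<lambda>z. f (inv_into U \<phi> (fst z)) (snd z))"
  shows "smooth_fam M W Q f"
  unfolding smooth_fam_def
proof (safe, goal_cases)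
  case (1 V \<psi>)
  have A: "smooth_on (\<psi> ` (V \<inter> W) \<times> Q) (\<lambda>z. (\<phi> (inv_into V \<psi> (fst z)), snd z))"
    by (intro smooth_on_Pair smooth_on_linear bounded_linear_snd
        smooth_on_compose[OF transition_smooth[OF 1 U]] bounded_linear_fst) (use W in auto)
  have B: "(\<lambda>z. (\<phi> (inv_into V \<psi> (fst z)), snd z)) ` (\<psi> ` (V \<inter> W) \<times> Q) \<subseteq> \<phi> ` W \<times> Q"
    using chart_inv[OF 1] by auto
  have "smooth_on (\<psi> ` (V \<inter> W) \<times> Q)
      (\<lambda>z. f (inv_into U \<phi> (\<phi> (inv_into V \<psi> (fst z)))) (snd z))"
    using smooth_on_compose[OF f A B] by simp
  then show ?case
    by (rule smooth_on_cong) (use W chart_inv[OF 1] chart_inv[OF U] in auto)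
qed

lemma smooth_fam_chart_comp:
  assumes U: "(U, \<phi>) \<in> charts M" and W: "W \<subseteq> U" and g: "smooth_on (\<phi> ` W) g"
  shows "smooth_fam M W Q (\<lambda>p q. g (\<phi> p))"
proof (rule smooth_fam_in_chart[OF U W])
  have "smooth_on (\<phi> ` W \<times> Q) (\<lambda>z. g (fst z))"
    by (rule smooth_on_compose[OF g smooth_on_linear[OF bounded_linear_fst]]) auto
  then show "smooth_on (\<phi> ` W \<times> Q) (\<lambda>z. g (\<phi> (inv_into U \<phi> (fst z))))"
    by (rule smooth_on_cong) (use chart_inv[OF U] W in auto)
qed

lemma smooth_fam_of_fun:
  assumes "f \<in> smooth_funs M"
  shows "smooth_fam M (points M) Q (\<lambda>p q. f p)"
  unfolding smooth_fam_def
proof (safe, goal_cases)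
  case (1 U \<phi>)
  have "smooth_on (\<phi> ` U) (\<lambda>x. f (inv_into U \<phi> x))" using assms 1 by (auto simp: smooth_funs_def)
  then show ?case by (rule smooth_on_compose[OF _ smooth_on_linear[OF bounded_linear_fst]]) auto
qed

lemma smooth_fun_of_fam:
  fixes f :: "'m \<Rightarrow> 'q::euclidean_space \<Rightarrow> real"
  assumes "smooth_fam M (points M) Q f" "q \<in> Q"
  shows "(\<lambda>p. f p q) \<in> smooth_funs M"
  unfolding smooth_funs_def
proof (safe, goal_cases)
  case (1 U \<phi>)
  have A: "smooth_on (\<phi> ` U) (\<lambda>x. (x, q))"
    by (intro smooth_on_Pair smooth_on_linear bounded_linear_ident smooth_on_const)
  have B: "(\<lambda>x. (x, q)) ` \<phi> ` U \<subseteq> \<phi> ` (U \<inter> points M) \<times> Q" using chart_subset[OF 1] assms(2) by blast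
  show ?case using smooth_on_compose[OF smooth_famD[OF assms(1) 1] A B] by simp
qed

lemma smooth_fun_iff: "f \<in> smooth_funs M \<longleftrightarrow> smooth_fam M (points M) (UNIV :: real set) (\<lambda>p q. f p)"
  using smooth_fam_of_fun smooth_fun_of_fam[of UNIV "\<lambda>p q. f p" 0] by blast

lemma smooth_fun_mult: "f \<in> smooth_funs M \<Longrightarrow> g \<in> smooth_funs M \<Longrightarrow> (\<lambda>p. f p * g p) \<in> smooth_funs M"
  unfolding smooth_fun_iff by (rule smooth_fam_mult)

lemma smooth_fun_add: "f \<in> smooth_funs M \<Longrightarrow> g \<in> smooth_funs M \<Longrightarrow> (\<lambda>p. f p + g p) \<in> smooth_funs M"
  unfolding smooth_fun_iff by (rule smooth_fam_add)

text \<open>On \<open>U\<close> the family is a product of smooth ones, off the closed set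
  \<open>K\<close> it is zero; these two open sets cover the manifold because \<open>K\<close> lies
  in \<open>U\<close>.\<close>

lemma smooth_fam_glue:
  assumes U: "openin (top M) U" and V: "V \<subseteq> points M" and K: "closedin (top M) K" "K \<subseteq> U"
    and \<rho>: "\<rho> \<in> smooth_funs M" "\<And>p. p \<in> points M \<Longrightarrow> p \<notin> K \<Longrightarrow> \<rho> p = 0"
    and f: "smooth_fam M (U \<inter> V) Q f"
  shows "smooth_fam M V Q (\<lambda>p q. if p \<in> U then \<rho> p *\<^sub>R f p q else 0)"
proof (rule smooth_fam_local)
  fix p assume p: "p \<in> V"
  have 1: "smooth_fam M (V \<inter> U) Q (\<lambda>p q. if p \<in> U then \<rho> p *\<^sub>R f p q else 0)"
  proof (rule smooth_fam_cong)
    show "smooth_fam M (V \<inter> U) Q (\<lambda>p q. \<rho> p *\<^sub>R f p q)"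
      by (intro smooth_fam_bilinear[OF bounded_bilinear_scaleR] smooth_fam_subset[OF smooth_fam_of_fun[OF \<rho>(1)]]
          smooth_fam_subset[OF f]) (use V in auto)
  qed auto
  have 2: "smooth_fam M (V \<inter> (points M - K)) Q (\<lambda>p q. if p \<in> U then \<rho> p *\<^sub>R f p q else 0)"
    by (rule smooth_fam_cong[OF smooth_fam_const[of M _ _ 0]]) (use \<rho>(2) in auto)
  show "\<exists>O'. openin (top M) O' \<and> p \<in> O' \<and> smooth_fam M (V \<inter> O') Q (\<lambda>p q. if p \<in> U then \<rho> p *\<^sub>R f p q else 0)"
  proof (cases "p \<in> U")
    case True
    then show ?thesis using 1 U by blast
  next
    case False
    then show ?thesis using 2 p V K by (intro exI[of _ "points M - K"]) auto
  qed
qed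

text \<open>A Euclidean bump function in a chart around \<open>p0\<close>, extended by zero. The
  point is that its support is closed in the whole manifold and not only in the chart domain: its
  chart image is compact because quadrants are closed, and compact sets in a Hausdorff space are
  closed.\<close>

lemma cutoff:
  assumes U: "openin (top M) U" and p0: "p0 \<in> U"
  obtains \<rho> O' K where "\<rho> \<in> smooth_funs M" "openin (top M) O'" "p0 \<in> O'" "O' \<subseteq> U"
    "\<And>p. p \<in> O' \<Longrightarrow> \<rho> p = 1" "closedin (top M) K" "K \<subseteq> U" "\<And>p. p \<in> points M \<Longrightarrow> p \<notin> K \<Longrightarrow> \<rho> p = 0"
proof -
  have "p0 \<in> points M" using U p0 openin_subset by blast
  then obtain V \<phi> where V: "(V, \<phi>) \<in> charts M" "p0 \<in> V" using chart_cover by blast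
  obtain B where B: "open B" "\<phi> ` (V \<inter> U) = \<phi> ` V \<inter> B" using chart_image_open[OF V(1) U] by blast
  obtain C where C: "openin (top_of_set (quadrant (dirs M) C)) (\<phi> ` V)" using chart_quadrant[OF V(1)] by blast
  then obtain B' where B': "open B'" "\<phi> ` V = quadrant (dirs M) C \<inter> B'" by (auto simp: openin_open)
  \<comment> \<open>\<open>B\<close> controls \<open>U\<close> in the chart, and within
    \<open>B'\<close> the chart image is the full quadrant; the closed ball has to lie in
    both.\<close>
  have "\<phi> p0 \<in> B \<inter> B'" using B(2) B'(2) V(2) p0 by blast
  then obtain e where e: "e > 0" "cball (\<phi> p0) e \<subseteq> B \<inter> B'"
    using open_contains_cball[of "B \<inter> B'"] B(1) B'(1) by blast
  obtain b :: "'a \<Rightarrow> real" and r where b: "\<And>k. C_k_on k UNIV b" "r > 0" "r < e"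
    "\<And>x. dist (\<phi> p0) x < r \<Longrightarrow> b x = 1" "\<And>x. e \<le> dist (\<phi> p0) x \<Longrightarrow> b x = 0"
    using smooth_bump[OF e(1), of "\<phi> p0"] by blast
  define \<rho> where "\<rho> p = (if p \<in> V then b (\<phi> p) else 0)" for p
  define K where "K = {p \<in> V. \<phi> p \<in> cball (\<phi> p0) e}"
  define O' where "O' = {p \<in> V. \<phi> p \<in> ball (\<phi> p0) r}"
  have inU: "p \<in> U" if "p \<in> V" "\<phi> p \<in> B" for p
  proof -
    have "\<phi> p \<in> \<phi> ` (V \<inter> U)" using that B(2) by blast
    then show ?thesis using that(1) chart_inj[OF V(1)] by (auto simp: inj_on_def)
  qed
  have KU: "K \<subseteq> U" using inU e(2) by (auto simp: K_def)
  have "closedin (top M) K"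
  proof -
    have "closed (quadrant (dirs M) C)"
    proof -
      have *: "quadrant (dirs M) C = (\<Inter>b\<in>Basis - dirs M. {x. x \<bullet> b = 0}) \<inter> (\<Inter>b\<in>C. {x. 0 \<le> x \<bullet> b})"
        by (auto simp: quadrant_def)
      show ?thesis unfolding *
        by (intro closed_Int closed_INT ballI closed_Collect_eq closed_Collect_le continuous_intros)
    qed
    then have "compact (quadrant (dirs M) C \<inter> cball (\<phi> p0) e)" by (intro closed_Int_compact) auto
    \<comment> \<open>No point of the quadrant in the closed ball is missing from the chart image,
      since the ball lies in \<open>B'\<close>; hence the image of \<open>K\<close> inherits
      compactness.\<close>
    moreover have img: "\<phi> ` K = quadrant (dirs M) C \<inter> cball (\<phi> p0) e"
    proof
      show "quadrant (dirs M) C \<inter> cball (\<phi> p0) e \<subseteq> \<phi> ` K"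
      proof
        fix x assume x: "x \<in> quadrant (dirs M) C \<inter> cball (\<phi> p0) e"
        then have "x \<in> \<phi> ` V" using B'(2) e(2) by blast
        then show "x \<in> \<phi> ` K" using x by (auto simp: K_def)
      qed
    qed (use B'(2) in \<open>auto simp: K_def\<close>)
    ultimately have c: "compactin (top_of_set (\<phi> ` V)) (\<phi> ` K)"
      using B'(2) e(2) by (auto simp: compactin_subtopology compactin_euclidean_iff K_def)
    obtain g where g: "homeomorphic_maps (subtopology (top M) V) (top_of_set (\<phi> ` V)) \<phi> g"
      using chart_homeo[OF V(1)] by (auto simp: homeomorphic_map_maps)
    have "g (\<phi> p) = p" if "p \<in> V" for p
      using g chart_subset[OF V(1)] that unfolding homeomorphic_maps_def topspace_subtopology by blast
    then have gK: "g ` \<phi> ` K = K" by (auto simp: K_def image_image)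
    have "continuous_map (top_of_set (\<phi> ` V)) (subtopology (top M) V) g"
      using g unfolding homeomorphic_maps_def by blast
    from image_compactin[OF c this] have "compactin (subtopology (top M) V) K" unfolding gK .
    then have "compactin (top M) K" by (simp add: compactin_subtopology)
    then show ?thesis using Hausdorff by (rule compactin_imp_closedin[rotated])
  qed
  moreover have \<rho>0: "\<rho> p = 0" if "p \<notin> K" for p
    using that b(5)[of "\<phi> p"] by (auto simp: \<rho>_def K_def)
  moreover have "\<rho> \<in> smooth_funs M"
    unfolding smooth_fun_iff
  proof (rule smooth_fam_local)
    fix p assume p: "p \<in> points M"
    have "smooth_fam M V UNIV (\<lambda>p q. b (\<phi> p))"
      by (rule smooth_fam_chart_comp[OF V(1) order_refl smooth_on_C_k]) (rule b(1))
    then have 1: "smooth_fam M (points M \<inter> V) (UNIV :: real set) (\<lambda>p q. \<rho> p)"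
      by (rule smooth_fam_cong[OF smooth_fam_subset]) (auto simp: \<rho>_def)
    have 2: "smooth_fam M (points M \<inter> (points M - K)) (UNIV :: real set) (\<lambda>p q. \<rho> p)"
      by (rule smooth_fam_cong[OF smooth_fam_const[of M _ _ 0]]) (auto simp: \<rho>0)
    show "\<exists>O'. openin (top M) O' \<and> p \<in> O' \<and> smooth_fam M (points M \<inter> O') (UNIV :: real set) (\<lambda>p q. \<rho> p)"
    proof (cases "p \<in> V")
      case True
      then show ?thesis using 1 chart_open[OF V(1)] by blast
    next
      case False
      then show ?thesis using 2 p \<open>closedin (top M) K\<close>
        by (intro exI[of _ "points M - K"]) (auto simp: K_def)
    qed
  qed
  moreover have "openin (top M) O'" unfolding O'_def by (rule chart_preimage_open[OF V(1) open_ball])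
  moreover have "ball (\<phi> p0) r \<subseteq> B" using e(2) b(3) by (auto simp: subset_iff)
  then have "O' \<subseteq> U" "p0 \<in> O'" using inU b(2) V(2) by (auto simp: O'_def)
  moreover have "\<rho> p = 1" if "p \<in> O'" for p using that b(4) by (auto simp: O'_def \<rho>_def)
  ultimately show ?thesis using that KU by blast
qed

end

section \<open>Vector fields in coordinates\<close>

lemma smooth_on_open: "open U \<Longrightarrow> (\<And>k. C_k_on k U g) \<Longrightarrow> S \<subseteq> U \<Longrightarrow> smooth_on S g"
  by (rule smooth_onI) blast

lemma smooth_on_sum:
  "(\<And>i. i \<in> I \<Longrightarrow> smooth_on S (f i)) \<Longrightarrow> smooth_on S (\<lambda>x. \<Sum>i\<in>I. f i x)"
proof (induction I rule: infinite_finite_induct)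
  case (insert i I)
  then have "smooth_on S (\<lambda>x. f i x + (\<Sum>i\<in>I. f i x))" by (intro smooth_on_add) auto
  then show ?case using insert.hyps by simp
qed (simp_all add: smooth_on_const)

lemma C_k_on_slice:
  fixes F :: "'a::euclidean_space \<times> 'q::euclidean_space \<Rightarrow> 'b::real_normed_vector"
  assumes O': "open O'" and F: "\<And>k. C_k_on k O' F"
  shows "open {y. (y, q) \<in> O'}"
    and "C_k_on k {y. (y, q) \<in> O'} (\<lambda>y. F (y, q))"
    and "(x, q) \<in> O' \<Longrightarrow> frechet_derivative (\<lambda>y. F (y, q)) (at x) v = frechet_derivative F (at (x, q)) (v, 0)"
proof -
  show op: "open {y. (y, q) \<in> O'}"
    using open_vimage[OF O', of "\<lambda>y. (y, q)"] by (simp add: vimage_def continuous_intros)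
  show "C_k_on k {y. (y, q) \<in> O'} (\<lambda>y. F (y, q))"
  proof (rule C_k_on_compose[OF op _ _ F])
    show "C_k_on k {y. (y, q) \<in> O'} (\<lambda>y. (y, q))" for k
      by (rule C_k_on_Pair[OF op C_k_on_bounded_linear[OF bounded_linear_ident] C_k_on_const])
  qed auto
  assume x: "(x, q) \<in> O'"
  have "((\<lambda>y. (y, q)) has_derivative (\<lambda>v. (v, 0))) (at x)" by (auto intro!: derivative_eq_intros)
  from has_derivative_compose[OF this C_k_on_has_derivative[OF F x]]
  show "frechet_derivative (\<lambda>y. F (y, q)) (at x) v = frechet_derivative F (at (x, q)) (v, 0)"
    by (simp add: frechet_derivative_eq)
qed

text \<open>The line is parametrised so that it passes through \<open>z\<close> at
  \<open>u0\<close>; with \<open>T\<close> free, the same statement yields one-sided and two-sided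
  partial derivatives.\<close>

lemma has_vector_derivative_along:
  assumes F: "\<And>k. C_k_on k O' F" and z: "z \<in> O'"
  shows "((\<lambda>u. F (z + (u - u0) *\<^sub>R d)) has_vector_derivative frechet_derivative F (at z) d) (at u0 within T)"
proof -
  have 1: "((\<lambda>u. z + (u - u0) *\<^sub>R d) has_derivative (\<lambda>h. h *\<^sub>R d)) (at u0 within T)"
    by (auto intro!: derivative_eq_intros)
  have 2: "(F has_derivative frechet_derivative F (at z)) (at (z + (u0 - u0) *\<^sub>R d))"
    using C_k_on_has_derivative[OF F z] by simp
  show ?thesis
    using has_derivative_compose[OF 1 2] linear_scale[OF has_derivative_linear[OF 2]]
    by (simp add: has_vector_derivative_def)
qed

lemma eventually_along:
  fixes z d :: "'a::real_normed_vector"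
  assumes "open O'" "z \<in> O'"
  obtains \<delta> where "\<delta> > 0" "\<And>u. dist u u0 < \<delta> \<Longrightarrow> z + (u - u0) *\<^sub>R d \<in> O'"
proof -
  have "((\<lambda>u. z + (u - u0) *\<^sub>R d) \<longlongrightarrow> z) (at u0)" by (auto intro!: tendsto_eq_intros)
  then have "\<forall>\<^sub>F u in at u0. z + (u - u0) *\<^sub>R d \<in> O'" using assms by (rule topological_tendstoD)
  then obtain \<delta> where "\<delta> > 0" "\<And>u. u \<noteq> u0 \<Longrightarrow> dist u u0 < \<delta> \<Longrightarrow> z + (u - u0) *\<^sub>R d \<in> O'"
    by (auto simp: eventually_at)
  moreover have "z + (u0 - u0) *\<^sub>R d \<in> O'" using assms by simp
  ultimately show ?thesis using that by metis
qed

context corner_manifold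
begin

lemma fam_extension:
  assumes f: "smooth_fam M W Q f" and U: "(U, \<phi>) \<in> charts M" and m: "m \<in> U" "m \<in> W" and q: "q \<in> Q"
  obtains O' F where "open O'" "(\<phi> m, q) \<in> O'" "\<And>k. C_k_on k O' F"
    "\<And>p r. p \<in> U \<Longrightarrow> p \<in> W \<Longrightarrow> r \<in> Q \<Longrightarrow> (\<phi> p, r) \<in> O' \<Longrightarrow> f p r = F (\<phi> p, r)"
proof -
  have "(\<phi> m, q) \<in> \<phi> ` (U \<inter> W) \<times> Q" using m q by blast
  from smooth_onE[OF smooth_famD[OF f U] this]
  obtain O' F where *: "open O'" "(\<phi> m, q) \<in> O'" "\<And>k. C_k_on k O' F"
    "\<And>z. z \<in> \<phi> ` (U \<inter> W) \<times> Q \<Longrightarrow> z \<in> O' \<Longrightarrow> f (inv_into U \<phi> (fst z)) (snd z) = F z" by metis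
  have "f p r = F (\<phi> p, r)" if "p \<in> U" "p \<in> W" "r \<in> Q" "(\<phi> p, r) \<in> O'" for p r
    using *(4)[of "(\<phi> p, r)"] that chart_inv[OF U that(1)] by simp
  with *(1-3) show ?thesis using that by blast
qed

text \<open>For parameters in \<open>T\<close> close to \<open>u0\<close> the family equals its
  extension \<open>F\<close>, which is differentiable on a full neighbourhood; derivatives at the
  end of an interval therefore come from \<open>F\<close> as well.\<close>

lemma fam_has_derivative:
  assumes ext: "open O'" "(\<phi> m, q) \<in> O'" "\<And>k. C_k_on k O' F"
    "\<And>p r. p \<in> U \<Longrightarrow> p \<in> W \<Longrightarrow> r \<in> Q \<Longrightarrow> (\<phi> p, r) \<in> O' \<Longrightarrow> f p r = F (\<phi> p, r)"
    and m: "m \<in> U" "m \<in> W" and T: "\<And>u. u \<in> T \<Longrightarrow> q + (u - u0) *\<^sub>R e \<in> Q" "u0 \<in> T"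
  shows "((\<lambda>u. f m (q + (u - u0) *\<^sub>R e)) has_vector_derivative frechet_derivative F (at (\<phi> m, q)) (0, e))
    (at u0 within T)"
proof -
  have eq: "(\<phi> m, q) + (u - u0) *\<^sub>R (0, e) = (\<phi> m, q + (u - u0) *\<^sub>R e)" for u by simp
  obtain \<delta> where \<delta>: "\<delta> > 0" "\<And>u. dist u u0 < \<delta> \<Longrightarrow> (\<phi> m, q + (u - u0) *\<^sub>R e) \<in> O'"
    using eventually_along[OF ext(1,2), of u0 "(0, e)"] unfolding eq by blast
  show ?thesis
    by (rule has_vector_derivative_transform_within[OF has_vector_derivative_along[OF ext(3,2), of u0 "(0, e)", unfolded eq] \<delta>(1) T(2)])
       (use ext(4) m T(1) \<delta>(2) in auto)
qed

lemma smooth_fam_differentiable: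
  assumes f: "smooth_fam M W Q f" "W \<subseteq> points M" and m: "m \<in> W"
    and T: "\<And>u. u \<in> T \<Longrightarrow> q + (u - u0) *\<^sub>R e \<in> Q" "u0 \<in> T"
  shows "\<exists>d. ((\<lambda>u. f m (q + (u - u0) *\<^sub>R e)) has_vector_derivative d) (at u0 within T)"
proof -
  obtain U \<phi> where U: "(U, \<phi>) \<in> charts M" "m \<in> U" using chart_cover f(2) m by blast
  have q: "q \<in> Q" using T(1)[OF T(2)] by simp
  obtain O' F where O': "open O'" "(\<phi> m, q) \<in> O'" "\<And>k. C_k_on k O' F"
    "\<And>p r. p \<in> U \<Longrightarrow> p \<in> W \<Longrightarrow> r \<in> Q \<Longrightarrow> (\<phi> p, r) \<in> O' \<Longrightarrow> f p r = F (\<phi> p, r)"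
    by (rule fam_extension[OF f(1) U m q]) blast
  show ?thesis
    by (rule exI, rule fam_has_derivative[where \<phi> = \<phi> and f = f and F = F and Q = Q and W = W, OF O' U(2) m T])
qed

text \<open>\<open>f'\<close> is given only pointwise, by one- or two-sided derivatives. Uniqueness
  identifies it with a directional derivative of any local extension \<open>F\<close>, and that is
  smooth again; for uniqueness the filter \<open>at u0 within T\<close> must be nontrivial.\<close>

lemma smooth_fam_derivative:
  assumes f: "smooth_fam M W Q f"
    and f': "\<And>m q. m \<in> W \<Longrightarrow> q \<in> Q \<Longrightarrow> \<exists>T u0. u0 \<in> T \<and> at u0 within T \<noteq> bot \<and>
      (\<forall>u\<in>T. q + (u - u0) *\<^sub>R e \<in> Q) \<and>
      ((\<lambda>u. f m (q + (u - u0) *\<^sub>R e)) has_vector_derivative f' m q) (at u0 within T)"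
  shows "smooth_fam M W Q f'"
  unfolding smooth_fam_def
proof (intro allI impI)
  fix U \<phi> assume U: "(U, \<phi>) \<in> charts M"
  show "smooth_on (\<phi> ` (U \<inter> W) \<times> Q) (\<lambda>z. f' (inv_into U \<phi> (fst z)) (snd z))"
  proof (rule smooth_onI)
    fix z assume "z \<in> \<phi> ` (U \<inter> W) \<times> Q"
    then obtain m q where m: "m \<in> U" "m \<in> W" "q \<in> Q" and z: "z = (\<phi> m, q)" by blast
    obtain O' F where O': "open O'" "(\<phi> m, q) \<in> O'" "\<And>k. C_k_on k O' F"
      "\<And>p r. p \<in> U \<Longrightarrow> p \<in> W \<Longrightarrow> r \<in> Q \<Longrightarrow> (\<phi> p, r) \<in> O' \<Longrightarrow> f p r = F (\<phi> p, r)"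
      by (rule fam_extension[OF f U m]) blast
    have "f' p r = frechet_derivative F (at (\<phi> p, r)) (0, e)"
      if p: "p \<in> U" "p \<in> W" "r \<in> Q" "(\<phi> p, r) \<in> O'" for p r
    proof -
      obtain T u0 where T: "u0 \<in> T" "at u0 within T \<noteq> bot" "\<And>u. u \<in> T \<Longrightarrow> r + (u - u0) *\<^sub>R e \<in> Q"
        "((\<lambda>u. f p (r + (u - u0) *\<^sub>R e)) has_vector_derivative f' p r) (at u0 within T)"
        using f'[OF p(2,3)] by blast
      show ?thesis
        by (rule vector_derivative_unique_within[OF T(2,4)])
           (rule fam_has_derivative[where \<phi> = \<phi> and f = f and F = F and Q = Q and W = W, OF O'(1) p(4) O'(3,4) p(1,2) T(3,1)])
    qed
    then have "\<forall>y\<in>\<phi> ` (U \<inter> W) \<times> Q \<inter> O'. f' (inv_into U \<phi> (fst y)) (snd y) = frechet_derivative F (at y) (0, e)"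
      using chart_inv[OF U] by auto
    moreover have "C_k_on k O' (\<lambda>y. frechet_derivative F (at y) (0, e))" for k
      using O'(3)[of "Suc k"] by simp
    ultimately show "\<exists>O' g. open O' \<and> z \<in> O' \<and> (\<forall>k. C_k_on k O' g) \<and>
        (\<forall>y\<in>\<phi> ` (U \<inter> W) \<times> Q \<inter> O'. f' (inv_into U \<phi> (fst y)) (snd y) = g y)"
      using O'(1,2) z by blast
  qed
qed

section \<open>Vector fields: locality, components, dependence on parameters\<close>

lemma vf_smooth: "X \<in> vector_fields M \<Longrightarrow> f \<in> smooth_funs M \<Longrightarrow> X f \<in> smooth_funs M"
  by (simp add: vector_fields_def)

lemma vf_linear:
  assumes "X \<in> vector_fields M" "f \<in> smooth_funs M" "g \<in> smooth_funs M" "m \<in> points M"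
  shows "X (\<lambda>p. a * f p + b * g p) m = a * X f m + b * X g m"
  using assms unfolding vector_fields_def by fast

lemma vf_mult:
  assumes "X \<in> vector_fields M" "f \<in> smooth_funs M" "g \<in> smooth_funs M" "m \<in> points M"
  shows "X (\<lambda>p. f p * g p) m = X f m * g m + f m * X g m"
  using assms unfolding vector_fields_def by fast

lemma vf_add:
  assumes "X \<in> vector_fields M" "f \<in> smooth_funs M" "g \<in> smooth_funs M" "m \<in> points M"
  shows "X (\<lambda>p. f p + g p) m = X f m + X g m"
  using vf_linear[OF assms, of 1 1] by simp

lemma smooth_fun_cong:
  "f \<in> smooth_funs M \<Longrightarrow> (\<And>p. p \<in> points M \<Longrightarrow> f p = g p) \<Longrightarrow> g \<in> smooth_funs M"
  unfolding smooth_fun_iff by (rule smooth_fam_cong)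

text \<open>The difference of the two functions vanishes on the manifold, hence is a product of two functions
  that do, and the Leibniz rule applies.\<close>

lemma vf_cong:
  assumes X: "X \<in> vector_fields M" and f: "f \<in> smooth_funs M" and eq: "\<And>p. p \<in> points M \<Longrightarrow> f p = g p"
    and m: "m \<in> points M"
  shows "X f m = X g m"
proof -
  define h where "h p = g p - f p" for p
  \<comment> \<open>Off the manifold \<open>h\<close> is arbitrary, and so are its two factors. They
    are smooth nevertheless, because smoothness tests only points of the manifold, where all three
    vanish.\<close>
  define h1 where "h1 p = sqrt \<bar>h p\<bar>" for p
  define h2 where "h2 p = sgn (h p) * sqrt \<bar>h p\<bar>" for p
  have z: "k \<in> smooth_funs M" if "\<And>p. p \<in> points M \<Longrightarrow> k p = 0" for k
    by (rule smooth_fun_cong[OF const_smooth_funs[of 0 M]]) (simp add: that)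
  have h12: "h1 \<in> smooth_funs M" "h2 \<in> smooth_funs M" and hz: "h \<in> smooth_funs M"
    by (rule z, simp add: h1_def h2_def h_def eq)+
  have "h = (\<lambda>p. h1 p * h2 p)"
  proof
    fix p
    have "h1 p * h2 p = sgn (h p) * (sqrt \<bar>h p\<bar> * sqrt \<bar>h p\<bar>)" by (simp add: h1_def h2_def)
    also have "\<dots> = h p" unfolding real_sqrt_mult_self by (simp add: mult_sgn_abs)
    finally show "h p = h1 p * h2 p" ..
  qed
  then have "X h m = X h1 m * h2 m + h1 m * X h2 m"
    using vf_mult[OF X h12 m] by simp
  then have "X h m = 0" using m by (simp add: h1_def h2_def h_def eq)
  moreover have "g = (\<lambda>p. f p + h p)" by (simp add: h_def fun_eq_iff)
  ultimately show ?thesis using vf_add[OF X f hz m] by simp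
qed

text \<open>Multiplied by a cutoff the two functions agree on the whole manifold; at
  \<open>m\<close>, where the cutoff is 1, the Leibniz rule gives back \<open>X f\<close> and
  \<open>X g\<close> up to the same extra term.\<close>

lemma vf_local:
  assumes X: "X \<in> vector_fields M" and f: "f \<in> smooth_funs M" and g: "g \<in> smooth_funs M"
    and O': "openin (top M) O'" "m \<in> O'" and eq: "\<And>p. p \<in> O' \<Longrightarrow> f p = g p"
  shows "X f m = X g m"
proof -
  have m: "m \<in> points M" using O' openin_subset by blast
  obtain \<rho> O2 K where \<rho>: "\<rho> \<in> smooth_funs M" "openin (top M) O2" "m \<in> O2" "O2 \<subseteq> O'"
    "\<And>p. p \<in> O2 \<Longrightarrow> \<rho> p = 1" "K \<subseteq> O'" "\<And>p. p \<in> points M \<Longrightarrow> p \<notin> K \<Longrightarrow> \<rho> p = 0"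
    using cutoff[OF O'] by metis
  have "\<rho> p * f p = \<rho> p * g p" if "p \<in> points M" for p using \<rho>(6,7) eq that by (cases "p \<in> K") auto
  then have "X (\<lambda>p. \<rho> p * f p) m = X (\<lambda>p. \<rho> p * g p) m"
    by (rule vf_cong[OF X smooth_fun_mult[OF \<rho>(1) f] _ m])
  then show ?thesis
    using vf_mult[OF X \<rho>(1) f m] vf_mult[OF X \<rho>(1) g m] \<rho>(3,5) eq[OF O'(2)] by simp
qed

lemma smooth_fun_sum:
  "(\<And>i. i \<in> I \<Longrightarrow> f i \<in> smooth_funs M) \<Longrightarrow> (\<lambda>p. \<Sum>i\<in>I. f i p) \<in> smooth_funs M"
  unfolding smooth_fun_iff by (rule smooth_fam_sum)

lemma vf_sum:
  assumes X: "X \<in> vector_fields M" and m: "m \<in> points M" and f: "\<And>i. i \<in> I \<Longrightarrow> f i \<in> smooth_funs M"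
  shows "X (\<lambda>p. \<Sum>i\<in>I. f i p) m = (\<Sum>i\<in>I. X (f i) m)"
  using f
proof (induction I rule: infinite_finite_induct)
  case (insert i I)
  then have "X (\<lambda>p. f i p + (\<Sum>i\<in>I. f i p)) m = X (f i) m + X (\<lambda>p. \<Sum>i\<in>I. f i p) m"
    by (intro vf_add[OF X _ _ m] smooth_fun_sum) auto
  then show ?case using insert by simp
qed (simp_all add: vector_field_const[OF X m])

text \<open>By Hadamard's lemma \<open>f\<close> minus its value is a combination of coordinate
  differences near the point, and the Leibniz rule leaves only the derivatives of the coordinates.
  \<open>B\<close> and \<open>a\<close> depend on the vector field alone, and \<open>g\<close> may
  be any smooth extension of \<open>f\<close> in the chart, so corners are included.\<close>

lemma vf_local_form:
  assumes U: "(U, \<phi>) \<in> charts M" "m0 \<in> U" and X: "X \<in> vector_fields M"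
  obtains B a where "open B" "\<phi> m0 \<in> B" "\<And>b. b \<in> Basis \<Longrightarrow> smooth_on (\<phi> ` U \<inter> B) (a b)"
    "\<And>f m V g. f \<in> smooth_funs M \<Longrightarrow> m \<in> U \<Longrightarrow> \<phi> m \<in> B \<Longrightarrow> open V \<Longrightarrow> \<phi> m \<in> V \<Longrightarrow> (\<And>k. C_k_on k V g) \<Longrightarrow>
      (\<And>p. p \<in> U \<Longrightarrow> \<phi> p \<in> V \<Longrightarrow> f p = g (\<phi> p)) \<Longrightarrow>
      X f m = (\<Sum>b\<in>Basis. a b (\<phi> m) * frechet_derivative g (at (\<phi> m)) b)"
proof -
  obtain \<rho> O' K where \<rho>: "\<rho> \<in> smooth_funs M" "openin (top M) O'" "m0 \<in> O'" "O' \<subseteq> U"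
    "\<And>p. p \<in> O' \<Longrightarrow> \<rho> p = 1" "closedin (top M) K" "K \<subseteq> U" "\<And>p. p \<in> points M \<Longrightarrow> p \<notin> K \<Longrightarrow> \<rho> p = 0"
    using cutoff[OF chart_open[OF U(1)] U(2)] by metis
  obtain B where B: "open B" "\<phi> ` (U \<inter> O') = \<phi> ` U \<inter> B" using chart_image_open[OF U(1) \<rho>(2)] by blast
  have inO: "p \<in> O'" if "p \<in> U" "\<phi> p \<in> B" for p
  proof -
    have "\<phi> p \<in> \<phi> ` (U \<inter> O')" using that B(2) by blast
    then show ?thesis using that(1) chart_inj[OF U(1)] by (auto simp: inj_on_def)
  qed
  have glue: "(\<lambda>p. if p \<in> U' then \<sigma> p * g (\<phi> p) else 0) \<in> smooth_funs M"
    if "openin (top M) U'" "closedin (top M) K'" "K' \<subseteq> U'" "\<sigma> \<in> smooth_funs M"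
      "\<And>p. p \<in> points M \<Longrightarrow> p \<notin> K' \<Longrightarrow> \<sigma> p = 0" "U' \<subseteq> U" "smooth_on (\<phi> ` U') g" for U' K' \<sigma> g
  proof -
    have "smooth_fam M (U' \<inter> points M) (UNIV :: real set) (\<lambda>p q. g (\<phi> p))"
      by (rule smooth_fam_subset[OF smooth_fam_chart_comp[OF U(1) that(6,7)]]) auto
    from smooth_fam_glue[OF that(1) order_refl that(2-5) this] show ?thesis
      unfolding smooth_fun_iff real_scaleR_def .
  qed
  have coord: "smooth_on S (\<lambda>x. x \<bullet> b)" for S and b :: 'a
    by (rule smooth_on_linear[OF bounded_linear_inner_left])
  define c where "c b p = (if p \<in> U then \<rho> p * (\<phi> p \<bullet> b) else 0)" for b p
  have c: "c b \<in> smooth_funs M" for b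
    unfolding c_def by (rule glue[OF chart_open[OF U(1)] \<rho>(6,7,1,8) order_refl coord])
  \<comment> \<open>Coordinates are not global functions, so \<open>X\<close> is applied to \<rho>
    times a coordinate and the contribution of \<rho> is subtracted; where \<rho> = 1 these are the
    components of \<open>X\<close>.\<close>
  define a where "a b x = X (c b) (inv_into U \<phi> x) - (x \<bullet> b) * X \<rho> (inv_into U \<phi> x)" for b x
  show ?thesis
  proof (rule that[OF B(1)])
    show "\<phi> m0 \<in> B" using \<rho>(3) U(2) B(2) by blast
    show "smooth_on (\<phi> ` U \<inter> B) (a b)" for b
    proof -
      have s: "smooth_on (\<phi> ` U \<inter> B) (\<lambda>x. X f (inv_into U \<phi> x))" if "f \<in> smooth_funs M" for f
        using vf_smooth[OF X that] U(1) by (auto simp: smooth_funs_def intro: smooth_on_subset)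
      have "smooth_on (\<phi> ` U \<inter> B) (\<lambda>x. X (c b) (inv_into U \<phi> x) + (- 1) * ((x \<bullet> b) * X \<rho> (inv_into U \<phi> x)))"
        by (intro smooth_on_add smooth_on_bilinear[OF bounded_bilinear_mult] smooth_on_const s c \<rho>(1) coord)
      then show ?thesis by (simp add: a_def[abs_def])
    qed
    fix f m V and g :: "'a \<Rightarrow> real"
    assume f: "f \<in> smooth_funs M" and m: "m \<in> U" "\<phi> m \<in> B" and V: "open V" "\<phi> m \<in> V"
      and g: "\<And>k. C_k_on k V g" and fg: "\<And>p. p \<in> U \<Longrightarrow> \<phi> p \<in> V \<Longrightarrow> f p = g (\<phi> p)"
    have mM: "m \<in> points M" using m(1) chart_subset[OF U(1)] by blast
    obtain e where e: "e > 0" "ball (\<phi> m) e \<subseteq> V" using V openE by blast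
    obtain G where G: "\<And>b k. C_k_on k (ball (\<phi> m) e) (G b)"
      "\<And>b. G b (\<phi> m) = frechet_derivative g (at (\<phi> m)) b"
      "\<And>x. x \<in> ball (\<phi> m) e \<Longrightarrow> g x = g (\<phi> m) + (\<Sum>b\<in>Basis. ((x - \<phi> m) \<bullet> b) * G b x)"
      using hadamard[OF C_k_on_subset[OF g e(2)] e(1)] by metis
    define U' where "U' = {p \<in> U. \<phi> p \<in> ball (\<phi> m) e}"
    have U': "openin (top M) U'" "m \<in> U'" "U' \<subseteq> U"
      using chart_preimage_open[OF U(1) open_ball] m e(1) by (auto simp: U'_def)
    obtain \<sigma> O2 K' where \<sigma>: "\<sigma> \<in> smooth_funs M" "m \<in> O2"
      "\<And>p. p \<in> O2 \<Longrightarrow> \<sigma> p = 1" "closedin (top M) K'" "K' \<subseteq> U'" "\<And>p. p \<in> points M \<Longrightarrow> p \<notin> K' \<Longrightarrow> \<sigma> p = 0"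
      using cutoff[OF U'(1,2)] by metis
    have \<rho>m: "\<rho> m = 1" by (rule \<rho>(5)[OF inO[OF m]])
    have \<sigma>m: "\<sigma> m = 1" by (rule \<sigma>(3)[OF \<sigma>(2)])
    define w where "w b p = (if p \<in> U' then \<sigma> p * G b (\<phi> p) else 0)" for b p
    have w: "w b \<in> smooth_funs M" for b
      unfolding w_def
      by (rule glue[OF U'(1) \<sigma>(4,5,1,6) U'(3) smooth_on_open[OF open_ball G(1)]]) (auto simp: U'_def)
    \<comment> \<open>\<open>v b\<close> is \<rho> times the coordinate difference to
      \<open>m\<close>, and \<open>w b\<close> is a Hadamard coefficient cut off inside
      \<open>U'\<close>. The coefficients 1 are written out so that \<open>vf_linear\<close> applies
      literally, here and for \<open>f0\<close>.\<close>
    define v where "v b p = 1 * c b p + (- (\<phi> m \<bullet> b)) * \<rho> p" for b p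
    have v: "v b \<in> smooth_funs M" for b
      unfolding v_def by (intro smooth_fun_add smooth_fun_mult c \<rho>(1) const_smooth_funs)
    define f0 where "f0 p = 1 * f p + (- f m) * 1" for p
    have f0: "f0 \<in> smooth_funs M"
      unfolding f0_def by (intro smooth_fun_add smooth_fun_mult f const_smooth_funs)
    have Xf0: "X f0 m = X f m"
      unfolding f0_def vf_linear[OF X f const_smooth_funs mM] by (simp add: vector_field_const[OF X mM])
    have Xv: "X (v b) m = a b (\<phi> m)" for b
      unfolding v_def vf_linear[OF X c \<rho>(1) mM] by (simp add: a_def chart_inv[OF U(1) m(1)])
    \<comment> \<open>Both sides vanish off \<open>U'\<close>, so Hadamard's local identity becomes
      one between functions on the whole manifold, to which \<open>X\<close> can be applied.\<close>
    have eq: "(\<rho> p * \<sigma> p) * f0 p = (\<Sum>b\<in>Basis. v b p * w b p)" if p: "p \<in> points M" for p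
    proof (cases "p \<in> U'")
      case True
      then have pU: "p \<in> U" "\<phi> p \<in> ball (\<phi> m) e" by (auto simp: U'_def)
      have "f p - f m = (\<Sum>b\<in>Basis. ((\<phi> p - \<phi> m) \<bullet> b) * G b (\<phi> p))"
        using G(3)[OF pU(2)] fg[of p] fg[of m] pU e m V(2) by auto
      then show ?thesis using True pU(1)
        by (simp add: f0_def v_def w_def c_def sum_distrib_left algebra_simps inner_diff_left)
    next
      case False
      then have "\<sigma> p = 0" using \<sigma>(5,6) p by blast
      then show ?thesis using False by (simp add: w_def)
    qed
    have "X (\<lambda>p. (\<rho> p * \<sigma> p) * f0 p) m = X (\<lambda>p. \<Sum>b\<in>Basis. v b p * w b p) m"
      by (rule vf_cong[OF X _ eq mM]) (intro smooth_fun_mult \<rho>(1) \<sigma>(1) f0)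
    moreover have "X (\<lambda>p. (\<rho> p * \<sigma> p) * f0 p) m = X f m"
      using vf_mult[OF X smooth_fun_mult[OF \<rho>(1) \<sigma>(1)] f0 mM] Xf0 \<rho>m \<sigma>m by (simp add: f0_def)
    moreover have "X (\<lambda>p. \<Sum>b\<in>Basis. v b p * w b p) m = (\<Sum>b\<in>Basis. a b (\<phi> m) * G b (\<phi> m))"
    proof -
      have "X (\<lambda>p. v b p * w b p) m = a b (\<phi> m) * G b (\<phi> m)" for b
        using vf_mult[OF X v[of b] w[of b] mM] U'(2) m \<rho>m \<sigma>m Xv[of b]
        by (simp add: v_def w_def c_def)
      then show ?thesis using vf_sum[OF X mM, of Basis "\<lambda>b p. v b p * w b p"] by (simp add: smooth_fun_mult v w)
    qed
    ultimately show "X f m = (\<Sum>b\<in>Basis. a b (\<phi> m) * frechet_derivative g (at (\<phi> m)) b)"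
      using G(2) by simp
  qed
qed

text \<open>The components of \<open>X\<close> do not involve the parameter, so in a chart the
  result is a sum of products of smooth functions of coordinate and parameter.\<close>

lemma smooth_fam_vf:
  fixes f :: "'m \<Rightarrow> 'q::euclidean_space \<Rightarrow> real"
  assumes X: "X \<in> vector_fields M" and f: "smooth_fam M (points M) Q f"
  shows "smooth_fam M (points M) Q (\<lambda>p q. X (\<lambda>p. f p q) p)"
  unfolding smooth_fam_def
proof (intro allI impI)
  fix U \<phi> assume U: "(U, \<phi>) \<in> charts M"
  show "smooth_on (\<phi> ` (U \<inter> points M) \<times> Q) (\<lambda>z. X (\<lambda>p. f p (snd z)) (inv_into U \<phi> (fst z)))"
  proof (rule smooth_on_local)
    fix z assume "z \<in> \<phi> ` (U \<inter> points M) \<times> Q"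
    then obtain m q where m: "m \<in> U" "m \<in> points M" "q \<in> Q" and z: "z = (\<phi> m, q)" by blast
    obtain B a where B: "open B" "\<phi> m \<in> B" "\<And>b. b \<in> Basis \<Longrightarrow> smooth_on (\<phi> ` U \<inter> B) (a b)"
      "\<And>f m V g. f \<in> smooth_funs M \<Longrightarrow> m \<in> U \<Longrightarrow> \<phi> m \<in> B \<Longrightarrow> open V \<Longrightarrow> \<phi> m \<in> V \<Longrightarrow> (\<And>k. C_k_on k V g) \<Longrightarrow>
        (\<And>p. p \<in> U \<Longrightarrow> \<phi> p \<in> V \<Longrightarrow> f p = g (\<phi> p)) \<Longrightarrow>
        X f m = (\<Sum>b\<in>Basis. a b (\<phi> m) * frechet_derivative g (at (\<phi> m)) b)"
      by (rule vf_local_form[OF U m(1) X]) blast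
    obtain O' F where O': "open O'" "(\<phi> m, q) \<in> O'" "\<And>k. C_k_on k O' F"
      "\<And>p r. p \<in> U \<Longrightarrow> p \<in> points M \<Longrightarrow> r \<in> Q \<Longrightarrow> (\<phi> p, r) \<in> O' \<Longrightarrow> f p r = F (\<phi> p, r)"
      by (rule fam_extension[OF f U m]) blast
    define W where "W = O' \<inter> B \<times> UNIV"
    have "X (\<lambda>p. f p r) p = (\<Sum>b\<in>Basis. a b (\<phi> p) * frechet_derivative F (at (\<phi> p, r)) (b, 0))"
      if p: "p \<in> U" "r \<in> Q" "(\<phi> p, r) \<in> O'" "\<phi> p \<in> B" for p r
      unfolding C_k_on_slice(3)[OF O'(1,3) p(3), symmetric]
      by (rule B(4)[OF smooth_fun_of_fam[OF f p(2)] p(1,4) C_k_on_slice(1)[OF O'(1,3), of r] _ C_k_on_slice(2)[OF O'(1,3)]])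
         (use O'(4) p chart_subset[OF U] in auto)
    then have eq: "X (\<lambda>p. f p (snd y)) (inv_into U \<phi> (fst y)) =
        (\<Sum>b\<in>Basis. a b (fst y) * frechet_derivative F (at y) (b, 0))"
      if "y \<in> \<phi> ` (U \<inter> points M) \<times> Q \<inter> W" for y
      using that chart_inv[OF U] by (auto simp: W_def)
    have "smooth_on (\<phi> ` (U \<inter> points M) \<times> Q \<inter> W) (\<lambda>y. \<Sum>b\<in>Basis. a b (fst y) * frechet_derivative F (at y) (b, 0))"
    proof (intro smooth_on_sum smooth_on_bilinear[OF bounded_bilinear_mult])
      fix b :: 'a assume b: "b \<in> Basis"
      show "smooth_on (\<phi> ` (U \<inter> points M) \<times> Q \<inter> W) (\<lambda>y. a b (fst y))"
        by (rule smooth_on_compose[OF B(3)[OF b] smooth_on_linear[OF bounded_linear_fst]]) (auto simp: W_def)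
      have "C_k_on k O' (\<lambda>y. frechet_derivative F (at y) (b, 0))" for k using O'(3)[of "Suc k"] by simp
      then show "smooth_on (\<phi> ` (U \<inter> points M) \<times> Q \<inter> W) (\<lambda>y. frechet_derivative F (at y) (b, 0))"
        by (rule smooth_on_open[OF O'(1)]) (auto simp: W_def)
    qed
    then have "smooth_on (\<phi> ` (U \<inter> points M) \<times> Q \<inter> W) (\<lambda>z. X (\<lambda>p. f p (snd z)) (inv_into U \<phi> (fst z)))"
      by (rule smooth_on_cong) (simp add: eq)
    moreover have "open W" using O'(1) B(1) by (auto simp: W_def intro!: open_Int open_Times)
    ultimately show "\<exists>W. open W \<and> z \<in> W \<and> smooth_on (\<phi> ` (U \<inter> points M) \<times> Q \<inter> W)
        (\<lambda>z. X (\<lambda>p. f p (snd z)) (inv_into U \<phi> (fst z)))"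
      using O'(2) B(2) z by (auto simp: W_def)
  qed
qed

text \<open>In coordinates both orders are second derivatives of one extension \<open>F\<close> in
  the directions \<open>(b, 0)\<close> and \<open>(0, e)\<close>, and mixed derivatives
  agree.\<close>

lemma vf_derivative_commute:
  fixes f :: "'m \<Rightarrow> 'q::euclidean_space \<Rightarrow> real"
  assumes X: "X \<in> vector_fields M" and f: "smooth_fam M (points M) Q f" and g: "g \<in> smooth_funs M"
    and T: "\<And>u. u \<in> T \<Longrightarrow> q + (u - u0) *\<^sub>R e \<in> Q" "u0 \<in> T" "at u0 within T \<noteq> bot"
    and fg: "\<And>p. p \<in> points M \<Longrightarrow>
      ((\<lambda>u. f p (q + (u - u0) *\<^sub>R e)) has_vector_derivative g p) (at u0 within T)"
    and m: "m \<in> points M"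
  shows "((\<lambda>u. X (\<lambda>p. f p (q + (u - u0) *\<^sub>R e)) m) has_vector_derivative X g m) (at u0 within T)"
proof -
  obtain U \<phi> where U: "(U, \<phi>) \<in> charts M" "m \<in> U" using chart_cover m by blast
  have q: "q \<in> Q" using T(1)[OF T(2)] by simp
  obtain B a where B: "\<phi> m \<in> B"
    "\<And>f m V g. f \<in> smooth_funs M \<Longrightarrow> m \<in> U \<Longrightarrow> \<phi> m \<in> B \<Longrightarrow> open V \<Longrightarrow> \<phi> m \<in> V \<Longrightarrow> (\<And>k. C_k_on k V g) \<Longrightarrow>
      (\<And>p. p \<in> U \<Longrightarrow> \<phi> p \<in> V \<Longrightarrow> f p = g (\<phi> p)) \<Longrightarrow>
      X f m = (\<Sum>b\<in>Basis. a b (\<phi> m) * frechet_derivative g (at (\<phi> m)) b)"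
    by (rule vf_local_form[OF U X]) blast
  obtain O' F where O': "open O'" "(\<phi> m, q) \<in> O'" "\<And>k. C_k_on k O' F"
    "\<And>p r. p \<in> U \<Longrightarrow> p \<in> points M \<Longrightarrow> r \<in> Q \<Longrightarrow> (\<phi> p, r) \<in> O' \<Longrightarrow> f p r = F (\<phi> p, r)"
    by (rule fam_extension[OF f U m q]) blast
  have CD: "C_k_on k O' (\<lambda>z. frechet_derivative F (at z) w)" for k w
    using O'(3)[of "Suc k"] unfolding C_k_on.simps by blast
  have 1: "X (\<lambda>p. f p r) m = (\<Sum>b\<in>Basis. a b (\<phi> m) * frechet_derivative F (at (\<phi> m, r)) (b, 0))"
    if r: "r \<in> Q" "(\<phi> m, r) \<in> O'" for r
    unfolding C_k_on_slice(3)[OF O'(1,3) r(2), symmetric]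
    by (rule B(2)[OF smooth_fun_of_fam[OF f r(1)] U(2) B(1) C_k_on_slice(1)[OF O'(1,3), of r] _ C_k_on_slice(2)[OF O'(1,3)]])
       (use O'(4) r chart_subset[OF U(1)] in auto)
  \<comment> \<open>The derivative of \<open>F\<close> in the direction \<open>(0, e)\<close>,
    restricted to the parameter \<open>q\<close>, is an extension of \<open>g\<close>, so the local
    form can be evaluated with it.\<close>
  have 2: "X g m = (\<Sum>b\<in>Basis. a b (\<phi> m) * frechet_derivative (\<lambda>z. frechet_derivative F (at z) (0, e)) (at (\<phi> m, q)) (b, 0))"
    unfolding C_k_on_slice(3)[OF O'(1) CD O'(2), symmetric]
  proof (rule B(2)[OF g U(2) B(1) C_k_on_slice(1)[OF O'(1,3), of q] _ C_k_on_slice(2)[OF O'(1) CD]])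
    fix p assume p: "p \<in> U" "\<phi> p \<in> {y. (y, q) \<in> O'}"
    then have pM: "p \<in> points M" using chart_subset[OF U(1)] by blast
    show "g p = frechet_derivative F (at (\<phi> p, q)) (0, e)"
      by (rule vector_derivative_unique_within[OF T(3) fg[OF pM]])
         (rule fam_has_derivative[where \<phi> = \<phi> and f = f and F = F and Q = Q and W = "points M", OF O'(1) _ O'(3,4) p(1) pM T(1,2)], use p in auto)
  qed (use O'(2) in auto)
  have eq: "(\<phi> m, q) + (u - u0) *\<^sub>R (0, e) = (\<phi> m, q + (u - u0) *\<^sub>R e)" for u by simp
  obtain \<delta> where \<delta>: "\<delta> > 0" "\<And>u. dist u u0 < \<delta> \<Longrightarrow> (\<phi> m, q + (u - u0) *\<^sub>R e) \<in> O'"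
    using eventually_along[OF O'(1,2), of u0 "(0, e)"] unfolding eq by blast
  have al: "((\<lambda>u. frechet_derivative F (at (\<phi> m, q + (u - u0) *\<^sub>R e)) w) has_vector_derivative
      frechet_derivative (\<lambda>z. frechet_derivative F (at z) w) (at (\<phi> m, q)) (0, e)) (at u0 within T)" for w
    using has_vector_derivative_along[OF CD[of _ w] O'(2), of u0 "(0, e)" T] unfolding eq .
  have "((\<lambda>u. \<Sum>b\<in>Basis. a b (\<phi> m) * frechet_derivative F (at (\<phi> m, q + (u - u0) *\<^sub>R e)) (b, 0)) has_vector_derivative
      (\<Sum>b\<in>Basis. a b (\<phi> m) * frechet_derivative (\<lambda>z. frechet_derivative F (at z) (b, 0)) (at (\<phi> m, q)) (0, e)))
      (at u0 within T)"
    by (intro has_vector_derivative_sum bounded_linear.has_vector_derivative[OF bounded_linear_mult_right] al)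
  moreover have "(\<Sum>b\<in>Basis. a b (\<phi> m) * frechet_derivative (\<lambda>z. frechet_derivative F (at z) (b, 0)) (at (\<phi> m, q)) (0, e)) = X g m"
    unfolding 2 C_k_on_mixed_derivatives[OF O'(1,2,3), where w = "(0, e)"] by (rule refl)
  ultimately have "((\<lambda>u. \<Sum>b\<in>Basis. a b (\<phi> m) * frechet_derivative F (at (\<phi> m, q + (u - u0) *\<^sub>R e)) (b, 0))
      has_vector_derivative X g m) (at u0 within T)" by simp
  then show ?thesis
    by (rule has_vector_derivative_transform_within[OF _ \<delta>(1) T(2)]) (simp add: 1 T(1) \<delta>(2))
qed

end

section \<open>Alternating sums over pairs\<close>

text \<open>Positions \<open>2 * k\<close> and \<open>2 * k + 1\<close> hold the two arguments of
  factor \<open>k\<close>. Exchanging them is odd and changes the sign of a curvature; exchanging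
  whole factors, as \<open>block_swap\<close> does, is even.\<close>

definition pair_swap :: "nat \<Rightarrow> nat \<Rightarrow> nat" where
  "pair_swap k = Transposition.transpose (2 * k) (2 * k + 1)"

definition block_swap :: "nat \<Rightarrow> nat \<Rightarrow> nat \<Rightarrow> nat" where
  "block_swap k l = Transposition.transpose (2 * k) (2 * l) \<circ> Transposition.transpose (2 * k + 1) (2 * l + 1)"

lemma block_swap_apply: "block_swap k l i = 2 * Transposition.transpose k l (i div 2) + i mod 2"
proof (cases "even i")
  case True
  then obtain q where i: "i = 2 * q" by blast
  have "2 * q \<noteq> 2 * k + 1" "2 * q \<noteq> 2 * l + 1" by presburger+
  then show ?thesis by (auto simp: i block_swap_def Transposition.transpose_def)
next
  case False
  then obtain q where i: "i = 2 * q + 1" by (elim oddE)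
  have "2 * q + 1 \<noteq> 2 * k" "2 * q + 1 \<noteq> 2 * l" by presburger+
  then show ?thesis by (auto simp: i block_swap_def Transposition.transpose_def)
qed

lemma pair_swap_permutes: "k < j \<Longrightarrow> pair_swap k permutes {..<2 * j}"
  unfolding pair_swap_def by (rule permutes_swap_id) auto

lemma block_swap_permutes: "k < j \<Longrightarrow> l < j \<Longrightarrow> block_swap k l permutes {..<2 * j}"
  unfolding block_swap_def by (intro permutes_compose permutes_swap_id) auto

lemma sign_pair_swap: "sign (pair_swap k) = - 1"
  by (simp add: pair_swap_def sign_swap_id)

lemma sign_block_swap: "sign (block_swap k l) = 1"
  by (simp add: block_swap_def sign_compose permutation_swap_id sign_swap_id)

lemma block_swap_involution: "block_swap k l (block_swap k l i) = i"
  by (simp add: block_swap_apply)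

lemma pair_swap_involution: "pair_swap k (pair_swap k i) = i"
  by (simp add: pair_swap_def)

text \<open>The values 0 and \<open>p + 1\<close> stand for \<partial>_t and \<partial>_\<theta>;
  they are fixed at the two ends, while \<pi> permutes the \<open>p\<close> fields tangent to the
  base in between.\<close>

definition lift_perm :: "nat \<Rightarrow> (nat \<Rightarrow> nat) \<Rightarrow> nat \<Rightarrow> nat" where
  "lift_perm p \<pi> = map_permutation {..<p} Suc \<pi>"

lemma lift_perm_apply:
  assumes "\<pi> permutes {..<p}"
  shows "lift_perm p \<pi> 0 = 0" "i < p \<Longrightarrow> lift_perm p \<pi> (Suc i) = Suc (\<pi> i)"
    "lift_perm p \<pi> (Suc p) = Suc p"
  using assms by (auto simp: lift_perm_def map_permutation_apply)
    (auto simp: map_permutation_def restrict_id_def)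

lemma sign_lift_perm: "\<pi> permutes {..<p} \<Longrightarrow> sign (lift_perm p \<pi>) = sign \<pi>"
  unfolding lift_perm_def by (rule sign_map_permutation) auto

lemma lift_perm_bij:
  "bij_betw (lift_perm p) {\<pi>. \<pi> permutes {..<p}} {\<pi>. \<pi> permutes {..<p + 2} \<and> \<pi> 0 = 0 \<and> \<pi> (Suc p) = Suc p}"
proof (rule bij_betwI[where g = "map_permutation (Suc ` {..<p}) (\<lambda>x. x - 1)"])
  have bij: "bij_betw Suc {..<p} (Suc ` {..<p})" "bij_betw (\<lambda>x. x - 1) (Suc ` {..<p}) {..<p}"
    by (auto simp: bij_betw_def inj_on_def image_image)
  have perm: "lift_perm p \<pi> permutes (Suc ` {..<p})" if "\<pi> permutes {..<p}" for \<pi>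
    unfolding lift_perm_def by (rule map_permutation_permutes[OF bij(1) that])
  show "lift_perm p \<in> {\<pi>. \<pi> permutes {..<p}} \<rightarrow> {\<pi>. \<pi> permutes {..<p + 2} \<and> \<pi> 0 = 0 \<and> \<pi> (Suc p) = Suc p}"
  proof
    fix \<pi> assume "\<pi> \<in> {\<pi>. \<pi> permutes {..<p}}"
    then have \<pi>: "\<pi> permutes {..<p}" by simp
    have "lift_perm p \<pi> permutes {..<p + 2}"
      by (rule permutes_subset[OF perm[OF \<pi>]]) auto
    then show "lift_perm p \<pi> \<in> {\<pi>. \<pi> permutes {..<p + 2} \<and> \<pi> 0 = 0 \<and> \<pi> (Suc p) = Suc p}"
      using lift_perm_apply[OF \<pi>] by simp
  qed
  have in_perm: "\<pi> permutes (Suc ` {..<p})" if "\<pi> permutes {..<p + 2}" "\<pi> 0 = 0" "\<pi> (Suc p) = Suc p" for \<pi>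
  proof -
    have "\<pi> permutes (UNIV \<inter> (Suc ` {..<p}))"
    proof (rule permutes_superset)
      show "\<pi> permutes {..<p + 2}" by fact
      show "\<pi> x = x" if "x \<in> {..<p + 2} - UNIV \<inter> Suc ` {..<p}" for x
      proof -
        have "x = 0 \<or> x = Suc p" using that by (cases x) auto
        then show ?thesis using \<open>\<pi> 0 = 0\<close> \<open>\<pi> (Suc p) = Suc p\<close> by auto
      qed
    qed
    then show ?thesis by simp
  qed
  show "map_permutation (Suc ` {..<p}) (\<lambda>x. x - 1) \<in> {\<pi>. \<pi> permutes {..<p + 2} \<and> \<pi> 0 = 0 \<and> \<pi> (Suc p) = Suc p} \<rightarrow> {\<pi>. \<pi> permutes {..<p}}"
    using in_perm map_permutation_permutes[OF bij(2)] by auto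
  show "map_permutation (Suc ` {..<p}) (\<lambda>x. x - 1) (lift_perm p \<pi>) = \<pi>" if "\<pi> \<in> {\<pi>. \<pi> permutes {..<p}}" for \<pi>
    unfolding lift_perm_def by (rule map_permutation_compose_inv[OF bij(1)]) (use that in auto)
  show "lift_perm p (map_permutation (Suc ` {..<p}) (\<lambda>x. x - 1) \<pi>) = \<pi>"
    if "\<pi> \<in> {\<pi>. \<pi> permutes {..<p + 2} \<and> \<pi> 0 = 0 \<and> \<pi> (Suc p) = Suc p}" for \<pi>
    unfolding lift_perm_def by (rule map_permutation_compose_inv[OF bij(2)]) (use that in_perm in auto)
qed

text \<open>A cycle of the positions 0 to \<open>p\<close>. Composed with a lifted permutation it
  moves the value 0 to position \<open>p\<close>, next to the value \<open>p + 1\<close>; for even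
  \<open>p\<close> these two positions form the last pair and the cycle is an even
  permutation.\<close>

definition rotation :: "nat \<Rightarrow> nat \<Rightarrow> nat" where
  "rotation p i = (if i < p then Suc i else if i = p then 0 else i)"

lemma rotation_Suc: "rotation (Suc p) = Transposition.transpose 0 (Suc p) \<circ> rotation p"
  by (auto simp: fun_eq_iff rotation_def Transposition.transpose_def)

lemma rotation_permutes: "rotation p permutes {..p}"
proof (induction p)
  case 0
  have "rotation 0 = id" by (auto simp: rotation_def fun_eq_iff)
  then show ?case by (metis permutes_id)
next
  case (Suc p)
  show ?case unfolding rotation_Suc
    by (intro permutes_compose permutes_subset[OF Suc] permutes_swap_id) auto
qed

lemma sign_rotation: "sign (rotation p) = (- 1) ^ p"
proof (induction p)
  case 0
  have "rotation 0 = id" by (auto simp: rotation_def fun_eq_iff)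
  then show ?case using sign_id by simp
next
  case (Suc p)
  have "permutation (rotation p)" using rotation_permutes permutation_permutes by blast
  then have "sign (rotation (Suc p)) = sign (Transposition.transpose 0 (Suc p)) * sign (rotation p)"
    unfolding rotation_Suc by (rule sign_compose[OF permutation_swap_id])
  then show ?case by (simp add: sign_swap_id Suc)
qed

lemma div_2_eq_iff: "(b :: nat) div 2 = q \<longleftrightarrow> b = 2 * q \<or> b = 2 * q + 1"
  by presburger

text \<open>The values 0 and \<open>p + 1\<close> of \<open>\<pi>\<close> are taken in two different pairs in \<open>4j(j - 1)\<close> ways, and in the
  same pair in \<open>2j\<close> ways; by \<open>anti\<close> and \<open>sym\<close> all ways of one kind contribute the same.\<close>

lemma alternating_pair_sum:
  fixes G :: "(nat \<Rightarrow> nat) \<Rightarrow> complex"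
  assumes j: "p + 2 = 2 * j"
    and anti: "\<And>\<pi> k. \<pi> permutes {..<2 * j} \<Longrightarrow> k < j \<Longrightarrow> G (\<pi> \<circ> pair_swap k) = - G \<pi>"
    and sym: "\<And>\<pi> k l. \<pi> permutes {..<2 * j} \<Longrightarrow> k < j \<Longrightarrow> l < j \<Longrightarrow> G (\<pi> \<circ> block_swap k l) = G \<pi>"
  shows "(\<Sum>\<pi> | \<pi> permutes {..<2 * j}. of_int (sign \<pi>) * G \<pi>) =
    4 * of_nat j * of_nat (j - 1) * (\<Sum>\<pi> | \<pi> permutes {..<p}. of_int (sign \<pi>) * G (lift_perm p \<pi>)) +
    2 * of_nat j * (\<Sum>\<pi> | \<pi> permutes {..<p}. of_int (sign \<pi>) * G (lift_perm p \<pi> \<circ> rotation p))"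
proof -
  define n where "n = 2 * j"
  have n: "n = p + 2" "n = 2 * j" using j by (simp_all add: n_def)
  define g where "g \<pi> = of_int (sign \<pi>) * G \<pi>" for \<pi>
  \<comment> \<open>\<open>S a b\<close> collects the permutations with the values 0 and
    \<open>n - 1\<close> at the positions \<open>a\<close> and \<open>b\<close>. It turns out to
    depend only on whether these positions belong to the same pair.\<close>
  define P where "P a b = {\<pi>. \<pi> permutes {..<n} \<and> \<pi> a = 0 \<and> \<pi> b = n - 1}" for a b
  define S where "S a b = sum g (P a b)" for a b
  have fin: "finite {\<pi>. \<pi> permutes {..<n}}" by (simp add: finite_permutations)
  have perm: "permutation \<pi>" if "\<pi> permutes {..<n}" for \<pi> using that permutation_permutes by blast
  \<comment> \<open>If the signed summand is invariant under right composition with an involution,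
    then the involution may be applied to both positions.\<close>
  have S_swap: "S a b = S (h a) (h b)"
    if h: "h permutes {..<n}" "\<And>i. h (h i) = i" and inv: "\<And>\<pi>. \<pi> permutes {..<n} \<Longrightarrow> g (\<pi> \<circ> h) = g \<pi>" for h a b
    unfolding S_def
    by (rule sum.reindex_bij_witness[where i = "\<lambda>\<pi>. \<pi> \<circ> h" and j = "\<lambda>\<pi>. \<pi> \<circ> h"])
       (use h inv in \<open>auto simp: P_def fun_eq_iff intro: permutes_compose\<close>)
  have g_pair: "g (\<pi> \<circ> pair_swap k) = g \<pi>" if "\<pi> permutes {..<n}" "k < j" for \<pi> k
    using anti[of \<pi> k] that perm[OF that(1)] perm[OF pair_swap_permutes[OF that(2), folded n_def]]
    by (simp add: g_def sign_compose sign_pair_swap n_def)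
  have g_block: "g (\<pi> \<circ> block_swap k l) = g \<pi>" if "\<pi> permutes {..<n}" "k < j" "l < j" for \<pi> k l
    using sym[of \<pi> k l] that perm[OF that(1)] perm[OF block_swap_permutes[OF that(2,3), folded n_def]]
    by (simp add: g_def sign_compose sign_block_swap n_def)
  have S_pair: "S a b = S (pair_swap k a) (pair_swap k b)" if "k < j" for k a b
    by (rule S_swap) (use that pair_swap_permutes g_pair in \<open>auto simp: n_def pair_swap_involution\<close>)
  have S_block: "S a b = S (block_swap k l a) (block_swap k l b)" if "k < j" "l < j" for k l a b
    by (rule S_swap) (use that block_swap_permutes g_block in \<open>auto simp: n_def block_swap_involution\<close>)
  have same: "S a b = S p (n - 1)" if "a < n" "b < n" "a \<noteq> b" "a div 2 = b div 2" for a b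
  proof -
    have *: "S (2 * k) (2 * k + 1) = S p (n - 1)" if "k < j" for k
    proof -
      have "S (2 * k) (2 * k + 1) = S (2 * (j - 1)) (2 * (j - 1) + 1)"
        using S_block[of k "j - 1" "2 * k" "2 * k + 1"] that by (simp add: block_swap_apply)
      moreover have "2 * (j - 1) = p" "2 * (j - 1) + 1 = n - 1" using n that by auto
      ultimately show ?thesis by simp
    qed
    show ?thesis
    proof (cases "even a")
      case True
      then obtain k where a: "a = 2 * k" by blast
      then have "b = 2 * k + 1" "k < j" using that n by presburger+
      then show ?thesis using * a by simp
    next
      case False
      then obtain k where a: "a = 2 * k + 1" by (elim oddE)
      then have b: "b = 2 * k" and k: "k < j" using that n by presburger+
      have "S a b = S b a" using S_pair[OF k, of a b] by (simp add: a b pair_swap_def)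
      then show ?thesis using *[OF k] a b by simp
    qed
  qed
  have diff: "S a b = S 0 (n - 1)" if ab: "a < n" "b < n" "a div 2 \<noteq> b div 2" for a b
  proof -
    have 1: "S (2 * k) (2 * l + 1) = S 0 (n - 1)" if "k < j" "l < j" "k \<noteq> l" for k l
    proof -
      \<comment> \<open>Bringing the pair of \<open>k\<close> to the front displaces the pair of
        \<open>l\<close> if that was the front pair; it then sits at \<open>k\<close>.\<close>
      define l' where "l' = (if l = 0 then k else l)"
      have l': "l' < j" "l' \<noteq> 0" "0 < j" using that by (auto simp: l'_def)
      have "S (2 * k) (2 * l + 1) = S 0 (2 * l' + 1)"
        using S_block[of k 0 "2 * k" "2 * l + 1"] that
        by (auto simp: block_swap_apply l'_def Transposition.transpose_def)
      also have "\<dots> = S 0 (2 * (j - 1) + 1)"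
        using S_block[of l' "j - 1" 0 "2 * l' + 1"] l' by (simp add: block_swap_apply Transposition.transpose_def)
      also have "2 * (j - 1) + 1 = n - 1" using n l' by auto
      finally show ?thesis .
    qed
    have 2: "S a (2 * l + 1) = S 0 (n - 1)" if "a < n" "l < j" "a div 2 \<noteq> l" for a l
    proof (cases "even a")
      case True
      then obtain k where "a = 2 * k" by blast
      then show ?thesis using 1[of k l] that n by simp
    next
      case False
      then obtain k where a: "a = 2 * k + 1" by (elim oddE)
      then have k: "k < j" "k \<noteq> l" using that n by auto
      have "S a (2 * l + 1) = S (2 * k) (2 * l + 1)"
        using S_pair[OF k(1), of a "2 * l + 1"] k(2) by (simp add: a pair_swap_def Transposition.transpose_def) presburger?
      then show ?thesis using 1 k that(2) by simp
    qed
    show ?thesis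
    proof (cases "even b")
      case False
      then obtain l where "b = 2 * l + 1" by (elim oddE)
      then show ?thesis using 2[of a l] ab n by simp
    next
      case True
      then obtain l where b: "b = 2 * l" by blast
      then have l: "l < j" "a div 2 \<noteq> l" using ab n by auto
      have "pair_swap l a = a" using l(2) by (auto simp: pair_swap_def Transposition.transpose_def)
      then have "S a b = S a (2 * l + 1)"
        using S_pair[OF l(1), of a b] by (simp add: b pair_swap_def)
      then show ?thesis using 2 ab(1) l by simp
    qed
  qed
  define A where "A = (SIGMA a:{..<n}. {..<n} - {a})"
  \<comment> \<open>Every permutation is filed under the two positions at which it takes the values
    0 and \<open>n - 1\<close>.\<close>
  have "sum g {\<pi>. \<pi> permutes {..<n}} =
      (\<Sum>ab\<in>A. sum g {\<pi> \<in> {\<pi>. \<pi> permutes {..<n}}. (inv_into UNIV \<pi> 0, inv_into UNIV \<pi> (n - 1)) = ab})"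
  proof (rule sum.group[symmetric, OF fin])
    show "(\<lambda>\<pi>. (inv_into UNIV \<pi> 0, inv_into UNIV \<pi> (n - 1))) ` {\<pi>. \<pi> permutes {..<n}} \<subseteq> A"
    proof clarify
      fix \<pi> assume \<pi>: "\<pi> permutes {..<n}"
      have i: "inv_into UNIV \<pi> permutes {..<n}" by (rule permutes_inv[OF \<pi>])
      have "inv_into UNIV \<pi> x < n" if "x < n" for x using permutes_in_image[OF i, of x] that by simp
      moreover have "inv_into UNIV \<pi> (n - 1) \<noteq> inv_into UNIV \<pi> 0"
        using permutes_inj[OF i] n by (auto simp: inj_eq)
      ultimately show "(inv_into UNIV \<pi> 0, inv_into UNIV \<pi> (n - 1)) \<in> A" using n by (auto simp: A_def)
    qed
  qed (simp add: A_def)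
  also have "\<dots> = (\<Sum>(a, b)\<in>A. S a b)"
  proof (rule sum.cong[OF refl], clarify)
    fix a b
    have "{\<pi> \<in> {\<pi>. \<pi> permutes {..<n}}. (inv_into UNIV \<pi> 0, inv_into UNIV \<pi> (n - 1)) = (a, b)} = P a b"
    proof (rule Set.set_eqI)
      fix \<pi>
      show "\<pi> \<in> {\<pi> \<in> {\<pi>. \<pi> permutes {..<n}}. (inv_into UNIV \<pi> 0, inv_into UNIV \<pi> (n - 1)) = (a, b)} \<longleftrightarrow> \<pi> \<in> P a b"
        using permutes_inv_eq[of \<pi> "{..<n}"] by (cases "\<pi> permutes {..<n}") (simp_all add: P_def)
    qed
    then show "sum g {\<pi> \<in> {\<pi>. \<pi> permutes {..<n}}. (inv_into UNIV \<pi> 0, inv_into UNIV \<pi> (n - 1)) = (a, b)} = S a b"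
      by (simp add: S_def)
  qed
  also have "\<dots> = (\<Sum>a<n. \<Sum>b\<in>{..<n} - {a}. S a b)"
    unfolding A_def by (rule sum.Sigma[symmetric]) auto
  also have "\<dots> = (\<Sum>a<n. S p (n - 1) + of_nat p * S 0 (n - 1))"
  proof (rule sum.cong[OF refl])
    fix a assume "a \<in> {..<n}"
    then have a: "a < n" by simp
    define a' where "a' = (if even a then a + 1 else a - 1)"
    define q where "q = a div 2"
    have "a = 2 * q \<or> a = 2 * q + 1" unfolding div_2_eq_iff[symmetric] by (simp add: q_def)
    then have "(a = 2 * q \<and> a' = 2 * q + 1) \<or> (a = 2 * q + 1 \<and> a' = 2 * q)" by (auto simp: a'_def)
    moreover have "q < j" using a n(2) by (auto simp: q_def)
    ultimately have a': "a' < n" "a' \<noteq> a" "a' div 2 = a div 2" and iff: "b div 2 = a div 2 \<longleftrightarrow> b = a \<or> b = a'" for b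
      using n(2) unfolding div_2_eq_iff[of b] by auto
    have "{..<n} - {a} = insert a' ({..<n} - {a, a'})" using a' by auto
    then have "(\<Sum>b\<in>{..<n} - {a}. S a b) = S a a' + (\<Sum>b\<in>{..<n} - {a, a'}. S a b)" by simp
    also have "(\<Sum>b\<in>{..<n} - {a, a'}. S a b) = (\<Sum>b\<in>{..<n} - {a, a'}. S 0 (n - 1))"
    proof (rule sum.cong[OF refl])
      fix b assume "b \<in> {..<n} - {a, a'}"
      then show "S a b = S 0 (n - 1)" using iff[of b] by (intro diff a) auto
    qed
    also have "\<dots> = of_nat p * S 0 (n - 1)" using a a' n by (simp add: card_Diff_subset)
    also have "S a a' = S p (n - 1)" using a a' by (intro same) auto
    finally show "(\<Sum>b\<in>{..<n} - {a}. S a b) = S p (n - 1) + of_nat p * S 0 (n - 1)" .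
  qed
  \<comment> \<open>There are \<open>n = 2 * j\<close> choices of \<open>a\<close>, each with one
    partner in its own pair and \<open>p = 2 * (j - 1)\<close> positions in other pairs.\<close>
  also have "\<dots> = 2 * of_nat j * S p (n - 1) + 4 * of_nat j * of_nat (j - 1) * S 0 (n - 1)"
  proof -
    have "p = 2 * (j - 1)" using n by auto
    then have "complex_of_nat p = 2 * of_nat (j - 1)" by simp
    then show ?thesis by (simp add: n_def algebra_simps del: of_nat_diff)
  qed
  finally have total: "sum g {\<pi>. \<pi> permutes {..<n}} =
      2 * of_nat j * S p (n - 1) + 4 * of_nat j * of_nat (j - 1) * S 0 (n - 1)" .
  have n1: "n - 1 = Suc p" using n by simp
  have S0: "S 0 (n - 1) = (\<Sum>\<pi> | \<pi> permutes {..<p}. of_int (sign \<pi>) * G (lift_perm p \<pi>))"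
  proof -
    have "S 0 (n - 1) = (\<Sum>\<pi>\<in>{\<pi>. \<pi> permutes {..<p}}. g (lift_perm p \<pi>))"
      unfolding S_def P_def n1 unfolding n(1)
      by (rule sum.reindex_bij_betw[OF lift_perm_bij, symmetric])
    then show ?thesis by (simp add: g_def sign_lift_perm)
  qed
  have rp: "rotation p permutes {..<n}"
    by (rule permutes_subset[OF rotation_permutes]) (auto simp: n)
  \<comment> \<open>Composition with the rotation moves the position of the value 0 from 0 to
    \<open>p\<close>; its sign is 1 because \<open>p\<close> is even.\<close>
  have Sp: "S p (n - 1) = (\<Sum>\<pi> | \<pi> permutes {..<p}. of_int (sign \<pi>) * G (lift_perm p \<pi> \<circ> rotation p))"
  proof -
    have r: "rotation p p = 0" "rotation p (Suc p) = Suc p" by (auto simp: rotation_def)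
    have "S p (n - 1) = (\<Sum>\<pi>\<in>P 0 (n - 1). g (\<pi> \<circ> rotation p))"
      unfolding S_def
    proof (rule sum.reindex_bij_witness[where i = "\<lambda>\<pi>. \<pi> \<circ> rotation p" and j = "\<lambda>\<pi>. \<pi> \<circ> inv_into UNIV (rotation p)"])
      have i: "inv_into UNIV (rotation p) 0 = p" "inv_into UNIV (rotation p) (Suc p) = Suc p"
        using r permutes_inv_eq[OF rp] by auto
      show "\<pi> \<circ> inv_into UNIV (rotation p) \<in> P 0 (n - 1)" if "\<pi> \<in> P p (n - 1)" for \<pi>
        using that i n1 by (auto simp: P_def intro!: permutes_compose permutes_inv rp)
      show "\<pi> \<circ> rotation p \<in> P p (n - 1)" if "\<pi> \<in> P 0 (n - 1)" for \<pi>
        using that r n1 by (auto simp: P_def intro!: permutes_compose rp)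
    qed (use permutes_inv_o[OF rp] in \<open>auto simp: o_assoc[symmetric]\<close>)
    also have "\<dots> = (\<Sum>\<pi>\<in>{\<pi>. \<pi> permutes {..<p}}. g (lift_perm p \<pi> \<circ> rotation p))"
      unfolding P_def n1 unfolding n(1)
      by (rule sum.reindex_bij_betw[OF lift_perm_bij, symmetric])
    also have "\<dots> = (\<Sum>\<pi> | \<pi> permutes {..<p}. of_int (sign \<pi>) * G (lift_perm p \<pi> \<circ> rotation p))"
    proof (rule sum.cong[OF refl])
      fix \<pi> assume "\<pi> \<in> {\<pi>. \<pi> permutes {..<p}}"
      then have \<pi>: "\<pi> permutes {..<p}" by simp
      have "lift_perm p \<pi> permutes {..<n}" using bij_betwE[OF lift_perm_bij] \<pi> n by blast
      moreover have "even p" using n by presburger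
      ultimately show "g (lift_perm p \<pi> \<circ> rotation p) = of_int (sign \<pi>) * G (lift_perm p \<pi> \<circ> rotation p)"
        using perm rp \<pi> by (simp add: g_def sign_compose sign_lift_perm sign_rotation)
    qed
    finally show ?thesis .
  qed
  show ?thesis using total unfolding S0 Sp g_def n_def[symmetric] by simp
qed

section \<open>Traces of products of matrices\<close>

type_synonym cmatrix = "nat \<Rightarrow> nat \<Rightarrow> complex"

fun mat_prod :: "nat \<Rightarrow> cmatrix list \<Rightarrow> cmatrix" where
  "mat_prod n [] i k = (if i = k then 1 else 0)"
| "mat_prod n (A # As) i k = (\<Sum>l<n. A i l * mat_prod n As l k)"

definition mat_trace :: "nat \<Rightarrow> cmatrix list \<Rightarrow> complex" where
  "mat_trace n As = (\<Sum>i<n. mat_prod n As i i)"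

text \<open>Matrices are functions on all pairs of naturals, but those of endomorphisms are known
  only below the rank; products do not look further.\<close>

lemma mat_prod_cong:
  "length As = length Bs \<Longrightarrow> (\<And>q i k. q < length As \<Longrightarrow> i < n \<Longrightarrow> k < n \<Longrightarrow> (As ! q) i k = (Bs ! q) i k) \<Longrightarrow>
    i < n \<Longrightarrow> k < n \<Longrightarrow> mat_prod n As i k = mat_prod n Bs i k"
proof (induction As Bs arbitrary: i rule: list_induct2)
  case (Cons A As B Bs)
  have "A i l * mat_prod n As l k = B i l * mat_prod n Bs l k" if "l < n" for l
    using Cons.IH[of l] Cons.prems(1)[of 0 i l] Cons.prems(1)[of "Suc _"] Cons.prems(2,3) that by fastforce
  then show ?case by simp
qed simp

lemma mat_trace_cong:
  "length As = length Bs \<Longrightarrow> (\<And>q i k. q < length As \<Longrightarrow> i < n \<Longrightarrow> k < n \<Longrightarrow> (As ! q) i k = (Bs ! q) i k) \<Longrightarrow>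
    mat_trace n As = mat_trace n Bs"
  unfolding mat_trace_def by (intro sum.cong refl mat_prod_cong) auto

lemma mat_prod_update_neg:
  "q < length As \<Longrightarrow> mat_prod n (As[q := (\<lambda>i k. - (As ! q) i k)]) i k = - mat_prod n As i k"
proof (induction As arbitrary: q i)
  case (Cons A As)
  then show ?case by (cases q) (auto simp: sum_negf)
qed simp

lemma mat_trace_update_neg:
  "q < length As \<Longrightarrow> mat_trace n (As[q := (\<lambda>i k. - (As ! q) i k)]) = - mat_trace n As"
  by (simp add: mat_trace_def mat_prod_update_neg sum_negf)

text \<open>A transposition of two factors moves their positions by a \<open>block_swap\<close>,
  which is even. By induction over transpositions every \<sigma> induces an even permutation of the
  \<open>2 * j\<close> positions, and the alternating sum is merely reindexed.\<close>

lemma sum_permutations_blocks: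
  fixes H :: "(nat \<Rightarrow> nat) \<Rightarrow> complex"
  assumes "\<sigma> permutes {..<j}"
  shows "(\<Sum>\<pi> | \<pi> permutes {..<2 * j}. of_int (sign \<pi>) * H (\<pi> \<circ> (\<lambda>i. 2 * \<sigma> (i div 2) + i mod 2))) =
    (\<Sum>\<pi> | \<pi> permutes {..<2 * j}. of_int (sign \<pi>) * H \<pi>)"
proof -
  define B where "B \<sigma> i = 2 * \<sigma> (i div 2) + i mod 2" for \<sigma> :: "nat \<Rightarrow> nat" and i
  have perm: "permutation \<pi>" if "\<pi> permutes {..<2 * j}" for \<pi>
    using that permutation_permutes by blast
  have B: "B \<sigma> permutes {..<2 * j} \<and> sign (B \<sigma>) = 1"
    using assms finite_lessThan[of j]
  proof (induction \<sigma> rule: permutes_induct)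
    case id
    have "B id = id" by (auto simp: B_def fun_eq_iff)
    then show ?case by (metis permutes_id sign_id)
  next
    case (swap a b \<sigma>)
    have IH: "B \<sigma> permutes {..<2 * j} \<and> sign (B \<sigma>) = 1" by fact
    have *: "B (Transposition.transpose a b \<circ> \<sigma>) = block_swap a b \<circ> B \<sigma>"
      by (auto simp: B_def fun_eq_iff block_swap_apply)
    have p: "block_swap a b permutes {..<2 * j}" using swap by (intro block_swap_permutes) auto
    have "permutation (B \<sigma>)" "permutation (block_swap a b)"
      using p IH by (auto intro: perm)
    then have "sign (block_swap a b \<circ> B \<sigma>) = 1"
      using IH by (subst sign_compose) (auto simp: sign_block_swap)
    moreover have "block_swap a b \<circ> B \<sigma> permutes {..<2 * j}"
      using IH p by (intro permutes_compose) auto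
    ultimately show ?case unfolding * by (rule conjI[rotated])
  qed
  have "(\<Sum>\<pi> | \<pi> permutes {..<2 * j}. of_int (sign \<pi>) * H \<pi>) =
      (\<Sum>\<pi> | \<pi> permutes {..<2 * j}. of_int (sign (\<pi> \<circ> B \<sigma>)) * H (\<pi> \<circ> B \<sigma>))"
    by (rule sum_permutations_compose_right) (use B in blast)
  also have "\<dots> = (\<Sum>\<pi> | \<pi> permutes {..<2 * j}. of_int (sign \<pi>) * H (\<pi> \<circ> B \<sigma>))"
  proof (rule sum.cong[OF refl])
    fix \<pi> assume "\<pi> \<in> {\<pi>. \<pi> permutes {..<2 * j}}"
    then have "permutation \<pi>" "permutation (B \<sigma>)" using B by (auto intro: perm)
    then show "of_int (sign (\<pi> \<circ> B \<sigma>)) * H (\<pi> \<circ> B \<sigma>) = of_int (sign \<pi>) * H (\<pi> \<circ> B \<sigma>)"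
      using B by (simp add: sign_compose)
  qed
  finally show ?thesis by (simp add: B_def[abs_def])
qed

text \<open>A trace of a product is only cyclically invariant, so the summand is first summed over
  all orders of the factors, at the price of \<open>fact j\<close>. The symmetrised summand is
  invariant under \<open>block_swap\<close>, and \<open>alternating_pair_sum\<close> applies.
  \<open>F a b\<close> stands for the curvature matrix in the directions of the fields with indices
  \<open>a\<close> and \<open>b\<close>.\<close>

lemma alternating_trace_sum:
  fixes F :: "nat \<Rightarrow> nat \<Rightarrow> cmatrix"
  assumes j: "p + 2 = 2 * j"
    and F: "\<And>a b. a < p + 2 \<Longrightarrow> b < p + 2 \<Longrightarrow> a \<noteq> b \<Longrightarrow> F b a = (\<lambda>i k. - F a b i k)"
  shows "fact j * (\<Sum>\<pi> | \<pi> permutes {..<p + 2}. of_int (sign \<pi>) *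
      mat_trace n (map (\<lambda>k. F (\<pi> (2 * k)) (\<pi> (2 * k + 1))) [0..<j])) =
    4 * of_nat j * of_nat (j - 1) * (\<Sum>\<pi> | \<pi> permutes {..<p}. of_int (sign \<pi>) * (\<Sum>\<sigma> | \<sigma> permutes {..<j}.
      mat_trace n (map (\<lambda>i. (F 0 (Suc (\<pi> 0)) #
        map (\<lambda>k. F (Suc (\<pi> (2 * k + 1))) (Suc (\<pi> (2 * k + 2)))) [0..<j - 2] @
        [F (Suc (\<pi> (p - 1))) (Suc p)]) ! \<sigma> i) [0..<j]))) +
    2 * of_nat j * (\<Sum>\<pi> | \<pi> permutes {..<p}. of_int (sign \<pi>) * (\<Sum>\<sigma> | \<sigma> permutes {..<j}.
      mat_trace n (map (\<lambda>i. (map (\<lambda>k. F (Suc (\<pi> (2 * k))) (Suc (\<pi> (2 * k + 1)))) [0..<j - 1] @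
        [F 0 (Suc p)]) ! \<sigma> i) [0..<j])))"
proof -
  define H where "H \<pi> = mat_trace n (map (\<lambda>k. F (\<pi> (2 * k)) (\<pi> (2 * k + 1))) [0..<j])" for \<pi>
  define G where "G \<pi> = (\<Sum>\<sigma> | \<sigma> permutes {..<j}. mat_trace n
    (map (\<lambda>i. F (\<pi> (2 * \<sigma> i)) (\<pi> (2 * \<sigma> i + 1))) [0..<j]))" for \<pi>
  have HG: "H (\<pi> \<circ> (\<lambda>i. 2 * \<sigma> (i div 2) + i mod 2)) =
      mat_trace n (map (\<lambda>i. F (\<pi> (2 * \<sigma> i)) (\<pi> (2 * \<sigma> i + 1))) [0..<j])" for \<pi> \<sigma>
    by (simp add: H_def)
  have "fact j * (\<Sum>\<pi> | \<pi> permutes {..<2 * j}. of_int (sign \<pi>) * H \<pi>) =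
      (\<Sum>\<sigma> | \<sigma> permutes {..<j}. \<Sum>\<pi> | \<pi> permutes {..<2 * j}. of_int (sign \<pi>) * H \<pi>)"
    by (simp add: card_permutations)
  also have "\<dots> = (\<Sum>\<sigma> | \<sigma> permutes {..<j}. \<Sum>\<pi> | \<pi> permutes {..<2 * j}. of_int (sign \<pi>) *
      H (\<pi> \<circ> (\<lambda>i. 2 * \<sigma> (i div 2) + i mod 2)))"
    by (rule sum.cong[OF refl]) (simp add: sum_permutations_blocks)
  also have "\<dots> = (\<Sum>\<pi> | \<pi> permutes {..<2 * j}. of_int (sign \<pi>) * G \<pi>)"
    unfolding HG G_def sum_distrib_left by (rule sum.swap)
  also have "\<dots> = 4 * of_nat j * of_nat (j - 1) * (\<Sum>\<pi> | \<pi> permutes {..<p}. of_int (sign \<pi>) * G (lift_perm p \<pi>)) +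
      2 * of_nat j * (\<Sum>\<pi> | \<pi> permutes {..<p}. of_int (sign \<pi>) * G (lift_perm p \<pi> \<circ> rotation p))"
  proof (rule alternating_pair_sum[OF j])
    fix \<pi> and k assume \<pi>: "\<pi> permutes {..<2 * j}" and k: "k < j"
    have "mat_trace n (map (\<lambda>i. F ((\<pi> \<circ> pair_swap k) (2 * \<sigma> i)) ((\<pi> \<circ> pair_swap k) (2 * \<sigma> i + 1))) [0..<j]) =
        - mat_trace n (map (\<lambda>i. F (\<pi> (2 * \<sigma> i)) (\<pi> (2 * \<sigma> i + 1))) [0..<j])"
      if \<sigma>: "\<sigma> permutes {..<j}" for \<sigma>
    proof -
      \<comment> \<open>The swapped arguments occur in exactly one factor of the product, at
        position \<open>q\<close>, and only that matrix changes sign.\<close>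
      define q where "q = inv_into UNIV \<sigma> k"
      define L where "L = map (\<lambda>i. F (\<pi> (2 * \<sigma> i)) (\<pi> (2 * \<sigma> i + 1))) [0..<j]"
      have q: "q < j" "\<sigma> q = k"
        using permutes_in_image[OF permutes_inv[OF \<sigma>], of k] k permutes_inverses[OF \<sigma>] by (auto simp: q_def)
      have **: "map (\<lambda>i. F ((\<pi> \<circ> pair_swap k) (2 * \<sigma> i)) ((\<pi> \<circ> pair_swap k) (2 * \<sigma> i + 1))) [0..<j] =
          L[q := (\<lambda>i k. - (L ! q) i k)]"
      proof (rule nth_equalityI)
        fix i assume "i < length (map (\<lambda>i. F ((\<pi> \<circ> pair_swap k) (2 * \<sigma> i)) ((\<pi> \<circ> pair_swap k) (2 * \<sigma> i + 1))) [0..<j])"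
        then have i: "i < j" by simp
        show "map (\<lambda>i. F ((\<pi> \<circ> pair_swap k) (2 * \<sigma> i)) ((\<pi> \<circ> pair_swap k) (2 * \<sigma> i + 1))) [0..<j] ! i =
            L[q := (\<lambda>i k. - (L ! q) i k)] ! i"
        proof (cases "i = q")
          case True
          have lt: "\<pi> (2 * k) < p + 2" "\<pi> (2 * k + 1) < p + 2"
            using permutes_in_image[OF \<pi>, of "2 * k"] permutes_in_image[OF \<pi>, of "2 * k + 1"] k j by auto
          have "\<pi> (2 * k) \<noteq> \<pi> (2 * k + 1)" by (simp add: inj_eq[OF permutes_inj[OF \<pi>]])
          from F[OF lt this] show ?thesis using True q by (simp add: L_def pair_swap_def)
        next
          case False
          then have "\<sigma> i \<noteq> k" using q(2) inj_eq[OF permutes_inj[OF \<sigma>], of i q] by simp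
          moreover have "2 * \<sigma> i \<noteq> 2 * k + 1" "2 * \<sigma> i + 1 \<noteq> 2 * k" by presburger+
          ultimately have "pair_swap k (2 * \<sigma> i) = 2 * \<sigma> i" "pair_swap k (2 * \<sigma> i + 1) = 2 * \<sigma> i + 1"
            by (auto simp: pair_swap_def Transposition.transpose_def)
          then show ?thesis using False i by (simp add: L_def)
        qed
      qed (simp add: L_def)
      then show ?thesis using mat_trace_update_neg[of q L n] q(1) by (simp add: L_def)
    qed
    then show "G (\<pi> \<circ> pair_swap k) = - G \<pi>"
      unfolding G_def sum_negf[symmetric] by (intro sum.cong refl) blast
  next
    fix \<pi> and k l assume "\<pi> permutes {..<2 * j}" and kl: "k < j" "l < j"
    have t: "Transposition.transpose k l permutes {..<j}" using kl by (intro permutes_swap_id) auto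
    have "G (\<pi> \<circ> block_swap k l) = (\<Sum>\<sigma> | \<sigma> permutes {..<j}. mat_trace n
        (map (\<lambda>i. F (\<pi> (2 * (Transposition.transpose k l \<circ> \<sigma>) i)) (\<pi> (2 * (Transposition.transpose k l \<circ> \<sigma>) i + 1))) [0..<j]))"
      by (simp add: G_def block_swap_apply)
    also have "\<dots> = G \<pi>"
      unfolding G_def
      by (rule sum.reindex_bij_witness[where i = "\<lambda>\<sigma>. Transposition.transpose k l \<circ> \<sigma>" and j = "\<lambda>\<sigma>. Transposition.transpose k l \<circ> \<sigma>"])
         (auto simp: fun_eq_iff intro!: permutes_compose t)
    finally show "G (\<pi> \<circ> block_swap k l) = G \<pi>" .
  qed
  finally have total: "fact j * (\<Sum>\<pi> | \<pi> permutes {..<2 * j}. of_int (sign \<pi>) * H \<pi>) =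
      4 * of_nat j * of_nat (j - 1) * (\<Sum>\<pi> | \<pi> permutes {..<p}. of_int (sign \<pi>) * G (lift_perm p \<pi>)) +
      2 * of_nat j * (\<Sum>\<pi> | \<pi> permutes {..<p}. of_int (sign \<pi>) * G (lift_perm p \<pi> \<circ> rotation p))" .
  \<comment> \<open>The factor \<open>j - 1\<close> stays on both sides: for \<open>j = 1\<close>
    there is a single pair, which the list with separate first and last factors does not
    describe.\<close>
  have S1: "of_nat (j - 1) * (\<Sum>\<pi> | \<pi> permutes {..<p}. of_int (sign \<pi>) * G (lift_perm p \<pi>)) =
      of_nat (j - 1) * (\<Sum>\<pi> | \<pi> permutes {..<p}. of_int (sign \<pi>) * (\<Sum>\<sigma> | \<sigma> permutes {..<j}.
      mat_trace n (map (\<lambda>i. (F 0 (Suc (\<pi> 0)) #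
        map (\<lambda>k. F (Suc (\<pi> (2 * k + 1))) (Suc (\<pi> (2 * k + 2)))) [0..<j - 2] @
        [F (Suc (\<pi> (p - 1))) (Suc p)]) ! \<sigma> i) [0..<j])))"
  proof (cases "j \<ge> 2")
    case True
    have *: "F (lift_perm p \<pi> (2 * i)) (lift_perm p \<pi> (2 * i + 1)) = (F 0 (Suc (\<pi> 0)) #
        map (\<lambda>k. F (Suc (\<pi> (2 * k + 1))) (Suc (\<pi> (2 * k + 2)))) [0..<j - 2] @
        [F (Suc (\<pi> (p - 1))) (Suc p)]) ! i" if \<pi>: "\<pi> permutes {..<p}" and i: "i < j" for \<pi> i
    proof -
      consider "i = 0" | i' where "i = Suc i'" "i' < j - 2" | "i = Suc (j - 2)"
        using i True by (cases i) force+
      then show ?thesis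
      proof cases
        case 1
        then show ?thesis using lift_perm_apply(1)[OF \<pi>] lift_perm_apply(2)[OF \<pi>, of 0] j True by simp
      next
        case 2
        then show ?thesis using lift_perm_apply(2)[OF \<pi>, of "2 * i' + 1"] lift_perm_apply(2)[OF \<pi>, of "2 * i' + 2"] j
          by (simp add: nth_append)
      next
        case 3
        have "2 * i = Suc (p - 1)" "2 * i + 1 = Suc p" using 3 j True by auto
        then show ?thesis using lift_perm_apply(2)[OF \<pi>, of "p - 1"] lift_perm_apply(3)[OF \<pi>] j True 3
          by (simp add: nth_append)
      qed
    qed
    have **: "map (\<lambda>i. F (lift_perm p \<pi> (2 * \<sigma> i)) (lift_perm p \<pi> (2 * \<sigma> i + 1))) [0..<j] =
        map (\<lambda>i. (F 0 (Suc (\<pi> 0)) #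
        map (\<lambda>k. F (Suc (\<pi> (2 * k + 1))) (Suc (\<pi> (2 * k + 2)))) [0..<j - 2] @
        [F (Suc (\<pi> (p - 1))) (Suc p)]) ! \<sigma> i) [0..<j]"
      if "\<pi> permutes {..<p}" "\<sigma> permutes {..<j}" for \<pi> \<sigma>
    proof (rule map_cong[OF refl])
      fix i assume "i \<in> set [0..<j]"
      then have "\<sigma> i < j" using permutes_in_image[OF that(2), of i] by simp
      then show "F (lift_perm p \<pi> (2 * \<sigma> i)) (lift_perm p \<pi> (2 * \<sigma> i + 1)) = (F 0 (Suc (\<pi> 0)) #
        map (\<lambda>k. F (Suc (\<pi> (2 * k + 1))) (Suc (\<pi> (2 * k + 2)))) [0..<j - 2] @
        [F (Suc (\<pi> (p - 1))) (Suc p)]) ! \<sigma> i" by (rule *[OF that(1)])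
    qed
    have ***: "G (lift_perm p \<pi>) = (\<Sum>\<sigma> | \<sigma> permutes {..<j}. mat_trace n (map (\<lambda>i. (F 0 (Suc (\<pi> 0)) #
        map (\<lambda>k. F (Suc (\<pi> (2 * k + 1))) (Suc (\<pi> (2 * k + 2)))) [0..<j - 2] @
        [F (Suc (\<pi> (p - 1))) (Suc p)]) ! \<sigma> i) [0..<j]))"
      if "\<pi> permutes {..<p}" for \<pi>
      unfolding G_def by (rule sum.cong[OF refl], rule arg_cong[of _ _ "mat_trace n"], rule **) (use that in simp_all)
    show ?thesis
      by (rule arg_cong[of _ _ "(*) _"], rule sum.cong[OF refl]) (simp only: mem_Collect_eq ***)
  qed (use j in \<open>auto simp: not_le less_2_cases_iff\<close>)
  have S2: "(\<Sum>\<pi> | \<pi> permutes {..<p}. of_int (sign \<pi>) * G (lift_perm p \<pi> \<circ> rotation p)) =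
      (\<Sum>\<pi> | \<pi> permutes {..<p}. of_int (sign \<pi>) * (\<Sum>\<sigma> | \<sigma> permutes {..<j}.
      mat_trace n (map (\<lambda>i. (map (\<lambda>k. F (Suc (\<pi> (2 * k))) (Suc (\<pi> (2 * k + 1)))) [0..<j - 1] @
        [F 0 (Suc p)]) ! \<sigma> i) [0..<j])))"
  proof -
    have *: "F ((lift_perm p \<pi> \<circ> rotation p) (2 * i)) ((lift_perm p \<pi> \<circ> rotation p) (2 * i + 1)) =
        (map (\<lambda>k. F (Suc (\<pi> (2 * k))) (Suc (\<pi> (2 * k + 1)))) [0..<j - 1] @
        [F 0 (Suc p)]) ! i" if \<pi>: "\<pi> permutes {..<p}" and i: "i < j" for \<pi> i
    proof (cases "i < j - 1")
      case True
      then have lt: "2 * i < p" "2 * i + 1 < p" using j by auto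
      show ?thesis using lift_perm_apply(2)[OF \<pi> lt(1)] lift_perm_apply(2)[OF \<pi> lt(2)] lt True
        by (simp add: nth_append rotation_def)
    next
      case False
      then have "2 * i = p" "i = j - 1" using i j by auto
      then show ?thesis using lift_perm_apply(1,3)[OF \<pi>] by (simp add: nth_append rotation_def)
    qed
    have **: "map (\<lambda>i. F ((lift_perm p \<pi> \<circ> rotation p) (2 * \<sigma> i)) ((lift_perm p \<pi> \<circ> rotation p) (2 * \<sigma> i + 1))) [0..<j] =
        map (\<lambda>i. (map (\<lambda>k. F (Suc (\<pi> (2 * k))) (Suc (\<pi> (2 * k + 1)))) [0..<j - 1] @
        [F 0 (Suc p)]) ! \<sigma> i) [0..<j]"
      if "\<pi> permutes {..<p}" "\<sigma> permutes {..<j}" for \<pi> \<sigma>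
    proof (rule map_cong[OF refl])
      fix i assume "i \<in> set [0..<j]"
      then have "\<sigma> i < j" using permutes_in_image[OF that(2), of i] by simp
      then show "F ((lift_perm p \<pi> \<circ> rotation p) (2 * \<sigma> i)) ((lift_perm p \<pi> \<circ> rotation p) (2 * \<sigma> i + 1)) =
        (map (\<lambda>k. F (Suc (\<pi> (2 * k))) (Suc (\<pi> (2 * k + 1)))) [0..<j - 1] @
        [F 0 (Suc p)]) ! \<sigma> i" by (rule *[OF that(1)])
    qed
    have ***: "G (lift_perm p \<pi> \<circ> rotation p) = (\<Sum>\<sigma> | \<sigma> permutes {..<j}. mat_trace n (map (\<lambda>i. (map (\<lambda>k. F (Suc (\<pi> (2 * k))) (Suc (\<pi> (2 * k + 1)))) [0..<j - 1] @
        [F 0 (Suc p)]) ! \<sigma> i) [0..<j]))"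
      if "\<pi> permutes {..<p}" for \<pi>
      unfolding G_def by (rule sum.cong[OF refl], rule arg_cong[of _ _ "mat_trace n"], rule **) (use that in simp_all)
    show ?thesis
      by (rule sum.cong[OF refl]) (simp only: mem_Collect_eq ***)
  qed
  show ?thesis using total unfolding mult.assoc S1 S2 H_def j .
qed

section \<open>Traces of endomorphisms of free modules\<close>

text \<open>Traces occur over the complex numbers, for the caloron fibres, and over loops evaluated
  at an angle, for the fibres of the \<Omega> bundle. A homomorphism to the complex numbers treats
  both at once.\<close>

locale evaluation =
  fixes R :: "('r, 'x) ring_scheme" (structure) and ev :: "'r \<Rightarrow> complex"
  assumes cring: "cring R"
    and ev_add: "a \<in> carrier R \<Longrightarrow> b \<in> carrier R \<Longrightarrow> ev (a \<oplus> b) = ev a + ev b"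
    and ev_mult: "a \<in> carrier R \<Longrightarrow> b \<in> carrier R \<Longrightarrow> ev (a \<otimes> b) = ev a * ev b"
    and ev_zero: "ev \<zero> = 0" and ev_one: "ev \<one> = 1"
begin

interpretation cring R by (rule cring)

lemma ev_finsum:
  fixes n :: nat
  assumes "\<And>i. i < n \<Longrightarrow> f i \<in> carrier R"
  shows "ev (finsum R f {..<n}) = (\<Sum>i<n. ev (f i))"
  using assms
proof (induction n)
  case (Suc n)
  have "finsum R f {..<Suc n} = f n \<oplus> finsum R f {..<n}"
    unfolding lessThan_Suc by (rule finsum_insert) (use Suc.prems in auto)
  moreover have "finsum R f {..<n} \<in> carrier R" using Suc.prems by (intro finsum_closed) auto
  ultimately show ?case using Suc by (simp add: ev_add add.commute)
qed (simp add: ev_zero)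

lemma std_basis_closed: "std_basis R n i \<in> {..<n} \<rightarrow>\<^sub>E carrier R"
  by (auto simp: std_basis_def)

lemma free_iso_inv:
  assumes "free_iso R n N \<beta>" "x \<in> {..<n} \<rightarrow>\<^sub>E carrier R"
  shows "inv_into (carrier N) \<beta> x \<in> carrier N" "\<beta> (inv_into (carrier N) \<beta> x) = x"
  using assms unfolding free_iso_def bij_betw_def by (metis inv_into_into f_inv_into_f)+

lemma ev_std_basis:
  assumes "free_iso R n N \<beta>" "k < n" "i < n"
  shows "ev (\<beta> (inv_into (carrier N) \<beta> (std_basis R n k)) i) = (if i = k then 1 else 0)"
  using assms(2,3) free_iso_inv(2)[OF assms(1) std_basis_closed[of n k]]
  by (simp add: std_basis_def ev_zero ev_one)

text \<open>A functional that is linear along \<open>ev\<close> is determined by the standard basis.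
  Besides the coordinate map the argument uses closure under the two operations of \<open>N\<close>,
  which is easily checked for quotient fibres.\<close>

lemma free_iso_functional:
  fixes N :: "('r, 'v, 'y) module_scheme"
  assumes \<beta>: "free_iso R n N \<beta>"
    and closed: "\<And>v w. v \<in> carrier N \<Longrightarrow> w \<in> carrier N \<Longrightarrow> v \<oplus>\<^bsub>N\<^esub> w \<in> carrier N"
      "\<And>r v. r \<in> carrier R \<Longrightarrow> v \<in> carrier N \<Longrightarrow> r \<odot>\<^bsub>N\<^esub> v \<in> carrier N"
    and G: "\<And>v w. v \<in> carrier N \<Longrightarrow> w \<in> carrier N \<Longrightarrow> G (v \<oplus>\<^bsub>N\<^esub> w) = G v + G w"
      "\<And>r v. r \<in> carrier R \<Longrightarrow> v \<in> carrier N \<Longrightarrow> G (r \<odot>\<^bsub>N\<^esub> v) = ev r * G v"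
    and v: "v \<in> carrier N"
  shows "G v = (\<Sum>k<n. ev (\<beta> v k) * G (inv_into (carrier N) \<beta> (std_basis R n k)))"
proof -
  define e where "e k = inv_into (carrier N) \<beta> (std_basis R n k)" for k
  \<comment> \<open>\<open>w k\<close> is \<open>v\<close> with all coordinates from
    \<open>k\<close> on replaced by zero; it grows by one basis multiple at a time and ends at
    \<open>v\<close>.\<close>
  define x where "x k = (\<lambda>i\<in>{..<n}. if i < k then \<beta> v i else \<zero>)" for k
  define w where "w k = inv_into (carrier N) \<beta> (x k)" for k
  have inj: "inj_on \<beta> (carrier N)" and \<beta>v: "\<beta> v \<in> {..<n} \<rightarrow>\<^sub>E carrier R"
    using \<beta> v by (auto simp: free_iso_def bij_betw_def)
  have \<beta>_add: "\<beta> (u \<oplus>\<^bsub>N\<^esub> u') = (\<lambda>i\<in>{..<n}. \<beta> u i \<oplus> \<beta> u' i)" if "u \<in> carrier N" "u' \<in> carrier N" for u u'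
    using \<beta> that unfolding free_iso_def by blast
  have \<beta>_smult: "\<beta> (r \<odot>\<^bsub>N\<^esub> u) = (\<lambda>i\<in>{..<n}. r \<otimes> \<beta> u i)" if "r \<in> carrier R" "u \<in> carrier N" for r u
    using \<beta> that unfolding free_iso_def by blast
  have bv: "\<beta> v k \<in> carrier R" if "k < n" for k using PiE_mem[OF \<beta>v] that by simp
  have x: "x k \<in> {..<n} \<rightarrow>\<^sub>E carrier R" for k by (simp add: x_def restrict_PiE_iff bv)
  have e: "e k \<in> carrier N" "\<beta> (e k) = std_basis R n k" for k
    unfolding e_def by (rule free_iso_inv[OF \<beta> std_basis_closed])+
  have w: "w k \<in> carrier N" "\<beta> (w k) = x k" for k
    unfolding w_def by (rule free_iso_inv[OF \<beta> x])+
  have "G (w k) = (\<Sum>i<k. ev (\<beta> v i) * G (e i))" if "k \<le> n" for k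
    using that
  proof (induction k)
    case 0
    \<comment> \<open>All coordinates of \<open>w 0\<close> are zero, so it equals its own zero
      multiple; \<open>G\<close> vanishes on it without any appeal to the zero element of
      \<open>N\<close>.\<close>
    have "\<beta> (\<zero> \<odot>\<^bsub>N\<^esub> w 0) = \<beta> (w 0)"
      unfolding \<beta>_smult[OF zero_closed w(1)] w(2) by (auto simp: x_def)
    then have "\<zero> \<odot>\<^bsub>N\<^esub> w 0 = w 0" using inj closed(2)[OF zero_closed w(1)] w(1) by (auto dest: inj_onD)
    then show ?case using G(2)[OF zero_closed w(1), of 0] by (simp add: ev_zero)
  next
    case (Suc k)
    then have k: "k < n" by simp
    have c: "\<beta> v k \<odot>\<^bsub>N\<^esub> e k \<in> carrier N" by (rule closed(2)[OF bv[OF k] e(1)])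
    have "\<beta> (w k \<oplus>\<^bsub>N\<^esub> (\<beta> v k \<odot>\<^bsub>N\<^esub> e k)) = \<beta> (w (Suc k))"
      unfolding \<beta>_add[OF w(1) c] \<beta>_smult[OF bv[OF k] e(1)] w(2) e(2)
      using bv k by (auto simp: x_def std_basis_def fun_eq_iff less_Suc_eq)
    then have "w k \<oplus>\<^bsub>N\<^esub> (\<beta> v k \<odot>\<^bsub>N\<^esub> e k) = w (Suc k)"
      by (rule inj_onD[OF inj _ closed(1)[OF w(1) c] w(1)])
    then have "G (w (Suc k)) = G (w k) + ev (\<beta> v k) * G (e k)"
      using G(1)[OF w(1) c] G(2)[OF bv[OF k] e(1)] by metis
    then show ?case using Suc by simp
  qed
  moreover have "\<beta> (w n) = \<beta> v" unfolding w(2) using \<beta>v by (auto simp: x_def fun_eq_iff PiE_def extensional_def)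
  then have "w n = v" by (rule inj_onD[OF inj _ w(1) v])
  ultimately show ?thesis by (auto simp: e_def)
qed

text \<open>Coordinates are compared after evaluation, so over loops the matrix belongs to a single
  angle and has complex entries. Operators obtained from chosen sections are accessible only through
  such coordinates.\<close>

definition represents :: "nat \<Rightarrow> ('r, 'v, 'y) module_scheme \<Rightarrow> ('v \<Rightarrow> nat \<Rightarrow> 'r) \<Rightarrow> ('v \<Rightarrow> 'v) \<Rightarrow> cmatrix \<Rightarrow> bool" where
  "represents n N \<beta> T A \<longleftrightarrow> (\<forall>v\<in>carrier N. T v \<in> carrier N \<and>
     (\<forall>i<n. ev (\<beta> (T v) i) = (\<Sum>k<n. A i k * ev (\<beta> v k))))"

text \<open>\<open>mod_trace\<close> uses an arbitrary basis, while matrices are computed in a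
  trivialisation. After evaluation the two bases are related by mutually inverse complex matrices,
  and a trace is invariant under conjugation.\<close>

lemma ev_mod_trace:
  fixes N :: "('r, 'v, 'y) module_scheme"
  assumes \<beta>0: "free_iso R n N \<beta>0"
    and closed: "\<And>v w. v \<in> carrier N \<Longrightarrow> w \<in> carrier N \<Longrightarrow> v \<oplus>\<^bsub>N\<^esub> w \<in> carrier N"
      "\<And>r v. r \<in> carrier R \<Longrightarrow> v \<in> carrier N \<Longrightarrow> r \<odot>\<^bsub>N\<^esub> v \<in> carrier N"
    and T: "represents n N \<beta>0 T A"
  shows "ev (mod_trace R n N T) = (\<Sum>i<n. A i i)"
proof -
  define \<beta> where "\<beta> = (SOME \<beta>. free_iso R n N \<beta>)"
  have \<beta>: "free_iso R n N \<beta>" unfolding \<beta>_def by (rule someI[of "free_iso R n N" \<beta>0, OF \<beta>0])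
  define e where "e k = inv_into (carrier N) \<beta> (std_basis R n k)" for k
  define f where "f k = inv_into (carrier N) \<beta>0 (std_basis R n k)" for k
  have e: "e k \<in> carrier N" for k unfolding e_def by (rule free_iso_inv(1)[OF \<beta> std_basis_closed])
  have f: "f k \<in> carrier N" for k unfolding f_def by (rule free_iso_inv(1)[OF \<beta>0 std_basis_closed])
  have c: "\<gamma> v i \<in> carrier R" if "free_iso R n N \<gamma>" "v \<in> carrier N" "i < n" for \<gamma> v i
    using that unfolding free_iso_def bij_betw_def by (blast dest: PiE_mem)
  have lin: "ev (\<gamma> v i) = (\<Sum>k<n. ev (\<gamma>' v k) * ev (\<gamma> (inv_into (carrier N) \<gamma>' (std_basis R n k)) i))"
    if \<gamma>: "free_iso R n N \<gamma>" and \<gamma>': "free_iso R n N \<gamma>'" and v: "v \<in> carrier N" and i: "i < n" for \<gamma> \<gamma>' v i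
  proof (rule free_iso_functional[OF \<gamma>' closed _ _ v, of "\<lambda>v. ev (\<gamma> v i)"])
    show "ev (\<gamma> (v \<oplus>\<^bsub>N\<^esub> w) i) = ev (\<gamma> v i) + ev (\<gamma> w i)" if "v \<in> carrier N" "w \<in> carrier N" for v w
    proof -
      have "\<gamma> (v \<oplus>\<^bsub>N\<^esub> w) = (\<lambda>i\<in>{..<n}. \<gamma> v i \<oplus> \<gamma> w i)" using \<gamma> that unfolding free_iso_def by blast
      then show ?thesis using i that by (simp add: ev_add c[OF \<gamma>])
    qed
    show "ev (\<gamma> (r \<odot>\<^bsub>N\<^esub> v) i) = ev r * ev (\<gamma> v i)" if "r \<in> carrier R" "v \<in> carrier N" for r v
    proof -
      have "\<gamma> (r \<odot>\<^bsub>N\<^esub> v) = (\<lambda>i\<in>{..<n}. r \<otimes> \<gamma> v i)" using \<gamma> that unfolding free_iso_def by blast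
      then show ?thesis using i that by (simp add: ev_mult c[OF \<gamma>])
    qed
  qed auto
  have T1: "T v \<in> carrier N" if "v \<in> carrier N" for v using T that by (simp add: represents_def)
  have T2: "ev (\<beta>0 (T v) i) = (\<Sum>k<n. A i k * ev (\<beta>0 v k))" if "v \<in> carrier N" "i < n" for v i
    using T that by (simp add: represents_def)
  have "ev (mod_trace R n N T) = (\<Sum>i<n. ev (\<beta> (T (e i)) i))"
    unfolding mod_trace_def \<beta>_def[symmetric] Let_def e_def[symmetric]
    by (rule ev_finsum) (rule c[OF \<beta> T1[OF e]])
  also have "\<dots> = (\<Sum>i<n. \<Sum>k<n. (\<Sum>l<n. A k l * ev (\<beta>0 (e i) l)) * ev (\<beta> (f k) i))"
    by (rule sum.cong[OF refl]) (simp add: lin[OF \<beta> \<beta>0 T1[OF e]] T2[OF e] f_def)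
  also have "\<dots> = (\<Sum>i<n. \<Sum>k<n. \<Sum>l<n. A k l * (ev (\<beta> (f k) i) * ev (\<beta>0 (e i) l)))"
    unfolding sum_distrib_right by (intro sum.cong refl) (simp add: mult.assoc mult.commute)
  also have "\<dots> = (\<Sum>k<n. \<Sum>i<n. \<Sum>l<n. A k l * (ev (\<beta> (f k) i) * ev (\<beta>0 (e i) l)))"
    by (rule sum.swap)
  also have "\<dots> = (\<Sum>k<n. \<Sum>l<n. A k l * (\<Sum>i<n. ev (\<beta> (f k) i) * ev (\<beta>0 (e i) l)))"
    unfolding sum_distrib_left by (rule sum.cong[OF refl], rule sum.swap)
  \<comment> \<open>The two changes of basis cancel: expanding \<open>f k\<close> in the other basis
    and reading off its coordinates in the first gives the Kronecker delta.\<close>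
  also have "\<dots> = (\<Sum>k<n. \<Sum>l<n. A k l * (if l = k then 1 else 0))"
  proof (intro sum.cong refl arg_cong[where f = "(*) _"])
    fix k l assume kl: "k \<in> {..<n}" "l \<in> {..<n}"
    have "(\<Sum>i<n. ev (\<beta> (f k) i) * ev (\<beta>0 (e i) l)) = ev (\<beta>0 (f k) l)"
      using lin[OF \<beta>0 \<beta> f, of l k] kl by (simp add: e_def)
    also have "\<dots> = (if l = k then 1 else 0)"
      unfolding f_def by (rule ev_std_basis[OF \<beta>0]) (use kl in auto)
    finally show "(\<Sum>i<n. ev (\<beta> (f k) i) * ev (\<beta>0 (e i) l)) = (if l = k then 1 else 0)" .
  qed
  also have "\<dots> = (\<Sum>i<n. A i i)" by (rule sum.cong[OF refl]) (simp add: if_distrib[of "(*) _"] cong: if_cong)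
  finally show ?thesis .
qed

lemma represents_foldr:
  assumes "list_all2 (represents n N \<beta>) Ts As"
  shows "represents n N \<beta> (foldr (\<circ>) Ts id) (mat_prod n As)"
  using assms
proof (induction Ts As)
  case Nil
  have "(\<Sum>k<n. mat_prod n [] i k * ev (\<beta> v k)) = ev (\<beta> v i)" if "i < n" for i v
    using that by (simp add: if_distrib[of "\<lambda>x. x * _"] cong: if_cong)
  then show ?case by (simp add: represents_def del: mat_prod.simps)
next
  case (Cons T Ts A As)
  have "(\<Sum>k<n. mat_prod n (A # As) i k * ev (\<beta> v k)) = ev (\<beta> (T (foldr (\<circ>) Ts id v)) i)"
    if v: "v \<in> carrier N" and i: "i < n" for v i
  proof -
    have "(\<Sum>k<n. mat_prod n (A # As) i k * ev (\<beta> v k)) = (\<Sum>k<n. \<Sum>l<n. A i l * (mat_prod n As l k * ev (\<beta> v k)))"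
      by (simp add: sum_distrib_right mult.assoc)
    also have "\<dots> = (\<Sum>l<n. A i l * (\<Sum>k<n. mat_prod n As l k * ev (\<beta> v k)))"
      unfolding sum_distrib_left by (rule sum.swap)
    also have "\<dots> = (\<Sum>l<n. A i l * ev (\<beta> (foldr (\<circ>) Ts id v) l))"
    proof (rule sum.cong[OF refl])
      fix l assume "l \<in> {..<n}"
      then have "ev (\<beta> (foldr (\<circ>) Ts id v) l) = (\<Sum>k<n. mat_prod n As l k * ev (\<beta> v k))"
        using Cons.IH v unfolding represents_def by blast
      then show "A i l * (\<Sum>k<n. mat_prod n As l k * ev (\<beta> v k)) = A i l * ev (\<beta> (foldr (\<circ>) Ts id v) l)"
        by (rule arg_cong[OF sym])
    qed
    also have "\<dots> = ev (\<beta> (T (foldr (\<circ>) Ts id v)) i)"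
      using Cons.hyps(1) Cons.IH v i unfolding represents_def by metis
    finally show ?thesis .
  qed
  moreover have "T (foldr (\<circ>) Ts id v) \<in> carrier N" if "v \<in> carrier N" for v
    using Cons.hyps(1) Cons.IH that unfolding represents_def by blast
  moreover have "foldr (\<circ>) (T # Ts) id v = T (foldr (\<circ>) Ts id v)" for v by simp
  ultimately show ?case unfolding represents_def by metis
qed

lemma ev_mod_trace_foldr:
  fixes N :: "('r, 'v, 'y) module_scheme"
  assumes "free_iso R n N \<beta>"
    and "\<And>v w. v \<in> carrier N \<Longrightarrow> w \<in> carrier N \<Longrightarrow> v \<oplus>\<^bsub>N\<^esub> w \<in> carrier N"
      "\<And>r v. r \<in> carrier R \<Longrightarrow> v \<in> carrier N \<Longrightarrow> r \<odot>\<^bsub>N\<^esub> v \<in> carrier N"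
    and "list_all2 (represents n N \<beta>) Ts As"
  shows "ev (mod_trace R n N (foldr (\<circ>) Ts id)) = mat_trace n As"
  unfolding mat_trace_def by (rule ev_mod_trace[OF assms(1-3) represents_foldr[OF assms(4)]])

end

section \<open>The two evaluations and coordinates on the quotient fibres\<close>

lemma evaluation_complex: "evaluation complex_ring id"
proof (rule evaluation.intro)
  show "cring complex_ring"
  proof (rule cringI)
    show "abelian_group complex_ring"
      by (rule abelian_groupI) (auto simp: complex_ring_def algebra_simps, metis add.right_inverse)
    show "Group.comm_monoid complex_ring"
      by (rule Group.comm_monoidI) (auto simp: complex_ring_def algebra_simps)
  qed (auto simp: complex_ring_def algebra_simps)
qed (auto simp: complex_ring_def)

lemma evaluation_loop: "cring loop_ring \<Longrightarrow> evaluation loop_ring (\<lambda>f. f \<theta>)"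
  by (rule evaluation.intro) (auto simp: loop_ring_def)

lemma omega_module_closed:
  assumes "omega_module n N fr"
  shows "cring loop_ring" "v \<in> carrier N \<Longrightarrow> w \<in> carrier N \<Longrightarrow> v \<oplus>\<^bsub>N\<^esub> w \<in> carrier N"
    "r \<in> carrier loop_ring \<Longrightarrow> v \<in> carrier N \<Longrightarrow> r \<odot>\<^bsub>N\<^esub> v \<in> carrier N"
proof -
  interpret N: Module.module loop_ring N using assms by (simp add: omega_module_def)
  show "cring loop_ring" ..
  show "v \<in> carrier N \<Longrightarrow> w \<in> carrier N \<Longrightarrow> v \<oplus>\<^bsub>N\<^esub> w \<in> carrier N"
    "r \<in> carrier loop_ring \<Longrightarrow> v \<in> carrier N \<Longrightarrow> r \<odot>\<^bsub>N\<^esub> v \<in> carrier N" by auto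
qed

text \<open>The definition quantifies over all isomorphisms. At the angle \<theta> the coordinates
  of any other isomorphism are complex combinations of those of \<beta>, so one isomorphism
  decides.\<close>

lemma vanishing_at_iff:
  assumes N: "omega_module n N fr" and \<beta>: "free_iso loop_ring n N \<beta>"
  shows "v \<in> vanishing_at n N \<theta> \<longleftrightarrow> v \<in> carrier N \<and> (\<forall>i<n. \<beta> v i \<theta> = 0)"
proof
  assume v: "v \<in> carrier N \<and> (\<forall>i<n. \<beta> v i \<theta> = 0)"
  interpret evaluation loop_ring "\<lambda>f. f \<theta>" by (rule evaluation_loop[OF omega_module_closed(1)[OF N]])
  have "\<gamma> v i \<theta> = 0" if \<gamma>: "free_iso loop_ring n N \<gamma>" and i: "i < n" for \<gamma> i
  proof -
    have "\<gamma> v i \<theta> = (\<Sum>k<n. \<beta> v k \<theta> * \<gamma> (inv_into (carrier N) \<beta> (std_basis loop_ring n k)) i \<theta>)"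
    proof (rule free_iso_functional[OF \<beta> omega_module_closed(2,3)[OF N], of "\<lambda>v. \<gamma> v i \<theta>"])
      show "\<gamma> (u \<oplus>\<^bsub>N\<^esub> w) i \<theta> = \<gamma> u i \<theta> + \<gamma> w i \<theta>" if "u \<in> carrier N" "w \<in> carrier N" for u w
        by (rule free_iso_add[OF \<gamma> that i])
      show "\<gamma> (r \<odot>\<^bsub>N\<^esub> u) i \<theta> = r \<theta> * \<gamma> u i \<theta>" if "r \<in> carrier loop_ring" "u \<in> carrier N" for r u
      proof -
        have "\<gamma> (r \<odot>\<^bsub>N\<^esub> u) = (\<lambda>i\<in>{..<n}. r \<otimes>\<^bsub>loop_ring\<^esub> \<gamma> u i)" using \<gamma> that unfolding free_iso_def by blast
        then show ?thesis using i by (simp add: loop_ring_def)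
      qed
    qed (use v in auto)
    then show ?thesis using v by simp
  qed
  then show "v \<in> vanishing_at n N \<theta>" using v by (simp add: vanishing_at_def)
qed (use \<beta> in \<open>auto simp: vanishing_at_def\<close>)

lemma eval_class_eq_iff:
  assumes E: "omega_vector_bundle M E" and m: "m \<in> points M"
    and \<beta>: "free_iso loop_ring (rank E) (fib E m) \<beta>"
    and e: "e \<in> carrier (fib E m)" "e' \<in> carrier (fib E m)"
  shows "eval_class E (m, \<theta>) e = eval_class E (m, \<theta>) e' \<longleftrightarrow> (\<forall>i<rank E. \<beta> e i \<theta> = \<beta> e' i \<theta>)"
proof -
  let ?N = "fib E m" and ?I = "vanishing_at (rank E) (fib E m) \<theta>"
  have om: "omega_module (rank E) ?N (framing E m)"
    using E m by (simp add: omega_vector_bundle_def)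
  interpret N: Module.module loop_ring ?N using om by (simp add: omega_module_def)
  interpret I: abelian_subgroup ?I ?N using om by (rule vanishing_at_subgroup)
  have "eval_class E (m, \<theta>) e = eval_class E (m, \<theta>) e' \<longleftrightarrow> e \<in> ?I +>\<^bsub>?N\<^esub> e'"
    unfolding eval_class_def prod.case
  proof
    assume eq: "?I +>\<^bsub>?N\<^esub> e = ?I +>\<^bsub>?N\<^esub> e'"
    show "e \<in> ?I +>\<^bsub>?N\<^esub> e'" unfolding eq[symmetric] by (rule I.a_rcos_self[OF e(1)])
  next
    assume "e \<in> ?I +>\<^bsub>?N\<^esub> e'"
    from I.a_repr_independence'[OF this e(2)] show "?I +>\<^bsub>?N\<^esub> e = ?I +>\<^bsub>?N\<^esub> e'" by (rule sym)
  qed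
  also have "\<dots> \<longleftrightarrow> e \<ominus>\<^bsub>?N\<^esub> e' \<in> ?I" unfolding N.M.minus_eq by (rule I.a_rcos_module[OF e(2,1)])
  also have "\<dots> \<longleftrightarrow> (\<forall>i<rank E. \<beta> e i \<theta> = \<beta> e' i \<theta>)"
  proof -
    have "e = (e \<ominus>\<^bsub>?N\<^esub> e') \<oplus>\<^bsub>?N\<^esub> e'" using e by (simp add: N.M.minus_eq N.M.a_assoc N.M.l_neg)
    then have "\<beta> e i \<theta> = \<beta> (e \<ominus>\<^bsub>?N\<^esub> e') i \<theta> + \<beta> e' i \<theta>" if "i < rank E" for i
      using free_iso_add[OF \<beta> N.M.minus_closed[OF e] e(2) that, of \<theta>] by simp
    then show ?thesis unfolding vanishing_at_iff[OF om \<beta>] using e by auto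
  qed
  finally show ?thesis .
qed

lemma caloron_carrier: "carrier (caloron_fib E (m, \<theta>)) = eval_class E (m, \<theta>) ` carrier (fib E m)"
  by (auto simp: caloron_fib_def quotient_at_def Let_def eval_class_def A_RCOSETS_def RCOSETS_def a_r_coset_def)

text \<open>The coordinates at \<theta> separate exactly the classes modulo elements vanishing
  there, so they descend to the quotient whatever representative is chosen.\<close>

lemma caloron_free_iso:
  assumes E: "omega_vector_bundle M E" and m: "m \<in> points M"
    and \<beta>: "free_iso loop_ring (rank E) (fib E m) \<beta>"
  obtains \<beta>' where "free_iso complex_ring (rank E) (caloron_fib E (m, \<theta>)) \<beta>'"
    "\<And>e i. e \<in> carrier (fib E m) \<Longrightarrow> i < rank E \<Longrightarrow> \<beta>' (eval_class E (m, \<theta>) e) i = \<beta> e i \<theta>"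
proof -
  let ?C = "carrier (fib E m)" and ?cl = "eval_class E (m, \<theta>)"
  define \<beta>' where "\<beta>' V = (\<lambda>i\<in>{..<rank E}. \<beta> (SOME e. e \<in> ?C \<and> ?cl e = V) i \<theta>)" for V
  have om: "omega_module (rank E) (fib E m) (framing E m)"
    using E m by (simp add: omega_vector_bundle_def)
  interpret N: Module.module loop_ring "fib E m" using om by (simp add: omega_module_def)
  have 1: "\<beta>' (?cl e) = (\<lambda>i\<in>{..<rank E}. \<beta> e i \<theta>)" if e: "e \<in> ?C" for e
  proof -
    define e' where "e' = (SOME e'. e' \<in> ?C \<and> ?cl e' = ?cl e)"
    have "e' \<in> ?C \<and> ?cl e' = ?cl e" unfolding e'_def by (rule someI[of _ e]) (simp add: e)
    then show ?thesis using eval_class_eq_iff[OF E m \<beta>, of e' e \<theta>] e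
      unfolding \<beta>'_def e'_def[symmetric] by auto
  qed
  have "free_iso complex_ring (rank E) (caloron_fib E (m, \<theta>)) \<beta>'"
    unfolding free_iso_def
  proof (intro conjI ballI)
    show "bij_betw \<beta>' (carrier (caloron_fib E (m, \<theta>))) ({..<rank E} \<rightarrow>\<^sub>E carrier complex_ring)"
      unfolding caloron_carrier
    proof (rule bij_betw_imageI)
      show "inj_on \<beta>' (?cl ` ?C)"
      proof (rule inj_onI)
        fix x y assume x: "x \<in> ?cl ` ?C" and y: "y \<in> ?cl ` ?C" and eq: "\<beta>' x = \<beta>' y"
        obtain e e' where e: "e \<in> ?C" "x = ?cl e" "e' \<in> ?C" "y = ?cl e'" using x y by blast
        have "\<beta> e i \<theta> = \<beta> e' i \<theta>" if "i < rank E" for i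
          using fun_cong[OF eq, of i] that unfolding e(2,4) 1[OF e(1)] 1[OF e(3)] by simp
        then show "x = y" using eval_class_eq_iff[OF E m \<beta> e(1,3)] e(2,4) by simp
      qed
      show "\<beta>' ` ?cl ` ?C = {..<rank E} \<rightarrow>\<^sub>E carrier complex_ring"
      proof (intro equalityI subsetI)
        fix x assume "x \<in> \<beta>' ` ?cl ` ?C"
        then obtain e where "e \<in> ?C" "x = \<beta>' (?cl e)" by blast
        then show "x \<in> {..<rank E} \<rightarrow>\<^sub>E carrier complex_ring"
          by (simp add: 1 restrict_PiE_iff complex_ring_def)
      next
        fix x :: "nat \<Rightarrow> complex" assume x: "x \<in> {..<rank E} \<rightarrow>\<^sub>E carrier complex_ring"
        \<comment> \<open>Constant loops provide a preimage of every complex vector.\<close>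
        define y where "y = (\<lambda>i\<in>{..<rank E}. (\<lambda>_ :: real. x i))"
        have "y \<in> {..<rank E} \<rightarrow>\<^sub>E carrier loop_ring" by (auto simp: y_def)
        then obtain e where e: "e \<in> ?C" "\<beta> e = y"
          using \<beta> unfolding free_iso_def bij_betw_def by (metis imageE)
        have "\<beta>' (?cl e) = x" unfolding 1[OF e(1)] e(2) using x by (auto simp: y_def fun_eq_iff PiE_def extensional_def)
        then show "x \<in> \<beta>' ` ?cl ` ?C" using e(1) by blast
      qed
    qed
  next
    fix V W assume "V \<in> carrier (caloron_fib E (m, \<theta>))" "W \<in> carrier (caloron_fib E (m, \<theta>))"
    then obtain e e' where e: "e \<in> ?C" "V = ?cl e" "e' \<in> ?C" "W = ?cl e'" unfolding caloron_carrier by blast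
    have "\<beta>' (?cl (e \<oplus>\<^bsub>fib E m\<^esub> e')) = (\<lambda>i\<in>{..<rank E}. \<beta>' (?cl e) i \<oplus>\<^bsub>complex_ring\<^esub> \<beta>' (?cl e') i)"
      unfolding 1[OF e(1)] 1[OF e(3)] 1[OF N.M.add.m_closed[OF e(1,3)]]
      using free_iso_add[OF \<beta> e(1,3)] by (auto simp: complex_ring_def)
    then show "\<beta>' (V \<oplus>\<^bsub>caloron_fib E (m, \<theta>)\<^esub> W) = (\<lambda>i\<in>{..<rank E}. \<beta>' V i \<oplus>\<^bsub>complex_ring\<^esub> \<beta>' W i)"
      unfolding e(2,4) eval_class_add[OF E m e(1,3)] .
  next
    fix c V assume "V \<in> carrier (caloron_fib E (m, \<theta>))"
    then obtain e where e: "e \<in> ?C" "V = ?cl e" unfolding caloron_carrier by blast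
    have "\<beta>' (?cl ((\<lambda>\<theta>. c) \<odot>\<^bsub>fib E m\<^esub> e)) = (\<lambda>i\<in>{..<rank E}. c \<otimes>\<^bsub>complex_ring\<^esub> \<beta>' (?cl e) i)"
      unfolding 1[OF e(1)] 1[OF N.smult_closed[OF const_loop e(1)]]
      using free_iso_smult[OF \<beta> e(1)] by (auto simp: complex_ring_def)
    then show "\<beta>' (c \<odot>\<^bsub>caloron_fib E (m, \<theta>)\<^esub> V) = (\<lambda>i\<in>{..<rank E}. c \<otimes>\<^bsub>complex_ring\<^esub> \<beta>' V i)"
      unfolding e(2) eval_class_smult[OF E m e(1)] .
  qed
  then show ?thesis using that 1 by simp
qed

lemma caloron_fib_closed:
  assumes E: "omega_vector_bundle M E" and m: "m \<in> points M"
  shows "V \<in> carrier (caloron_fib E (m, \<theta>)) \<Longrightarrow> W \<in> carrier (caloron_fib E (m, \<theta>)) \<Longrightarrow>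
      V \<oplus>\<^bsub>caloron_fib E (m, \<theta>)\<^esub> W \<in> carrier (caloron_fib E (m, \<theta>))"
    "V \<in> carrier (caloron_fib E (m, \<theta>)) \<Longrightarrow> c \<odot>\<^bsub>caloron_fib E (m, \<theta>)\<^esub> V \<in> carrier (caloron_fib E (m, \<theta>))"
proof -
  interpret N: Module.module loop_ring "fib E m"
    using E m by (simp add: omega_vector_bundle_def omega_module_def)
  show "V \<in> carrier (caloron_fib E (m, \<theta>)) \<Longrightarrow> W \<in> carrier (caloron_fib E (m, \<theta>)) \<Longrightarrow>
      V \<oplus>\<^bsub>caloron_fib E (m, \<theta>)\<^esub> W \<in> carrier (caloron_fib E (m, \<theta>))"
    unfolding caloron_carrier using eval_class_add[OF E m] by auto
  show "V \<in> carrier (caloron_fib E (m, \<theta>)) \<Longrightarrow> c \<odot>\<^bsub>caloron_fib E (m, \<theta>)\<^esub> V \<in> carrier (caloron_fib E (m, \<theta>))"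
    unfolding caloron_carrier using eval_class_smult[OF E m] N.smult_closed[OF const_loop] by auto
qed

section \<open>Sections of \<open>\<Omega>\<close> vector bundles in a local frame\<close>

context corner_manifold
begin

section \<open>Complex-valued functions, loops and loop families\<close>

definition smooth_complex :: "('m \<Rightarrow> complex) \<Rightarrow> bool" where
  "smooth_complex f \<longleftrightarrow> (\<lambda>p. Re (f p)) \<in> smooth_funs M \<and> (\<lambda>p. Im (f p)) \<in> smooth_funs M"

lemma smooth_complex_of_fam:
  "smooth_fam M (points M) Q f \<Longrightarrow> q \<in> Q \<Longrightarrow> smooth_complex (\<lambda>p. f p q)"
  unfolding smooth_complex_def
  by (auto intro: smooth_fun_of_fam[OF smooth_fam_linear[OF bounded_linear_Re]]
      smooth_fun_of_fam[OF smooth_fam_linear[OF bounded_linear_Im]])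

lemma cd_const: "X \<in> vector_fields M \<Longrightarrow> m \<in> points M \<Longrightarrow> complex_derivative X (\<lambda>_. c) m = 0"
  by (simp add: complex_derivative_def vector_field_const complex_eq_iff)

lemma cd_local:
  assumes "X \<in> vector_fields M" "smooth_complex f" "smooth_complex g" "openin (top M) O'" "m \<in> O'"
    and "\<And>p. p \<in> O' \<Longrightarrow> f p = g p"
  shows "complex_derivative X f m = complex_derivative X g m"
proof -
  have "X (\<lambda>p. Re (f p)) m = X (\<lambda>p. Re (g p)) m" "X (\<lambda>p. Im (f p)) m = X (\<lambda>p. Im (g p)) m"
    by (rule vf_local[OF assms(1) _ _ assms(4,5)]; use assms(2,3,6) in \<open>simp add: smooth_complex_def\<close>)+
  then show ?thesis by (simp add: complex_derivative_def)
qed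

lemma cd_fam:
  fixes f :: "'m \<Rightarrow> 'q::euclidean_space \<Rightarrow> complex"
  assumes X: "X \<in> vector_fields M" and f: "smooth_fam M (points M) Q f"
  shows "smooth_fam M (points M) Q (\<lambda>p q. complex_derivative X (\<lambda>p. f p q) p)"
proof -
  have "smooth_fam M (points M) Q (\<lambda>p q. complex_of_real (X (\<lambda>p. Re (f p q)) p) + \<i> * complex_of_real (X (\<lambda>p. Im (f p q)) p))"
    by (intro smooth_fam_add smooth_fam_linear[OF bounded_linear_mult_right] smooth_fam_linear[OF bounded_linear_of_real]
        smooth_fam_vf[OF X] smooth_fam_linear[OF bounded_linear_Re f] smooth_fam_linear[OF bounded_linear_Im f])
  then show ?thesis by (simp add: complex_derivative_def Complex_eq)
qed

lemma cd_commute: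
  fixes f :: "'m \<Rightarrow> 'q::euclidean_space \<Rightarrow> complex"
  assumes X: "X \<in> vector_fields M" and f: "smooth_fam M (points M) Q f" and g: "smooth_complex g"
    and T: "\<And>u. u \<in> T \<Longrightarrow> q + (u - u0) *\<^sub>R e \<in> Q" "u0 \<in> T" "at u0 within T \<noteq> bot"
    and fg: "\<And>p. p \<in> points M \<Longrightarrow>
      ((\<lambda>u. f p (q + (u - u0) *\<^sub>R e)) has_vector_derivative g p) (at u0 within T)"
    and m: "m \<in> points M"
  shows "((\<lambda>u. complex_derivative X (\<lambda>p. f p (q + (u - u0) *\<^sub>R e)) m) has_vector_derivative
    complex_derivative X g m) (at u0 within T)"
proof -
  have "((\<lambda>u. X (\<lambda>p. Re (f p (q + (u - u0) *\<^sub>R e))) m) has_vector_derivative X (\<lambda>p. Re (g p)) m) (at u0 within T)"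
    by (rule vf_derivative_commute[OF X smooth_fam_linear[OF bounded_linear_Re f] _ T _ m])
       (use g fg in \<open>auto simp: smooth_complex_def intro: bounded_linear.has_vector_derivative[OF bounded_linear_Re]\<close>)
  moreover have "((\<lambda>u. X (\<lambda>p. Im (f p (q + (u - u0) *\<^sub>R e))) m) has_vector_derivative X (\<lambda>p. Im (g p)) m) (at u0 within T)"
    by (rule vf_derivative_commute[OF X smooth_fam_linear[OF bounded_linear_Im f] _ T _ m])
       (use g fg in \<open>auto simp: smooth_complex_def intro: bounded_linear.has_vector_derivative[OF bounded_linear_Im]\<close>)
  ultimately have "((\<lambda>u. complex_of_real (X (\<lambda>p. Re (f p (q + (u - u0) *\<^sub>R e))) m) +
      \<i> * complex_of_real (X (\<lambda>p. Im (f p (q + (u - u0) *\<^sub>R e))) m)) has_vector_derivative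
      complex_of_real (X (\<lambda>p. Re (g p)) m) + \<i> * complex_of_real (X (\<lambda>p. Im (g p)) m)) (at u0 within T)"
    by (intro has_vector_derivative_add bounded_linear.has_vector_derivative[OF bounded_linear_mult_right]
        bounded_linear.has_vector_derivative[OF bounded_linear_of_real])
  then show ?thesis by (simp add: complex_derivative_def Complex_eq)
qed

lemma fam_slice:
  assumes f: "smooth_fam M W Q f" and W: "W \<subseteq> points M" and m: "m \<in> W"
  shows "smooth_on Q (f m)"
proof -
  obtain U \<phi> where U: "(U, \<phi>) \<in> charts M" "m \<in> U" using chart_cover W m by blast
  have A: "smooth_on Q (\<lambda>q. (\<phi> m, q))"
    by (intro smooth_on_Pair smooth_on_linear bounded_linear_ident smooth_on_const)
  have B: "(\<lambda>q. (\<phi> m, q)) ` Q \<subseteq> \<phi> ` (U \<inter> W) \<times> Q" using U(2) m by blast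
  show ?thesis using smooth_on_compose[OF smooth_famD[OF f U(1)] A B] by (simp add: chart_inv[OF U])
qed

lemma loop_family_iff:
  "smooth_loop_family M W f \<longleftrightarrow> smooth_fam M W UNIV f \<and> (\<forall>m\<in>W. \<forall>\<theta>. f m (\<theta> + 2 * pi) = f m \<theta>)"
  by (auto simp: smooth_loop_family_def smooth_fam_def case_prod_unfold)

lemma loop_family_carrier:
  "smooth_loop_family M W f \<Longrightarrow> W \<subseteq> points M \<Longrightarrow> m \<in> W \<Longrightarrow> f m \<in> carrier loop_ring"
  unfolding loop_family_iff by (auto simp: loop_ring_def intro: fam_slice)

lemma loop_has_derivative:
  assumes "f \<in> carrier loop_ring"
  shows "(f has_vector_derivative vector_derivative f (at \<theta>)) (at \<theta>)"
proof -
  have "smooth_on UNIV f" using assms by (simp add: loop_ring_def)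
  from smooth_onE[OF this, of \<theta>] obtain U g where U: "open U" "\<theta> \<in> U" "\<And>k. C_k_on k U g" "\<And>y. y \<in> U \<Longrightarrow> f y = g y"
    by (metis UNIV_I)
  have "(f has_derivative frechet_derivative g (at \<theta>)) (at \<theta>)"
    by (rule has_derivative_transform_within_open[OF C_k_on_has_derivative[OF U(3,2)] U(1,2)]) (simp add: U(4))
  then have "f differentiable (at \<theta>)" by (auto simp: differentiable_def)
  then show ?thesis using vector_derivative_works by blast
qed

lemma loop_family_derivative:
  assumes f: "smooth_loop_family M W f" and W: "W \<subseteq> points M"
  shows "smooth_loop_family M W (\<lambda>m \<theta>. vector_derivative (f m) (at \<theta>))"
proof -
  have d: "(f m has_vector_derivative vector_derivative (f m) (at \<theta>)) (at \<theta>)" if "m \<in> W" for m \<theta>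
    by (rule loop_has_derivative[OF loop_family_carrier[OF f W that]])
  have "vector_derivative (f m) (at (\<theta> + 2 * pi)) = vector_derivative (f m) (at \<theta>)" if m: "m \<in> W" for m \<theta>
  proof -
    have s: "((\<lambda>\<theta>. \<theta> + 2 * pi) has_vector_derivative 1) (at \<theta>)"
      by (auto intro!: derivative_eq_intros)
    have "((\<lambda>\<theta>. f m (\<theta> + 2 * pi)) has_vector_derivative vector_derivative (f m) (at (\<theta> + 2 * pi))) (at \<theta>)"
      using vector_diff_chain_at[OF s d[OF m]] by (simp add: o_def)
    moreover have "(\<lambda>\<theta>. f m (\<theta> + 2 * pi)) = f m" using f m by (auto simp: smooth_loop_family_def)
    ultimately show ?thesis using vector_derivative_at by metis
  qed
  moreover have "smooth_fam M W UNIV (\<lambda>m \<theta>. vector_derivative (f m) (at \<theta>))"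
  proof (rule smooth_fam_derivative[where e = 1])
    show "smooth_fam M W UNIV f" using f by (simp add: loop_family_iff)
    fix m and \<theta> :: real assume "m \<in> W"
    then show "\<exists>T u0. u0 \<in> T \<and> at u0 within T \<noteq> bot \<and> (\<forall>u\<in>T. \<theta> + (u - u0) *\<^sub>R 1 \<in> UNIV) \<and>
        ((\<lambda>u. f m (\<theta> + (u - u0) *\<^sub>R 1)) has_vector_derivative vector_derivative (f m) (at \<theta>)) (at u0 within T)"
      using d[of m \<theta>] by (intro exI[of _ UNIV] exI[of _ \<theta>]) simp
  qed
  ultimately show ?thesis by (simp add: loop_family_iff)
qed

lemma loop_family_add:
  "smooth_loop_family M W f \<Longrightarrow> smooth_loop_family M W g \<Longrightarrow> smooth_loop_family M W (\<lambda>p \<theta>. f p \<theta> + g p \<theta>)"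
  by (auto simp: loop_family_iff smooth_fam_add)

lemma loop_family_mult:
  "smooth_loop_family M W f \<Longrightarrow> smooth_loop_family M W g \<Longrightarrow> smooth_loop_family M W (\<lambda>p \<theta>. f p \<theta> * g p \<theta>)"
  by (auto simp: loop_family_iff smooth_fam_mult)

lemma loop_family_subset:
  "smooth_loop_family M W f \<Longrightarrow> W' \<subseteq> W \<Longrightarrow> smooth_loop_family M W' f"
  by (auto simp: loop_family_iff intro: smooth_fam_subset)

lemma loop_family_cong:
  "smooth_loop_family M W f \<Longrightarrow> (\<And>p \<theta>. p \<in> W \<Longrightarrow> f p \<theta> = g p \<theta>) \<Longrightarrow> smooth_loop_family M W g"
  by (auto simp: loop_family_iff intro: smooth_fam_cong)

text \<open>Smoothness is inherited from \<open>cd_fam\<close>. For periodicity, the functions at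
  \<theta> and \<theta> + 2 \<pi> agree only at points of the manifold, which is why locality of the
  vector field is invoked, with the whole space as neighbourhood.\<close>

lemma loop_family_cd:
  assumes "X \<in> vector_fields M" "smooth_loop_family M (points M) f"
  shows "smooth_loop_family M (points M) (\<lambda>p \<theta>. complex_derivative X (\<lambda>p. f p \<theta>) p)"
proof -
  have "complex_derivative X (\<lambda>p. f p (\<theta> + 2 * pi)) m = complex_derivative X (\<lambda>p. f p \<theta>) m" if m: "m \<in> points M" for m \<theta>
  proof -
    have s: "smooth_complex (\<lambda>p. f p \<theta>')" for \<theta>'
      using assms(2) by (auto simp: loop_family_iff intro: smooth_complex_of_fam)
    show ?thesis
      by (rule cd_local[OF assms(1) s s openin_topspace m]) (use assms(2) in \<open>auto simp: loop_family_iff\<close>)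
  qed
  then show ?thesis using assms by (auto simp: loop_family_iff intro: cd_fam)
qed

lemma lie_bracket_vector_field:
  assumes X: "X \<in> vector_fields M" and Y: "Y \<in> vector_fields M"
  shows "lie_bracket X Y \<in> vector_fields M"
  unfolding vector_fields_def
proof (intro CollectI conjI ballI allI)
  fix f assume f: "f \<in> smooth_funs M"
  have "(\<lambda>p. X (Y f) p + (- 1) * Y (X f) p) \<in> smooth_funs M"
    by (rule smooth_fun_add[OF vf_smooth[OF X vf_smooth[OF Y f]]
          smooth_fun_mult[OF const_smooth_funs vf_smooth[OF Y vf_smooth[OF X f]]]])
  then show "lie_bracket X Y f \<in> smooth_funs M" by (simp add: lie_bracket_def)
  fix g m assume g: "g \<in> smooth_funs M" and m: "m \<in> points M"
  have lc: "(\<lambda>p. a * f p + b * g p) \<in> smooth_funs M" for a b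
    by (rule smooth_fun_add[OF smooth_fun_mult[OF const_smooth_funs f] smooth_fun_mult[OF const_smooth_funs g]])
  \<comment> \<open>The rule for \<open>B\<close> holds at points of the manifold only, so it is
    inserted under \<open>A\<close> by \<open>vf_cong\<close>; the same applies to the product rule
    below.\<close>
  have lin: "A (B (\<lambda>p. a * f p + b * g p)) m = a * A (B f) m + b * A (B g) m"
    if A: "A \<in> vector_fields M" and B: "B \<in> vector_fields M" for A B a b
  proof -
    have "A (B (\<lambda>p. a * f p + b * g p)) m = A (\<lambda>p. a * B f p + b * B g p) m"
      by (rule vf_cong[OF A vf_smooth[OF B lc[of a b]] vf_linear[OF B f g] m])
    then show ?thesis using vf_linear[OF A vf_smooth[OF B f] vf_smooth[OF B g] m] by simp
  qed
  show "lie_bracket X Y (\<lambda>p. a * f p + b * g p) m = a * lie_bracket X Y f m + b * lie_bracket X Y g m" for a b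
    by (simp add: lie_bracket_def lin[OF X Y] lin[OF Y X] algebra_simps)
  have prod: "A (B (\<lambda>p. f p * g p)) m = A (B f) m * g m + B f m * A g m + A f m * B g m + f m * A (B g) m"
    if A: "A \<in> vector_fields M" and B: "B \<in> vector_fields M" for A B
  proof -
    have "A (B (\<lambda>p. f p * g p)) m = A (\<lambda>p. B f p * g p + f p * B g p) m"
      by (rule vf_cong[OF A vf_smooth[OF B smooth_fun_mult[OF f g]] vf_mult[OF B f g] m])
    also have "\<dots> = A (\<lambda>p. B f p * g p) m + A (\<lambda>p. f p * B g p) m"
      by (rule vf_add[OF A smooth_fun_mult[OF vf_smooth[OF B f] g] smooth_fun_mult[OF f vf_smooth[OF B g]] m])
    also have "A (\<lambda>p. B f p * g p) m = A (B f) m * g m + B f m * A g m"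
      by (rule vf_mult[OF A vf_smooth[OF B f] g m])
    also have "A (\<lambda>p. f p * B g p) m = A f m * B g m + f m * A (B g) m"
      by (rule vf_mult[OF A f vf_smooth[OF B g] m])
    finally show ?thesis by simp
  qed
  show "lie_bracket X Y (\<lambda>p. f p * g p) m = lie_bracket X Y f m * g m + f m * lie_bracket X Y g m"
    by (simp add: lie_bracket_def prod[OF X Y] prod[OF Y X] algebra_simps)
qed

end

section \<open>Fibre coordinates and operations on sections\<close>

locale omega_bundle_manifold = corner_manifold M
  for M :: "('m, 'a::euclidean_space) manifold" +
  fixes E :: "('m, 'e) omega_bundle"
  assumes E: "omega_vector_bundle M E"
begin

lemmas bundle_data = E[unfolded omega_vector_bundle_def]

lemma om: "m \<in> points M \<Longrightarrow> omega_module (rank E) (fib E m) (framing E m)"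
  using bundle_data by simp

lemma triv_cover: "m \<in> points M \<Longrightarrow> \<exists>U \<tau>. (U, \<tau>) \<in> trivs E \<and> m \<in> U"
proof -
  assume "m \<in> points M"
  then have "m \<in> (\<Union>(U, \<tau>)\<in>trivs E. U)" using bundle_data by simp
  then obtain x where "x \<in> trivs E" "m \<in> (case x of (U, \<tau>) \<Rightarrow> U)" by (elim UN_E)
  then show "\<exists>U \<tau>. (U, \<tau>) \<in> trivs E \<and> m \<in> U" by (cases x) auto
qed

context
  fixes U \<tau>
  assumes U: "(U, \<tau>) \<in> trivs E"
begin

lemmas triv_data = bspec[OF bundle_data[THEN conjunct2, THEN conjunct2, THEN conjunct1] U, unfolded prod.case]

lemma triv_open: "openin (top M) U"
  and triv_iso: "m \<in> U \<Longrightarrow> free_iso loop_ring (rank E) (fib E m) (\<tau> m)"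
  and triv_framing: "m \<in> U \<Longrightarrow> v \<in> carrier (fib E m) \<Longrightarrow> i < rank E \<Longrightarrow> \<tau> m v i 0 = framing E m v i"
  using triv_data by simp_all

lemma triv_smooth:
  assumes V: "(V, \<sigma>) \<in> trivs E" and ij: "i < rank E" "j < rank E"
  shows "smooth_loop_family M (U \<inter> V)
      (\<lambda>m. \<sigma> m (inv_into (carrier (fib E m)) (\<tau> m) (std_basis loop_ring (rank E) i)) j)"
  using bspec[OF bspec[OF bundle_data[THEN conjunct2, THEN conjunct2, THEN conjunct2] U, unfolded prod.case] V,
    unfolded prod.case] ij by simp

end

lemma triv_subset: "(U, \<tau>) \<in> trivs E \<Longrightarrow> U \<subseteq> points M"
  using triv_open openin_subset by blast

lemma fib_module: "m \<in> points M \<Longrightarrow> Module.module loop_ring (fib E m)"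
  using om by (simp add: omega_module_def)

lemma fib_add: "m \<in> points M \<Longrightarrow> v \<in> carrier (fib E m) \<Longrightarrow> w \<in> carrier (fib E m) \<Longrightarrow> v \<oplus>\<^bsub>fib E m\<^esub> w \<in> carrier (fib E m)"
  and fib_smult: "m \<in> points M \<Longrightarrow> r \<in> carrier loop_ring \<Longrightarrow> v \<in> carrier (fib E m) \<Longrightarrow> r \<odot>\<^bsub>fib E m\<^esub> v \<in> carrier (fib E m)"
  by (rule omega_module_closed[OF om]; assumption)+

lemma fib_zero: "m \<in> points M \<Longrightarrow> \<zero>\<^bsub>fib E m\<^esub> \<in> carrier (fib E m)"
proof -
  assume "m \<in> points M"
  then interpret Module.module loop_ring "fib E m" by (rule fib_module)
  show ?thesis by simp
qed

lemma fib_minus: "m \<in> points M \<Longrightarrow> v \<in> carrier (fib E m) \<Longrightarrow> w \<in> carrier (fib E m) \<Longrightarrow> v \<ominus>\<^bsub>fib E m\<^esub> w \<in> carrier (fib E m)"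
proof -
  assume m: "m \<in> points M" and vw: "v \<in> carrier (fib E m)" "w \<in> carrier (fib E m)"
  interpret Module.module loop_ring "fib E m" using m by (rule fib_module)
  show ?thesis using vw by (rule M.minus_closed)
qed

context
  fixes m \<beta>
  assumes m: "m \<in> points M" and \<beta>: "free_iso loop_ring (rank E) (fib E m) \<beta>"
begin

lemma coord_add: "v \<in> carrier (fib E m) \<Longrightarrow> w \<in> carrier (fib E m) \<Longrightarrow> i < rank E \<Longrightarrow>
    \<beta> (v \<oplus>\<^bsub>fib E m\<^esub> w) i \<theta> = \<beta> v i \<theta> + \<beta> w i \<theta>"
  by (rule free_iso_add[OF \<beta>])

lemma coord_smult: "r \<in> carrier loop_ring \<Longrightarrow> v \<in> carrier (fib E m) \<Longrightarrow> i < rank E \<Longrightarrow>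
    \<beta> (r \<odot>\<^bsub>fib E m\<^esub> v) i \<theta> = r \<theta> * \<beta> v i \<theta>"
proof -
  assume *: "r \<in> carrier loop_ring" "v \<in> carrier (fib E m)" "i < rank E"
  have "\<beta> (r \<odot>\<^bsub>fib E m\<^esub> v) = (\<lambda>i\<in>{..<rank E}. r \<otimes>\<^bsub>loop_ring\<^esub> \<beta> v i)"
    using \<beta> *(1,2) unfolding free_iso_def by blast
  then show ?thesis using *(3) by (simp add: loop_ring_def)
qed

lemma coord_zero: "i < rank E \<Longrightarrow> \<beta> \<zero>\<^bsub>fib E m\<^esub> i \<theta> = 0"
proof -
  interpret Module.module loop_ring "fib E m" using m by (rule fib_module)
  show "i < rank E \<Longrightarrow> \<beta> \<zero>\<^bsub>fib E m\<^esub> i \<theta> = 0"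
    using coord_add[OF M.zero_closed M.zero_closed, of i \<theta>] by simp
qed

lemma coord_minus: "v \<in> carrier (fib E m) \<Longrightarrow> w \<in> carrier (fib E m) \<Longrightarrow> i < rank E \<Longrightarrow>
    \<beta> (v \<ominus>\<^bsub>fib E m\<^esub> w) i \<theta> = \<beta> v i \<theta> - \<beta> w i \<theta>"
proof -
  assume vw: "v \<in> carrier (fib E m)" "w \<in> carrier (fib E m)" and i: "i < rank E"
  interpret Module.module loop_ring "fib E m" using m by (rule fib_module)
  have "v = (v \<ominus>\<^bsub>fib E m\<^esub> w) \<oplus>\<^bsub>fib E m\<^esub> w" using vw by (simp add: M.minus_eq M.a_assoc M.l_neg)
  then have "\<beta> v i \<theta> = \<beta> (v \<ominus>\<^bsub>fib E m\<^esub> w) i \<theta> + \<beta> w i \<theta>"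
    using coord_add[OF M.minus_closed[OF vw] vw(2) i] by simp
  then show ?thesis by simp
qed

lemma coord_closed: "v \<in> carrier (fib E m) \<Longrightarrow> i < rank E \<Longrightarrow> \<beta> v i \<in> carrier loop_ring"
  using \<beta> unfolding free_iso_def bij_betw_def by (blast dest: PiE_mem)

lemma coord_eqI:
  assumes "v \<in> carrier (fib E m)" "w \<in> carrier (fib E m)" "\<And>i \<theta>. i < rank E \<Longrightarrow> \<beta> v i \<theta> = \<beta> w i \<theta>"
  shows "v = w"
proof -
  have "\<beta> v \<in> {..<rank E} \<rightarrow>\<^sub>E carrier loop_ring" "\<beta> w \<in> {..<rank E} \<rightarrow>\<^sub>E carrier loop_ring"
    using \<beta> assms(1,2) by (auto simp: free_iso_def bij_betw_def)
  then have "\<beta> v = \<beta> w" by (rule PiE_ext) (use assms(3) in auto)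
  then show ?thesis using \<beta> assms(1,2) by (auto simp: free_iso_def bij_betw_def inj_on_def)
qed

lemma coord_exists:
  assumes "\<And>i. i < rank E \<Longrightarrow> c i \<in> carrier loop_ring"
  obtains v where "v \<in> carrier (fib E m)" "\<And>i. i < rank E \<Longrightarrow> \<beta> v i = c i"
proof -
  have "restrict c {..<rank E} \<in> {..<rank E} \<rightarrow>\<^sub>E carrier loop_ring" by (simp add: restrict_PiE_iff assms)
  moreover have "\<beta> ` carrier (fib E m) = {..<rank E} \<rightarrow>\<^sub>E carrier loop_ring"
    using \<beta> by (simp add: free_iso_def bij_betw_def)
  ultimately have "restrict c {..<rank E} \<in> \<beta> ` carrier (fib E m)" by simp
  then obtain v where "v \<in> carrier (fib E m)" "\<beta> v = restrict c {..<rank E}" by (elim imageE) simp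
  then show ?thesis using that by simp
qed

end

definition sec_add :: "('m \<Rightarrow> 'e) \<Rightarrow> ('m \<Rightarrow> 'e) \<Rightarrow> 'm \<Rightarrow> 'e" where
  "sec_add v w = (\<lambda>p\<in>points M. v p \<oplus>\<^bsub>fib E p\<^esub> w p)"

definition sec_smult :: "('m \<Rightarrow> real \<Rightarrow> complex) \<Rightarrow> ('m \<Rightarrow> 'e) \<Rightarrow> 'm \<Rightarrow> 'e" where
  "sec_smult f v = (\<lambda>p\<in>points M. f p \<odot>\<^bsub>fib E p\<^esub> v p)"

lemma sections_iff: "v \<in> sections M E \<longleftrightarrow> v \<in> extensional (points M) \<and> (\<forall>m\<in>points M. v m \<in> carrier (fib E m)) \<and>
    (\<forall>U \<tau> i. (U, \<tau>) \<in> trivs E \<longrightarrow> i < rank E \<longrightarrow> smooth_loop_family M U (\<lambda>m. \<tau> m (v m) i))"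
  unfolding sections_def PiE_def by (auto simp: Pi_iff)

lemma section_smooth: "v \<in> sections M E \<Longrightarrow> (U, \<tau>) \<in> trivs E \<Longrightarrow> i < rank E \<Longrightarrow>
    smooth_loop_family M U (\<lambda>m. \<tau> m (v m) i)"
  by (simp add: sections_iff)

lemma sections_ext:
  "v \<in> sections M E \<Longrightarrow> w \<in> sections M E \<Longrightarrow> (\<And>p. p \<in> points M \<Longrightarrow> v p = w p) \<Longrightarrow> v = w"
  by (auto simp: sections_iff intro: extensionalityI)

lemma sec_add_section:
  assumes v: "v \<in> sections M E" and w: "w \<in> sections M E"
  shows "sec_add v w \<in> sections M E"
  unfolding sections_iff
proof (intro conjI ballI allI impI)
  fix U \<tau> i assume U: "(U, \<tau>) \<in> trivs E" and i: "i < rank E"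
  show "smooth_loop_family M U (\<lambda>m. \<tau> m (sec_add v w m) i)"
    by (rule loop_family_cong[OF loop_family_add[OF section_smooth[OF v U i] section_smooth[OF w U i]]])
       (use triv_subset[OF U] triv_iso[OF U] i section_closed[OF v] section_closed[OF w] in
         \<open>auto simp: sec_add_def coord_add subsetD\<close>)
qed (auto simp: sec_add_def fib_add section_closed[OF v] section_closed[OF w])

lemma sec_smult_section:
  assumes f: "smooth_loop_family M (points M) f" and v: "v \<in> sections M E"
  shows "sec_smult f v \<in> sections M E"
  unfolding sections_iff
proof (intro conjI ballI allI impI)
  fix U \<tau> i assume U: "(U, \<tau>) \<in> trivs E" and i: "i < rank E"
  show "smooth_loop_family M U (\<lambda>m. \<tau> m (sec_smult f v m) i)"
    by (rule loop_family_cong[OF loop_family_mult[OF loop_family_subset[OF f triv_subset[OF U]] section_smooth[OF v U i]]])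
       (use triv_subset[OF U] triv_iso[OF U] i section_closed[OF v] loop_family_carrier[OF f order_refl] in
         \<open>auto simp: sec_smult_def coord_smult subsetD\<close>)
qed (auto simp: sec_smult_def fib_smult section_closed[OF v] loop_family_carrier[OF f order_refl])

end

text \<open>A trivialisation with a cutoff: on \<open>O'\<close>, where \<rho> is 1, formulas are
  read off; vanishing of \<rho> outside the closed set \<open>K\<close> inside \<open>U\<close>
  makes extension by zero smooth.\<close>

locale local_frame = omega_bundle_manifold M E
  for M :: "('m, 'a::euclidean_space) manifold" and E :: "('m, 'e) omega_bundle" +
  fixes U \<tau> \<rho> O' K
  assumes U: "(U, \<tau>) \<in> trivs E" and \<rho>: "\<rho> \<in> smooth_funs M" and O': "openin (top M) O'" "O' \<subseteq> U"
    and \<rho>_1: "p \<in> O' \<Longrightarrow> \<rho> p = 1" and K: "closedin (top M) K" "K \<subseteq> U"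
    and \<rho>_0: "p \<in> points M \<Longrightarrow> p \<notin> K \<Longrightarrow> \<rho> p = 0"

lemma (in omega_bundle_manifold) local_frame_exists:
  assumes "(U, \<tau>) \<in> trivs E" "p0 \<in> U"
  obtains \<rho> O' K where "local_frame M E U \<tau> \<rho> O' K" "p0 \<in> O'"
  using cutoff[OF triv_open[OF assms(1)] assms(2)] assms(1) omega_bundle_manifold_axioms
  unfolding local_frame_def local_frame_axioms_def by (metis (no_types, lifting))

context local_frame
begin

lemma U_sub: "U \<subseteq> points M" by (rule triv_subset[OF U])

lemma O_sub: "O' \<subseteq> points M" using O'(2) U_sub by blast

lemma iso: "p \<in> U \<Longrightarrow> free_iso loop_ring (rank E) (fib E p) (\<tau> p)" by (rule triv_iso[OF U])

lemma glue:
  fixes f :: "'m \<Rightarrow> 'q::euclidean_space \<Rightarrow> complex"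
  shows "smooth_fam M U Q f \<Longrightarrow> smooth_fam M (points M) Q (\<lambda>p q. if p \<in> U then \<rho> p *\<^sub>R f p q else 0)"
  by (rule smooth_fam_glue[OF triv_open[OF U] order_refl K \<rho> \<rho>_0]) (auto intro: smooth_fam_subset)

lemma loop_glue:
  assumes "smooth_loop_family M (U \<inter> V) f" "V \<subseteq> points M"
  shows "smooth_loop_family M V (\<lambda>p \<theta>. if p \<in> U then \<rho> p *\<^sub>R f p \<theta> else 0)"
  using assms smooth_fam_glue[OF triv_open[OF U] assms(2) K \<rho> \<rho>_0] by (auto simp: loop_family_iff)

definition basis :: "nat \<Rightarrow> 'm \<Rightarrow> 'e" where
  "basis k p = inv_into (carrier (fib E p)) (\<tau> p) (std_basis loop_ring (rank E) k)"

text \<open>Connections can be applied to global sections only, so the local basis is cut off and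
  extended by zero; on \<open>O'\<close> nothing is lost.\<close>

definition frame :: "nat \<Rightarrow> 'm \<Rightarrow> 'e" where
  "frame k = (\<lambda>p\<in>points M. if p \<in> U then (\<lambda>\<theta>. of_real (\<rho> p)) \<odot>\<^bsub>fib E p\<^esub> basis k p else \<zero>\<^bsub>fib E p\<^esub>)"

definition coef :: "('m \<Rightarrow> 'e) \<Rightarrow> nat \<Rightarrow> 'm \<Rightarrow> real \<Rightarrow> complex" where
  "coef v k = (\<lambda>p \<theta>. if p \<in> U then \<rho> p *\<^sub>R \<tau> p (v p) k \<theta> else 0)"

lemma basis_closed: "p \<in> U \<Longrightarrow> basis k p \<in> carrier (fib E p)"
  and basis_coord: "p \<in> U \<Longrightarrow> i < rank E \<Longrightarrow> \<tau> p (basis k p) i \<theta> = (if i = k then 1 else 0)"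
proof -
  assume p: "p \<in> U"
  interpret evaluation loop_ring "\<lambda>f. f \<theta>"
    using p U_sub by (intro evaluation_loop omega_module_closed(1)[OF om]) auto
  show "basis k p \<in> carrier (fib E p)"
    unfolding basis_def by (rule free_iso_inv(1)[OF iso[OF p] std_basis_closed])
  show "i < rank E \<Longrightarrow> \<tau> p (basis k p) i \<theta> = (if i = k then 1 else 0)"
    unfolding basis_def free_iso_inv(2)[OF iso[OF p] std_basis_closed] by (simp add: std_basis_def ev_zero ev_one)
qed

lemma frame_closed: "p \<in> points M \<Longrightarrow> frame k p \<in> carrier (fib E p)"
  by (auto simp: frame_def fib_smult fib_zero basis_closed)

lemma frame_section:
  assumes k: "k < rank E"
  shows "frame k \<in> sections M E"
  unfolding sections_iff
proof (intro conjI ballI allI impI)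
  fix V \<sigma> i assume V: "(V, \<sigma>) \<in> trivs E" and i: "i < rank E"
  have V_sub: "V \<subseteq> points M" by (rule triv_subset[OF V])
  show "smooth_loop_family M V (\<lambda>p. \<sigma> p (frame k p) i)"
  proof (rule loop_family_cong[OF loop_glue[OF triv_smooth[OF U V k i] V_sub]])
    fix p \<theta> assume p: "p \<in> V"
    then have pM: "p \<in> points M" using V_sub by blast
    show "(if p \<in> U then \<rho> p *\<^sub>R \<sigma> p (inv_into (carrier (fib E p)) (\<tau> p) (std_basis loop_ring (rank E) k)) i \<theta> else 0) =
        \<sigma> p (frame k p) i \<theta>"
      using pM coord_zero[OF pM triv_iso[OF V p] i] coord_smult[OF pM triv_iso[OF V p] const_loop basis_closed i]
      by (auto simp: frame_def basis_def[symmetric] scaleR_conv_of_real)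
  qed
qed (auto simp: frame_closed, simp add: frame_def)

lemma frame_coord:
  assumes "p \<in> U" "i < rank E"
  shows "\<tau> p (frame k p) i \<theta> = (if i = k then of_real (\<rho> p) else 0)"
proof -
  have pM: "p \<in> points M" using assms(1) U_sub by blast
  show ?thesis using coord_smult[OF pM iso[OF assms(1)] const_loop basis_closed[OF assms(1)] assms(2)]
    assms pM by (simp add: frame_def basis_coord)
qed

lemma coef_loop: "v \<in> sections M E \<Longrightarrow> k < rank E \<Longrightarrow> smooth_loop_family M (points M) (coef v k)"
  unfolding coef_def by (rule loop_glue) (auto intro: loop_family_subset[OF section_smooth[OF _ U]])

lemma loop_family_fun: "f \<in> smooth_funs M \<Longrightarrow> smooth_loop_family M (points M) (\<lambda>p \<theta>. complex_of_real (f p))"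
  using smooth_fam_linear[OF bounded_linear_of_real smooth_fam_of_fun] by (auto simp: loop_family_iff)

text \<open>The empty sum is written as a multiple of the zero section, so that the Leibniz rule
  alone evaluates an operator on it.\<close>

fun frame_sum :: "(nat \<Rightarrow> 'm \<Rightarrow> real \<Rightarrow> complex) \<Rightarrow> nat \<Rightarrow> 'm \<Rightarrow> 'e" where
  "frame_sum f 0 = sec_smult (\<lambda>_ _. 0) (\<lambda>p\<in>points M. \<zero>\<^bsub>fib E p\<^esub>)"
| "frame_sum f (Suc k) = sec_add (frame_sum f k) (sec_smult (f k) (frame k))"

lemma zero_section: "(\<lambda>p\<in>points M. \<zero>\<^bsub>fib E p\<^esub>) \<in> sections M E"
  unfolding sections_iff
proof (intro conjI ballI allI impI)
  fix V \<sigma> i assume V: "(V, \<sigma>) \<in> trivs E" and i: "i < rank E"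
  have "smooth_loop_family M V (\<lambda>_ _. 0)" by (simp add: loop_family_iff smooth_fam_const)
  then show "smooth_loop_family M V (\<lambda>p. \<sigma> p ((\<lambda>p\<in>points M. \<zero>\<^bsub>fib E p\<^esub>) p) i)"
    by (rule loop_family_cong) (use triv_subset[OF V] coord_zero[OF _ triv_iso[OF V] i] in auto)
qed (auto simp: fib_zero)

lemma zero_loop_family: "smooth_loop_family M W (\<lambda>_ _. 0)"
  by (simp add: loop_family_iff smooth_fam_const)

lemma frame_sum_section:
  assumes f: "\<And>k. k < rank E \<Longrightarrow> smooth_loop_family M (points M) (f k)"
  shows "l \<le> rank E \<Longrightarrow> frame_sum f l \<in> sections M E"
  by (induction l) (auto intro!: sec_add_section sec_smult_section zero_section zero_loop_family frame_section f)

lemma frame_sum_coord: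
  assumes f: "\<And>k. k < rank E \<Longrightarrow> smooth_loop_family M (points M) (f k)" and p: "p \<in> U" and i: "i < rank E"
  shows "l \<le> rank E \<Longrightarrow> \<tau> p (frame_sum f l p) i \<theta> = (if i < l then f i p \<theta> * of_real (\<rho> p) else 0)"
proof (induction l)
  case 0
  have pM: "p \<in> points M" using p U_sub by blast
  show ?case using coord_smult[OF pM iso[OF p] const_loop fib_zero[OF pM] i] pM by (simp add: sec_smult_def)
next
  case (Suc l)
  have pM: "p \<in> points M" using p U_sub by blast
  have l: "l < rank E" using Suc.prems by simp
  have c: "f l p \<in> carrier loop_ring" by (rule loop_family_carrier[OF f[OF l] order_refl pM])
  have S: "frame_sum f l \<in> sections M E" by (rule frame_sum_section[of f, OF f]) (use l in auto)
  have "\<tau> p (frame_sum f (Suc l) p) i \<theta> = \<tau> p (frame_sum f l p) i \<theta> + f l p \<theta> * \<tau> p (frame l p) i \<theta>"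
    using coord_add[OF pM iso[OF p] section_closed[OF S pM] fib_smult[OF pM c frame_closed[OF pM]] i]
      coord_smult[OF pM iso[OF p] c frame_closed[OF pM] i] l pM
    by (simp add: sec_add_def sec_smult_def)
  then show ?case using Suc by (auto simp: frame_coord[OF p i] less_Suc_eq)
qed

lemma frame_sum_outside:
  assumes f: "\<And>k. k < rank E \<Longrightarrow> f k p = (\<lambda>_. 0)" and p: "p \<in> points M"
  shows "l \<le> rank E \<Longrightarrow> frame_sum f l p = \<zero>\<^bsub>fib E p\<^esub>"
proof -
  interpret Module.module loop_ring "fib E p" by (rule fib_module[OF p])
  have z: "(\<lambda>_. 0) = \<zero>\<^bsub>loop_ring\<^esub>" by (simp add: loop_ring_def)
  show "l \<le> rank E \<Longrightarrow> frame_sum f l p = \<zero>\<^bsub>fib E p\<^esub>"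
  proof (induction l)
    case 0
    show ?case using p by (simp add: sec_smult_def z)
  next
    case (Suc l)
    then show ?case using p f[of l] smult_l_null[OF frame_closed[OF p]] by (simp add: sec_add_def sec_smult_def z)
  qed
qed

text \<open>The coordinates of \<open>e\<close>, taken as coefficients constant in the base point,
  give a combination of the frame with value \<open>e\<close> at \<open>p\<close>, because the
  cutoff is 1 there. This is the existence statement behind the choice in
  \<open>at_point\<close>.\<close>

lemma section_through:
  assumes p: "p \<in> O'" and e: "e \<in> carrier (fib E p)"
  obtains v where "v \<in> sections M E" "v p = e"
proof -
  have pU: "p \<in> U" and pM: "p \<in> points M" using p O'(2) O_sub by auto
  define f where "f k = (\<lambda>(_ :: 'm) \<theta>. \<tau> p e k \<theta>)" for k
  have f: "smooth_loop_family M (points M) (f k)" if "k < rank E" for k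
  proof -
    have "\<tau> p e k \<in> carrier loop_ring" by (rule coord_closed[OF pM iso[OF pU] e that])
    then have s: "smooth_on UNIV (\<tau> p e k)" "\<And>\<theta>. \<tau> p e k (\<theta> + 2 * pi) = \<tau> p e k \<theta>"
      by (auto simp: loop_ring_def)
    have "smooth_fam M (points M) UNIV (f k)"
      unfolding smooth_fam_def f_def
      by (intro allI impI smooth_on_compose[OF s(1) smooth_on_linear[OF bounded_linear_snd]]) auto
    then show ?thesis using s(2) by (simp add: loop_family_iff f_def)
  qed
  have S: "frame_sum f (rank E) \<in> sections M E" by (rule frame_sum_section[of f, OF f]) auto
  have "\<tau> p (frame_sum f (rank E) p) i \<theta> = \<tau> p e i \<theta>" if "i < rank E" for i \<theta>
    using frame_sum_coord[of f, OF f pU that order_refl] that \<rho>_1[OF p] by (simp add: f_def)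
  then have "frame_sum f (rank E) p = e" by (rule coord_eqI[OF pM iso[OF pU] section_closed[OF S pM] e])
  then show ?thesis using that S by blast
qed

text \<open>The operator \<open>L\<close> is only defined on global sections; the cutoff makes
  \<open>\<rho>\<^sup>2 v = \<Sum>\<^sub>k coef v k \<cdot> frame k\<close> an identity between such sections.\<close>

lemma frame_expansion:
  assumes p: "p \<in> O'" and i: "i < rank E" and v: "v \<in> sections M E"
    and add: "\<And>v w. v \<in> sections M E \<Longrightarrow> w \<in> sections M E \<Longrightarrow> L (sec_add v w) = L v + L w"
    and leibniz: "\<And>f v. smooth_loop_family M (points M) f \<Longrightarrow> v \<in> sections M E \<Longrightarrow>
      L (sec_smult f v) = d f * \<tau> p (v p) i \<theta> + f p \<theta> * L v"
    and d1: "d (\<lambda>p \<theta>. of_real (\<rho> p * \<rho> p)) = 0"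
  shows "L v = d (coef v i) + (\<Sum>k<rank E. \<tau> p (v p) k \<theta> * L (frame k))"
proof -
  have pU: "p \<in> U" and pM: "p \<in> points M" using p O'(2) O_sub by auto
  have c: "smooth_loop_family M (points M) (coef v k)" if "k < rank E" for k by (rule coef_loop[OF v that])
  have r: "smooth_loop_family M (points M) (\<lambda>p \<theta>. of_real (\<rho> p * \<rho> p))"
    by (rule loop_family_fun[OF smooth_fun_mult[OF \<rho> \<rho>]])
  have FS: "frame_sum (coef v) l \<in> sections M E" if "l \<le> rank E" for l
    by (rule frame_sum_section[of "coef v", OF c that])
  have eq: "sec_smult (\<lambda>p \<theta>. of_real (\<rho> p * \<rho> p)) v = frame_sum (coef v) (rank E)"
  proof (rule sections_ext[OF sec_smult_section[OF r v] FS[OF order_refl]])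
    fix q assume q: "q \<in> points M"
    have vq: "v q \<in> carrier (fib E q)" by (rule section_closed[OF v q])
    show "sec_smult (\<lambda>p \<theta>. of_real (\<rho> p * \<rho> p)) v q = frame_sum (coef v) (rank E) q"
    proof (cases "q \<in> U")
      case True
      show ?thesis
      proof (rule coord_eqI[OF q iso[OF True]])
        show "sec_smult (\<lambda>p \<theta>. of_real (\<rho> p * \<rho> p)) v q \<in> carrier (fib E q)"
          by (rule section_closed[OF sec_smult_section[OF r v] q])
        show "frame_sum (coef v) (rank E) q \<in> carrier (fib E q)"
          by (rule section_closed[OF FS[OF order_refl] q])
        show "\<tau> q (sec_smult (\<lambda>p \<theta>. of_real (\<rho> p * \<rho> p)) v q) i \<theta> = \<tau> q (frame_sum (coef v) (rank E) q) i \<theta>"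
          if "i < rank E" for i \<theta>
          using coord_smult[OF q iso[OF True] const_loop vq that] q that True frame_sum_coord[of "coef v", OF c True that order_refl]
          by (simp add: sec_smult_def coef_def scaleR_conv_of_real)
      qed
    next
      case False
      interpret Module.module loop_ring "fib E q" by (rule fib_module[OF q])
      have z: "(\<lambda>_. 0) = \<zero>\<^bsub>loop_ring\<^esub>" by (simp add: loop_ring_def)
      have "\<rho> q = 0" using False K(2) \<rho>_0[OF q] by blast
      moreover have "frame_sum (coef v) (rank E) q = \<zero>\<^bsub>fib E q\<^esub>"
        by (rule frame_sum_outside[OF _ q]) (use False in \<open>auto simp: coef_def\<close>)
      ultimately show ?thesis using q smult_l_null[OF vq] by (simp add: sec_smult_def z)
    qed
  qed
  \<comment> \<open>At \<open>p\<close> the square of the cutoff is 1 and its derivative vanishes,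
    so \<open>L\<close> does not notice the factor.\<close>
  have "L (sec_smult (\<lambda>p \<theta>. of_real (\<rho> p * \<rho> p)) v) = L v"
    using leibniz[OF r v] d1 \<rho>_1[OF p] by simp
  \<comment> \<open>The \<open>i\<close>-th coordinate of \<open>frame k\<close> at \<open>p\<close>
    is the Kronecker delta; among the derivatives of coefficients only that of
    \<open>coef v i\<close> survives.\<close>
  moreover have "L (frame_sum (coef v) l) = (\<Sum>k<l. d (coef v k) * (if i = k then 1 else 0) + \<tau> p (v p) k \<theta> * L (frame k))"
    if "l \<le> rank E" for l
    using that
  proof (induction l)
    case 0
    have "L (frame_sum (coef v) 0) = d (\<lambda>_ _. 0) * \<tau> p \<zero>\<^bsub>fib E p\<^esub> i \<theta>"
      using leibniz[OF zero_loop_family zero_section] pM by simp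
    then show ?case using coord_zero[OF pM iso[OF pU] i] by simp
  next
    case (Suc l)
    then have l: "l < rank E" by simp
    have "L (frame_sum (coef v) (Suc l)) = L (frame_sum (coef v) l) + L (sec_smult (coef v l) (frame l))"
      using l by (simp add: add FS sec_smult_section[OF c frame_section])
    also have "L (sec_smult (coef v l) (frame l)) =
        d (coef v l) * (if i = l then 1 else 0) + \<tau> p (v p) l \<theta> * L (frame l)"
      using leibniz[OF c[OF l] frame_section[OF l]] frame_coord[OF pU i] pU \<rho>_1[OF p] by (simp add: coef_def)
    finally show ?case using Suc l by simp
  qed
  ultimately have "L v = (\<Sum>k<rank E. d (coef v k) * (if i = k then 1 else 0) + \<tau> p (v p) k \<theta> * L (frame k))"
    unfolding eq by simp
  also have "\<dots> = (\<Sum>k<rank E. d (coef v k) * (if i = k then 1 else 0)) + (\<Sum>k<rank E. \<tau> p (v p) k \<theta> * L (frame k))"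
    by (rule sum.distrib)
  also have "(\<Sum>k<rank E. d (coef v k) * (if i = k then 1 else 0)) = d (coef v i)"
    using i by (simp add: if_distrib[of "(*) _"] cong: if_cong)
  finally show ?thesis .
qed

end

section \<open>Connections and Higgs fields in a local frame\<close>

lemma (in corner_manifold) cd_lie_bracket:
  "complex_derivative (lie_bracket X Y) f m =
    complex_derivative X (\<lambda>p. complex_derivative Y f p) m - complex_derivative Y (\<lambda>p. complex_derivative X f p) m"
  by (simp add: complex_derivative_def lie_bracket_def complex_eq_iff)

context omega_bundle_manifold
begin

definition sec_higgs :: "('m, 'e) higgs \<Rightarrow> ('m \<Rightarrow> 'e) \<Rightarrow> 'm \<Rightarrow> 'e" where
  "sec_higgs \<phi> v = (\<lambda>m\<in>points M. \<phi> m (v m))"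

context
  fixes D X
  assumes D: "module_connection M E D" and X: "X \<in> vector_fields M"
begin

lemma conn_section: "v \<in> sections M E \<Longrightarrow> D X v \<in> sections M E"
  by (rule module_connection_closed[OF D X])

lemma conn_closed: "v \<in> sections M E \<Longrightarrow> p \<in> points M \<Longrightarrow> D X v p \<in> carrier (fib E p)"
  by (rule section_closed[OF conn_section])

lemma conn_add:
  assumes "v \<in> sections M E" "w \<in> sections M E" "m \<in> points M"
  shows "D X (sec_add v w) m = D X v m \<oplus>\<^bsub>fib E m\<^esub> D X w m"
  using D X assms unfolding module_connection_def sec_add_def by blast

lemma conn_leibniz:
  assumes "smooth_loop_family M (points M) f" "v \<in> sections M E" "m \<in> points M"
  shows "D X (sec_smult f v) m =
    (\<lambda>\<theta>. complex_derivative X (\<lambda>p. f p \<theta>) m) \<odot>\<^bsub>fib E m\<^esub> v m \<oplus>\<^bsub>fib E m\<^esub> f m \<odot>\<^bsub>fib E m\<^esub> D X v m"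
  using D X assms unfolding module_connection_def sec_smult_def by blast

lemma cd_carrier: "smooth_loop_family M (points M) f \<Longrightarrow> m \<in> points M \<Longrightarrow>
    (\<lambda>\<theta>. complex_derivative X (\<lambda>p. f p \<theta>) m) \<in> carrier loop_ring"
  using loop_family_carrier[OF loop_family_cd[OF X] order_refl] by simp

lemma conn_add_section:
  assumes "v \<in> sections M E" "w \<in> sections M E"
  shows "D X (sec_add v w) = sec_add (D X v) (D X w)"
  by (rule sections_ext)
     (use assms in \<open>simp_all add: conn_section sec_add_section conn_add, simp add: sec_add_def\<close>)

lemma conn_leibniz_section:
  assumes f: "smooth_loop_family M (points M) f" and v: "v \<in> sections M E"
  shows "D X (sec_smult f v) =
    sec_add (sec_smult (\<lambda>p \<theta>. complex_derivative X (\<lambda>p. f p \<theta>) p) v) (sec_smult f (D X v))"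
proof (rule sections_ext)
  show "D X (sec_smult f v) \<in> sections M E" by (rule conn_section[OF sec_smult_section[OF f v]])
  show "sec_add (sec_smult (\<lambda>p \<theta>. complex_derivative X (\<lambda>p. f p \<theta>) p) v) (sec_smult f (D X v)) \<in> sections M E"
    by (intro sec_add_section sec_smult_section loop_family_cd[OF X] conn_section f v)
  fix p assume "p \<in> points M"
  then show "D X (sec_smult f v) p =
      sec_add (sec_smult (\<lambda>p \<theta>. complex_derivative X (\<lambda>p. f p \<theta>) p) v) (sec_smult f (D X v)) p"
    by (simp add: conn_leibniz[OF f v]) (simp add: sec_add_def sec_smult_def)
qed

context
  fixes m \<beta> i
  assumes m: "m \<in> points M" and \<beta>: "free_iso loop_ring (rank E) (fib E m) \<beta>" and i: "i < rank E"
begin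

lemma conn_add_coord: "v \<in> sections M E \<Longrightarrow> w \<in> sections M E \<Longrightarrow>
    \<beta> (D X (sec_add v w) m) i \<theta> = \<beta> (D X v m) i \<theta> + \<beta> (D X w m) i \<theta>"
  using conn_add[OF _ _ m] coord_add[OF m \<beta> conn_closed[OF _ m] conn_closed[OF _ m] i] by simp

lemma conn_leibniz_coord:
  assumes f: "smooth_loop_family M (points M) f" and v: "v \<in> sections M E"
  shows "\<beta> (D X (sec_smult f v) m) i \<theta> =
    complex_derivative X (\<lambda>p. f p \<theta>) m * \<beta> (v m) i \<theta> + f m \<theta> * \<beta> (D X v m) i \<theta>"
proof -
  have c: "f m \<in> carrier loop_ring" by (rule loop_family_carrier[OF f order_refl m])
  have vm: "v m \<in> carrier (fib E m)" by (rule section_closed[OF v m])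
  show ?thesis
    unfolding conn_leibniz[OF f v m]
      coord_add[OF m \<beta> fib_smult[OF m cd_carrier[OF f m] vm] fib_smult[OF m c conn_closed[OF v m]] i]
      coord_smult[OF m \<beta> cd_carrier[OF f m] vm i] coord_smult[OF m \<beta> c conn_closed[OF v m] i] by (rule refl)
qed

end

end

lemma sec_add_coord:
  assumes "m \<in> points M" "free_iso loop_ring (rank E) (fib E m) \<beta>" "i < rank E"
    "v \<in> sections M E" "w \<in> sections M E"
  shows "\<beta> (sec_add v w m) i \<theta> = \<beta> (v m) i \<theta> + \<beta> (w m) i \<theta>"
  using coord_add[OF assms(1,2) section_closed[OF assms(4,1)] section_closed[OF assms(5,1)] assms(3)] assms(1)
  by (simp add: sec_add_def)

lemma sec_smult_coord:
  assumes "m \<in> points M" "free_iso loop_ring (rank E) (fib E m) \<beta>" "i < rank E"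
    "smooth_loop_family M (points M) f" "v \<in> sections M E"
  shows "\<beta> (sec_smult f v m) i \<theta> = f m \<theta> * \<beta> (v m) i \<theta>"
  using coord_smult[OF assms(1,2) loop_family_carrier[OF assms(4) order_refl assms(1)] section_closed[OF assms(5,1)] assms(3)]
    assms(1) by (simp add: sec_smult_def)

context
  fixes \<phi>
  assumes \<phi>: "higgs_field M E \<phi>"
begin

lemma higgs_closed: "p \<in> points M \<Longrightarrow> e \<in> carrier (fib E p) \<Longrightarrow> \<phi> p e \<in> carrier (fib E p)"
  by (rule higgs_field_closed[OF \<phi>])

lemma sec_higgs_section: "v \<in> sections M E \<Longrightarrow> sec_higgs \<phi> v \<in> sections M E"
  using \<phi> unfolding higgs_field_def sec_higgs_def by blast

lemma higgs_add: "p \<in> points M \<Longrightarrow> e \<in> carrier (fib E p) \<Longrightarrow> e' \<in> carrier (fib E p) \<Longrightarrow>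
    \<phi> p (e \<oplus>\<^bsub>fib E p\<^esub> e') = \<phi> p e \<oplus>\<^bsub>fib E p\<^esub> \<phi> p e'"
  using \<phi> unfolding higgs_field_def by blast

lemma higgs_leibniz: "p \<in> points M \<Longrightarrow> e \<in> carrier (fib E p) \<Longrightarrow> f \<in> carrier loop_ring \<Longrightarrow>
    \<phi> p (f \<odot>\<^bsub>fib E p\<^esub> e) =
      (\<lambda>\<theta>. vector_derivative f (at \<theta>)) \<odot>\<^bsub>fib E p\<^esub> e \<oplus>\<^bsub>fib E p\<^esub> f \<odot>\<^bsub>fib E p\<^esub> \<phi> p e"
  using \<phi> unfolding higgs_field_def by blast

text \<open>A single loop is regarded as a family constant in the base point, so that the result on
  families applies.\<close>

lemma loop_derivative_closed:
  assumes "p \<in> points M" "f \<in> carrier loop_ring"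
  shows "(\<lambda>\<theta>. vector_derivative f (at \<theta>)) \<in> carrier loop_ring"
proof -
  have "smooth_fam M (points M) UNIV (\<lambda>_ :: 'm. f)"
    unfolding smooth_fam_def using assms(2)
    by (intro allI impI smooth_on_compose[OF _ smooth_on_linear[OF bounded_linear_snd], of UNIV])
       (auto simp: loop_ring_def)
  then have "smooth_loop_family M (points M) (\<lambda>_. f)" using assms(2) by (simp add: loop_family_iff loop_ring_def)
  from loop_family_carrier[OF loop_family_derivative[OF this order_refl] order_refl assms(1)] show ?thesis .
qed

context
  fixes p \<beta> i
  assumes p: "p \<in> points M" and \<beta>: "free_iso loop_ring (rank E) (fib E p) \<beta>" and i: "i < rank E"
begin

lemma higgs_add_coord: "e \<in> carrier (fib E p) \<Longrightarrow> e' \<in> carrier (fib E p) \<Longrightarrow>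
    \<beta> (\<phi> p (e \<oplus>\<^bsub>fib E p\<^esub> e')) i \<theta> = \<beta> (\<phi> p e) i \<theta> + \<beta> (\<phi> p e') i \<theta>"
  using coord_add[OF p \<beta> higgs_closed[OF p] higgs_closed[OF p] i] by (simp add: higgs_add[OF p])

lemma higgs_leibniz_coord:
  assumes e: "e \<in> carrier (fib E p)" and f: "f \<in> carrier loop_ring"
  shows "\<beta> (\<phi> p (f \<odot>\<^bsub>fib E p\<^esub> e)) i \<theta> = vector_derivative f (at \<theta>) * \<beta> e i \<theta> + f \<theta> * \<beta> (\<phi> p e) i \<theta>"
  unfolding higgs_leibniz[OF p e f]
    coord_add[OF p \<beta> fib_smult[OF p loop_derivative_closed[OF p f] e] fib_smult[OF p f higgs_closed[OF p e]] i]
    coord_smult[OF p \<beta> loop_derivative_closed[OF p f] e i] coord_smult[OF p \<beta> f higgs_closed[OF p e] i] by (rule refl)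

end

lemma sec_higgs_add:
  assumes "v \<in> sections M E" "w \<in> sections M E"
  shows "sec_higgs \<phi> (sec_add v w) = sec_add (sec_higgs \<phi> v) (sec_higgs \<phi> w)"
  by (rule sections_ext)
     (use assms in \<open>simp_all add: sec_higgs_section sec_add_section, simp add: sec_higgs_def sec_add_def higgs_add section_closed\<close>)

lemma sec_higgs_leibniz:
  assumes f: "smooth_loop_family M (points M) f" and v: "v \<in> sections M E"
  shows "sec_higgs \<phi> (sec_smult f v) =
    sec_add (sec_smult (\<lambda>p \<theta>. vector_derivative (f p) (at \<theta>)) v) (sec_smult f (sec_higgs \<phi> v))"
proof (rule sections_ext)
  show "sec_higgs \<phi> (sec_smult f v) \<in> sections M E" by (rule sec_higgs_section[OF sec_smult_section[OF f v]])
  show "sec_add (sec_smult (\<lambda>p \<theta>. vector_derivative (f p) (at \<theta>)) v) (sec_smult f (sec_higgs \<phi> v)) \<in> sections M E"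
    by (intro sec_add_section sec_smult_section loop_family_derivative[OF f order_refl] sec_higgs_section f v)
  fix p assume "p \<in> points M"
  then show "sec_higgs \<phi> (sec_smult f v) p =
      sec_add (sec_smult (\<lambda>p \<theta>. vector_derivative (f p) (at \<theta>)) v) (sec_smult f (sec_higgs \<phi> v)) p"
    using higgs_leibniz[OF _ section_closed[OF v] loop_family_carrier[OF f order_refl]]
    by (simp add: sec_add_def sec_smult_def sec_higgs_def)
qed

end

end

context local_frame
begin

text \<open>The squared cutoff is constant near \<open>p\<close>, and vector fields are
  local.\<close>

lemma cd_cutoff_square:
  assumes X: "X \<in> vector_fields M" and p: "p \<in> O'"
  shows "complex_derivative X (\<lambda>p. complex_of_real (\<rho> p * \<rho> p)) p = 0"
proof -
  have pM: "p \<in> points M" using p O_sub by blast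
  have s: "smooth_complex (\<lambda>p. complex_of_real (\<rho> p * \<rho> p))"
    using smooth_fun_mult[OF \<rho> \<rho>] const_smooth_funs[of 0 M] by (simp add: smooth_complex_def)
  have s1: "smooth_complex (\<lambda>_. 1)" using const_smooth_funs[of _ M] by (simp add: smooth_complex_def)
  have "complex_derivative X (\<lambda>p. complex_of_real (\<rho> p * \<rho> p)) p = complex_derivative X (\<lambda>_. 1) p"
    by (rule cd_local[OF X s s1 O'(1) p]) (simp add: \<rho>_1)
  then show ?thesis by (simp add: cd_const[OF X pM])
qed

text \<open>This is the form d + A of a connection, with the entries of A given by the derivatives
  of the frame. The vector field acts on global functions, hence the cut-off coordinates
  \<open>coef\<close> in the first term.\<close>

lemma conn_expansion:
  assumes D: "module_connection M E D" and X: "X \<in> vector_fields M" and v: "v \<in> sections M E"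
    and p: "p \<in> O'" and i: "i < rank E"
  shows "\<tau> p (D X v p) i \<theta> = complex_derivative X (\<lambda>p. coef v i p \<theta>) p +
    (\<Sum>k<rank E. \<tau> p (v p) k \<theta> * \<tau> p (D X (frame k) p) i \<theta>)"
proof -
  have pU: "p \<in> U" and pM: "p \<in> points M" using p O'(2) O_sub by auto
  show ?thesis
    by (rule frame_expansion[where L = "\<lambda>v. \<tau> p (D X v p) i \<theta>" and d = "\<lambda>f. complex_derivative X (\<lambda>p. f p \<theta>) p", OF p i v])
       (simp_all add: conn_add_coord[OF D X pM iso[OF pU] i] conn_leibniz_coord[OF D X pM iso[OF pU] i]
         cd_cutoff_square[OF X p] del: of_real_mult)
qed

text \<open>The same expansion with differentiation in \<theta>. A section through \<open>e\<close>
  is needed only as an intermediary; its cut-off coordinates at \<open>p\<close> are those of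
  \<open>e\<close>.\<close>

lemma higgs_expansion:
  assumes \<phi>: "higgs_field M E \<phi>" and p: "p \<in> O'" and e: "e \<in> carrier (fib E p)" and i: "i < rank E"
  shows "\<tau> p (\<phi> p e) i \<theta> = vector_derivative (\<tau> p e i) (at \<theta>) +
    (\<Sum>k<rank E. \<tau> p e k \<theta> * \<tau> p (\<phi> p (frame k p)) i \<theta>)"
proof -
  have pU: "p \<in> U" and pM: "p \<in> points M" using p O'(2) O_sub by auto
  obtain v where v: "v \<in> sections M E" "v p = e" using section_through[OF p e] by blast
  have "\<tau> p (\<phi> p (v p)) i \<theta> = vector_derivative (coef v i p) (at \<theta>) +
    (\<Sum>k<rank E. \<tau> p (v p) k \<theta> * \<tau> p (\<phi> p (frame k p)) i \<theta>)"
  proof (rule frame_expansion[where L = "\<lambda>v. \<tau> p (\<phi> p (v p)) i \<theta>" and d = "\<lambda>f. vector_derivative (f p) (at \<theta>)", OF p i v(1)])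
    show "\<tau> p (\<phi> p (sec_add v w p)) i \<theta> = \<tau> p (\<phi> p (v p)) i \<theta> + \<tau> p (\<phi> p (w p)) i \<theta>"
      if "v \<in> sections M E" "w \<in> sections M E" for v w
      using higgs_add_coord[OF \<phi> pM iso[OF pU] i section_closed[OF that(1) pM] section_closed[OF that(2) pM]] pM
      by (simp add: sec_add_def)
    show "\<tau> p (\<phi> p (sec_smult f v p)) i \<theta> =
        vector_derivative (f p) (at \<theta>) * \<tau> p (v p) i \<theta> + f p \<theta> * \<tau> p (\<phi> p (v p)) i \<theta>"
      if "smooth_loop_family M (points M) f" "v \<in> sections M E" for f v
      using higgs_leibniz_coord[OF \<phi> pM iso[OF pU] i section_closed[OF that(2) pM] loop_family_carrier[OF that(1) order_refl pM]] pM
      by (simp add: sec_smult_def)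
  qed simp
  moreover have "coef v i p = \<tau> p e i" using pU \<rho>_1[OF p] v(2) by (simp add: coef_def)
  ultimately show ?thesis using v(2) by simp
qed

text \<open>The case of an operator linear over functions, where no derivative of coefficients
  occurs: such an operator is given by a matrix on the values at \<open>p\<close>.\<close>

lemma tensorial_expansion:
  assumes p: "p \<in> O'" and i: "i < rank E" and v: "v \<in> sections M E"
    and "\<And>v w. v \<in> sections M E \<Longrightarrow> w \<in> sections M E \<Longrightarrow> L (sec_add v w) = L v + L w"
    and "\<And>f v. smooth_loop_family M (points M) f \<Longrightarrow> v \<in> sections M E \<Longrightarrow> L (sec_smult f v) = f p \<theta> * L v"
  shows "L v = (\<Sum>k<rank E. \<tau> p (v p) k \<theta> * L (frame k))"
  using frame_expansion[of p i v L "\<lambda>_. 0" \<theta>] assms by simp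

text \<open>For a section multiplied by f the mixed terms are symmetric in X and Y and cancel; what
  remains is X(Yf) - Y(Xf) - [X,Y]f = 0.\<close>

lemma curvature_tensorial:
  assumes D: "module_connection M E D" and X: "X \<in> vector_fields M" and Y: "Y \<in> vector_fields M"
    and v: "v \<in> sections M E" and p: "p \<in> O'" and i: "i < rank E"
  shows "\<tau> p (curvature (points M) (fib E) D X Y v p) i \<theta> =
    (\<Sum>k<rank E. \<tau> p (v p) k \<theta> * \<tau> p (curvature (points M) (fib E) D X Y (frame k) p) i \<theta>)"
proof (rule tensorial_expansion[where L = "\<lambda>v. \<tau> p (curvature (points M) (fib E) D X Y v p) i \<theta>", OF p i v])
  have pU: "p \<in> U" and pM: "p \<in> points M" using p O'(2) O_sub by auto
  note b = iso[OF pU]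
  have XY: "lie_bracket X Y \<in> vector_fields M" by (rule lie_bracket_vector_field[OF X Y])
  note s = conn_section[OF D X] conn_section[OF D Y] conn_section[OF D XY]
  have c: "\<tau> p (curvature (points M) (fib E) D X Y v p) i \<theta> =
      \<tau> p (D X (D Y v) p) i \<theta> - \<tau> p (D Y (D X v) p) i \<theta> - \<tau> p (D (lie_bracket X Y) v p) i \<theta>"
    if "v \<in> sections M E" for v
  proof -
    have k: "D X (D Y v) p \<in> carrier (fib E p)" "D Y (D X v) p \<in> carrier (fib E p)" "D (lie_bracket X Y) v p \<in> carrier (fib E p)"
      using that s by (auto intro: section_closed[OF _ pM])
    show ?thesis unfolding curvature_def restrict_apply if_P[OF pM]
      coord_minus[OF pM b fib_minus[OF pM k(1,2)] k(3) i] coord_minus[OF pM b k(1,2) i] by (rule refl)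
  qed
  show "\<tau> p (curvature (points M) (fib E) D X Y (sec_add v w) p) i \<theta> =
      \<tau> p (curvature (points M) (fib E) D X Y v p) i \<theta> + \<tau> p (curvature (points M) (fib E) D X Y w p) i \<theta>"
    if "v \<in> sections M E" "w \<in> sections M E" for v w
    using that s by (simp add: c sec_add_section conn_add_section[OF D X] conn_add_section[OF D Y]
      sec_add_coord[OF pM b i] conn_add_coord[OF D XY pM b i])
  show "\<tau> p (curvature (points M) (fib E) D X Y (sec_smult f v) p) i \<theta> =
      f p \<theta> * \<tau> p (curvature (points M) (fib E) D X Y v p) i \<theta>"
    if f: "smooth_loop_family M (points M) f" and v: "v \<in> sections M E" for f v
    using f v s by (simp add: c sec_add_section sec_smult_section loop_family_cd[OF X] loop_family_cd[OF Y]
      conn_leibniz_section[OF D X] conn_leibniz_section[OF D Y]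
      sec_add_coord[OF pM b i] sec_smult_coord[OF pM b i] conn_add_section[OF D X] conn_add_section[OF D Y]
      conn_leibniz_coord[OF D XY pM b i]
      cd_lie_bracket algebra_simps)
qed

text \<open>For a section multiplied by f the first-order terms cancel in pairs, and the
  second-order term is the difference of the two mixed derivatives of f along X and
  \<theta>.\<close>

lemma higgs_derivative_tensorial:
  assumes D: "module_connection M E D" and \<phi>: "higgs_field M E \<phi>" and X: "X \<in> vector_fields M"
    and v: "v \<in> sections M E" and p: "p \<in> O'" and i: "i < rank E"
  shows "\<tau> p (higgs_derivative (points M) (fib E) D \<phi> X v p) i \<theta> =
    (\<Sum>k<rank E. \<tau> p (v p) k \<theta> * \<tau> p (higgs_derivative (points M) (fib E) D \<phi> X (frame k) p) i \<theta>)"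
proof (rule tensorial_expansion[where L = "\<lambda>v. \<tau> p (higgs_derivative (points M) (fib E) D \<phi> X v p) i \<theta>", OF p i v])
  have pU: "p \<in> U" and pM: "p \<in> points M" using p O'(2) O_sub by auto
  note b = iso[OF pU]
  note s = conn_section[OF D X] sec_higgs_section[OF \<phi>]
  have c: "\<tau> p (higgs_derivative (points M) (fib E) D \<phi> X v p) i \<theta> =
      \<tau> p (D X (sec_higgs \<phi> v) p) i \<theta> - \<tau> p (\<phi> p (D X v p)) i \<theta>" if "v \<in> sections M E" for v
  proof -
    have k: "D X (sec_higgs \<phi> v) p \<in> carrier (fib E p)" "\<phi> p (D X v p) \<in> carrier (fib E p)"
      using that s by (auto intro!: section_closed[OF _ pM] higgs_closed[OF \<phi> pM])
    show ?thesis unfolding higgs_derivative_def restrict_apply if_P[OF pM] sec_higgs_def[symmetric]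
      coord_minus[OF pM b k i] by (rule refl)
  qed
  show "\<tau> p (higgs_derivative (points M) (fib E) D \<phi> X (sec_add v w) p) i \<theta> =
      \<tau> p (higgs_derivative (points M) (fib E) D \<phi> X v p) i \<theta> + \<tau> p (higgs_derivative (points M) (fib E) D \<phi> X w p) i \<theta>"
    if "v \<in> sections M E" "w \<in> sections M E" for v w
    unfolding c[OF that(1)] c[OF that(2)] c[OF sec_add_section[OF that]] sec_higgs_add[OF \<phi> that]
      conn_add[OF D X that pM] conn_add_coord[OF D X pM b i s(2)[OF that(1)] s(2)[OF that(2)]]
      higgs_add_coord[OF \<phi> pM b i conn_closed[OF D X that(1) pM] conn_closed[OF D X that(2) pM]] by simp
  show "\<tau> p (higgs_derivative (points M) (fib E) D \<phi> X (sec_smult f v) p) i \<theta> =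
      f p \<theta> * \<tau> p (higgs_derivative (points M) (fib E) D \<phi> X v p) i \<theta>"
    if f: "smooth_loop_family M (points M) f" and v: "v \<in> sections M E" for f v
  proof -
    have f': "smooth_loop_family M (points M) (\<lambda>p \<theta>. vector_derivative (f p) (at \<theta>))"
      by (rule loop_family_derivative[OF f order_refl])
    have fd: "(f q has_vector_derivative vector_derivative (f q) (at \<theta>)) (at \<theta>)" if "q \<in> points M" for q
      by (rule loop_has_derivative[OF loop_family_carrier[OF f order_refl that]])
    \<comment> \<open>The only analytic ingredient: differentiation along \<open>X\<close> commutes
      with differentiation in the angle.\<close>
    have "((\<lambda>u. complex_derivative X (\<lambda>p. f p (\<theta> + (u - \<theta>) *\<^sub>R 1)) p) has_vector_derivative
        complex_derivative X (\<lambda>p. vector_derivative (f p) (at \<theta>)) p) (at \<theta>)"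
    proof (rule cd_commute[OF X])
      show "smooth_fam M (points M) UNIV f" using f by (simp add: loop_family_iff)
      show "smooth_complex (\<lambda>p. vector_derivative (f p) (at \<theta>))"
        using f' by (auto simp: loop_family_iff intro: smooth_complex_of_fam)
    qed (use fd pM in auto)
    then have comm: "vector_derivative (\<lambda>u. complex_derivative X (\<lambda>p. f p u) p) (at \<theta>) =
        complex_derivative X (\<lambda>p. vector_derivative (f p) (at \<theta>)) p"
      by (simp add: vector_derivative_at)
    have vp: "v p \<in> carrier (fib E p)" by (rule section_closed[OF v pM])
    have fp: "f p \<in> carrier loop_ring" by (rule loop_family_carrier[OF f order_refl pM])
    have Dp: "D X v p \<in> carrier (fib E p)" by (rule conn_closed[OF D X v pM])
    note Xf = cd_carrier[OF D X f pM]
    have "\<tau> p (\<phi> p (D X (sec_smult f v) p)) i \<theta> =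
        complex_derivative X (\<lambda>p. vector_derivative (f p) (at \<theta>)) p * \<tau> p (v p) i \<theta> +
        complex_derivative X (\<lambda>p. f p \<theta>) p * \<tau> p (\<phi> p (v p)) i \<theta> +
        (vector_derivative (f p) (at \<theta>) * \<tau> p (D X v p) i \<theta> + f p \<theta> * \<tau> p (\<phi> p (D X v p)) i \<theta>)"
      unfolding conn_leibniz[OF D X f v pM]
        higgs_add_coord[OF \<phi> pM b i fib_smult[OF pM Xf vp] fib_smult[OF pM fp Dp]]
        higgs_leibniz_coord[OF \<phi> pM b i vp Xf] higgs_leibniz_coord[OF \<phi> pM b i Dp fp] comm by (rule refl)
    moreover have "\<tau> p (D X (sec_higgs \<phi> (sec_smult f v)) p) i \<theta> =
        complex_derivative X (\<lambda>p. vector_derivative (f p) (at \<theta>)) p * \<tau> p (v p) i \<theta> +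
        vector_derivative (f p) (at \<theta>) * \<tau> p (D X v p) i \<theta> +
        (complex_derivative X (\<lambda>p. f p \<theta>) p * \<tau> p (sec_higgs \<phi> v p) i \<theta> + f p \<theta> * \<tau> p (D X (sec_higgs \<phi> v) p) i \<theta>)"
      unfolding sec_higgs_leibniz[OF \<phi> f v]
        conn_add_coord[OF D X pM b i sec_smult_section[OF f' v] sec_smult_section[OF f s(2)[OF v]]]
        conn_leibniz_coord[OF D X pM b i f' v] conn_leibniz_coord[OF D X pM b i f s(2)[OF v]] by (rule refl)
    moreover have "sec_higgs \<phi> v p = \<phi> p (v p)" using pM by (simp add: sec_higgs_def)
    ultimately show ?thesis unfolding c[OF sec_smult_section[OF f v]] c[OF v] by (simp add: algebra_simps)
  qed
qed

abbreviation loop_represents :: "'m \<Rightarrow> real \<Rightarrow> ('e \<Rightarrow> 'e) \<Rightarrow> cmatrix \<Rightarrow> bool" where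
  "loop_represents p \<theta> \<equiv> evaluation.represents (\<lambda>f. f \<theta>) (rank E) (fib E p) (\<tau> p)"

lemma loop_represents_def: "p \<in> points M \<Longrightarrow> loop_represents p \<theta> T A \<longleftrightarrow>
    (\<forall>v\<in>carrier (fib E p). T v \<in> carrier (fib E p) \<and>
      (\<forall>i<rank E. \<tau> p (T v) i \<theta> = (\<Sum>k<rank E. A i k * \<tau> p v k \<theta>)))"
  by (rule evaluation.represents_def[OF evaluation_loop[OF omega_module_closed(1)[OF om]]])

text \<open>\<open>at_point\<close> picks some section through the given element. The coordinates of
  \<open>T v\<close> depend on the value of \<open>v\<close> at \<open>p\<close> alone, so the
  choice has no influence on them.\<close>

lemma at_point_represents:
  assumes p: "p \<in> O'"
    and T: "\<And>v. v \<in> sections M E \<Longrightarrow> T v p \<in> carrier (fib E p)"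
      "\<And>v i. v \<in> sections M E \<Longrightarrow> i < rank E \<Longrightarrow> \<tau> p (T v p) i \<theta> = (\<Sum>k<rank E. A i k * \<tau> p (v p) k \<theta>)"
  shows "loop_represents p \<theta> (at_point (sections M E) T p) A"
proof -
  have pM: "p \<in> points M" using p O_sub by blast
  have "at_point (sections M E) T p e \<in> carrier (fib E p) \<and>
      (\<forall>i<rank E. \<tau> p (at_point (sections M E) T p e) i \<theta> = (\<Sum>k<rank E. A i k * \<tau> p e k \<theta>))"
    if e: "e \<in> carrier (fib E p)" for e
  proof -
    define s where "s = (SOME s. s \<in> sections M E \<and> s p = e)"
    obtain v where "v \<in> sections M E \<and> v p = e" using section_through[OF p e] by metis
    then have "s \<in> sections M E \<and> s p = e"
      unfolding s_def by (rule someI[of "\<lambda>s. s \<in> sections M E \<and> s p = e"])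
    then show ?thesis using T(1)[of s] T(2)[of s] unfolding at_point_def s_def[symmetric] by simp
  qed
  then show ?thesis by (simp add: loop_represents_def[OF pM])
qed

end

section \<open>Sections over \<open>M \<times> [0,1]\<close>\<close>

lemma smooth_on_Pair_left: "smooth_on S (\<lambda>y. (c, y))"
  by (rule smooth_on_Pair[OF smooth_on_const smooth_on_linear[OF bounded_linear_ident]])

lemma at_within_unit: "t \<in> {0..1} \<Longrightarrow> at t within {0..1::real} \<noteq> bot"
  by (simp add: trivial_limit_within islimpt_Icc)

text \<open>On the closed strip the derivative in t is one-sided at the ends. Near the point both
  partial derivatives agree with those of a smooth extension \<open>G\<close>, and for
  \<open>G\<close> mixed derivatives commute.\<close>

lemma mixed_partials_strip:
  fixes g :: "real \<times> real \<Rightarrow> complex"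
  assumes g: "smooth_on ({0..1} \<times> UNIV) g" and t: "t \<in> {0..1}"
    and g1: "\<And>\<theta>'. ((\<lambda>u. g (u, \<theta>')) has_vector_derivative g1 \<theta>') (at t within {0..1})"
  shows "((\<lambda>u. vector_derivative (\<lambda>\<theta>. g (u, \<theta>)) (at \<theta>)) has_vector_derivative
    vector_derivative g1 (at \<theta>)) (at t within {0..1})"
proof -
  obtain U G where U: "open U" "(t, \<theta>) \<in> U" "\<And>k. C_k_on k U G"
    "\<And>y. y \<in> {0..1} \<times> UNIV \<Longrightarrow> y \<in> U \<Longrightarrow> g y = G y"
    by (rule smooth_onE[OF g, of "(t, \<theta>)"]) (use t in blast)+
  define G2 where "G2 z = frechet_derivative G (at z) (0, 1)" for z
  define G1 where "G1 z = frechet_derivative G (at z) (1, 0)" for z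
  have C1: "C_k_on k U G1" and C2: "C_k_on k U G2" for k
    using U(3)[of "Suc k"] by (auto simp: G1_def[abs_def] G2_def[abs_def])
  have vert: "((\<lambda>v. H (u, v)) has_vector_derivative frechet_derivative H (at (u, v0)) (0, 1)) (at v0)"
    if "(u, v0) \<in> U" "\<And>k. C_k_on k U H" for u v0 and H :: "real \<times> real \<Rightarrow> complex"
    using has_vector_derivative_along[OF that(2,1), of v0 "(0, 1)" UNIV] by simp
  have hor: "((\<lambda>u. H (u, v)) has_vector_derivative frechet_derivative H (at (u0, v)) (1, 0)) (at u0 within {0..1})"
    if "(u0, v) \<in> U" "\<And>k. C_k_on k U H" for u0 v and H :: "real \<times> real \<Rightarrow> complex"
    using has_vector_derivative_along[OF that(2,1), of u0 "(1, 0)" "{0..1}"] by simp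
  obtain \<delta> where \<delta>: "\<delta> > 0" "\<And>u. dist u t < \<delta> \<Longrightarrow> (u, \<theta>) \<in> U"
    using eventually_along[OF U(1,2), of t "(1, 0)"] by auto
  obtain \<epsilon> where \<epsilon>: "\<epsilon> > 0" "\<And>v. dist v \<theta> < \<epsilon> \<Longrightarrow> (t, v) \<in> U"
    using eventually_along[OF U(1,2), of \<theta> "(0, 1)"] by auto
  have d2: "vector_derivative (\<lambda>\<theta>. g (u, \<theta>)) (at \<theta>) = G2 (u, \<theta>)" if u: "u \<in> {0..1}" "(u, \<theta>) \<in> U" for u
  proof (rule vector_derivative_at)
    obtain \<eta> where \<eta>: "\<eta> > 0" "\<And>v. dist v \<theta> < \<eta> \<Longrightarrow> (u, v) \<in> U"
      using eventually_along[OF U(1) u(2), of \<theta> "(0, 1)"] by auto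
    show "((\<lambda>\<theta>. g (u, \<theta>)) has_vector_derivative G2 (u, \<theta>)) (at \<theta>)"
      unfolding G2_def
      by (rule has_vector_derivative_transform_within[OF vert[OF u(2) U(3)] \<eta>(1)]) (use U(4) \<eta>(2) u(1) in auto)
  qed
  \<comment> \<open>The derivative \<open>g1\<close> is given pointwise; identifying it with a
    partial derivative of \<open>G\<close> is what makes it differentiable in the angle.\<close>
  have g1_eq: "g1 v = G1 (t, v)" if v: "(t, v) \<in> U" for v
  proof (rule vector_derivative_unique_within[OF at_within_unit[OF t] g1])
    obtain \<eta> where \<eta>: "\<eta> > 0" "\<And>u. dist u t < \<eta> \<Longrightarrow> (u, v) \<in> U"
      using eventually_along[OF U(1) v, of t "(1, 0)"] by auto
    show "((\<lambda>u. g (u, v)) has_vector_derivative G1 (t, v)) (at t within {0..1})"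
      unfolding G1_def
      by (rule has_vector_derivative_transform_within[OF hor[OF v U(3)] \<eta>(1) t]) (use U(4) \<eta>(2) in auto)
  qed
  have "(g1 has_vector_derivative frechet_derivative G1 (at (t, \<theta>)) (0, 1)) (at \<theta>)"
    by (rule has_vector_derivative_transform_within[OF vert[OF U(2) C1] \<epsilon>(1)]) (simp_all add: g1_eq \<epsilon>(2))
  then have "vector_derivative g1 (at \<theta>) = frechet_derivative G1 (at (t, \<theta>)) (0, 1)"
    by (rule vector_derivative_at)
  also have "\<dots> = frechet_derivative G2 (at (t, \<theta>)) (1, 0)"
    unfolding G1_def[abs_def] G2_def[abs_def] by (rule C_k_on_mixed_derivatives[OF U(1,2,3)])
  finally have eq: "vector_derivative g1 (at \<theta>) = frechet_derivative G2 (at (t, \<theta>)) (1, 0)" .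
  show ?thesis unfolding eq
    by (rule has_vector_derivative_transform_within[OF hor[OF U(2) C2] \<delta>(1) t]) (simp add: d2 \<delta>(2))
qed

section \<open>Families over the strip [0,1] \<times> \<real>\<close>

context corner_manifold
begin

abbreviation strip :: "(real \<times> real) set" where
  "strip \<equiv> {0..1} \<times> UNIV"

definition tder :: "('m \<Rightarrow> real \<times> real \<Rightarrow> complex) \<Rightarrow> 'm \<Rightarrow> real \<times> real \<Rightarrow> complex" where
  "tder f p q = vector_derivative (\<lambda>u. f p (u, snd q)) (at (fst q) within {0..1})"

lemma tder_works:
  assumes f: "smooth_fam M W strip f" "W \<subseteq> points M" and p: "p \<in> W" and t: "t \<in> {0..1}"
  shows "((\<lambda>u. f p (u, \<theta>)) has_vector_derivative tder f p (t, \<theta>)) (at t within {0..1})"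
proof -
  have "\<exists>d. ((\<lambda>u. f p ((t, \<theta>) + (u - t) *\<^sub>R (1, 0))) has_vector_derivative d) (at t within {0..1})"
    by (rule smooth_fam_differentiable[OF f p]) (use t in auto)
  then obtain d where "((\<lambda>u. f p ((t, \<theta>) + (u - t) *\<^sub>R (1, 0))) has_vector_derivative d) (at t within {0..1})"
    by (elim exE)
  then have d: "((\<lambda>u. f p (u, \<theta>)) has_vector_derivative d) (at t within {0..1})" by simp
  then show ?thesis unfolding tder_def fst_conv snd_conv
    using vector_derivative_within[OF at_within_unit[OF t] d] by simp
qed

lemma tder_smooth:
  assumes f: "smooth_fam M W strip f" "W \<subseteq> points M"
  shows "smooth_fam M W strip (tder f)"
proof (rule smooth_fam_derivative[where e = "(1, 0)", OF f(1)])
  fix p and q :: "real \<times> real" assume p: "p \<in> W" and q: "q \<in> strip"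
  then show "\<exists>T u0. u0 \<in> T \<and> at u0 within T \<noteq> bot \<and> (\<forall>u\<in>T. q + (u - u0) *\<^sub>R (1, 0) \<in> strip) \<and>
      ((\<lambda>u. f p (q + (u - u0) *\<^sub>R (1, 0))) has_vector_derivative tder f p q) (at u0 within T)"
    using tder_works[OF f p, of "fst q" "snd q"] at_within_unit[of "fst q"]
    by (intro exI[of _ "{0..1}"] exI[of _ "fst q"]) (simp add: plus_prod_def mem_Times_iff)
qed

lemma angle_derivative_works:
  assumes f: "smooth_fam M W strip f" "W \<subseteq> points M" and p: "p \<in> W" and t: "t \<in> {0..1}"
  shows "(((\<lambda>\<theta>. f p (t, \<theta>))) has_vector_derivative vector_derivative (\<lambda>\<theta>. f p (t, \<theta>)) (at \<theta>)) (at \<theta>)"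
proof -
  have "\<exists>d. ((\<lambda>u. f p ((t, \<theta>) + (u - \<theta>) *\<^sub>R (0, 1))) has_vector_derivative d) (at \<theta> within UNIV)"
    by (rule smooth_fam_differentiable[OF f p]) (use t in auto)
  then obtain d where "((\<lambda>u. f p ((t, \<theta>) + (u - \<theta>) *\<^sub>R (0, 1))) has_vector_derivative d) (at \<theta>)" by (elim exE)
  then have d: "((\<lambda>u. f p (t, u)) has_vector_derivative d) (at \<theta>)" by simp
  then show ?thesis using vector_derivative_at[OF d] by simp
qed

lemma angle_derivative_smooth:
  assumes f: "smooth_fam M W strip f" "W \<subseteq> points M"
  shows "smooth_fam M W strip (\<lambda>p q. vector_derivative (\<lambda>\<theta>. f p (fst q, \<theta>)) (at (snd q)))"
proof (rule smooth_fam_derivative[where e = "(0, 1)", OF f(1)])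
  fix p and q :: "real \<times> real" assume p: "p \<in> W" and q: "q \<in> strip"
  then show "\<exists>T u0. u0 \<in> T \<and> at u0 within T \<noteq> bot \<and> (\<forall>u\<in>T. q + (u - u0) *\<^sub>R (0, 1) \<in> strip) \<and>
      ((\<lambda>u. f p (q + (u - u0) *\<^sub>R (0, 1))) has_vector_derivative
        vector_derivative (\<lambda>\<theta>. f p (fst q, \<theta>)) (at (snd q))) (at u0 within T)"
    using angle_derivative_works[OF f p, of "fst q" "snd q"]
    by (intro exI[of _ UNIV] exI[of _ "snd q"]) (simp add: plus_prod_def mem_Times_iff)
qed

lemma points_times_interval: "points (times_interval M) = points M \<times> {0..1}"
  by (simp add: times_interval_def)

text \<open>Serves both kinds of chart of the cylinder: \<open>h\<close> is the identity or 1 - t,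
  an involution in either case, and reparametrises the interval coordinate.\<close>

lemma smooth_on_cylinder_chart:
  fixes h :: "real \<Rightarrow> real" and f :: "'m \<times> real \<Rightarrow> real \<Rightarrow> complex"
  assumes U: "(U, \<phi>) \<in> charts M" and h: "\<And>S. smooth_on S h" "\<And>t. h (h t) = t"
  shows "smooth_on ((\<lambda>(m, t). (\<phi> m, h t)) ` ((U \<times> T) \<inter> (W \<times> {0..1})) \<times> UNIV)
      (\<lambda>z. f (inv_into (U \<times> T) (\<lambda>(m, t). (\<phi> m, h t)) (fst z)) (snd z)) \<longleftrightarrow>
    smooth_on (\<phi> ` (U \<inter> W) \<times> ((T \<inter> {0..1}) \<times> UNIV))
      (\<lambda>z. f (inv_into U \<phi> (fst z), fst (snd z)) (snd (snd z)))"
    (is "smooth_on ?S ?g \<longleftrightarrow> smooth_on ?S' ?g'")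
proof -
  let ?\<phi> = "\<lambda>(m, t). (\<phi> m, h t)"
  have inj: "inj_on ?\<phi> (U \<times> T)"
  proof (rule inj_onI, clarify)
    fix m t m' t' assume m: "m \<in> U" "m' \<in> U" "\<phi> m = \<phi> m'" and t: "h t = h t'"
    have "t = t'" using arg_cong[OF t, of h] unfolding h(2) .
    then show "m = m' \<and> t = t'" using inj_onD[OF chart_inj[OF U] m(3,1,2)] by simp
  qed
  have inv: "inv_into (U \<times> T) ?\<phi> (\<phi> m, h t) = (m, t)" if "m \<in> U" "t \<in> T" for m t
    using inv_into_f_f[OF inj, of "(m, t)"] that by simp
  show ?thesis
  proof
    assume g: "smooth_on ?S ?g"
    have 1: "smooth_on ?S' (\<lambda>z. ((fst z, h (fst (snd z))), snd (snd z)))"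
      by (intro smooth_on_Pair smooth_on_linear bounded_linear_fst smooth_on_compose[OF h(1)[of UNIV]]
          bounded_linear_compose[OF bounded_linear_fst bounded_linear_snd]
          bounded_linear_compose[OF bounded_linear_snd bounded_linear_snd]) auto
    have 2: "(\<lambda>z. ((fst z, h (fst (snd z))), snd (snd z))) ` ?S' \<subseteq> ?S" by force
    show "smooth_on ?S' ?g'"
      by (rule smooth_on_cong[OF smooth_on_compose[OF g 1 2]]) (auto simp: inv chart_inv[OF U])
  next
    assume g': "smooth_on ?S' ?g'"
    have 1: "smooth_on ?S (\<lambda>z. (fst (fst z), (h (snd (fst z)), snd z)))"
      by (intro smooth_on_Pair smooth_on_linear bounded_linear_snd smooth_on_compose[OF h(1)[of UNIV]]
          bounded_linear_compose[OF bounded_linear_fst bounded_linear_fst]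
          bounded_linear_compose[OF bounded_linear_snd bounded_linear_fst]) auto
    have 2: "(\<lambda>z. (fst (fst z), (h (snd (fst z)), snd z))) ` ?S \<subseteq> ?S'" by (auto simp: h(2))
    show "smooth_on ?S ?g"
      by (rule smooth_on_cong[OF smooth_on_compose[OF g' 1 2]]) (auto simp: inv chart_inv[OF U] h(2))
  qed
qed

text \<open>Trades smoothness over the cylinder for smoothness over \<open>M\<close> with t as an
  additional parameter, where the calculus of families is available. The charts cover
  [0,1) and (0,1], which are relatively open in [0,1], so smoothness on both pieces
  suffices.\<close>

lemma loop_family_times_interval_iff:
  "smooth_loop_family (times_interval M) (W \<times> {0..1}) f \<longleftrightarrow>
    smooth_fam M W strip (\<lambda>p q. f (p, fst q) (snd q)) \<and>
    (\<forall>p\<in>W. \<forall>t\<in>{0..1}. \<forall>\<theta>. f (p, t) (\<theta> + 2 * pi) = f (p, t) \<theta>)"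
proof -
  let ?g = "\<lambda>\<phi> U z. f (inv_into U \<phi> (fst z), fst (snd z)) (snd (snd z))"
  have id: "smooth_on S (\<lambda>t::real. t)" and flip: "smooth_on S (\<lambda>t::real. 1 - t)" for S
  proof -
    show id: "smooth_on S (\<lambda>t::real. t)" by (rule smooth_on_linear[OF bounded_linear_ident])
    have "smooth_on S (\<lambda>t::real. 1 + (- 1) * t)"
      by (intro smooth_on_add smooth_on_const smooth_on_bilinear[OF bounded_bilinear_mult] id)
    then show "smooth_on S (\<lambda>t::real. 1 - t)" by simp
  qed
  have "(\<forall>(V, \<psi>)\<in>charts (times_interval M).
      smooth_on (\<psi> ` (V \<inter> W \<times> {0..1}) \<times> UNIV) (\<lambda>(x, \<theta>). f (inv_into V \<psi> x) \<theta>)) \<longleftrightarrow>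
    (\<forall>(U, \<phi>)\<in>charts M.
      smooth_on (\<phi> ` (U \<inter> W) \<times> (({0..<1} \<inter> {0..1}) \<times> UNIV)) (?g \<phi> U) \<and>
      smooth_on (\<phi> ` (U \<inter> W) \<times> (({0<..1} \<inter> {0..1}) \<times> UNIV)) (?g \<phi> U))"
    (is "?L \<longleftrightarrow> ?R")
  proof -
    have "?L \<longleftrightarrow> (\<forall>(U, \<phi>)\<in>charts M.
      smooth_on ((\<lambda>(m, t). (\<phi> m, t)) ` ((U \<times> {0..<1}) \<inter> (W \<times> {0..1})) \<times> UNIV)
        (\<lambda>z. f (inv_into (U \<times> {0..<1}) (\<lambda>(m, t). (\<phi> m, t)) (fst z)) (snd z)) \<and>
      smooth_on ((\<lambda>(m, t). (\<phi> m, 1 - t)) ` ((U \<times> {0<..1}) \<inter> (W \<times> {0..1})) \<times> UNIV)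
        (\<lambda>z. f (inv_into (U \<times> {0<..1}) (\<lambda>(m, t). (\<phi> m, 1 - t)) (fst z)) (snd z)))"
      unfolding times_interval_def manifold.simps ball_Un Ball_image_comp o_def case_prod_unfold fst_conv snd_conv
      by blast
    also have "\<dots> \<longleftrightarrow> ?R"
      by (intro ball_cong refl)
         (auto simp: smooth_on_cylinder_chart[OF _ id refl] smooth_on_cylinder_chart[OF _ flip])
    finally show ?thesis .
  qed
  also have "\<dots> \<longleftrightarrow> smooth_fam M W strip (\<lambda>p q. f (p, fst q) (snd q))"
  proof
    assume R: ?R
    show "smooth_fam M W strip (\<lambda>p q. f (p, fst q) (snd q))"
      unfolding smooth_fam_def
    proof (intro allI impI)
      fix U \<phi> assume U: "(U, \<phi>) \<in> charts M"
      have s1: "smooth_on (\<phi> ` (U \<inter> W) \<times> (({0..<1} \<inter> {0..1}) \<times> UNIV)) (?g \<phi> U)"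
        and s2: "smooth_on (\<phi> ` (U \<inter> W) \<times> (({0<..1} \<inter> {0..1}) \<times> UNIV)) (?g \<phi> U)"
        using bspec[OF R U] by simp_all
      show "smooth_on (\<phi> ` (U \<inter> W) \<times> strip) (?g \<phi> U)"
      proof (rule smooth_on_local)
        fix z assume z: "z \<in> \<phi> ` (U \<inter> W) \<times> strip"
        have o1: "open (UNIV \<times> {..<1::real} \<times> (UNIV :: real set) :: ('a \<times> real \<times> real) set)"
          and o2: "open (UNIV \<times> {0<..} \<times> UNIV :: ('a \<times> real \<times> real) set)"
          by (intro open_Times open_UNIV open_lessThan open_greaterThan)+
        show "\<exists>W'. open W' \<and> z \<in> W' \<and> smooth_on (\<phi> ` (U \<inter> W) \<times> strip \<inter> W') (?g \<phi> U)"
        proof (cases "fst (snd z) < 1")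
          case True
          have "smooth_on (\<phi> ` (U \<inter> W) \<times> strip \<inter> UNIV \<times> {..<1} \<times> UNIV) (?g \<phi> U)"
            by (rule smooth_on_subset[OF s1]) auto
          then show ?thesis using o1 True by (intro exI[of _ "UNIV \<times> {..<1} \<times> UNIV"]) (auto simp: mem_Times_iff)
        next
          case False
          have "smooth_on (\<phi> ` (U \<inter> W) \<times> strip \<inter> UNIV \<times> {0<..} \<times> UNIV) (?g \<phi> U)"
            by (rule smooth_on_subset[OF s2]) auto
          then show ?thesis using o2 False by (intro exI[of _ "UNIV \<times> {0<..} \<times> UNIV"]) (auto simp: mem_Times_iff)
        qed
      qed
    qed
  next
    assume s: "smooth_fam M W strip (\<lambda>p q. f (p, fst q) (snd q))"
    show ?R
    proof (clarify, intro conjI)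
      fix U \<phi> assume U: "(U, \<phi>) \<in> charts M"
      show "smooth_on (\<phi> ` (U \<inter> W) \<times> (({0..<1} \<inter> {0..1}) \<times> UNIV)) (?g \<phi> U)"
        by (rule smooth_on_subset[OF smooth_famD[OF s U]]) auto
      show "smooth_on (\<phi> ` (U \<inter> W) \<times> (({0<..1} \<inter> {0..1}) \<times> UNIV)) (?g \<phi> U)"
        by (rule smooth_on_subset[OF smooth_famD[OF s U]]) auto
    qed
  qed
  finally show ?thesis unfolding smooth_loop_family_def by auto
qed

end

section \<open>The pulled-back bundle over the cylinder\<close>

context omega_bundle_manifold
begin

abbreviation "N' \<equiv> times_interval M"
abbreviation "E' \<equiv> pull_interval E"

lemma pull_simps [simp]: "rank E' = rank E" "fib E' q = fib E (fst q)" "framing E' q = framing E (fst q)"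
  "trivs E' = (\<lambda>(U, \<tau>). (U \<times> {0..1}, \<lambda>q. \<tau> (fst q))) ` trivs E"
  by (simp_all add: pull_interval_def)

lemma reparam_snd: "smooth_fam M W (UNIV :: real set) f \<Longrightarrow> smooth_fam M W strip (\<lambda>p q. f p (snd q))"
  by (rule smooth_fam_reparam[OF _ smooth_on_linear[OF bounded_linear_snd]]) auto

text \<open>The caloron connection of the path lives on this bundle; injectivity of evaluation and
  the computations with cosets are available as soon as it is an \<Omega> bundle.\<close>

lemma pull_interval_bundle: "omega_vector_bundle N' E'"
  unfolding omega_vector_bundle_def
proof (intro conjI)
  show "\<forall>m\<in>points N'. omega_module (rank E') (fib E' m) (framing E' m)"
    using om by (auto simp: points_times_interval)
  have "(\<Union>(U, \<tau>)\<in>trivs E'. U) = (\<Union>(U, \<tau>)\<in>trivs E. U) \<times> {0..1}" by auto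
  then show "(\<Union>(U, \<tau>)\<in>trivs E'. U) = points N'"
    using bundle_data by (simp add: points_times_interval)
  show "\<forall>(U, \<tau>)\<in>trivs E'. openin (top N') U \<and>
      (\<forall>m\<in>U. free_iso loop_ring (rank E') (fib E' m) (\<tau> m) \<and>
        (\<forall>v\<in>carrier (fib E' m). \<forall>i<rank E'. \<tau> m v i 0 = framing E' m v i))"
  proof clarify
    fix V \<sigma> assume "(V, \<sigma>) \<in> trivs E'"
    then obtain U \<tau> where U: "(U, \<tau>) \<in> trivs E" "V = U \<times> {0..1}" "\<sigma> = (\<lambda>q. \<tau> (fst q))" by auto
    have "openin (prod_topology (top M) (top_of_set {0..1::real})) (U \<times> {0..1})"
      using triv_open[OF U(1)] by (simp add: openin_prod_Times_iff)
    then show "openin (top N') V \<and> (\<forall>m\<in>V. free_iso loop_ring (rank E') (fib E' m) (\<sigma> m) \<and>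
        (\<forall>v\<in>carrier (fib E' m). \<forall>i<rank E'. \<sigma> m v i 0 = framing E' m v i))"
      using triv_iso[OF U(1)] triv_framing[OF U(1)] by (auto simp: U(2,3) times_interval_def)
  qed
  show "\<forall>(U, \<tau>)\<in>trivs E'. \<forall>(V, \<sigma>)\<in>trivs E'. \<forall>i<rank E'. \<forall>j<rank E'.
      smooth_loop_family N' (U \<inter> V)
        (\<lambda>m. \<sigma> m (inv_into (carrier (fib E' m)) (\<tau> m) (std_basis loop_ring (rank E') i)) j)"
  proof clarify
    fix U' \<tau>' V' \<sigma>' i j
    assume "(U', \<tau>') \<in> trivs E'" "(V', \<sigma>') \<in> trivs E'" and ij: "i < rank E'" "j < rank E'"
    then obtain U \<tau> V \<sigma> where U: "(U, \<tau>) \<in> trivs E" "U' = U \<times> {0..1}" "\<tau>' = (\<lambda>q. \<tau> (fst q))"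
      and V: "(V, \<sigma>) \<in> trivs E" "V' = V \<times> {0..1}" "\<sigma>' = (\<lambda>q. \<sigma> (fst q))" by auto
    have eq: "U' \<inter> V' = (U \<inter> V) \<times> {0..1}" by (auto simp: U(2) V(2))
    have s: "smooth_loop_family M (U \<inter> V)
        (\<lambda>m. \<sigma> m (inv_into (carrier (fib E m)) (\<tau> m) (std_basis loop_ring (rank E) i)) j)"
      by (rule triv_smooth[OF U(1) V(1)]) (use ij in auto)
    show "smooth_loop_family N' (U' \<inter> V')
        (\<lambda>m. \<sigma>' m (inv_into (carrier (fib E' m)) (\<tau>' m) (std_basis loop_ring (rank E') i)) j)"
      unfolding eq loop_family_times_interval_iff
      using reparam_snd[OF conjunct1[OF s[unfolded loop_family_iff]]] conjunct2[OF s[unfolded loop_family_iff]]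
      by (simp add: U(3) V(3))
  qed
qed

text \<open>Periodicity in \<theta> is contained in the second condition, since coordinates of a
  fibre element are loops; smoothness is expressed over \<open>M\<close> with parameter (t,
  \<theta>).\<close>

lemma sections_pull_iff: "w \<in> sections N' E' \<longleftrightarrow> w \<in> extensional (points M \<times> {0..1}) \<and>
    (\<forall>p\<in>points M. \<forall>t\<in>{0..1}. w (p, t) \<in> carrier (fib E p)) \<and>
    (\<forall>U \<tau> i. (U, \<tau>) \<in> trivs E \<longrightarrow> i < rank E \<longrightarrow> smooth_fam M U strip (\<lambda>p q. \<tau> p (w (p, fst q)) i (snd q)))"
    (is "?l \<longleftrightarrow> ?e \<and> ?c \<and> ?s")
proof -
  have 1: "w \<in> (\<Pi>\<^sub>E m\<in>points N'. carrier (fib E' m)) \<longleftrightarrow> ?e \<and> ?c"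
    by (auto simp: points_times_interval PiE_def Pi_iff)
  have 2: "(\<forall>(V, \<sigma>)\<in>trivs E'. \<forall>i<rank E'. smooth_loop_family N' V (\<lambda>m. \<sigma> m (w m) i)) \<longleftrightarrow>
      (\<forall>U \<tau> i. (U, \<tau>) \<in> trivs E \<longrightarrow> i < rank E \<longrightarrow> smooth_loop_family N' (U \<times> {0..1}) (\<lambda>q. \<tau> (fst q) (w q) i))"
    by auto
  have 3: "\<tau> p (w (p, t)) i (\<theta> + 2 * pi) = \<tau> p (w (p, t)) i \<theta>"
    if "(U, \<tau>) \<in> trivs E" "i < rank E" "p \<in> U" "t \<in> {0..1}" ?c for U \<tau> i p t \<theta>
  proof -
    have pM: "p \<in> points M" using triv_subset that(1,3) by blast
    have "\<tau> p (w (p, t)) i \<in> carrier loop_ring"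
      by (rule coord_closed[OF pM triv_iso[OF that(1,3)] _ that(2)]) (use that pM in auto)
    then show ?thesis by (simp add: loop_ring_def)
  qed
  show ?thesis
  proof (cases ?c)
    case True
    then have "(\<forall>U \<tau> i. (U, \<tau>) \<in> trivs E \<longrightarrow> i < rank E \<longrightarrow> smooth_loop_family N' (U \<times> {0..1}) (\<lambda>q. \<tau> (fst q) (w q) i)) \<longleftrightarrow> ?s"
      unfolding loop_family_times_interval_iff fst_conv using 3 by blast
    then show ?thesis unfolding sections_def mem_Collect_eq 1 2 by blast
  next
    case False
    then show ?thesis unfolding sections_def mem_Collect_eq 1 by blast
  qed
qed

definition slice :: "('m \<times> real \<Rightarrow> 'e) \<Rightarrow> real \<Rightarrow> 'm \<Rightarrow> 'e" where
  "slice w t = (\<lambda>p\<in>points M. w (p, t))"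

context
  fixes w
  assumes w: "w \<in> sections N' E'"
begin

lemma pull_closed: "p \<in> points M \<Longrightarrow> t \<in> {0..1} \<Longrightarrow> w (p, t) \<in> carrier (fib E p)"
  using w by (simp add: sections_pull_iff)

lemma pull_smooth: "(U, \<tau>) \<in> trivs E \<Longrightarrow> i < rank E \<Longrightarrow> smooth_fam M U strip (\<lambda>p q. \<tau> p (w (p, fst q)) i (snd q))"
  using w by (simp add: sections_pull_iff)

lemma slice_section:
  assumes t: "t \<in> {0..1}"
  shows "slice w t \<in> sections M E"
  unfolding sections_iff
proof (intro conjI ballI allI impI)
  fix U \<tau> i assume U: "(U, \<tau>) \<in> trivs E" and i: "i < rank E"
  have "smooth_fam M U UNIV (\<lambda>p \<theta>. \<tau> p (w (p, fst (t, \<theta>))) i (snd (t, \<theta>)))"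
    by (rule smooth_fam_reparam[OF pull_smooth[OF U i] smooth_on_Pair_left]) (use t in auto)
  moreover have "\<tau> p (w (p, t)) i (\<theta> + 2 * pi) = \<tau> p (w (p, t)) i \<theta>" if p: "p \<in> U" for p \<theta>
  proof -
    have pM: "p \<in> points M" using triv_subset[OF U] p by blast
    have "\<tau> p (w (p, t)) i \<in> carrier loop_ring"
      by (rule coord_closed[OF pM triv_iso[OF U p] pull_closed[OF pM t] i])
    then show ?thesis by (simp add: loop_ring_def)
  qed
  ultimately have "smooth_loop_family M U (\<lambda>p. \<tau> p (w (p, t)) i)" by (simp add: loop_family_iff)
  then show "smooth_loop_family M U (\<lambda>p. \<tau> p (slice w t p) i)"
    by (rule loop_family_cong) (use triv_subset[OF U] in \<open>auto simp: slice_def\<close>)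
qed (use t pull_closed in \<open>auto simp: slice_def\<close>)

end

definition pull :: "('m \<Rightarrow> 'e) \<Rightarrow> 'm \<times> real \<Rightarrow> 'e" where
  "pull v = (\<lambda>q\<in>points M \<times> {0..1}. v (fst q))"

lemma pull_section: "v \<in> sections M E \<Longrightarrow> pull v \<in> sections N' E'"
  unfolding sections_pull_iff
proof (intro conjI ballI allI impI)
  fix U \<tau> i assume v: "v \<in> sections M E" and U: "(U, \<tau>) \<in> trivs E" and i: "i < rank E"
  have "smooth_fam M U strip (\<lambda>p q. \<tau> p (v p) i (snd q))"
    by (rule reparam_snd) (use section_smooth[OF v U i] in \<open>simp add: loop_family_iff\<close>)
  then show "smooth_fam M U strip (\<lambda>p q. \<tau> p (pull v (p, fst q)) i (snd q))"
    by (rule smooth_fam_cong) (use triv_subset[OF U] in \<open>auto simp: pull_def\<close>)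
qed (auto simp: pull_def section_closed)

text \<open>\<open>fibre_derivative\<close> asks for the derivative in all coordinate systems. At a
  fixed angle two of them differ by a matrix constant in t, so one is enough.\<close>

lemma fibre_derivative_eq:
  assumes p: "p \<in> points M" and \<beta>: "free_iso loop_ring (rank E) (fib E p) \<beta>" and t: "t \<in> {0..1}"
    and c: "\<And>u. u \<in> {0..1} \<Longrightarrow> c u \<in> carrier (fib E p)" and r: "r \<in> carrier (fib E p)"
    and d: "\<And>i \<theta>. i < rank E \<Longrightarrow> ((\<lambda>u. \<beta> (c u) i \<theta>) has_vector_derivative \<beta> r i \<theta>) (at t within {0..1})"
  shows "fibre_derivative (rank E) (fib E p) c t = r"
  unfolding fibre_derivative_def
proof (rule the_equality)
  have "((\<lambda>u. \<gamma> (c u) i \<theta>) has_vector_derivative \<gamma> r i \<theta>) (at t within {0..1})"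
    if \<gamma>: "free_iso loop_ring (rank E) (fib E p) \<gamma>" and i: "i < rank E" for \<gamma> i and \<theta> :: real
  proof -
    interpret evaluation loop_ring "\<lambda>f. f \<theta>" by (rule evaluation_loop[OF omega_module_closed(1)[OF om[OF p]]])
    define P where "P k = \<gamma> (inv_into (carrier (fib E p)) \<beta> (std_basis loop_ring (rank E) k)) i \<theta>" for k
    have lin: "\<gamma> v i \<theta> = (\<Sum>k<rank E. \<beta> v k \<theta> * P k)" if v: "v \<in> carrier (fib E p)" for v
      unfolding P_def
      by (rule free_iso_functional[OF \<beta> fib_add[OF p] fib_smult[OF p], of "\<lambda>v. \<gamma> v i \<theta>"])
         (use coord_add[OF p \<gamma>] coord_smult[OF p \<gamma>] i v in auto)
    have "((\<lambda>u. \<Sum>k<rank E. \<beta> (c u) k \<theta> * P k) has_vector_derivative (\<Sum>k<rank E. \<beta> r k \<theta> * P k)) (at t within {0..1})"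
      by (intro has_vector_derivative_sum bounded_linear.has_vector_derivative[OF bounded_linear_mult_left] d) simp
    then show ?thesis unfolding lin[OF r]
      by (rule has_vector_derivative_transform[OF t, rotated]) (simp add: lin c)
  qed
  then show "r \<in> carrier (fib E p) \<and> (\<forall>\<gamma>. free_iso loop_ring (rank E) (fib E p) \<gamma> \<longrightarrow> (\<forall>i<rank E. \<forall>\<theta>.
      ((\<lambda>u. \<gamma> (c u) i \<theta>) has_vector_derivative \<gamma> r i \<theta>) (at t within {0..1})))"
    using r by blast
next
  fix r' assume r': "r' \<in> carrier (fib E p) \<and> (\<forall>\<gamma>. free_iso loop_ring (rank E) (fib E p) \<gamma> \<longrightarrow> (\<forall>i<rank E. \<forall>\<theta>.
      ((\<lambda>u. \<gamma> (c u) i \<theta>) has_vector_derivative \<gamma> r' i \<theta>) (at t within {0..1})))"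
  show "r' = r"
  proof (rule coord_eqI[OF p \<beta> _ r])
    show "r' \<in> carrier (fib E p)" using r' by blast
    show "\<beta> r' i \<theta> = \<beta> r i \<theta>" if "i < rank E" for i \<theta>
      by (rule vector_derivative_unique_within[OF at_within_unit[OF t] _ d[OF that]]) (use r' \<beta> that in blast)
  qed
qed

text \<open>The coordinatewise derivatives must be loops to define an element of the fibre: they are
  smooth in \<theta> by \<open>tder_smooth\<close>, and periodic because derivatives are
  unique.\<close>

lemma fibre_derivative_coord:
  assumes w: "w \<in> sections N' E'" and U: "(U, \<tau>) \<in> trivs E" and p: "p \<in> U" and t: "t \<in> {0..1}"
    and c: "\<And>u. u \<in> {0..1} \<Longrightarrow> c u = w (p, u)"
  shows "fibre_derivative (rank E) (fib E p) c t \<in> carrier (fib E p)"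
    and "i < rank E \<Longrightarrow> \<tau> p (fibre_derivative (rank E) (fib E p) c t) i \<theta> =
      tder (\<lambda>p q. \<tau> p (w (p, fst q)) i (snd q)) p (t, \<theta>)"
proof -
  have pM: "p \<in> points M" using triv_subset[OF U] p by blast
  note b = triv_iso[OF U p]
  define g where "g i \<theta> = tder (\<lambda>p q. \<tau> p (w (p, fst q)) i (snd q)) p (t, \<theta>)" for i \<theta>
  have cl: "w (p, u) \<in> carrier (fib E p)" if "u \<in> {0..1}" for u using pull_closed[OF w pM that] .
  have per: "\<tau> p (w (p, u)) i (\<theta> + 2 * pi) = \<tau> p (w (p, u)) i \<theta>" if "i < rank E" "u \<in> {0..1}" for i u \<theta>
    using coord_closed[OF pM b cl[OF that(2)] that(1)] by (simp add: loop_ring_def)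
  have d: "((\<lambda>u. \<tau> p (w (p, u)) i \<theta>) has_vector_derivative g i \<theta>) (at t within {0..1})" if "i < rank E" for i \<theta>
    using tder_works[OF pull_smooth[OF w U that] triv_subset[OF U] p t, of \<theta>] by (simp add: g_def)
  have g: "g i \<in> carrier loop_ring" if i: "i < rank E" for i
  proof -
    have "smooth_fam M U strip (tder (\<lambda>p q. \<tau> p (w (p, fst q)) i (snd q)))"
      by (rule tder_smooth[OF pull_smooth[OF w U i] triv_subset[OF U]])
    from fam_slice[OF this triv_subset[OF U] p]
    have "smooth_on UNIV (\<lambda>\<theta>. tder (\<lambda>p q. \<tau> p (w (p, fst q)) i (snd q)) p (t, \<theta>))"
      by (rule smooth_on_compose[OF _ smooth_on_Pair_left]) (use t in auto)
    moreover have "g i (\<theta> + 2 * pi) = g i \<theta>" for \<theta>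
    proof (rule vector_derivative_unique_within[OF at_within_unit[OF t] _ d[OF i]])
      show "((\<lambda>u. \<tau> p (w (p, u)) i \<theta>) has_vector_derivative g i (\<theta> + 2 * pi)) (at t within {0..1})"
        by (rule has_vector_derivative_transform[OF t _ d[OF i]]) (simp add: per i)
    qed
    ultimately show ?thesis by (simp add: loop_ring_def g_def[abs_def])
  qed
  obtain r where r: "r \<in> carrier (fib E p)" "\<And>i. i < rank E \<Longrightarrow> \<tau> p r i = g i"
    using coord_exists[OF pM b, of g] g by blast
  have "fibre_derivative (rank E) (fib E p) c t = r"
  proof (rule fibre_derivative_eq[OF pM b t _ r(1)])
    show "c u \<in> carrier (fib E p)" if "u \<in> {0..1}" for u using cl c that by simp
    show "((\<lambda>u. \<tau> p (c u) i \<theta>) has_vector_derivative \<tau> p r i \<theta>) (at t within {0..1})" if "i < rank E" for i \<theta>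
      unfolding r(2)[OF that] by (rule has_vector_derivative_transform[OF t _ d[OF that]]) (simp add: c)
  qed
  then show "fibre_derivative (rank E) (fib E p) c t \<in> carrier (fib E p)"
    and "i < rank E \<Longrightarrow> \<tau> p (fibre_derivative (rank E) (fib E p) c t) i \<theta> =
      tder (\<lambda>p q. \<tau> p (w (p, fst q)) i (snd q)) p (t, \<theta>)"
    using r by (simp_all add: g_def)
qed

lemma fibre_derivative_works:
  assumes w: "w \<in> sections N' E'" and U: "(U, \<tau>) \<in> trivs E" and p: "p \<in> U" and t: "t \<in> {0..1}"
    and c: "\<And>u. u \<in> {0..1} \<Longrightarrow> c u = w (p, u)" and i: "i < rank E"
  shows "((\<lambda>u. \<tau> p (c u) i \<theta>) has_vector_derivative
    \<tau> p (fibre_derivative (rank E) (fib E p) c t) i \<theta>) (at t within {0..1})"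
proof -
  have d: "((\<lambda>u. \<tau> p (w (p, u)) i \<theta>) has_vector_derivative
      tder (\<lambda>p q. \<tau> p (w (p, fst q)) i (snd q)) p (t, \<theta>)) (at t within {0..1})"
    using tder_works[OF pull_smooth[OF w U i] triv_subset[OF U] p t, of \<theta>] by simp
  have "((\<lambda>u. \<tau> p (c u) i \<theta>) has_vector_derivative
      tder (\<lambda>p q. \<tau> p (w (p, fst q)) i (snd q)) p (t, \<theta>)) (at t within {0..1})"
    by (rule has_vector_derivative_transform[OF t _ d]) (simp add: c)
  then show ?thesis using fibre_derivative_coord(2)[OF w U p t c i] by simp
qed

text \<open>The covariant derivative of the path connection along \<partial>_t, as an operator on
  sections over the cylinder.\<close>

definition conT :: "('m \<times> real \<Rightarrow> 'e) \<Rightarrow> 'm \<times> real \<Rightarrow> 'e" where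
  "conT w = (\<lambda>q\<in>points M \<times> {0..1}. fibre_derivative (rank E) (fib E (fst q)) (\<lambda>u. w (fst q, u)) (snd q))"

lemma conT_section:
  assumes w: "w \<in> sections N' E'"
  shows "conT w \<in> sections N' E'"
  unfolding sections_pull_iff
proof (intro conjI ballI allI impI)
  show "conT w \<in> extensional (points M \<times> {0..1})" by (simp add: conT_def)
next
  fix p and t :: real assume p: "p \<in> points M" and t: "t \<in> {0..1}"
  obtain U \<tau> where U: "(U, \<tau>) \<in> trivs E" "p \<in> U" using triv_cover[OF p] by blast
  show "conT w (p, t) \<in> carrier (fib E p)"
    using fibre_derivative_coord(1)[OF w U t refl] p t by (simp add: conT_def)
next
  fix U \<tau> i assume U: "(U, \<tau>) \<in> trivs E" and i: "i < rank E"
  show "smooth_fam M U strip (\<lambda>p q. \<tau> p (conT w (p, fst q)) i (snd q))"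
    by (rule smooth_fam_cong[OF tder_smooth[OF pull_smooth[OF w U i] triv_subset[OF U]]])
       (use triv_subset[OF U] fibre_derivative_coord(2)[OF w U _ _ refl i] in \<open>auto simp: conT_def subsetD\<close>)
qed

lemma conT_works:
  assumes w: "w \<in> sections N' E'" and U: "(U, \<tau>) \<in> trivs E" and p: "p \<in> U" and t: "t \<in> {0..1}" and i: "i < rank E"
  shows "((\<lambda>u. \<tau> p (w (p, u)) i \<theta>) has_vector_derivative \<tau> p (conT w (p, t)) i \<theta>) (at t within {0..1})"
  using fibre_derivative_works[OF w U p t refl i, of \<theta>] triv_subset[OF U] p t by (auto simp: conT_def subsetD)

end

section \<open>The operators of the path connection and their commutators\<close>

locale connection_path = omega_bundle_manifold M E
  for M :: "('m, 'a::euclidean_space) manifold" and E :: "('m, 'e) omega_bundle" +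
  fixes D :: "real \<Rightarrow> ('m, 'e) conn" and \<phi> :: "real \<Rightarrow> ('m, 'e) higgs"
  assumes path: "smooth_path M E D \<phi>"
begin

lemma conn: "t \<in> {0..1} \<Longrightarrow> module_connection M E (D t)"
  and higgs: "t \<in> {0..1} \<Longrightarrow> higgs_field M E (\<phi> t)"
  and conn_smooth: "v \<in> sections M E \<Longrightarrow> X \<in> vector_fields M \<Longrightarrow>
    (\<lambda>q\<in>points M \<times> {0..1}. D (snd q) X v (fst q)) \<in> sections N' E'"
  and higgs_smooth: "v \<in> sections M E \<Longrightarrow>
    (\<lambda>q\<in>points M \<times> {0..1}. \<phi> (snd q) (fst q) (v (fst q))) \<in> sections N' E'"
  using path unfolding smooth_path_def by simp_all

text \<open>Together with \<open>conT\<close> and \<open>hig\<close>, these are the operators to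
  which the caloron connection of the path reduces, so that its curvature becomes a commutator on
  \<open>sections N' E'\<close>.\<close>

definition conX :: "'m vfield \<Rightarrow> ('m \<times> real \<Rightarrow> 'e) \<Rightarrow> 'm \<times> real \<Rightarrow> 'e" where
  "conX X w = (\<lambda>q\<in>points M \<times> {0..1}. D (snd q) X (slice w (snd q)) (fst q))"

definition hig :: "('m \<times> real \<Rightarrow> 'e) \<Rightarrow> 'm \<times> real \<Rightarrow> 'e" where
  "hig w = (\<lambda>q\<in>points M \<times> {0..1}. \<phi> (snd q) (fst q) (w q))"

end

locale path_frame = connection_path M E D \<phi> + local_frame M E U \<tau> \<rho> O' K
  for M :: "('m, 'a::euclidean_space) manifold" and E :: "('m, 'e) omega_bundle" and D \<phi> U \<tau> \<rho> O' K
begin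

lemma coef_fam:
  assumes w: "w \<in> sections N' E'" and i: "i < rank E"
  shows "smooth_fam M (points M) strip (\<lambda>p q. coef (slice w (fst q)) i p (snd q))"
  by (rule smooth_fam_cong[OF glue[OF pull_smooth[OF w U i]]]) (auto simp: coef_def slice_def)

lemma conX_coord:
  assumes w: "w \<in> sections N' E'" and X: "X \<in> vector_fields M" and p: "p \<in> O'" and t: "t \<in> {0..1}" and i: "i < rank E"
  shows "\<tau> p (conX X w (p, t)) i \<theta> = complex_derivative X (\<lambda>p. coef (slice w t) i p \<theta>) p +
    (\<Sum>k<rank E. \<tau> p (w (p, t)) k \<theta> * \<tau> p (D t X (frame k) p) i \<theta>)"
proof -
  have pM: "p \<in> points M" using p O_sub by blast
  show ?thesis using conn_expansion[OF conn[OF t] X slice_section[OF w t] p i, of \<theta>] pM t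
    by (simp add: conX_def slice_def)
qed

lemma hig_coord:
  assumes w: "w \<in> sections N' E'" and p: "p \<in> O'" and t: "t \<in> {0..1}" and i: "i < rank E"
  shows "\<tau> p (hig w (p, t)) i \<theta> = vector_derivative (\<tau> p (w (p, t)) i) (at \<theta>) +
    (\<Sum>k<rank E. \<tau> p (w (p, t)) k \<theta> * \<tau> p (\<phi> t p (frame k p)) i \<theta>)"
proof -
  have pM: "p \<in> points M" using p O_sub by blast
  show ?thesis using higgs_expansion[OF higgs[OF t] p pull_closed[OF w pM t] i, of \<theta>] pM t
    by (simp add: hig_def)
qed

text \<open>The smoothness assumed of a path concerns sections independent of t. Expansion in the
  frame reduces a general section to its coordinates, which are smooth families, and to the
  frame.\<close>

lemma conX_fam:
  assumes w: "w \<in> sections N' E'" and X: "X \<in> vector_fields M" and i: "i < rank E"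
  shows "smooth_fam M O' strip (\<lambda>p q. \<tau> p (conX X w (p, fst q)) i (snd q))"
proof (rule smooth_fam_cong)
  have s: "smooth_fam M O' strip (\<lambda>p q. \<tau> p ((\<lambda>q\<in>points M \<times> {0..1}. D (snd q) X (frame k) (fst q)) (p, fst q)) i (snd q))"
    if "k < rank E" for k
    by (rule smooth_fam_subset[OF pull_smooth[OF conn_smooth[OF frame_section[OF that] X] U i] O'(2) order_refl])
  show "smooth_fam M O' strip (\<lambda>p q. complex_derivative X (\<lambda>p. coef (slice w (fst q)) i p (snd q)) p +
      (\<Sum>k<rank E. \<tau> p (w (p, fst q)) k (snd q) *
        \<tau> p ((\<lambda>q\<in>points M \<times> {0..1}. D (snd q) X (frame k) (fst q)) (p, fst q)) i (snd q)))"
    by (intro smooth_fam_add smooth_fam_sum smooth_fam_mult s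
        smooth_fam_subset[OF cd_fam[OF X coef_fam[OF w i]] O_sub order_refl]
        smooth_fam_subset[OF pull_smooth[OF w U] O'(2) order_refl]) auto
qed (use O_sub in \<open>auto simp: conX_coord[OF w X _ _ i] subsetD\<close>)

lemma hig_fam:
  assumes w: "w \<in> sections N' E'" and i: "i < rank E"
  shows "smooth_fam M O' strip (\<lambda>p q. \<tau> p (hig w (p, fst q)) i (snd q))"
proof (rule smooth_fam_cong)
  have s: "smooth_fam M O' strip (\<lambda>p q. \<tau> p ((\<lambda>q\<in>points M \<times> {0..1}. \<phi> (snd q) (fst q) (frame k (fst q))) (p, fst q)) i (snd q))"
    if "k < rank E" for k
    by (rule smooth_fam_subset[OF pull_smooth[OF higgs_smooth[OF frame_section[OF that]] U i] O'(2) order_refl])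
  have a: "smooth_fam M O' strip (\<lambda>p q. vector_derivative (\<lambda>\<theta>. \<tau> p (w (p, fst q)) i \<theta>) (at (snd q)))"
    using smooth_fam_subset[OF angle_derivative_smooth[OF pull_smooth[OF w U i] U_sub] O'(2) order_refl] by simp
  show "smooth_fam M O' strip (\<lambda>p q. vector_derivative (\<lambda>\<theta>. \<tau> p (w (p, fst q)) i \<theta>) (at (snd q)) +
      (\<Sum>k<rank E. \<tau> p (w (p, fst q)) k (snd q) *
        \<tau> p ((\<lambda>q\<in>points M \<times> {0..1}. \<phi> (snd q) (fst q) (frame k (fst q))) (p, fst q)) i (snd q)))"
    by (intro smooth_fam_add smooth_fam_sum smooth_fam_mult s a
        smooth_fam_subset[OF pull_smooth[OF w U] O'(2) order_refl]) auto
qed (use O_sub in \<open>auto simp: hig_coord[OF w _ _ i] subsetD\<close>)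

text \<open>The commutators of the covariant derivatives of the path connection: \<open>[\<partial>\<^sub>t, \<nabla>\<^sub>X] = \<triangle>'(X)\<close>
  and \<open>[\<partial>\<^sub>t, \<phi>] = \<phi>'\<close>.\<close>

lemma conT_conX:
  assumes w: "w \<in> sections N' E'" and X: "X \<in> vector_fields M" and p: "p \<in> O'" and t: "t \<in> {0..1}" and i: "i < rank E"
    and wX: "conX X w \<in> sections N' E'"
  shows "\<tau> p (conT (conX X w) (p, t)) i \<theta> - \<tau> p (conX X (conT w) (p, t)) i \<theta> =
    (\<Sum>k<rank E. \<tau> p (w (p, t)) k \<theta> *
      \<tau> p (fibre_derivative (rank E) (fib E p) (\<lambda>u. D u X (frame k) p) t) i \<theta>)"
proof -
  have pU: "p \<in> U" and pM: "p \<in> points M" using p O'(2) O_sub by auto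
  have wT: "conT w \<in> sections N' E'" by (rule conT_section[OF w])
  have d1: "((\<lambda>u. coef (slice w u) i q \<theta>) has_vector_derivative coef (slice (conT w) t) i q \<theta>) (at t within {0..1})"
    if q: "q \<in> points M" for q
  proof (cases "q \<in> U")
    case True
    have "((\<lambda>u. \<rho> q *\<^sub>R \<tau> q (w (q, u)) i \<theta>) has_vector_derivative \<rho> q *\<^sub>R \<tau> q (conT w (q, t)) i \<theta>) (at t within {0..1})"
      by (rule bounded_linear.has_vector_derivative[OF bounded_linear_scaleR_right conT_works[OF w U True t i]])
    then show ?thesis using True q by (simp add: coef_def slice_def)
  qed (simp add: coef_def)
  \<comment> \<open>Differentiation along \<open>X\<close> commutes with that in t. The result is
    the first-order part of \<open>conX X (conT w)\<close> and cancels in the commutator.\<close>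
  have d2: "((\<lambda>u. complex_derivative X (\<lambda>p. coef (slice w u) i p \<theta>) p) has_vector_derivative
      complex_derivative X (\<lambda>p. coef (slice (conT w) t) i p \<theta>) p) (at t within {0..1})"
  proof -
    have "((\<lambda>u. complex_derivative X (\<lambda>p. coef (slice w (fst ((t, \<theta>) + (u - t) *\<^sub>R (1, 0)))) i p
        (snd ((t, \<theta>) + (u - t) *\<^sub>R (1, 0)))) p) has_vector_derivative
        complex_derivative X (\<lambda>p. coef (slice (conT w) t) i p \<theta>) p) (at t within {0..1})"
    proof (rule cd_commute[OF X coef_fam[OF w i] _ _ t at_within_unit[OF t] _ pM])
      show "smooth_complex (\<lambda>p. coef (slice (conT w) t) i p \<theta>)"
        using smooth_complex_of_fam[OF coef_fam[OF wT i], of "(t, \<theta>)"] t by simp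
    qed (use d1 in auto)
    then show ?thesis by simp
  qed
  have d3: "((\<lambda>u. \<tau> p (D u X (frame k) p) i \<theta>) has_vector_derivative
      \<tau> p (fibre_derivative (rank E) (fib E p) (\<lambda>u. D u X (frame k) p) t) i \<theta>) (at t within {0..1})" if "k < rank E" for k
    by (rule fibre_derivative_works[OF conn_smooth[OF frame_section[OF that] X] U pU t _ i]) (simp add: pM)
  have "((\<lambda>u. complex_derivative X (\<lambda>p. coef (slice w u) i p \<theta>) p +
      (\<Sum>k<rank E. \<tau> p (w (p, u)) k \<theta> * \<tau> p (D u X (frame k) p) i \<theta>)) has_vector_derivative
      complex_derivative X (\<lambda>p. coef (slice (conT w) t) i p \<theta>) p +
      (\<Sum>k<rank E. \<tau> p (w (p, t)) k \<theta> * \<tau> p (fibre_derivative (rank E) (fib E p) (\<lambda>u. D u X (frame k) p) t) i \<theta> +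
        \<tau> p (conT w (p, t)) k \<theta> * \<tau> p (D t X (frame k) p) i \<theta>)) (at t within {0..1})"
    by (intro has_vector_derivative_add has_vector_derivative_sum has_vector_derivative_mult d2 d3 conT_works[OF w U pU t]) auto
  then have "((\<lambda>u. \<tau> p (conX X w (p, u)) i \<theta>) has_vector_derivative
      complex_derivative X (\<lambda>p. coef (slice (conT w) t) i p \<theta>) p +
      (\<Sum>k<rank E. \<tau> p (w (p, t)) k \<theta> * \<tau> p (fibre_derivative (rank E) (fib E p) (\<lambda>u. D u X (frame k) p) t) i \<theta> +
        \<tau> p (conT w (p, t)) k \<theta> * \<tau> p (D t X (frame k) p) i \<theta>)) (at t within {0..1})"
    by (rule has_vector_derivative_transform[OF t, rotated]) (simp add: conX_coord[OF w X p _ i])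
  from vector_derivative_unique_within[OF at_within_unit[OF t] conT_works[OF wX U pU t i] this]
  show ?thesis by (simp add: conX_coord[OF wT X p t i] sum.distrib)
qed

text \<open>As for \<open>conX\<close>, except that the mixed derivatives are those in t and
  \<theta>. Differentiation in \<theta> takes place in the single fibre at \<open>p\<close>, so the
  coordinates enter without cutoff.\<close>

lemma conT_hig:
  assumes w: "w \<in> sections N' E'" and p: "p \<in> O'" and t: "t \<in> {0..1}" and i: "i < rank E"
    and wh: "hig w \<in> sections N' E'"
  shows "\<tau> p (conT (hig w) (p, t)) i \<theta> - \<tau> p (hig (conT w) (p, t)) i \<theta> =
    (\<Sum>k<rank E. \<tau> p (w (p, t)) k \<theta> *
      \<tau> p (fibre_derivative (rank E) (fib E p) (\<lambda>u. \<phi> u p (frame k p)) t) i \<theta>)"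
proof -
  have pU: "p \<in> U" and pM: "p \<in> points M" using p O'(2) O_sub by auto
  have wT: "conT w \<in> sections N' E'" by (rule conT_section[OF w])
  have d2: "((\<lambda>u. vector_derivative (\<tau> p (w (p, u)) i) (at \<theta>)) has_vector_derivative
      vector_derivative (\<tau> p (conT w (p, t)) i) (at \<theta>)) (at t within {0..1})"
  proof -
    have g: "smooth_on strip (\<lambda>q. \<tau> p (w (p, fst q)) i (snd q))"
      by (rule fam_slice[OF pull_smooth[OF w U i] U_sub pU])
    show ?thesis using mixed_partials_strip[OF g t, of "\<tau> p (conT w (p, t)) i" \<theta>] conT_works[OF w U pU t i] by simp
  qed
  have d3: "((\<lambda>u. \<tau> p (\<phi> u p (frame k p)) i \<theta>) has_vector_derivative
      \<tau> p (fibre_derivative (rank E) (fib E p) (\<lambda>u. \<phi> u p (frame k p)) t) i \<theta>) (at t within {0..1})" if "k < rank E" for k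
    by (rule fibre_derivative_works[OF higgs_smooth[OF frame_section[OF that]] U pU t _ i]) (simp add: pM)
  have "((\<lambda>u. vector_derivative (\<tau> p (w (p, u)) i) (at \<theta>) +
      (\<Sum>k<rank E. \<tau> p (w (p, u)) k \<theta> * \<tau> p (\<phi> u p (frame k p)) i \<theta>)) has_vector_derivative
      vector_derivative (\<tau> p (conT w (p, t)) i) (at \<theta>) +
      (\<Sum>k<rank E. \<tau> p (w (p, t)) k \<theta> * \<tau> p (fibre_derivative (rank E) (fib E p) (\<lambda>u. \<phi> u p (frame k p)) t) i \<theta> +
        \<tau> p (conT w (p, t)) k \<theta> * \<tau> p (\<phi> t p (frame k p)) i \<theta>)) (at t within {0..1})"
    by (intro has_vector_derivative_add has_vector_derivative_sum has_vector_derivative_mult d2 d3 conT_works[OF w U pU t]) auto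
  then have "((\<lambda>u. \<tau> p (hig w (p, u)) i \<theta>) has_vector_derivative
      vector_derivative (\<tau> p (conT w (p, t)) i) (at \<theta>) +
      (\<Sum>k<rank E. \<tau> p (w (p, t)) k \<theta> * \<tau> p (fibre_derivative (rank E) (fib E p) (\<lambda>u. \<phi> u p (frame k p)) t) i \<theta> +
        \<tau> p (conT w (p, t)) k \<theta> * \<tau> p (\<phi> t p (frame k p)) i \<theta>)) (at t within {0..1})"
    by (rule has_vector_derivative_transform[OF t, rotated]) (simp add: hig_coord[OF w p _ i])
  from vector_derivative_unique_within[OF at_within_unit[OF t] conT_works[OF wh U pU t i] this]
  show ?thesis by (simp add: hig_coord[OF wT p t i] sum.distrib)
qed

end

context connection_path
begin

text \<open>\<open>conX_fam\<close> gives smoothness where the cutoff of a frame is 1; such sets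
  cover \<open>V\<close>, and smoothness is local.\<close>

lemma conX_section:
  assumes w: "w \<in> sections N' E'" and X: "X \<in> vector_fields M"
  shows "conX X w \<in> sections N' E'"
  unfolding sections_pull_iff
proof (intro conjI ballI allI impI)
  fix V \<sigma> i assume V: "(V, \<sigma>) \<in> trivs E" and i: "i < rank E"
  show "smooth_fam M V strip (\<lambda>p q. \<sigma> p (conX X w (p, fst q)) i (snd q))"
  proof (rule smooth_fam_local)
    fix p assume p: "p \<in> V"
    obtain \<rho> O' K where lf: "local_frame M E V \<sigma> \<rho> O' K" and pO: "p \<in> O'" using local_frame_exists[OF V p] by metis
    interpret path_frame M E D \<phi> V \<sigma> \<rho> O' K using lf connection_path_axioms by (simp add: path_frame_def)
    show "\<exists>O'. openin (top M) O' \<and> p \<in> O' \<and> smooth_fam M (V \<inter> O') strip (\<lambda>p q. \<sigma> p (conX X w (p, fst q)) i (snd q))"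
      using O'(1) pO smooth_fam_subset[OF conX_fam[OF w X i], of "V \<inter> O'" strip] by blast
  qed
qed (use slice_section[OF w] conn_closed[OF conn X] in \<open>auto simp: conX_def\<close>)

lemma hig_section:
  assumes w: "w \<in> sections N' E'"
  shows "hig w \<in> sections N' E'"
  unfolding sections_pull_iff
proof (intro conjI ballI allI impI)
  fix V \<sigma> i assume V: "(V, \<sigma>) \<in> trivs E" and i: "i < rank E"
  show "smooth_fam M V strip (\<lambda>p q. \<sigma> p (hig w (p, fst q)) i (snd q))"
  proof (rule smooth_fam_local)
    fix p assume p: "p \<in> V"
    obtain \<rho> O' K where lf: "local_frame M E V \<sigma> \<rho> O' K" and pO: "p \<in> O'" using local_frame_exists[OF V p] by metis
    interpret path_frame M E D \<phi> V \<sigma> \<rho> O' K using lf connection_path_axioms by (simp add: path_frame_def)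
    show "\<exists>O'. openin (top M) O' \<and> p \<in> O' \<and> smooth_fam M (V \<inter> O') strip (\<lambda>p q. \<sigma> p (hig w (p, fst q)) i (snd q))"
      using O'(1) pO smooth_fam_subset[OF hig_fam[OF w i], of "V \<inter> O'" strip] by blast
  qed
qed (use pull_closed[OF w] higgs_closed[OF higgs] in \<open>auto simp: hig_def\<close>)

end

section \<open>The curvature of the caloron connection of a path\<close>

context omega_bundle_manifold
begin

text \<open>Brackets of lifted and coordinate fields vanish only at points of the manifold and are
  unrestricted elsewhere; they still have to be recognised as vector fields before a connection can
  be applied.\<close>

lemma null_vector_field:
  assumes "\<And>g p. p \<in> points M \<Longrightarrow> Y g p = 0"
  shows "Y \<in> vector_fields M"
  unfolding vector_fields_def using assms
  by (auto intro: smooth_fun_cong[OF const_smooth_funs[of 0 M]])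

text \<open>\<open>curvature\<close> subtracts in the caloron fibres, and cancelling there requires
  the group laws.\<close>

lemma caloron_abelian_group:
  assumes m: "m \<in> points M"
  shows "abelian_group (caloron_fib E (m, \<theta>))"
proof -
  interpret N: Module.module loop_ring "fib E m" by (rule fib_module[OF m])
  interpret I: abelian_subgroup "vanishing_at (rank E) (fib E m) \<theta>" "fib E m"
    by (rule vanishing_at_subgroup[OF om[OF m]])
  have add: "eval_class E (m, \<theta>) v \<oplus>\<^bsub>caloron_fib E (m, \<theta>)\<^esub> eval_class E (m, \<theta>) w =
      eval_class E (m, \<theta>) (v \<oplus>\<^bsub>fib E m\<^esub> w)" if "v \<in> carrier (fib E m)" "w \<in> carrier (fib E m)" for v w
    by (rule eval_class_add[OF E m that])
  have zero: "\<zero>\<^bsub>caloron_fib E (m, \<theta>)\<^esub> = eval_class E (m, \<theta>) \<zero>\<^bsub>fib E m\<^esub>"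
    by (simp add: caloron_fib_def quotient_at_def Let_def eval_class_def N.M.a_coset_add_zero[OF I.a_subset])
  show ?thesis
  proof (rule abelian_groupI)
    fix x assume "x \<in> carrier (caloron_fib E (m, \<theta>))"
    then obtain v where v: "v \<in> carrier (fib E m)" "x = eval_class E (m, \<theta>) v" unfolding caloron_carrier by blast
    show "\<exists>y\<in>carrier (caloron_fib E (m, \<theta>)). y \<oplus>\<^bsub>caloron_fib E (m, \<theta>)\<^esub> x = \<zero>\<^bsub>caloron_fib E (m, \<theta>)\<^esub>"
      by (rule bexI[of _ "eval_class E (m, \<theta>) (\<ominus>\<^bsub>fib E m\<^esub> v)"])
         (use v in \<open>auto simp: caloron_carrier add zero N.M.l_neg\<close>)
  qed (auto simp: caloron_carrier add zero N.M.a_ac)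
qed

lemma eval_class_minus:
  assumes m: "m \<in> points M" and v: "v \<in> carrier (fib E m)" and w: "w \<in> carrier (fib E m)"
  shows "eval_class E (m, \<theta>) v \<ominus>\<^bsub>caloron_fib E (m, \<theta>)\<^esub> eval_class E (m, \<theta>) w =
    eval_class E (m, \<theta>) (v \<ominus>\<^bsub>fib E m\<^esub> w)"
proof -
  interpret N: Module.module loop_ring "fib E m" by (rule fib_module[OF m])
  interpret C: abelian_group "caloron_fib E (m, \<theta>)" by (rule caloron_abelian_group[OF m])
  have c: "eval_class E (m, \<theta>) u \<in> carrier (caloron_fib E (m, \<theta>))" if "u \<in> carrier (fib E m)" for u
    using that by (simp add: caloron_carrier)
  have "(v \<ominus>\<^bsub>fib E m\<^esub> w) \<oplus>\<^bsub>fib E m\<^esub> w = v" using v w by (simp add: N.M.minus_eq N.M.a_assoc N.M.l_neg)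
  then have "eval_class E (m, \<theta>) (v \<ominus>\<^bsub>fib E m\<^esub> w) \<oplus>\<^bsub>caloron_fib E (m, \<theta>)\<^esub> eval_class E (m, \<theta>) w = eval_class E (m, \<theta>) v"
    using eval_class_add[OF E m N.M.minus_closed[OF v w] w] by simp
  then have "eval_class E (m, \<theta>) v \<ominus>\<^bsub>caloron_fib E (m, \<theta>)\<^esub> eval_class E (m, \<theta>) w =
      (eval_class E (m, \<theta>) (v \<ominus>\<^bsub>fib E m\<^esub> w) \<oplus>\<^bsub>caloron_fib E (m, \<theta>)\<^esub> eval_class E (m, \<theta>) w) \<ominus>\<^bsub>caloron_fib E (m, \<theta>)\<^esub> eval_class E (m, \<theta>) w"
    by simp
  also have "\<dots> = eval_class E (m, \<theta>) (v \<ominus>\<^bsub>fib E m\<^esub> w)"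
    using c[OF N.M.minus_closed[OF v w]] c[OF w] by (simp add: C.minus_eq C.a_assoc C.r_neg)
  finally show ?thesis .
qed

end

lemma dtheta_lift:
  assumes "\<And>c. Y (\<lambda>_. c) q = 0"
  shows "dtheta (lift Y) (q, \<theta>) = 0"
  by (simp add: dtheta_def lift_def assms)

lemma base_part_lift: "base_part (lift Y) r = Y"
  by (simp add: base_part_def lift_def)

lemma lie_bracket_lift: "lie_bracket (lift X) (lift Y) = lift (lie_bracket X Y)"
  by (auto simp: lie_bracket_def lift_def fun_eq_iff)

lemma deriv_sin_cos: "vector_derivative sin (at \<theta>) = cos \<theta>" "vector_derivative cos (at \<theta>) = - sin \<theta>"
  for \<theta> :: real
  by (auto intro!: vector_derivative_at simp flip: has_real_derivative_iff_has_vector_derivative)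

text \<open>The base part retains \<open>Y (\<lambda>_. 0)\<close>, which vanishes at points of the
  manifold but is not the zero operator; it is disposed of by \<open>pc_null\<close>.\<close>

lemma bracket_coord_UNIV:
  assumes "\<And>c. Y (\<lambda>_. c) q = 0"
  shows "base_part (lie_bracket (lift Y) (coord_field UNIV)) \<theta> = (\<lambda>g. Y (\<lambda>_. 0))"
    and "base_part (lie_bracket (coord_field UNIV) (lift Y)) \<theta> = (\<lambda>g q. - Y (\<lambda>_. 0) q)"
    and "dtheta (lie_bracket (lift Y) (coord_field UNIV)) (q, \<theta>) = 0"
    and "dtheta (lie_bracket (coord_field UNIV) (lift Y)) (q, \<theta>) = 0"
  by (simp_all add: base_part_def lie_bracket_def lift_def coord_field_def dtheta_def deriv_sin_cos assms fun_eq_iff)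

context connection_path
begin

abbreviation "pc \<equiv> path_connection M E D"
abbreviation "nab \<equiv> caloron_connection N' E' pc (path_higgs \<phi>)"
abbreviation "ev_sec \<equiv> eval_section N' E'"
abbreviation "cl \<equiv> eval_class E'"

lemma pN: "p \<in> points M \<Longrightarrow> t \<in> {0..1} \<Longrightarrow> (p, t) \<in> points N'"
  by (simp add: points_times_interval)

lemma pc_apply:
  assumes "p \<in> points M" "t \<in> {0..1}"
  shows "pc Y w (p, t) = D t (base_part Y t) (slice w t) p \<oplus>\<^bsub>fib E p\<^esub>
    (\<lambda>_. complex_of_real (Y snd (p, t))) \<odot>\<^bsub>fib E p\<^esub> conT w (p, t)"
proof -
  have q: "(p, t) \<in> points M \<times> {0..1}" using assms by simp
  show ?thesis unfolding path_connection_def conT_def restrict_apply if_P[OF q] slice_def by simp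
qed

context
  fixes w
  assumes w: "w \<in> sections N' E'"
begin

lemma pc_base:
  assumes p: "p \<in> points M" and t: "t \<in> {0..1}" and X: "base_part Y t \<in> vector_fields M" and 0: "Y snd (p, t) = 0"
  shows "pc Y w (p, t) = D t (base_part Y t) (slice w t) p"
proof -
  interpret Module.module loop_ring "fib E p" by (rule fib_module[OF p])
  have z: "(\<lambda>_. 0) = \<zero>\<^bsub>loop_ring\<^esub>" by (simp add: loop_ring_def)
  have "conT w (p, t) \<in> carrier (fib E p)" by (rule pull_closed[OF conT_section[OF w] p t])
  moreover have "D t (base_part Y t) (slice w t) p \<in> carrier (fib E p)"
    by (rule conn_closed[OF conn[OF t] X slice_section[OF w t] p])
  ultimately show ?thesis by (simp add: pc_apply[OF p t] 0 z)
qed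

lemma pc_null:
  assumes p: "p \<in> points M" and t: "t \<in> {0..1}" and X: "\<And>g p. p \<in> points M \<Longrightarrow> base_part Y t g p = 0" and 0: "Y snd (p, t) = 0"
  shows "pc Y w (p, t) = \<zero>\<^bsub>fib E p\<^esub>"
proof -
  have V: "base_part Y t \<in> vector_fields M" by (rule null_vector_field) (rule X)
  have "D t (base_part Y t) (slice w t) p = \<zero>\<^bsub>fib E p\<^esub>"
    by (rule module_connection_zero[where D = "D t", OF E conn[OF t] slice_section[OF w t] p V]) (rule X)
  then show ?thesis using pc_base[where Y = Y, OF p t V 0] by simp
qed

lemma pc_lift:
  assumes p: "p \<in> points M" and t: "t \<in> {0..1}" and X: "X \<in> vector_fields M"
  shows "pc (lift X) w (p, t) = conX X w (p, t)"
proof -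
  have "lift X snd (p, t) = 0" by (simp add: lift_def vector_field_const[OF X p])
  from pc_base[where Y = "lift X", OF p t _ this] show ?thesis using X p t by (simp add: base_part_lift conX_def)
qed

lemma coord_const: "t \<in> {0..1} \<Longrightarrow> coord_field {0..1} (\<lambda>q. g (fst q)) (p, t) = 0"
  by (simp add: coord_field_def vector_derivative_within[OF at_within_unit has_vector_derivative_const])

lemma coord_snd: "t \<in> {0..1} \<Longrightarrow> coord_field {0..1} snd (p, t) = 1"
  by (simp add: coord_field_def vector_derivative_within[OF at_within_unit has_vector_derivative_id])

lemma pc_coord:
  assumes p: "p \<in> points M" and t: "t \<in> {0..1}"
  shows "pc (coord_field {0..1}) w (p, t) = conT w (p, t)"
proof -
  interpret Module.module loop_ring "fib E p" by (rule fib_module[OF p])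
  have b: "base_part (coord_field {0..1}) t = (\<lambda>g p. 0)" by (simp add: base_part_def coord_const[OF t])
  have o: "(\<lambda>_. 1) = \<one>\<^bsub>loop_ring\<^esub>" by (simp add: loop_ring_def)
  have "D t (\<lambda>g p. 0) (slice w t) p = \<zero>\<^bsub>fib E p\<^esub>"
    by (rule module_connection_zero[where D = "D t", OF E conn[OF t] slice_section[OF w t] p zero_vector_field]) (rule refl)
  moreover have "conT w (p, t) \<in> carrier (fib E p)" by (rule pull_closed[OF conT_section[OF w] p t])
  ultimately show ?thesis by (simp add: pc_apply[OF p t] b coord_snd[OF t] o)
qed

lemma pc_bracket:
  assumes p: "p \<in> points M" and t: "t \<in> {0..1}" and X: "X \<in> vector_fields M"
  shows "pc (lie_bracket (coord_field {0..1}) (lift X)) w (p, t) = \<zero>\<^bsub>fib E p\<^esub>"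
    and "pc (lie_bracket (lift X) (coord_field {0..1})) w (p, t) = \<zero>\<^bsub>fib E p\<^esub>"
proof -
  have c: "vector_derivative (\<lambda>u. k) (at t within {0..1}) = 0" for k :: real
    by (rule vector_derivative_within[OF at_within_unit[OF t] has_vector_derivative_const])
  show "pc (lie_bracket (coord_field {0..1}) (lift X)) w (p, t) = \<zero>\<^bsub>fib E p\<^esub>"
    by (rule pc_null[OF p t])
       (simp_all add: base_part_def lie_bracket_def coord_field_def lift_def c vector_field_const[OF X] p)
  show "pc (lie_bracket (lift X) (coord_field {0..1})) w (p, t) = \<zero>\<^bsub>fib E p\<^esub>"
    by (rule pc_null[OF p t])
       (simp_all add: base_part_def lie_bracket_def coord_field_def lift_def c vector_field_const[OF X] p)
qed

lemma nab_eval: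
  assumes q: "q \<in> points N'"
  shows "nab Z (ev_sec w) (q, \<theta>) = cl (q, \<theta>) (pc (base_part Z \<theta>) w q) \<oplus>\<^bsub>caloron_fib E' (q, \<theta>)\<^esub>
    complex_of_real (dtheta Z (q, \<theta>)) \<odot>\<^bsub>caloron_fib E' (q, \<theta>)\<^esub> cl (q, \<theta>) (path_higgs \<phi> q (w q))"
  by (rule caloron_connection_eval_section[OF pull_interval_bundle w q])

lemma path_higgs_hig: "q \<in> points N' \<Longrightarrow> path_higgs \<phi> q (w q) = hig w q"
  by (auto simp: path_higgs_def hig_def points_times_interval)

lemma hig_closed: "q \<in> points N' \<Longrightarrow> hig w q \<in> carrier (fib E' q)"
  using pull_closed[OF hig_section[OF w]] by (auto simp: points_times_interval)

lemma nab_base: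
  assumes q: "q \<in> points N'" and r: "pc (base_part Z \<theta>) w q \<in> carrier (fib E' q)" and 0: "dtheta Z (q, \<theta>) = 0"
  shows "nab Z (ev_sec w) (q, \<theta>) = cl (q, \<theta>) (pc (base_part Z \<theta>) w q)"
proof -
  interpret Module.module loop_ring "fib E' q"
    using pull_interval_bundle q by (simp add: omega_vector_bundle_def omega_module_def del: pull_simps)
  have z: "(\<lambda>_. 0) = \<zero>\<^bsub>loop_ring\<^esub>" by (simp add: loop_ring_def)
  note h = hig_closed[OF q]
  show ?thesis
    unfolding nab_eval[OF q] path_higgs_hig[OF q] 0 of_real_0 eval_class_smult[OF pull_interval_bundle q h]
      z smult_l_null[OF h] eval_class_add[OF pull_interval_bundle q r M.zero_closed] M.r_zero[OF r] by (rule refl)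
qed

lemma nab_angle: "nab (coord_field UNIV) (ev_sec w) = ev_sec (hig w)"
proof
  fix x :: "('m \<times> real) \<times> real"
  obtain q \<theta> where x: "x = (q, \<theta>)" by fastforce
  show "nab (coord_field UNIV) (ev_sec w) x = ev_sec (hig w) x"
  proof (cases "q \<in> points N'")
    case q: True
    interpret Module.module loop_ring "fib E' q"
      using pull_interval_bundle q by (simp add: omega_vector_bundle_def omega_module_def del: pull_simps)
    have o: "(\<lambda>_. 1) = \<one>\<^bsub>loop_ring\<^esub>" by (simp add: loop_ring_def)
    obtain p t where pt: "q = (p, t)" "p \<in> points M" "t \<in> {0..1}" using q by (auto simp: points_times_interval)
    have b: "base_part (coord_field UNIV) \<theta> = (\<lambda>(f :: 'm \<times> real \<Rightarrow> real) p. 0)"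
      by (simp add: base_part_def coord_field_def)
    have d: "dtheta (coord_field UNIV) (q, \<theta>) = 1"
      using sin_cos_squared_add2[of \<theta>] by (simp add: dtheta_def coord_field_def deriv_sin_cos power2_eq_square)
    have n: "pc (\<lambda>f p. 0) w q = \<zero>\<^bsub>fib E' q\<^esub>"
      unfolding pt(1) using pc_null[OF pt(2,3), of "\<lambda>f p. 0"] by (simp add: base_part_def)
    note h = hig_closed[OF q]
    show ?thesis
      unfolding x nab_eval[OF q] path_higgs_hig[OF q] b d n of_real_1 eval_class_smult[OF pull_interval_bundle q h]
        o smult_one[OF h] eval_class_add[OF pull_interval_bundle q M.zero_closed h] M.l_zero[OF h]
        eval_section_apply[OF q] by (rule refl)
  qed (simp add: x eval_section_outside)
qed

text \<open>The equality concerns whole sections and not only values at a point, because the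
  curvature applies the connection to the result once more.\<close>

lemma nab_lift:
  assumes r: "r \<in> sections N' E'" and pc: "\<And>p t. p \<in> points M \<Longrightarrow> t \<in> {0..1} \<Longrightarrow> pc Y w (p, t) = r (p, t)"
    and Y: "\<And>p t c. p \<in> points M \<Longrightarrow> t \<in> {0..1} \<Longrightarrow> Y (\<lambda>_. c) (p, t) = 0"
  shows "nab (lift Y) (ev_sec w) = ev_sec r"
proof
  fix x :: "('m \<times> real) \<times> real"
  obtain q \<theta> where x: "x = (q, \<theta>)" by fastforce
  show "nab (lift Y) (ev_sec w) x = ev_sec r x"
  proof (cases "q \<in> points N'")
    case q: True
    obtain p t where pt: "q = (p, t)" "p \<in> points M" "t \<in> {0..1}" using q by (auto simp: points_times_interval)
    have e: "pc (base_part (lift Y) \<theta>) w q = r q" unfolding base_part_lift pt(1) by (rule pc[OF pt(2,3)])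
    have c: "pc (base_part (lift Y) \<theta>) w q \<in> carrier (fib E' q)"
      unfolding e using pull_closed[OF r pt(2,3)] pt(1) by simp
    have d: "dtheta (lift Y) (q, \<theta>) = 0" by (rule dtheta_lift) (simp only: pt(1) Y[OF pt(2,3)])
    have "nab (lift Y) (ev_sec w) (q, \<theta>) = cl (q, \<theta>) (pc (base_part (lift Y) \<theta>) w q)"
      by (rule nab_base[OF q c d])
    then show ?thesis unfolding x e eval_section_apply[OF q] .
  qed (simp add: x eval_section_outside)
qed

lemma lift_const: "X \<in> vector_fields M \<Longrightarrow> p \<in> points M \<Longrightarrow> lift X (\<lambda>_. c) (p, t) = 0"
  by (simp add: lift_def vector_field_const)

lemma nab_X: "X \<in> vector_fields M \<Longrightarrow> nab (lift (lift X)) (ev_sec w) = ev_sec (conX X w)"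
  by (rule nab_lift) (simp_all add: conX_section[OF w] pc_lift lift_const)

lemma nab_t: "nab (lift (coord_field {0..1})) (ev_sec w) = ev_sec (conT w)"
  by (rule nab_lift) (simp_all add: conT_section[OF w] pc_coord coord_const[where g = "\<lambda>_. _"])

lemma nab_null:
  assumes p: "p \<in> points M" and t: "t \<in> {0..1}" and 0: "pc (base_part Z \<theta>) w (p, t) = \<zero>\<^bsub>fib E p\<^esub>" "dtheta Z ((p, t), \<theta>) = 0"
  shows "nab Z (ev_sec w) ((p, t), \<theta>) = cl ((p, t), \<theta>) \<zero>\<^bsub>fib E p\<^esub>"
  using nab_base[OF pN[OF p t], of Z \<theta>] 0 fib_zero[OF p] by simp

lemma nab_bracket_angle:
  assumes p: "p \<in> points M" and t: "t \<in> {0..1}" and Y: "\<And>p t c. p \<in> points M \<Longrightarrow> t \<in> {0..1} \<Longrightarrow> Y (\<lambda>_. c) (p, t) = 0"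
  shows "nab (lie_bracket (lift Y) (coord_field UNIV)) (ev_sec w) ((p, t), \<theta>) = cl ((p, t), \<theta>) \<zero>\<^bsub>fib E p\<^esub>"
    and "nab (lie_bracket (coord_field UNIV) (lift Y)) (ev_sec w) ((p, t), \<theta>) = cl ((p, t), \<theta>) \<zero>\<^bsub>fib E p\<^esub>"
proof -
  have Y0: "Y (\<lambda>_. c) (p, t) = 0" for c by (rule Y[OF p t])
  have "pc (\<lambda>g. Y (\<lambda>_. 0)) w (p, t) = \<zero>\<^bsub>fib E p\<^esub>" "pc (\<lambda>g q. - Y (\<lambda>_. 0) q) w (p, t) = \<zero>\<^bsub>fib E p\<^esub>"
    by (rule pc_null[OF p t]; simp add: base_part_def Y[OF _ t] p)+
  then show "nab (lie_bracket (lift Y) (coord_field UNIV)) (ev_sec w) ((p, t), \<theta>) = cl ((p, t), \<theta>) \<zero>\<^bsub>fib E p\<^esub>"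
    and "nab (lie_bracket (coord_field UNIV) (lift Y)) (ev_sec w) ((p, t), \<theta>) = cl ((p, t), \<theta>) \<zero>\<^bsub>fib E p\<^esub>"
    by (simp_all add: nab_null[OF p t] bracket_coord_UNIV[of Y "(p, t)", OF Y0])
qed

lemma nab_bracket_tX:
  assumes p: "p \<in> points M" and t: "t \<in> {0..1}" and X: "X \<in> vector_fields M"
  shows "nab (lie_bracket (lift (coord_field {0..1})) (lift (lift X))) (ev_sec w) ((p, t), \<theta>) = cl ((p, t), \<theta>) \<zero>\<^bsub>fib E p\<^esub>"
    and "nab (lie_bracket (lift (lift X)) (lift (coord_field {0..1}))) (ev_sec w) ((p, t), \<theta>) = cl ((p, t), \<theta>) \<zero>\<^bsub>fib E p\<^esub>"
proof -
  have c: "vector_derivative (\<lambda>u. k) (at t within {0..1}) = 0" for k :: real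
    by (rule vector_derivative_within[OF at_within_unit[OF t] has_vector_derivative_const])
  have "dtheta (lift (lie_bracket (coord_field {0..1}) (lift X))) ((p, t), \<theta>) = 0"
    "dtheta (lift (lie_bracket (lift X) (coord_field {0..1}))) ((p, t), \<theta>) = 0"
    by (rule dtheta_lift, simp add: lie_bracket_def coord_field_def lift_def c vector_field_const[OF X p])+
  then show "nab (lie_bracket (lift (coord_field {0..1})) (lift (lift X))) (ev_sec w) ((p, t), \<theta>) = cl ((p, t), \<theta>) \<zero>\<^bsub>fib E p\<^esub>"
    and "nab (lie_bracket (lift (lift X)) (lift (coord_field {0..1}))) (ev_sec w) ((p, t), \<theta>) = cl ((p, t), \<theta>) \<zero>\<^bsub>fib E p\<^esub>"
    unfolding lie_bracket_lift by (simp_all add: nab_null[OF p t] base_part_lift pc_bracket[OF p t X])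
qed

end

abbreviation "curv \<equiv> curvature (points N' \<times> UNIV) (caloron_fib E') nab"

text \<open>If both directional derivatives take evaluated sections to evaluated sections, then so
  do their compositions, and all subtractions can be carried out in the fibre of the \<Omega> bundle
  before passing to the quotient.\<close>

lemma curv_eval:
  assumes p: "p \<in> points M" and t: "t \<in> {0..1}" and w: "w \<in> sections N' E'"
    and A: "\<And>w. w \<in> sections N' E' \<Longrightarrow> A w \<in> sections N' E'" "\<And>w. w \<in> sections N' E' \<Longrightarrow> nab Z (ev_sec w) = ev_sec (A w)"
    and B: "\<And>w. w \<in> sections N' E' \<Longrightarrow> B w \<in> sections N' E'" "\<And>w. w \<in> sections N' E' \<Longrightarrow> nab Z' (ev_sec w) = ev_sec (B w)"
    and r: "nab (lie_bracket Z Z') (ev_sec w) ((p, t), \<theta>) = cl ((p, t), \<theta>) r" "r \<in> carrier (fib E p)"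
  shows "curv Z Z' (ev_sec w) ((p, t), \<theta>) =
    cl ((p, t), \<theta>) (A (B w) (p, t) \<ominus>\<^bsub>fib E p\<^esub> B (A w) (p, t) \<ominus>\<^bsub>fib E p\<^esub> r)"
proof -
  have q: "((p, t), \<theta>) \<in> points N' \<times> UNIV" using pN[OF p t] by simp

  have c: "A (B w) (p, t) \<in> carrier (fib E p)" "B (A w) (p, t) \<in> carrier (fib E p)"
    using A(1) B(1) w by (auto intro: pull_closed[OF _ p t])
  have minus: "cl ((p, t), \<theta>) u \<ominus>\<^bsub>caloron_fib E' ((p, t), \<theta>)\<^esub> cl ((p, t), \<theta>) v = cl ((p, t), \<theta>) (u \<ominus>\<^bsub>fib E p\<^esub> v)"
    if "u \<in> carrier (fib E p)" "v \<in> carrier (fib E p)" for u v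
    using eval_class_minus[OF p that, of \<theta>]
    by (simp add: eval_class_def caloron_fib_def)
  show ?thesis
    unfolding curvature_def restrict_apply if_P[OF q] A(2)[OF w] B(2)[OF w] A(2)[OF B(1)[OF w]] B(2)[OF A(1)[OF w]] r(1)
      eval_section_apply[OF pN[OF p t]] minus[OF c] minus[OF fib_minus[OF p c] r(2)] by (rule refl)
qed

end

section \<open>Curvature matrices of the caloron connection\<close>

lemma eval_blocks_append:
  "eval_blocks (As @ Bs) Xs = eval_blocks As Xs @ eval_blocks Bs (drop (sum_list (map fst As)) Xs)"
  by (induction As Xs rule: eval_blocks.induct) (simp_all add: add.commute)

lemma eval_blocks_replicate:
  "eval_blocks (replicate j (2, A)) Xs = map (\<lambda>k. A (take 2 (drop (2 * k) Xs))) [0..<j]"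
proof (induction j arbitrary: Xs)
  case (Suc j)
  have "eval_blocks (replicate (Suc j) (2, A)) Xs =
      A (take 2 Xs) # map (\<lambda>k. A (take 2 (drop (2 * k) (drop 2 Xs)))) [0..<j]"
    by (simp add: Suc)
  also have "\<dots> = map (\<lambda>k. A (take 2 (drop (2 * k) Xs))) [0..<Suc j]"
    unfolding upt_conv_Cons[OF zero_less_Suc] map_Suc_upt[symmetric] by (simp add: add.commute)
  finally show ?case .
qed simp

lemma prod_list_fact_replicate:
  "(\<Prod>(p, A)\<leftarrow>replicate j (2, B). fact p :: complex) = 2 ^ j"
  by (induction j) simp_all

context local_frame
begin

lemma sym_trace_represents:
  assumes p: "p \<in> O'" and T: "list_all2 (loop_represents p \<theta>) Ts Ms"
  shows "sym_trace (rank E) (fib E p) \<theta> Ts = 1 / ((fact (length Ms))\<^sup>2 * (2 * pi * \<i>) ^ length Ms) *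
    (\<Sum>\<sigma> | \<sigma> permutes {..<length Ms}. mat_trace (rank E) (map (\<lambda>i. Ms ! \<sigma> i) [0..<length Ms]))"
proof -
  have pU: "p \<in> U" and pM: "p \<in> points M" using p O'(2) O_sub by auto
  interpret evaluation loop_ring "\<lambda>f. f \<theta>" by (rule evaluation_loop[OF omega_module_closed(1)[OF om[OF pM]]])
  have len: "length Ts = length Ms" by (rule list_all2_lengthD[OF T])
  have "mod_trace loop_ring (rank E) (fib E p) (foldr (\<circ>) (map (\<lambda>i. Ts ! \<sigma> i) [0..<length Ms]) id) \<theta> =
      mat_trace (rank E) (map (\<lambda>i. Ms ! \<sigma> i) [0..<length Ms])"
    if \<sigma>: "\<sigma> permutes {..<length Ms}" for \<sigma>
  proof (rule ev_mod_trace_foldr[OF iso[OF pU] fib_add[OF pM] fib_smult[OF pM]])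
    show "list_all2 (loop_represents p \<theta>) (map (\<lambda>i. Ts ! \<sigma> i) [0..<length Ms]) (map (\<lambda>i. Ms ! \<sigma> i) [0..<length Ms])"
      using list_all2_nthD2[OF T] permutes_in_image[OF \<sigma>] by (simp add: list_all2_conv_all_nth)
  qed
  then show ?thesis unfolding sym_trace_def len by simp
qed

text \<open>The counterpart of \<open>at_point_represents\<close> for an operator that is already
  given on the fibre, as the derivative of the Higgs field is.\<close>

lemma section_at_represents:
  assumes p: "p \<in> O'"
    and T: "\<And>v. v \<in> sections M E \<Longrightarrow> T (v p) \<in> carrier (fib E p)"
      "\<And>v i. v \<in> sections M E \<Longrightarrow> i < rank E \<Longrightarrow> \<tau> p (T (v p)) i \<theta> = (\<Sum>k<rank E. A i k * \<tau> p (v p) k \<theta>)"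
  shows "loop_represents p \<theta> T A"
proof -
  have pM: "p \<in> points M" using p O_sub by blast
  have "T e \<in> carrier (fib E p) \<and> (\<forall>i<rank E. \<tau> p (T e) i \<theta> = (\<Sum>k<rank E. A i k * \<tau> p e k \<theta>))"
    if e: "e \<in> carrier (fib E p)" for e
  proof -
    obtain v where "v \<in> sections M E" "v p = e" using section_through[OF p e] by metis
    then show ?thesis using T(1)[of v] T(2)[of v] by simp
  qed
  then show ?thesis by (simp add: loop_represents_def[OF pM])
qed

end

context path_frame
begin

definition curv_mat :: "real \<Rightarrow> 'm \<Rightarrow> real \<Rightarrow> 'm vfield \<Rightarrow> 'm vfield \<Rightarrow> cmatrix" where
  "curv_mat t p \<theta> X Y i k = \<tau> p (curvature (points M) (fib E) (D t) X Y (frame k) p) i \<theta>"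

definition conn_dot_mat :: "real \<Rightarrow> 'm \<Rightarrow> real \<Rightarrow> 'm vfield \<Rightarrow> cmatrix" where
  "conn_dot_mat t p \<theta> X i k = \<tau> p (fibre_derivative (rank E) (fib E p) (\<lambda>u. D u X (frame k) p) t) i \<theta>"

definition higgs_mat :: "real \<Rightarrow> 'm \<Rightarrow> real \<Rightarrow> 'm vfield \<Rightarrow> cmatrix" where
  "higgs_mat t p \<theta> X i k = \<tau> p (higgs_derivative (points M) (fib E) (D t) (\<phi> t) X (frame k) p) i \<theta>"

definition higgs_dot_mat :: "real \<Rightarrow> 'm \<Rightarrow> real \<Rightarrow> cmatrix" where
  "higgs_dot_mat t p \<theta> i k = \<tau> p (fibre_derivative (rank E) (fib E p) (\<lambda>u. \<phi> u p (frame k p)) t) i \<theta>"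

text \<open>A matrix for the curvature at one point, tested on all evaluated sections. The value is
  given through a representative \<open>r\<close>, because \<tau> reads elements of the fibre and
  not their classes.\<close>

definition cal_rep :: "real \<Rightarrow> 'm \<Rightarrow> real \<Rightarrow> (('m \<times> real) \<times> real) vfield \<Rightarrow> (('m \<times> real) \<times> real) vfield \<Rightarrow> cmatrix \<Rightarrow> bool" where
  "cal_rep t p \<theta> Z Z' A \<longleftrightarrow> (\<forall>w\<in>sections N' E'. \<exists>r\<in>carrier (fib E p).
     curv Z Z' (ev_sec w) ((p, t), \<theta>) = cl ((p, t), \<theta>) r \<and>
     (\<forall>i<rank E. \<tau> p r i \<theta> = (\<Sum>k<rank E. A i k * \<tau> p (w (p, t)) k \<theta>)))"

context
  fixes p :: 'm and t :: real
  assumes p: "p \<in> O'" and t: "t \<in> {0..1}"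
begin

lemma pU: "p \<in> U" and pM: "p \<in> points M"
  using p O'(2) O_sub by auto

text \<open>Handles the pairs of directions with vanishing bracket term, in both orders at once: the
  curvature is then the commutator of the operators \<open>A\<close> and \<open>B\<close>, whose
  matrix is \<open>C\<close>.\<close>

lemma cal_rep_pair:
  assumes A: "\<And>w. w \<in> sections N' E' \<Longrightarrow> A w \<in> sections N' E'" "\<And>w. w \<in> sections N' E' \<Longrightarrow> nab Z (ev_sec w) = ev_sec (A w)"
    and B: "\<And>w. w \<in> sections N' E' \<Longrightarrow> B w \<in> sections N' E'" "\<And>w. w \<in> sections N' E' \<Longrightarrow> nab Z' (ev_sec w) = ev_sec (B w)"
    and 0: "\<And>w. w \<in> sections N' E' \<Longrightarrow> nab (lie_bracket Z Z') (ev_sec w) ((p, t), \<theta>) = cl ((p, t), \<theta>) \<zero>\<^bsub>fib E p\<^esub>"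
      "\<And>w. w \<in> sections N' E' \<Longrightarrow> nab (lie_bracket Z' Z) (ev_sec w) ((p, t), \<theta>) = cl ((p, t), \<theta>) \<zero>\<^bsub>fib E p\<^esub>"
    and C: "\<And>w i. w \<in> sections N' E' \<Longrightarrow> i < rank E \<Longrightarrow>
      \<tau> p (A (B w) (p, t)) i \<theta> - \<tau> p (B (A w) (p, t)) i \<theta> = (\<Sum>k<rank E. \<tau> p (w (p, t)) k \<theta> * C i k)"
  shows "cal_rep t p \<theta> Z Z' C" "cal_rep t p \<theta> Z' Z (\<lambda>i k. - C i k)"
proof -
  note z = fib_zero[OF pM]
  have c: "A (B w) (p, t) \<in> carrier (fib E p)" "B (A w) (p, t) \<in> carrier (fib E p)" if "w \<in> sections N' E'" for w
    using A(1) B(1) that by (auto intro: pull_closed[OF _ pM t])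
  have d: "\<tau> p (x \<ominus>\<^bsub>fib E p\<^esub> y \<ominus>\<^bsub>fib E p\<^esub> \<zero>\<^bsub>fib E p\<^esub>) i \<theta> = \<tau> p x i \<theta> - \<tau> p y i \<theta>"
    if "x \<in> carrier (fib E p)" "y \<in> carrier (fib E p)" "i < rank E" for x y i
    unfolding coord_minus[OF pM iso[OF pU] fib_minus[OF pM that(1,2)] z that(3)] coord_minus[OF pM iso[OF pU] that]
      coord_zero[OF pM iso[OF pU] that(3)] by simp
  show "cal_rep t p \<theta> Z Z' C"
    unfolding cal_rep_def
  proof
    fix w assume w: "w \<in> sections N' E'"
    show "\<exists>r\<in>carrier (fib E p). curv Z Z' (ev_sec w) ((p, t), \<theta>) = cl ((p, t), \<theta>) r \<and>
        (\<forall>i<rank E. \<tau> p r i \<theta> = (\<Sum>k<rank E. C i k * \<tau> p (w (p, t)) k \<theta>))"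
      by (rule bexI[of _ "A (B w) (p, t) \<ominus>\<^bsub>fib E p\<^esub> B (A w) (p, t) \<ominus>\<^bsub>fib E p\<^esub> \<zero>\<^bsub>fib E p\<^esub>"])
         (simp_all add: curv_eval[OF pM t w A B 0(1)[OF w] z] d c w C fib_minus[OF pM] z mult.commute)
  qed
  show "cal_rep t p \<theta> Z' Z (\<lambda>i k. - C i k)"
    unfolding cal_rep_def
  proof
    fix w assume w: "w \<in> sections N' E'"
    have C': "\<tau> p (B (A w) (p, t)) i \<theta> - \<tau> p (A (B w) (p, t)) i \<theta> = (\<Sum>k<rank E. - C i k * \<tau> p (w (p, t)) k \<theta>)"
      if "i < rank E" for i
      using C[OF w that] by (simp add: sum_negf mult.commute) (simp add: algebra_simps)
    show "\<exists>r\<in>carrier (fib E p). curv Z' Z (ev_sec w) ((p, t), \<theta>) = cl ((p, t), \<theta>) r \<and>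
        (\<forall>i<rank E. \<tau> p r i \<theta> = (\<Sum>k<rank E. - C i k * \<tau> p (w (p, t)) k \<theta>))"
      by (intro bexI[of _ "B (A w) (p, t) \<ominus>\<^bsub>fib E p\<^esub> A (B w) (p, t) \<ominus>\<^bsub>fib E p\<^esub> \<zero>\<^bsub>fib E p\<^esub>"] conjI allI impI)
         (simp_all only: curv_eval[OF pM t w B A 0(2)[OF w] z] d[OF c(2,1)[OF w]] C' fib_minus[OF pM] c[OF w] z)
  qed
qed

lemma cal_rep_tX:
  assumes X: "X \<in> vector_fields M"
  shows "cal_rep t p \<theta> (lift (coord_field {0..1})) (lift (lift X)) (conn_dot_mat t p \<theta> X)"
    and "cal_rep t p \<theta> (lift (lift X)) (lift (coord_field {0..1})) (\<lambda>i k. - conn_dot_mat t p \<theta> X i k)"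
  by (rule cal_rep_pair[where A = conT and B = "conX X"],
      simp_all add: conT_section nab_t conX_section[OF _ X] nab_X[OF _ X] nab_bracket_tX[OF _ pM t X]
        conT_conX[OF _ X p t] conn_dot_mat_def)+

lemma nab_coord_angle:
  assumes w: "w \<in> sections N' E'"
  shows "nab (lie_bracket (lift (coord_field {0..1})) (coord_field UNIV)) (ev_sec w) ((p, t), \<theta>) = cl ((p, t), \<theta>) \<zero>\<^bsub>fib E p\<^esub>"
    and "nab (lie_bracket (coord_field UNIV) (lift (coord_field {0..1}))) (ev_sec w) ((p, t), \<theta>) = cl ((p, t), \<theta>) \<zero>\<^bsub>fib E p\<^esub>"
  by (rule nab_bracket_angle[OF w pM t]; simp add: coord_const[OF w, where g = "\<lambda>_. _"])+

lemma nab_lift_angle: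
  assumes w: "w \<in> sections N' E'" and X: "X \<in> vector_fields M"
  shows "nab (lie_bracket (lift (lift X)) (coord_field UNIV)) (ev_sec w) ((p, t), \<theta>) = cl ((p, t), \<theta>) \<zero>\<^bsub>fib E p\<^esub>"
    and "nab (lie_bracket (coord_field UNIV) (lift (lift X))) (ev_sec w) ((p, t), \<theta>) = cl ((p, t), \<theta>) \<zero>\<^bsub>fib E p\<^esub>"
  by (rule nab_bracket_angle[OF w pM t]; simp add: lift_const[OF w X])+

lemma cal_rep_t_angle:
  shows "cal_rep t p \<theta> (lift (coord_field {0..1})) (coord_field UNIV) (higgs_dot_mat t p \<theta>)"
    and "cal_rep t p \<theta> (coord_field UNIV) (lift (coord_field {0..1})) (\<lambda>i k. - higgs_dot_mat t p \<theta> i k)"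
  by (rule cal_rep_pair[where A = conT and B = hig],
      simp_all add: conT_section nab_t hig_section nab_angle
        nab_coord_angle conT_hig[OF _ p t] higgs_dot_mat_def)+

lemma slice_conX: "w \<in> sections N' E' \<Longrightarrow> X \<in> vector_fields M \<Longrightarrow> slice (conX X w) t = D t X (slice w t)"
  by (rule sections_ext)
     (use t in \<open>simp_all add: slice_section conX_section conn_section[OF conn[OF t]], simp add: slice_def conX_def\<close>)

lemma slice_hig: "w \<in> sections N' E' \<Longrightarrow> slice (hig w) t = sec_higgs (\<phi> t) (slice w t)"
  by (rule sections_ext)
     (use t in \<open>simp_all add: slice_section hig_section sec_higgs_section[OF higgs[OF t]], simp add: slice_def hig_def sec_higgs_def\<close>)

lemma slice_at: "slice w t p = w (p, t)"
  using pM by (simp add: slice_def)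

lemma conX_at: "conX X w (p, t) = D t X (slice w t) p" and hig_at: "hig w (p, t) = \<phi> t p (w (p, t))"
  using pM t by (simp_all add: conX_def hig_def)

lemma cal_rep_X_angle:
  assumes X: "X \<in> vector_fields M"
  shows "cal_rep t p \<theta> (lift (lift X)) (coord_field UNIV) (higgs_mat t p \<theta> X)"
    and "cal_rep t p \<theta> (coord_field UNIV) (lift (lift X)) (\<lambda>i k. - higgs_mat t p \<theta> X i k)"
proof -
  have C: "\<tau> p (conX X (hig w) (p, t)) i \<theta> - \<tau> p (hig (conX X w) (p, t)) i \<theta> =
      (\<Sum>k<rank E. \<tau> p (w (p, t)) k \<theta> * higgs_mat t p \<theta> X i k)" if w: "w \<in> sections N' E'" and i: "i < rank E" for w i
  proof -
    have v: "slice w t \<in> sections M E" by (rule slice_section[OF w t])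
    have c: "D t X (sec_higgs (\<phi> t) (slice w t)) p \<in> carrier (fib E p)" "\<phi> t p (D t X (slice w t) p) \<in> carrier (fib E p)"
      by (intro conn_closed[OF conn[OF t] X] higgs_closed[OF higgs[OF t] pM] sec_higgs_section[OF higgs[OF t]] v pM)+
    have "\<tau> p (conX X (hig w) (p, t)) i \<theta> - \<tau> p (hig (conX X w) (p, t)) i \<theta> =
        \<tau> p (higgs_derivative (points M) (fib E) (D t) (\<phi> t) X (slice w t) p) i \<theta>"
      unfolding higgs_derivative_def restrict_apply if_P[OF pM] sec_higgs_def[symmetric] coord_minus[OF pM iso[OF pU] c i]
        conX_at hig_at slice_hig[OF w] by (rule refl)
    also have "\<dots> = (\<Sum>k<rank E. \<tau> p (w (p, t)) k \<theta> * higgs_mat t p \<theta> X i k)"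
      using higgs_derivative_tensorial[OF conn[OF t] higgs[OF t] X v p i] by (simp add: slice_at higgs_mat_def)
    finally show ?thesis .
  qed
  show "cal_rep t p \<theta> (lift (lift X)) (coord_field UNIV) (higgs_mat t p \<theta> X)"
    and "cal_rep t p \<theta> (coord_field UNIV) (lift (lift X)) (\<lambda>i k. - higgs_mat t p \<theta> X i k)"
    by (rule cal_rep_pair[where A = "conX X" and B = hig],
        simp_all add: conX_section[OF _ X] nab_X[OF _ X] hig_section nab_angle nab_lift_angle[OF _ X] C)+
qed

text \<open>Here the bracket term is present. At fixed t the three terms together are the curvature
  of \<open>D t\<close> on the slice of \<open>w\<close>, whose tensoriality provides the
  matrix.\<close>

lemma cal_rep_XY:
  assumes X: "X \<in> vector_fields M" and Y: "Y \<in> vector_fields M"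
  shows "cal_rep t p \<theta> (lift (lift X)) (lift (lift Y)) (curv_mat t p \<theta> X Y)"
  unfolding cal_rep_def
proof
  fix w assume w: "w \<in> sections N' E'"
  have XY: "lie_bracket X Y \<in> vector_fields M" by (rule lie_bracket_vector_field[OF X Y])
  have v: "slice w t \<in> sections M E" by (rule slice_section[OF w t])
  have b: "nab (lie_bracket (lift (lift X)) (lift (lift Y))) (ev_sec w) ((p, t), \<theta>) =
      cl ((p, t), \<theta>) (D t (lie_bracket X Y) (slice w t) p)"
    unfolding lie_bracket_lift nab_X[OF w XY] eval_section_apply[OF pN[OF pM t]] conX_at by (rule refl)
  have bc: "D t (lie_bracket X Y) (slice w t) p \<in> carrier (fib E p)"
    by (rule conn_closed[OF conn[OF t] XY v pM])
  define r where "r = curvature (points M) (fib E) (D t) X Y (slice w t) p"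
  have c: "conX X (conX Y w) (p, t) \<in> carrier (fib E p)" "conX Y (conX X w) (p, t) \<in> carrier (fib E p)"
    by (intro pull_closed[OF _ pM t] conX_section w X Y)+
  have req: "r = conX X (conX Y w) (p, t) \<ominus>\<^bsub>fib E p\<^esub> conX Y (conX X w) (p, t) \<ominus>\<^bsub>fib E p\<^esub> D t (lie_bracket X Y) (slice w t) p"
    unfolding r_def curvature_def restrict_apply if_P[OF pM] conX_at slice_conX[OF w X] slice_conX[OF w Y] by (rule refl)
  have "curv (lift (lift X)) (lift (lift Y)) (ev_sec w) ((p, t), \<theta>) = cl ((p, t), \<theta>) r"
    unfolding req
    by (rule curv_eval[OF pM t w conX_section[OF _ X] nab_X[OF _ X] conX_section[OF _ Y] nab_X[OF _ Y] b bc])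
  moreover have "r \<in> carrier (fib E p)" unfolding req by (intro fib_minus[OF pM] c bc)
  moreover have "\<tau> p r i \<theta> = (\<Sum>k<rank E. curv_mat t p \<theta> X Y i k * \<tau> p (w (p, t)) k \<theta>)" if "i < rank E" for i
    using curvature_tensorial[OF conn[OF t] X Y v p that] by (simp add: r_def curv_mat_def slice_at mult.commute)
  ultimately show "\<exists>r\<in>carrier (fib E p). curv (lift (lift X)) (lift (lift Y)) (ev_sec w) ((p, t), \<theta>) = cl ((p, t), \<theta>) r \<and>
      (\<forall>i<rank E. \<tau> p r i \<theta> = (\<Sum>k<rank E. curv_mat t p \<theta> X Y i k * \<tau> p (w (p, t)) k \<theta>))"
    by blast
qed

text \<open>The bracket term changes sign because a connection is linear over functions in its
  direction, here over the constant -1. The restriction on the entries comes from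
  \<open>frame k\<close>, a section only below the rank.\<close>

lemma curv_mat_swap:
  assumes X: "X \<in> vector_fields M" and Y: "Y \<in> vector_fields M" and ik: "i < rank E" "k < rank E"
  shows "curv_mat t p \<theta> Y X i k = - curv_mat t p \<theta> X Y i k"
proof -
  have v: "frame k \<in> sections M E" by (rule frame_section[OF ik(2)])
  have XY: "lie_bracket X Y \<in> vector_fields M" by (rule lie_bracket_vector_field[OF X Y])
  have YX: "lie_bracket Y X \<in> vector_fields M" by (rule lie_bracket_vector_field[OF Y X])
  note cc = conn_closed[OF conn[OF t]]
  note cs = conn_section[OF conn[OF t]]
  have "lie_bracket Y X = (\<lambda>h p. (- 1) * lie_bracket X Y h p)" by (auto simp: lie_bracket_def fun_eq_iff)
  then have "D t (lie_bracket Y X) (frame k) p = (\<lambda>\<theta>. complex_of_real (- 1)) \<odot>\<^bsub>fib E p\<^esub> D t (lie_bracket X Y) (frame k) p"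
    using module_connection_scale[OF conn[OF t] XY v const_smooth_funs[of "-1"] pM] by simp
  then have b: "\<tau> p (D t (lie_bracket Y X) (frame k) p) i \<theta> = - \<tau> p (D t (lie_bracket X Y) (frame k) p) i \<theta>"
    using coord_smult[OF pM iso[OF pU] const_loop cc[OF XY v pM] ik(1)] by simp
  have c: "curv_mat t p \<theta> A B i k = \<tau> p (D t A (D t B (frame k)) p) i \<theta> - \<tau> p (D t B (D t A (frame k)) p) i \<theta>
      - \<tau> p (D t (lie_bracket A B) (frame k) p) i \<theta>"
    if A: "A \<in> vector_fields M" and B: "B \<in> vector_fields M" and AB: "lie_bracket A B \<in> vector_fields M" for A B
    unfolding curv_mat_def curvature_def restrict_apply if_P[OF pM]
      coord_minus[OF pM iso[OF pU] fib_minus[OF pM cc[OF A cs[OF B v] pM] cc[OF B cs[OF A v] pM]] cc[OF AB v pM] ik(1)]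
      coord_minus[OF pM iso[OF pU] cc[OF A cs[OF B v] pM] cc[OF B cs[OF A v] pM] ik(1)] by (rule refl)
  show ?thesis unfolding c[OF X Y XY] c[OF Y X YX] b by simp
qed

lemma curvature_form_represents:
  assumes "X \<in> vector_fields M" "Y \<in> vector_fields M"
  shows "loop_represents p \<theta> (at_point (sections M E) (curvature (points M) (fib E) (D t) X Y) p) (curv_mat t p \<theta> X Y)"
proof (rule at_point_represents[OF p])
  note XY = assms and L = lie_bracket_vector_field[OF assms]
  show "curvature (points M) (fib E) (D t) X Y v p \<in> carrier (fib E p)" if "v \<in> sections M E" for v
    unfolding curvature_def restrict_apply if_P[OF pM]
    by (intro fib_minus[OF pM] conn_closed[OF conn[OF t] _ _ pM] conn_section[OF conn[OF t]] XY L that)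
qed (simp add: curvature_tensorial[OF conn[OF t] assms _ p] curv_mat_def mult.commute)

lemma higgs_derivative_form_represents:
  assumes X: "X \<in> vector_fields M"
  shows "loop_represents p \<theta> (at_point (sections M E) (higgs_derivative (points M) (fib E) (D t) (\<phi> t) X) p) (higgs_mat t p \<theta> X)"
proof (rule at_point_represents[OF p])
  show "higgs_derivative (points M) (fib E) (D t) (\<phi> t) X v p \<in> carrier (fib E p)" if "v \<in> sections M E" for v
    unfolding higgs_derivative_def restrict_apply if_P[OF pM] sec_higgs_def[symmetric]
    by (intro fib_minus[OF pM] conn_closed[OF conn[OF t] X _ pM] higgs_closed[OF higgs[OF t] pM] sec_higgs_section[OF higgs[OF t]] that)
qed (simp add: higgs_derivative_tensorial[OF conn[OF t] higgs[OF t] X _ p] higgs_mat_def mult.commute)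

text \<open>In the expansion of the connection the term that differentiates the coefficients of
  \<open>v\<close> is the same for all parameters of the path, so the derivative of the path is
  tensorial.\<close>

lemma conn_dot_form_represents:
  assumes X: "X \<in> vector_fields M"
  shows "loop_represents p \<theta> (at_point (sections M E)
    (\<lambda>v. \<lambda>m\<in>points M. fibre_derivative (rank E) (fib E m) (\<lambda>u. D u X v m) t) p) (conn_dot_mat t p \<theta> X)"
proof (rule at_point_represents[OF p])
  fix v assume v: "v \<in> sections M E"
  have c: "D u X v p = (\<lambda>q\<in>points M \<times> {0..1}. D (snd q) X v (fst q)) (p, u)" if "u \<in> {0..1}" for u v
    using pM that by simp
  show "(\<lambda>m\<in>points M. fibre_derivative (rank E) (fib E m) (\<lambda>u. D u X v m) t) p \<in> carrier (fib E p)"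
    using fibre_derivative_coord(1)[OF conn_smooth[OF v X] U pU t c] pM by simp
  fix i assume i: "i < rank E"
  have "((\<lambda>u. complex_derivative X (\<lambda>p. coef v i p \<theta>) p + (\<Sum>k<rank E. \<tau> p (v p) k \<theta> * \<tau> p (D u X (frame k) p) i \<theta>))
      has_vector_derivative 0 + (\<Sum>k<rank E. \<tau> p (v p) k \<theta> * conn_dot_mat t p \<theta> X i k)) (at t within {0..1})"
    unfolding conn_dot_mat_def
    by (intro has_vector_derivative_add has_vector_derivative_const has_vector_derivative_sum
        bounded_linear.has_vector_derivative[OF bounded_linear_mult_right]
        fibre_derivative_works[OF conn_smooth[OF frame_section X] U pU t c i]) auto
  then have "((\<lambda>u. \<tau> p (D u X v p) i \<theta>) has_vector_derivative
      0 + (\<Sum>k<rank E. \<tau> p (v p) k \<theta> * conn_dot_mat t p \<theta> X i k)) (at t within {0..1})"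
    by (rule has_vector_derivative_transform[OF t, rotated]) (simp add: conn_expansion[OF conn X v p i])
  from vector_derivative_unique_within[OF at_within_unit[OF t] fibre_derivative_works[OF conn_smooth[OF v X] U pU t c i] this]
  show "\<tau> p ((\<lambda>m\<in>points M. fibre_derivative (rank E) (fib E m) (\<lambda>u. D u X v m) t) p) i \<theta> =
      (\<Sum>k<rank E. conn_dot_mat t p \<theta> X i k * \<tau> p (v p) k \<theta>)"
    using pM by (simp add: mult.commute)
qed

text \<open>Again the differentiated term, here the derivative in \<theta>, does not depend on the
  path parameter and drops out.\<close>

lemma higgs_dot_form_represents:
  "loop_represents p \<theta> (\<lambda>e. fibre_derivative (rank E) (fib E p) (\<lambda>u. \<phi> u p e) t) (higgs_dot_mat t p \<theta>)"
proof (rule section_at_represents[OF p])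
  fix v assume v: "v \<in> sections M E"
  have c: "\<phi> u p (v p) = (\<lambda>q\<in>points M \<times> {0..1}. \<phi> (snd q) (fst q) (v (fst q))) (p, u)" if "u \<in> {0..1}" for u v
    using pM that by simp
  show "fibre_derivative (rank E) (fib E p) (\<lambda>u. \<phi> u p (v p)) t \<in> carrier (fib E p)"
    by (rule fibre_derivative_coord(1)[OF higgs_smooth[OF v] U pU t c])
  fix i assume i: "i < rank E"
  have "((\<lambda>u. vector_derivative (\<tau> p (v p) i) (at \<theta>) + (\<Sum>k<rank E. \<tau> p (v p) k \<theta> * \<tau> p (\<phi> u p (frame k p)) i \<theta>))
      has_vector_derivative 0 + (\<Sum>k<rank E. \<tau> p (v p) k \<theta> * higgs_dot_mat t p \<theta> i k)) (at t within {0..1})"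
    unfolding higgs_dot_mat_def
    by (intro has_vector_derivative_add has_vector_derivative_const has_vector_derivative_sum
        bounded_linear.has_vector_derivative[OF bounded_linear_mult_right]
        fibre_derivative_works[OF higgs_smooth[OF frame_section] U pU t c i]) auto
  then have "((\<lambda>u. \<tau> p (\<phi> u p (v p)) i \<theta>) has_vector_derivative
      0 + (\<Sum>k<rank E. \<tau> p (v p) k \<theta> * higgs_dot_mat t p \<theta> i k)) (at t within {0..1})"
    by (rule has_vector_derivative_transform[OF t, rotated])
       (simp add: higgs_expansion[OF higgs p section_closed[OF v pM] i])
  from vector_derivative_unique_within[OF at_within_unit[OF t] fibre_derivative_works[OF higgs_smooth[OF v] U pU t c i] this]
  show "\<tau> p (fibre_derivative (rank E) (fib E p) (\<lambda>u. \<phi> u p (v p)) t) i \<theta> =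
      (\<Sum>k<rank E. higgs_dot_mat t p \<theta> i k * \<tau> p (v p) k \<theta>)"
    by (simp add: mult.commute)
qed

text \<open>The section chosen by \<open>at_point\<close> is the evaluation of some
  \<open>w\<close>. Whichever it is, \<open>cal_rep\<close> determines the coordinates of the result
  from those of \<open>w (p, t)\<close> at \<theta>, that is, from the class
  \<open>V\<close>.\<close>

lemma caloron_represents:
  assumes A: "cal_rep t p \<theta> Z Z' A"
    and \<beta>: "\<And>e i. e \<in> carrier (fib E p) \<Longrightarrow> i < rank E \<Longrightarrow> \<beta> (cl ((p, t), \<theta>) e) i = \<tau> p e i \<theta>"
  shows "evaluation.represents id (rank E) (caloron_fib E' ((p, t), \<theta>)) \<beta>
    (at_point (caloron_sections N' E') (curv Z Z') ((p, t), \<theta>)) A"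
  unfolding evaluation.represents_def[OF evaluation_complex] id_apply
proof
  fix V assume "V \<in> carrier (caloron_fib E' ((p, t), \<theta>))"
  then obtain e where e: "e \<in> carrier (fib E p)" "V = cl ((p, t), \<theta>) e"
    by (auto simp: caloron_carrier)
  obtain v where v: "v \<in> sections M E" "v p = e" using section_through[OF p e(1)] by metis
  define s where "s = (SOME s. s \<in> caloron_sections N' E' \<and> s ((p, t), \<theta>) = V)"
  \<comment> \<open>A section over \<open>M\<close> through \<open>e\<close>, pulled back to the
    cylinder, shows that a section with value \<open>V\<close> exists.\<close>
  have "ev_sec (pull v) \<in> caloron_sections N' E' \<and> ev_sec (pull v) ((p, t), \<theta>) = V"
    using pull_section[OF v(1)] e(2) v(2) pM t
    by (simp add: caloron_sections_def eval_section_apply[OF pN[OF pM t]] pull_def)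
  then have "s \<in> caloron_sections N' E' \<and> s ((p, t), \<theta>) = V"
    unfolding s_def by (rule someI[of "\<lambda>s. s \<in> caloron_sections N' E' \<and> s ((p, t), \<theta>) = V"])
  then obtain w where w: "w \<in> sections N' E'" "s = ev_sec w" "V = cl ((p, t), \<theta>) (w (p, t))"
    by (auto simp: caloron_sections_def eval_section_apply[OF pN[OF pM t]])
  have wc: "w (p, t) \<in> carrier (fib E p)" by (rule pull_closed[OF w(1) pM t])
  obtain r where r: "r \<in> carrier (fib E p)" "curv Z Z' (ev_sec w) ((p, t), \<theta>) = cl ((p, t), \<theta>) r"
    "\<And>i. i < rank E \<Longrightarrow> \<tau> p r i \<theta> = (\<Sum>k<rank E. A i k * \<tau> p (w (p, t)) k \<theta>)"
    using bspec[OF A[unfolded cal_rep_def] w(1)] by (elim bexE conjE) simp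
  have eq: "at_point (caloron_sections N' E') (curv Z Z') ((p, t), \<theta>) V = cl ((p, t), \<theta>) r"
    unfolding at_point_def s_def[symmetric] w(2) by (rule r(2))
  show "at_point (caloron_sections N' E') (curv Z Z') ((p, t), \<theta>) V \<in> carrier (caloron_fib E' ((p, t), \<theta>)) \<and>
      (\<forall>i<rank E. \<beta> (at_point (caloron_sections N' E') (curv Z Z') ((p, t), \<theta>) V) i = (\<Sum>k<rank E. A i k * \<beta> V k))"
    unfolding eq unfolding w(3) using r \<beta>[OF r(1)] \<beta>[OF wc] by (simp add: caloron_carrier)
qed

end

end

section \<open>The string potential\<close>

text \<open>\<open>1 / 2 ^ j\<close> is the normalisation of the wedge product for \<open>j\<close>
  factors of degree 2.\<close>

lemma extend_to_forms_replicate: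
  fixes Zs :: "'v list"
  assumes len: "length Zs = 2 * j"
  shows "extend_to_forms \<Phi> (replicate j (2, \<lambda>Ws. B (Ws ! 0) (Ws ! 1))) Zs = 1 / 2 ^ j *
    (\<Sum>\<pi> | \<pi> permutes {..<length Zs}. of_int (sign \<pi>) *
      \<Phi> (map (\<lambda>k. B (Zs ! \<pi> (2 * k)) (Zs ! \<pi> (2 * k + 1))) [0..<j]))"
proof -
  have "eval_blocks (replicate j (2, \<lambda>Ws. B (Ws ! 0) (Ws ! 1))) (map (\<lambda>i. Zs ! \<pi> i) [0..<length Zs]) =
      map (\<lambda>k. B (Zs ! \<pi> (2 * k)) (Zs ! \<pi> (2 * k + 1))) [0..<j]" for \<pi>
    unfolding eval_blocks_replicate by (rule map_cong[OF refl]) (simp add: len)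
  moreover have "sum_list (map fst (replicate j (2 :: nat, \<lambda>Ws :: 'v list. B (Ws ! 0) (Ws ! 1)))) = length Zs"
    by (simp add: len sum_list_replicate)
  ultimately show ?thesis
    unfolding extend_to_forms_def prod_list_fact_replicate by simp
qed

lemma extend_to_forms_degree:
  "length Xs \<noteq> sum_list (map fst As) \<Longrightarrow> extend_to_forms \<Phi> As Xs = 0"
  by (simp add: extend_to_forms_def)

lemma extend_to_forms_eqI:
  assumes "length Xs = sum_list (map fst As)" "(\<Prod>(p, A)\<leftarrow>As. fact p) = c"
    and "\<And>\<pi>. \<pi> permutes {..<length Xs} \<Longrightarrow> \<Phi> (eval_blocks As (map (\<lambda>i. Xs ! \<pi> i) [0..<length Xs])) = d * f \<pi>"
  shows "extend_to_forms \<Phi> As Xs = 1 / c * (d * (\<Sum>\<pi> | \<pi> permutes {..<length Xs}. of_int (sign \<pi>) * f \<pi>))"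
proof -
  have "(\<Sum>\<pi> | \<pi> permutes {..<length Xs}. of_int (sign \<pi>) * \<Phi> (eval_blocks As (map (\<lambda>i. Xs ! \<pi> i) [0..<length Xs]))) =
      d * (\<Sum>\<pi> | \<pi> permutes {..<length Xs}. of_int (sign \<pi>) * f \<pi>)"
    unfolding sum_distrib_left by (intro sum.cong refl) (simp add: assms(3) del: upt_Suc)
  then show ?thesis unfolding extend_to_forms_def using assms(1,2) by simp
qed

lemma tr_bar_degree:
  "length Xs \<noteq> sum_list (map fst As) \<Longrightarrow> tr_bar E As \<theta> Xs m = 0"
  unfolding tr_bar_def by (rule extend_to_forms_degree) (simp add: comp_def case_prod_beta)

lemma chern_character_eq_0:
  assumes "odd (length Zs)"
  shows "chern_character P n F \<Gamma> D Zs x = 0"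
proof -
  have "length Zs \<noteq> sum_list (map fst (replicate j (2 :: nat, B)))" for j :: nat and B :: "'a vfield list \<Rightarrow> 'b \<Rightarrow> 'b"
    using assms by (auto simp: sum_list_replicate)
  then show ?thesis unfolding chern_character_def by (simp add: extend_to_forms_degree)
qed

text \<open>Only the summand with index \<open>j\<close> has degree \<open>2 * j\<close>, so the
  series reduces to one term.\<close>

lemma chern_character_even:
  assumes len: "length Zs = 2 * j"
  shows "chern_character P n F \<Gamma> D Zs x = 1 / fact j * (1 / (2 * pi * \<i>)) ^ j * (1 / 2 ^ j *
    (\<Sum>\<pi> | \<pi> permutes {..<length Zs}. of_int (sign \<pi>) * mod_trace complex_ring n (F x)
      (foldr (\<circ>) (map (\<lambda>k. at_point \<Gamma> (curvature P F D (Zs ! \<pi> (2 * k)) (Zs ! \<pi> (2 * k + 1))) x) [0..<j]) id)))"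
proof -
  have "length Zs \<noteq> sum_list (map fst (replicate k (2 :: nat, B)))" if "k \<noteq> j" for k and B :: "'a vfield list \<Rightarrow> 'b \<Rightarrow> 'b"
    using that by (simp add: sum_list_replicate len)
  then have "extend_to_forms \<Phi> (replicate k (2, B)) Zs = 0" if "k \<noteq> j" for k \<Phi> and B :: "'a vfield list \<Rightarrow> 'b \<Rightarrow> 'b"
    using that by (intro extend_to_forms_degree) blast
  then have "chern_character P n F \<Gamma> D Zs x = 1 / fact j * (1 / (2 * pi * \<i>)) ^ j *
      extend_to_forms (\<lambda>Ts. mod_trace complex_ring n (F x) (foldr (\<circ>) Ts id))
        (replicate j (2, \<lambda>Ws. at_point \<Gamma> (curvature P F D (Ws ! 0) (Ws ! 1)) x)) Zs"
    unfolding chern_character_def by (subst suminf_finite[of "{j}"]) simp_all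
  then show ?thesis
    unfolding extend_to_forms_replicate[OF len, where B = "\<lambda>X Y. at_point \<Gamma> (curvature P F D X Y) x"] .
qed

lemma eval_blocks_curvature_derivatives:
  assumes "length Xs = 2 * q + 2"
  shows "eval_blocks ((1, \<lambda>Ys. C (Ys ! 0)) # replicate q (2, \<lambda>Ys. R (Ys ! 0) (Ys ! 1)) @ [(1, \<lambda>Ys. H (Ys ! 0))]) Xs =
    C (Xs ! 0) # map (\<lambda>k. R (Xs ! (2 * k + 1)) (Xs ! (2 * k + 2))) [0..<q] @ [H (Xs ! (2 * q + 1))]"
  using assms
  by (auto simp: eval_blocks_append eval_blocks_replicate sum_list_replicate add.commute mult.commute)

lemma eval_blocks_curvature_zero:
  assumes "length Xs = 2 * q"
  shows "eval_blocks (replicate q (2, \<lambda>Ys. R (Ys ! 0) (Ys ! 1)) @ [(0, \<lambda>Ys. H)]) Xs =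
    map (\<lambda>k. R (Xs ! (2 * k)) (Xs ! (2 * k + 1))) [0..<q] @ [H]"
  using assms by (simp add: eval_blocks_append eval_blocks_replicate)

text \<open>The argument list produced by unfolding \<open>string_potential\<close>: the pull-back
  lifts the fields to the cylinder, the interior product prepends \<partial>_t, and fibre
  integration lifts once more and appends \<partial>_\<theta>.\<close>

definition caloron_fields :: "'m vfield list \<Rightarrow> (('m \<times> real) \<times> real) vfield list" where
  "caloron_fields Xs = map lift (coord_field {0..1} # map lift Xs) @ [coord_field UNIV]"

lemma length_caloron_fields [simp]: "length (caloron_fields Xs) = length Xs + 2"
  by (simp add: caloron_fields_def)

lemma nth_caloron_fields:
  "a < length Xs + 2 \<Longrightarrow> caloron_fields Xs ! a =
    (if a = 0 then lift (coord_field {0..1}) else if a = Suc (length Xs) then coord_field UNIV else lift (lift (Xs ! (a - 1))))"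
  by (cases a) (auto simp: caloron_fields_def nth_append)

context path_frame
begin

text \<open>Meant for \<open>a < b\<close>. Since \<partial>_t occupies index 0, a positive index
  \<open>a\<close> refers to \<open>Xs ! (a - 1)\<close>.\<close>

definition upper_mat :: "real \<Rightarrow> 'm \<Rightarrow> real \<Rightarrow> 'm vfield list \<Rightarrow> nat \<Rightarrow> nat \<Rightarrow> cmatrix" where
  "upper_mat t p \<theta> Xs a b =
    (if a = 0 then if b = Suc (length Xs) then higgs_dot_mat t p \<theta> else conn_dot_mat t p \<theta> (Xs ! (b - 1))
     else if b = Suc (length Xs) then higgs_mat t p \<theta> (Xs ! (a - 1)) else curv_mat t p \<theta> (Xs ! (a - 1)) (Xs ! (b - 1)))"

text \<open>Antisymmetry is built in: \<open>alternating_trace_sum\<close> wants it as an equality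
  of functions, while \<open>curv_mat_swap\<close> yields it only for entries below the
  rank.\<close>

definition caloron_mat :: "real \<Rightarrow> 'm \<Rightarrow> real \<Rightarrow> 'm vfield list \<Rightarrow> nat \<Rightarrow> nat \<Rightarrow> cmatrix" where
  "caloron_mat t p \<theta> Xs a b =
    (if a < b then upper_mat t p \<theta> Xs a b else (\<lambda>i k. - upper_mat t p \<theta> Xs b a i k))"

lemma caloron_mat_swap: "a \<noteq> b \<Longrightarrow> caloron_mat t p \<theta> Xs b a = (\<lambda>i k. - caloron_mat t p \<theta> Xs a b i k)"
  by (auto simp: caloron_mat_def)

context
  fixes p :: 'm and t :: real and Xs :: "'m vfield list"
  assumes p: "p \<in> O'" and t: "t \<in> {0..1}" and Xs: "set Xs \<subseteq> vector_fields M"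
begin

lemma Xs_field: "a < length Xs \<Longrightarrow> Xs ! a \<in> vector_fields M"
  using Xs nth_mem by blast

lemma cal_rep_upper:
  assumes ab: "a < b" "b < length Xs + 2"
  shows "cal_rep t p \<theta> (caloron_fields Xs ! a) (caloron_fields Xs ! b) (upper_mat t p \<theta> Xs a b)"
    and "cal_rep t p \<theta> (caloron_fields Xs ! b) (caloron_fields Xs ! a) (\<lambda>i k. - upper_mat t p \<theta> Xs a b i k)"
proof -
  have a: "caloron_fields Xs ! a = (if a = 0 then lift (coord_field {0..1}) else lift (lift (Xs ! (a - 1))))"
    and b: "caloron_fields Xs ! b = (if b = Suc (length Xs) then coord_field UNIV else lift (lift (Xs ! (b - 1))))"
    using ab by (simp_all add: nth_caloron_fields)
  have Xa: "Xs ! (a - 1) \<in> vector_fields M" if "a \<noteq> 0" using ab that by (intro Xs_field) simp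
  have Xb: "Xs ! (b - 1) \<in> vector_fields M" if "b \<noteq> Suc (length Xs)" using ab that by (intro Xs_field) simp
  have swap: "cal_rep t p \<theta> (lift (lift (Xs ! (b - 1)))) (lift (lift (Xs ! (a - 1))))
      (\<lambda>i k. - curv_mat t p \<theta> (Xs ! (a - 1)) (Xs ! (b - 1)) i k)"
    if "a \<noteq> 0" "b \<noteq> Suc (length Xs)"
    using cal_rep_XY[OF p t Xb Xa, OF that(2,1), of \<theta>] curv_mat_swap[OF p t Xa Xb, OF that]
    unfolding cal_rep_def by simp
  show "cal_rep t p \<theta> (caloron_fields Xs ! a) (caloron_fields Xs ! b) (upper_mat t p \<theta> Xs a b)"
    unfolding a b upper_mat_def
    using cal_rep_tX(1)[OF p t Xb] cal_rep_t_angle(1)[OF p t] cal_rep_X_angle(1)[OF p t Xa] cal_rep_XY[OF p t Xa Xb]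
    by simp
  show "cal_rep t p \<theta> (caloron_fields Xs ! b) (caloron_fields Xs ! a) (\<lambda>i k. - upper_mat t p \<theta> Xs a b i k)"
    unfolding a b upper_mat_def
    using cal_rep_tX(2)[OF p t Xb] cal_rep_t_angle(2)[OF p t] cal_rep_X_angle(2)[OF p t Xa] swap
    by simp
qed

lemma cal_rep_caloron_mat:
  assumes "a \<noteq> b" "a < length Xs + 2" "b < length Xs + 2"
  shows "cal_rep t p \<theta> (caloron_fields Xs ! a) (caloron_fields Xs ! b) (caloron_mat t p \<theta> Xs a b)"
  using assms cal_rep_upper(1)[of a b \<theta>] cal_rep_upper(2)[of b a \<theta>] by (cases "a < b") (simp_all add: caloron_mat_def)

text \<open>The coordinates on the quotient fibre are those of the trivialisation evaluated at
  \<theta>, so the trace over the caloron fibre is computed with the same matrices as the forms on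
  the base.\<close>

lemma mod_trace_caloron:
  assumes \<pi>: "\<pi> permutes {..<length Xs + 2}" and j: "length Xs + 2 = 2 * j"
  shows "mod_trace complex_ring (rank E) (caloron_fib E' ((p, t), \<theta>)) (foldr (\<circ>)
      (map (\<lambda>k. at_point (caloron_sections N' E')
        (curv (caloron_fields Xs ! \<pi> (2 * k)) (caloron_fields Xs ! \<pi> (2 * k + 1))) ((p, t), \<theta>)) [0..<j]) id) =
    mat_trace (rank E) (map (\<lambda>k. caloron_mat t p \<theta> Xs (\<pi> (2 * k)) (\<pi> (2 * k + 1))) [0..<j])"
proof -
  have pU: "p \<in> U" and pM: "p \<in> points M" using p O'(2) O_sub by auto
  have "free_iso loop_ring (rank E') (fib E' (p, t)) (\<tau> p)" using iso[OF pU] by simp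
  then obtain \<beta> where \<beta>: "free_iso complex_ring (rank E') (caloron_fib E' ((p, t), \<theta>)) \<beta>"
    "\<And>e i. e \<in> carrier (fib E' (p, t)) \<Longrightarrow> i < rank E' \<Longrightarrow> \<beta> (cl ((p, t), \<theta>) e) i = \<tau> p e i \<theta>"
    using caloron_free_iso[OF pull_interval_bundle pN[OF pM t], where \<theta> = \<theta>] by metis
  note c = caloron_fib_closed[OF pull_interval_bundle pN[OF pM t], where \<theta> = \<theta>]
  have "\<pi> (2 * k) \<noteq> \<pi> (2 * k + 1) \<and> \<pi> (2 * k) < length Xs + 2 \<and> \<pi> (2 * k + 1) < length Xs + 2" if "k < j" for k
    using permutes_in_image[OF \<pi>, of "2 * k"] permutes_in_image[OF \<pi>, of "2 * k + 1"] that j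
      inj_eq[OF permutes_inj[OF \<pi>], of "2 * k" "2 * k + 1"] by simp
  then have "list_all2 (evaluation.represents id (rank E) (caloron_fib E' ((p, t), \<theta>)) \<beta>)
      (map (\<lambda>k. at_point (caloron_sections N' E')
        (curv (caloron_fields Xs ! \<pi> (2 * k)) (caloron_fields Xs ! \<pi> (2 * k + 1))) ((p, t), \<theta>)) [0..<j])
      (map (\<lambda>k. caloron_mat t p \<theta> Xs (\<pi> (2 * k)) (\<pi> (2 * k + 1))) [0..<j])"
    using \<beta>(2) by (auto simp: list_all2_conv_all_nth intro!: caloron_represents[OF p t cal_rep_caloron_mat])
  from evaluation.ev_mod_trace_foldr[OF evaluation_complex \<beta>(1)[unfolded pull_simps] c this]
  show ?thesis by (simp add: complex_ring_def)
qed

lemma chern_character_caloron: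
  assumes j: "length Xs + 2 = 2 * j"
  shows "chern_character (points N' \<times> UNIV) (rank E') (caloron_fib E') (caloron_sections N' E') nab
      (caloron_fields Xs) ((p, t), \<theta>) =
    1 / fact j * (1 / (2 * pi * \<i>)) ^ j * (1 / 2 ^ j *
      (\<Sum>\<pi> | \<pi> permutes {..<length Xs + 2}. of_int (sign \<pi>) *
        mat_trace (rank E) (map (\<lambda>k. caloron_mat t p \<theta> Xs (\<pi> (2 * k)) (\<pi> (2 * k + 1))) [0..<j])))"
proof -
  have "length (caloron_fields Xs) = 2 * j" unfolding length_caloron_fields by (rule j)
  note L = this
  show ?thesis
    unfolding chern_character_even[OF L] length_caloron_fields pull_simps(1)
    by (intro arg_cong[where f = "(*) _"] sum.cong refl mod_trace_caloron[OF _ j]) simp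
qed

lemma caloron_mat_curv:
  assumes "a < length Xs" "b < length Xs" "a \<noteq> b" "i < rank E" "k < rank E"
  shows "caloron_mat t p \<theta> Xs (Suc a) (Suc b) i k = curv_mat t p \<theta> (Xs ! a) (Xs ! b) i k"
  using assms curv_mat_swap[OF p t Xs_field Xs_field assms(4,5), of a b \<theta>]
  by (auto simp: caloron_mat_def upper_mat_def)

text \<open>The matrices of the forms on the base are exchanged for entries of
  \<open>caloron_mat\<close>, so that the sum matches the first one in
  \<open>alternating_trace_sum\<close> with \<open>j = q + 2\<close> and
  \<open>p = 2 * q + 2\<close>.\<close>

lemma sym_trace_curvature_derivatives:
  assumes \<pi>: "\<pi> permutes {..<length Xs}" and j: "length Xs = 2 * q + 2"
  shows "sym_trace (rank E) (fib E p) \<theta>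
      (at_point (sections M E) (\<lambda>v. \<lambda>m\<in>points M. fibre_derivative (rank E) (fib E m) (\<lambda>u. D u (Xs ! \<pi> 0) v m) t) p #
       map (\<lambda>k. at_point (sections M E) (curvature (points M) (fib E) (D t) (Xs ! \<pi> (2 * k + 1)) (Xs ! \<pi> (2 * k + 2))) p) [0..<q] @
       [at_point (sections M E) (higgs_derivative (points M) (fib E) (D t) (\<phi> t) (Xs ! \<pi> (2 * q + 1))) p]) =
    1 / ((fact (q + 2))\<^sup>2 * (2 * pi * \<i>) ^ (q + 2)) * (\<Sum>\<sigma> | \<sigma> permutes {..<q + 2}. mat_trace (rank E) (map (\<lambda>i.
      (caloron_mat t p \<theta> Xs 0 (Suc (\<pi> 0)) #
       map (\<lambda>k. caloron_mat t p \<theta> Xs (Suc (\<pi> (2 * k + 1))) (Suc (\<pi> (2 * k + 2)))) [0..<q] @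
       [caloron_mat t p \<theta> Xs (Suc (\<pi> (2 * q + 1))) (Suc (length Xs))]) ! \<sigma> i) [0..<q + 2]))"
proof -
  have \<pi>_less: "\<pi> a < length Xs" if "a < length Xs" for a using permutes_in_image[OF \<pi>, of a] that by simp
  have \<pi>_neq: "\<pi> (2 * k + 1) \<noteq> \<pi> (2 * k + 2)" for k
    using inj_eq[OF permutes_inj[OF \<pi>], of "2 * k + 1" "2 * k + 2"] by simp
  have X: "Xs ! \<pi> a \<in> vector_fields M" if "a < length Xs" for a by (rule Xs_field[OF \<pi>_less[OF that]])
  define Ms where "Ms = conn_dot_mat t p \<theta> (Xs ! \<pi> 0) #
       map (\<lambda>k. curv_mat t p \<theta> (Xs ! \<pi> (2 * k + 1)) (Xs ! \<pi> (2 * k + 2))) [0..<q] @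
       [higgs_mat t p \<theta> (Xs ! \<pi> (2 * q + 1))]"
  define Fs where "Fs = caloron_mat t p \<theta> Xs 0 (Suc (\<pi> 0)) #
       map (\<lambda>k. caloron_mat t p \<theta> Xs (Suc (\<pi> (2 * k + 1))) (Suc (\<pi> (2 * k + 2)))) [0..<q] @
       [caloron_mat t p \<theta> Xs (Suc (\<pi> (2 * q + 1))) (Suc (length Xs))]"
  have len: "length Ms = q + 2" by (simp add: Ms_def)
  have ends: "caloron_mat t p \<theta> Xs 0 (Suc (\<pi> 0)) = conn_dot_mat t p \<theta> (Xs ! \<pi> 0)"
    "caloron_mat t p \<theta> Xs (Suc (\<pi> (2 * q + 1))) (Suc (length Xs)) = higgs_mat t p \<theta> (Xs ! \<pi> (2 * q + 1))"
    using \<pi>_less[of 0] \<pi>_less[of "2 * q + 1"] j by (auto simp: caloron_mat_def upper_mat_def)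
  have eq0: "(Fs ! a) i k = (Ms ! a) i k" if "a < q + 2" "i < rank E" "k < rank E" for a i k
    unfolding Fs_def Ms_def ends using that \<pi>_less \<pi>_neq j by (auto simp: nth_Cons' nth_append caloron_mat_curv)
  have eq: "mat_trace (rank E) (map (\<lambda>i. Ms ! \<sigma> i) [0..<q + 2]) = mat_trace (rank E) (map (\<lambda>i. Fs ! \<sigma> i) [0..<q + 2])"
    if "\<sigma> permutes {..<q + 2}" for \<sigma>
    using permutes_in_image[OF that] by (intro mat_trace_cong) (simp_all add: eq0 del: upt_Suc)
  have "list_all2 (loop_represents p \<theta>)
      (at_point (sections M E) (\<lambda>v. \<lambda>m\<in>points M. fibre_derivative (rank E) (fib E m) (\<lambda>u. D u (Xs ! \<pi> 0) v m) t) p #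
       map (\<lambda>k. at_point (sections M E) (curvature (points M) (fib E) (D t) (Xs ! \<pi> (2 * k + 1)) (Xs ! \<pi> (2 * k + 2))) p) [0..<q] @
       [at_point (sections M E) (higgs_derivative (points M) (fib E) (D t) (\<phi> t) (Xs ! \<pi> (2 * q + 1))) p]) Ms"
    unfolding Ms_def using j by (auto simp: list_all2_append list_all2_conv_all_nth[of _ "map _ _"] intro!: conn_dot_form_represents[OF p t X]
      curvature_form_represents[OF p t X X] higgs_derivative_form_represents[OF p t X] list_all2_appendI)
  note R = this
  show ?thesis
    unfolding Fs_def[symmetric] sym_trace_represents[OF p R] len by (intro arg_cong[where f = "(*) _"] sum.cong refl eq) simp
qed

lemma sym_trace_curvature_higgs_dot:
  assumes \<pi>: "\<pi> permutes {..<length Xs}" and j: "length Xs = 2 * q"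
  shows "sym_trace (rank E) (fib E p) \<theta>
      (map (\<lambda>k. at_point (sections M E) (curvature (points M) (fib E) (D t) (Xs ! \<pi> (2 * k)) (Xs ! \<pi> (2 * k + 1))) p) [0..<q] @
       [\<lambda>e. fibre_derivative (rank E) (fib E p) (\<lambda>u. \<phi> u p e) t]) =
    1 / ((fact (q + 1))\<^sup>2 * (2 * pi * \<i>) ^ (q + 1)) * (\<Sum>\<sigma> | \<sigma> permutes {..<q + 1}. mat_trace (rank E) (map (\<lambda>i.
      (map (\<lambda>k. caloron_mat t p \<theta> Xs (Suc (\<pi> (2 * k))) (Suc (\<pi> (2 * k + 1)))) [0..<q] @
       [caloron_mat t p \<theta> Xs 0 (Suc (length Xs))]) ! \<sigma> i) [0..<q + 1]))"
proof -
  have \<pi>_less: "\<pi> a < length Xs" if "a < length Xs" for a using permutes_in_image[OF \<pi>, of a] that by simp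
  have \<pi>_neq: "\<pi> (2 * k) \<noteq> \<pi> (2 * k + 1)" for k
    using inj_eq[OF permutes_inj[OF \<pi>], of "2 * k" "2 * k + 1"] by simp
  have X: "Xs ! \<pi> a \<in> vector_fields M" if "a < length Xs" for a by (rule Xs_field[OF \<pi>_less[OF that]])
  define Ms where "Ms = map (\<lambda>k. curv_mat t p \<theta> (Xs ! \<pi> (2 * k)) (Xs ! \<pi> (2 * k + 1))) [0..<q] @ [higgs_dot_mat t p \<theta>]"
  define Fs where "Fs = map (\<lambda>k. caloron_mat t p \<theta> Xs (Suc (\<pi> (2 * k))) (Suc (\<pi> (2 * k + 1)))) [0..<q] @
       [caloron_mat t p \<theta> Xs 0 (Suc (length Xs))]"
  have len: "length Ms = q + 1" by (simp add: Ms_def)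
  have ends: "caloron_mat t p \<theta> Xs 0 (Suc (length Xs)) = higgs_dot_mat t p \<theta>"
    by (simp add: caloron_mat_def upper_mat_def)
  have eq0: "(Fs ! a) i k = (Ms ! a) i k" if "a < q + 1" "i < rank E" "k < rank E" for a i k
    unfolding Fs_def Ms_def ends using that \<pi>_less \<pi>_neq j by (auto simp: nth_append caloron_mat_curv)
  have eq: "mat_trace (rank E) (map (\<lambda>i. Ms ! \<sigma> i) [0..<q + 1]) = mat_trace (rank E) (map (\<lambda>i. Fs ! \<sigma> i) [0..<q + 1])"
    if "\<sigma> permutes {..<q + 1}" for \<sigma>
    using permutes_in_image[OF that] by (intro mat_trace_cong) (simp_all add: eq0 del: upt_Suc)
  have "list_all2 (loop_represents p \<theta>)
      (map (\<lambda>k. at_point (sections M E) (curvature (points M) (fib E) (D t) (Xs ! \<pi> (2 * k)) (Xs ! \<pi> (2 * k + 1))) p) [0..<q] @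
       [\<lambda>e. fibre_derivative (rank E) (fib E p) (\<lambda>u. \<phi> u p e) t]) Ms"
    unfolding Ms_def using j by (auto simp: list_all2_conv_all_nth[of _ "map _ _"] intro!: curvature_form_represents[OF p t X X]
      higgs_dot_form_represents[OF p t] list_all2_appendI)
  note R = this
  show ?thesis
    unfolding Fs_def[symmetric] sym_trace_represents[OF p R] len by (intro arg_cong[where f = "(*) _"] sum.cong refl eq) simp
qed

text \<open>Only the \<open>q\<close> curvature forms, being of degree 2, contribute to the
  normalisation \<open>1 / 2 ^ q\<close> of the wedge product.\<close>

lemma tr_bar_curvature_derivatives:
  assumes j: "length Xs = 2 * q + 2"
  shows "tr_bar E (conn_dot_form M E D t # replicate q (curvature_form M E (D t)) @ [higgs_derivative_form M E (D t) (\<phi> t)]) \<theta> Xs p =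
    1 / 2 ^ q * (1 / ((fact (q + 2))\<^sup>2 * (2 * pi * \<i>) ^ (q + 2)) *
      (\<Sum>\<pi> | \<pi> permutes {..<length Xs}. of_int (sign \<pi>) * (\<Sum>\<sigma> | \<sigma> permutes {..<q + 2}. mat_trace (rank E) (map (\<lambda>i.
        (caloron_mat t p \<theta> Xs 0 (Suc (\<pi> 0)) #
         map (\<lambda>k. caloron_mat t p \<theta> Xs (Suc (\<pi> (2 * k + 1))) (Suc (\<pi> (2 * k + 2)))) [0..<q] @
         [caloron_mat t p \<theta> Xs (Suc (\<pi> (2 * q + 1))) (Suc (length Xs))]) ! \<sigma> i) [0..<q + 2]))))"
proof -
  have "eval_blocks ((1, \<lambda>Ys. at_point (sections M E) (\<lambda>v. \<lambda>m\<in>points M. fibre_derivative (rank E) (fib E m) (\<lambda>u. D u (Ys ! 0) v m) t) p) #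
        replicate q (2, \<lambda>Ys. at_point (sections M E) (curvature (points M) (fib E) (D t) (Ys ! 0) (Ys ! 1)) p) @
        [(1, \<lambda>Ys. at_point (sections M E) (higgs_derivative (points M) (fib E) (D t) (\<phi> t) (Ys ! 0)) p)])
        (map (\<lambda>i. Xs ! \<pi> i) [0..<length Xs]) =
      at_point (sections M E) (\<lambda>v. \<lambda>m\<in>points M. fibre_derivative (rank E) (fib E m) (\<lambda>u. D u (Xs ! \<pi> 0) v m) t) p #
       map (\<lambda>k. at_point (sections M E) (curvature (points M) (fib E) (D t) (Xs ! \<pi> (2 * k + 1)) (Xs ! \<pi> (2 * k + 2))) p) [0..<q] @
       [at_point (sections M E) (higgs_derivative (points M) (fib E) (D t) (\<phi> t) (Xs ! \<pi> (2 * q + 1))) p]" for \<pi>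
    by (subst eval_blocks_curvature_derivatives[where C = "\<lambda>X. at_point (sections M E) (\<lambda>v. \<lambda>m\<in>points M. fibre_derivative (rank E) (fib E m) (\<lambda>u. D u X v m) t) p"
          and R = "\<lambda>X Y. at_point (sections M E) (curvature (points M) (fib E) (D t) X Y) p"
          and H = "\<lambda>X. at_point (sections M E) (higgs_derivative (points M) (fib E) (D t) (\<phi> t) X) p"])
       (simp_all add: j del: upt_Suc)
  note e = this
  show ?thesis
    unfolding tr_bar_def conn_dot_form_def curvature_form_def higgs_derivative_form_def
      list.map map_append map_replicate prod.case
    by (rule extend_to_forms_eqI; (simp add: j sum_list_replicate prod_list_fact_replicate; fail)?)
       (simp only: e sym_trace_curvature_derivatives[OF _ j])
qed

lemma tr_bar_curvature_higgs_dot: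
  assumes j: "length Xs = 2 * q"
  shows "tr_bar E (replicate q (curvature_form M E (D t)) @ [higgs_dot_form E \<phi> t]) \<theta> Xs p =
    1 / 2 ^ q * (1 / ((fact (q + 1))\<^sup>2 * (2 * pi * \<i>) ^ (q + 1)) *
      (\<Sum>\<pi> | \<pi> permutes {..<length Xs}. of_int (sign \<pi>) * (\<Sum>\<sigma> | \<sigma> permutes {..<q + 1}. mat_trace (rank E) (map (\<lambda>i.
        (map (\<lambda>k. caloron_mat t p \<theta> Xs (Suc (\<pi> (2 * k))) (Suc (\<pi> (2 * k + 1)))) [0..<q] @
         [caloron_mat t p \<theta> Xs 0 (Suc (length Xs))]) ! \<sigma> i) [0..<q + 1]))))"
proof -
  have "eval_blocks (replicate q (2, \<lambda>Ys. at_point (sections M E) (curvature (points M) (fib E) (D t) (Ys ! 0) (Ys ! 1)) p) @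
        [(0, \<lambda>Ys e. fibre_derivative (rank E) (fib E p) (\<lambda>u. \<phi> u p e) t)])
        (map (\<lambda>i. Xs ! \<pi> i) [0..<length Xs]) =
       map (\<lambda>k. at_point (sections M E) (curvature (points M) (fib E) (D t) (Xs ! \<pi> (2 * k)) (Xs ! \<pi> (2 * k + 1))) p) [0..<q] @
       [\<lambda>e. fibre_derivative (rank E) (fib E p) (\<lambda>u. \<phi> u p e) t]" for \<pi>
    by (subst eval_blocks_curvature_zero[where R = "\<lambda>X Y. at_point (sections M E) (curvature (points M) (fib E) (D t) X Y) p"])
       (simp_all add: j del: upt_Suc)
  note e = this
  show ?thesis
    unfolding tr_bar_def curvature_form_def higgs_dot_form_def list.map map_append map_replicate prod.case
    by (rule extend_to_forms_eqI; (simp add: j sum_list_replicate prod_list_fact_replicate; fail)?)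
       (simp only: e sym_trace_curvature_higgs_dot[OF _ j])
qed

text \<open>Both sides have become combinations of the same alternating sums of traces, so
  arithmetic with the normalising constants remains.\<close>

lemma chern_character_integrand:
  assumes j: "length Xs + 2 = 2 * j"
  shows "chern_character (points N' \<times> UNIV) (rank E') (caloron_fib E') (caloron_sections N' E') nab
      (caloron_fields Xs) ((p, t), \<theta>) =
    of_nat j * (of_nat (j - 1) * tr_bar E (conn_dot_form M E D t # replicate (j - 2) (curvature_form M E (D t)) @
        [higgs_derivative_form M E (D t) (\<phi> t)]) \<theta> Xs p +
      tr_bar E (replicate (j - 1) (curvature_form M E (D t)) @ [higgs_dot_form E \<phi> t]) \<theta> Xs p)"
proof (cases "j = 1")
  case True
  \<comment> \<open>There are no base fields and \<open>j - 2\<close> is a truncated difference; the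
    first term has coefficient 0, and the second alone gives the value.\<close>
  then have "length Xs = 2 * 0" using j by simp
  from tr_bar_curvature_higgs_dot[OF this, of \<theta>] chern_character_caloron[OF j, of \<theta>]
    alternating_trace_sum[where n = "rank E" and F = "caloron_mat t p \<theta> Xs", OF j caloron_mat_swap]
  show ?thesis using True by simp
next
  case False
  define q where "q = j - 2"
  have q: "j = q + 2" using j False by (simp add: q_def)
  have l: "length Xs = 2 * q + 2" "length Xs = 2 * (q + 1)" using j q by simp_all
  define A where "A = (\<Sum>\<pi> | \<pi> permutes {..<length Xs + 2}. of_int (sign \<pi>) *
    mat_trace (rank E) (map (\<lambda>k. caloron_mat t p \<theta> Xs (\<pi> (2 * k)) (\<pi> (2 * k + 1))) [0..<j]))"
  define B where "B = (\<Sum>\<pi> | \<pi> permutes {..<length Xs}. of_int (sign \<pi>) * (\<Sum>\<sigma> | \<sigma> permutes {..<q + 2}. mat_trace (rank E) (map (\<lambda>i.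
        (caloron_mat t p \<theta> Xs 0 (Suc (\<pi> 0)) #
         map (\<lambda>k. caloron_mat t p \<theta> Xs (Suc (\<pi> (2 * k + 1))) (Suc (\<pi> (2 * k + 2)))) [0..<q] @
         [caloron_mat t p \<theta> Xs (Suc (\<pi> (2 * q + 1))) (Suc (length Xs))]) ! \<sigma> i) [0..<q + 2])))"
  define C where "C = (\<Sum>\<pi> | \<pi> permutes {..<length Xs}. of_int (sign \<pi>) * (\<Sum>\<sigma> | \<sigma> permutes {..<q + 2}. mat_trace (rank E) (map (\<lambda>i.
        (map (\<lambda>k. caloron_mat t p \<theta> Xs (Suc (\<pi> (2 * k))) (Suc (\<pi> (2 * k + 1)))) [0..<q + 1] @
         [caloron_mat t p \<theta> Xs 0 (Suc (length Xs))]) ! \<sigma> i) [0..<q + 2])))"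
  have n: "q + 2 - 2 = q" "q + 2 - 1 = q + 1" "2 * q + 2 - 1 = 2 * q + 1" "q + 1 + 1 = q + 2" by simp_all
  have *: "fact j * A = 4 * of_nat j * of_nat (j - 1) * B + 2 * of_nat j * C"
    using alternating_trace_sum[where n = "rank E" and F = "caloron_mat t p \<theta> Xs", OF j caloron_mat_swap]
    unfolding A_def B_def C_def q n(1,2,4) l(1) n(3) by blast
  \<comment> \<open>\<open>F\<close> stands for \<open>fact j\<close> and \<open>P\<close> for 2
    \<pi> i. The powers of 2 match because 4/2^(q+2) = 1/2^q and 2/2^(q+2) = 1/2^(q+1).\<close>
  have c: "a / F * (1 / P) ^ (q + 2) * (1 / 2 ^ (q + 2) * A) =
      J * (J' * (1 / 2 ^ q * (1 / (F\<^sup>2 * P ^ (q + 2)) * B)) + 1 / 2 ^ (q + 1) * (1 / (F\<^sup>2 * P ^ (q + 2)) * C))"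
    if "F * A = 4 * J * J' * B + 2 * J * C" "F \<noteq> 0" "P \<noteq> 0" "a = 1" for F P J J' a :: complex
  proof -
    have "A = (4 * J * J' * B + 2 * J * C) / F" using that by (simp add: field_simps)
    then show ?thesis using that(2-4) by (simp add: field_simps power2_eq_square)
  qed
  show ?thesis
    unfolding chern_character_caloron[OF j] A_def[symmetric]
    unfolding q n tr_bar_curvature_derivatives[OF l(1)] tr_bar_curvature_higgs_dot[OF l(2)]
    unfolding n B_def[symmetric] C_def[symmetric]
    by (rule c[OF *[unfolded q n] fact_nonzero]) simp_all
qed

end

end

theorem proposition2p8:
  fixes M :: "('m, 'a::euclidean_space) manifold"
    and E :: "('m, 'e) omega_bundle"
    and D :: "real \<Rightarrow> ('m, 'e) conn"
    and \<phi> :: "real \<Rightarrow> ('m, 'e) higgs"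
    and Xs :: "'m vfield list"
    and m :: 'm
  assumes "compact_manifold_with_corners M"
    and "omega_vector_bundle M E"
    and "smooth_path M E D \<phi>"
    and "set Xs \<subseteq> vector_fields M"
    and "m \<in> points M"
  shows "(\<lambda>k. let j = Suc k in
            of_nat j * integral {0..1} (\<lambda>t. integral {0..2*pi} (\<lambda>\<theta>.
              of_nat (j - 1) *
                tr_bar E
                  (conn_dot_form M E D t # replicate (j - 2) (curvature_form M E (D t))
                    @ [higgs_derivative_form M E (D t) (\<phi> t)]) \<theta> Xs m
              + tr_bar E
                  (replicate (j - 1) (curvature_form M E (D t)) @ [higgs_dot_form E \<phi> t]) \<theta> Xs m)))
         sums string_potential M E D \<phi> Xs m"
proof -
  interpret connection_path M E D \<phi>
    by (intro connection_path.intro omega_bundle_manifold.intro corner_manifold.intro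
      omega_bundle_manifold_axioms.intro connection_path_axioms.intro assms)
  define T where "T j t \<theta> = of_nat (j - 1) *
      tr_bar E (conn_dot_form M E D t # replicate (j - 2) (curvature_form M E (D t))
        @ [higgs_derivative_form M E (D t) (\<phi> t)]) \<theta> Xs m
      + tr_bar E (replicate (j - 1) (curvature_form M E (D t)) @ [higgs_dot_form E \<phi> t]) \<theta> Xs m" for j t \<theta>
  let ?Ch = "chern_character (points N' \<times> UNIV) (rank E') (caloron_fib E') (caloron_sections N' E') nab"
  have potential: "string_potential M E D \<phi> Xs m =
      integral {0..1} (\<lambda>t. integral {0..2 * pi} (\<lambda>\<theta>. ?Ch (caloron_fields Xs) ((m, t), \<theta>)))"
    by (simp add: string_potential_def slice_pullback_def interior_product_def string_form_def
      fibre_integral_def caloron_fields_def)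
  \<comment> \<open>For \<open>j > 1\<close> both forms have degree \<open>2 * j - 2\<close>, so at
    most one index fits the number of fields in \<open>Xs\<close>.\<close>
  have zero: "T j = (\<lambda>t \<theta>. 0)" if "length Xs + 2 \<noteq> 2 * j" "j > 0" for j
  proof (intro ext)
    fix t \<theta>
    have "of_nat (j - 1) * tr_bar E (conn_dot_form M E D t # replicate (j - 2) (curvature_form M E (D t))
        @ [higgs_derivative_form M E (D t) (\<phi> t)]) \<theta> Xs m = 0"
    \<comment> \<open>For \<open>j = 1\<close> truncated subtraction leaves a list of degree 2 where
      degree 0 would be expected, but its coefficient is 0.\<close>
    proof (cases "j = 1")
      case False
      then show ?thesis using that
        by (subst tr_bar_degree)
           (auto simp: conn_dot_form_def curvature_form_def higgs_derivative_form_def sum_list_replicate)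
    qed simp
    moreover have "tr_bar E (replicate (j - 1) (curvature_form M E (D t)) @ [higgs_dot_form E \<phi> t]) \<theta> Xs m = 0"
      using that by (intro tr_bar_degree) (auto simp: curvature_form_def higgs_dot_form_def sum_list_replicate)
    ultimately show "T j t \<theta> = 0" by (simp add: T_def)
  qed
  have "(\<lambda>k. of_nat (Suc k) * integral {0..1} (\<lambda>t. integral {0..2 * pi} (T (Suc k) t))) sums
      string_potential M E D \<phi> Xs m"
  proof (cases "even (length Xs)")
    case False
    then have "length Xs + 2 \<noteq> 2 * Suc k" for k by presburger
    then have "T (Suc k) = (\<lambda>t \<theta>. 0)" for k by (intro zero) simp_all
    moreover have "string_potential M E D \<phi> Xs m = 0"
      unfolding potential using False by (simp add: chern_character_eq_0)
    ultimately show ?thesis by simp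
  next
    case True
    then obtain k where k: "length Xs + 2 = 2 * Suc k" by (auto elim!: evenE)
    \<comment> \<open>Since \<open>m\<close> is fixed, one frame around it serves all t and
      \<theta>.\<close>
    obtain U \<tau> where U: "(U, \<tau>) \<in> trivs E" "m \<in> U" using triv_cover[OF assms(5)] by metis
    obtain \<rho> O' K where frame: "local_frame M E U \<tau> \<rho> O' K" and m: "m \<in> O'"
      using local_frame_exists[OF U] by metis
    interpret path_frame M E D \<phi> U \<tau> \<rho> O' K using frame connection_path_axioms by (simp add: path_frame_def)
    have "string_potential M E D \<phi> Xs m =
        integral {0..1} (\<lambda>t. integral {0..2 * pi} (\<lambda>\<theta>. of_nat (Suc k) * T (Suc k) t \<theta>))"
      unfolding potential T_def
      by (intro integral_cong chern_character_integrand[OF m _ assms(4) k])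
    \<comment> \<open>Scalars move out of both integrals without any knowledge of integrability, so
      the identity between integrands is all that is required.\<close>
    then have "string_potential M E D \<phi> Xs m =
        of_nat (Suc k) * integral {0..1} (\<lambda>t. integral {0..2 * pi} (T (Suc k) t))"
      by (simp only: integral_mult_right)
    moreover have "T (Suc l) = (\<lambda>t \<theta>. 0)" if "l \<noteq> k" for l
      using that k by (intro zero) simp_all
    ultimately show ?thesis
      using sums_finite[of "{k}" "\<lambda>k. of_nat (Suc k) * integral {0..1} (\<lambda>t. integral {0..2 * pi} (T (Suc k) t))"]
      by simp
  qed
  then show ?thesis unfolding T_def Let_def .
qed

end
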